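(* Let $\gamma\in[0,\infty)$. For every $x\in\mathbb R$, $P_x$-a.s., $$\mathbb E_x\left[\exp\left\{-\gamma\int_0^Ge^{\alpha X_u}du\right\}\,\Big|\,\overline X_{\mathsf e}\right]=\frac{\mathcal I^{p,\alpha}(\gamma e^{\alpha x})}{\mathcal I^{p,\alpha}(\gamma e^{\alpha\overline X_{\mathsf e}})};$$ in other words, for every $y\in(0,\infty)$, $Q_y$-a.s., $$\mathbb E^Q_y\bigl[e^{-\gamma L}\,\big|\,\overline Y_\infty\bigr]=\frac{\mathcal I^{p,\alpha}(\gamma y^\alpha)}{\mathcal I^{p,\alpha}(\gamma\,\overline Y_\infty^{\,\alpha})}.$$
   Context: Conventions: $\mathbb N=\{1,2,\dots\}$, $\mathbb N_0=\mathbb N\cup\{0\}$, $\inf\emptyset=\infty$, empty products equal $1$. The process $X$. $X=(X_t)_{t\in[0,\infty)}$ is a spectrally negative Lévy process under probabilities $(P_x)_{x\in\mathbb R}$ in a filtration $\mathcal F=(\mathcal F_t)_{t\in[0,\infty)}$: it is càdlàg, real-valued, $\mathcal F$-adapted, with stationary independent increments relative to $\mathcal F$, no positive jumps and non-monotone paths; $X_0=0$ a.s. under $P_0$; and for each $x\in\mathbb R$ the law of $X$ under $P_x$ is that of $x+X$ under $P_0$. $\mathbb E_x$ is expectation under $P_x$. $\mathsf e$ is an a.s. strictly positive $\mathcal F$-stopping time such that for some $p\in[0,\infty)$, for all $x\in\mathbb R$, $s,t\in[0,\infty)$ and Borel $g:\mathbb R\to[0,\infty]$, $\mathbb E_x[g(X_{t+s}-X_t)\mathbf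 1_{\{\mathsf e>t+s\}}\mid\mathcal F_t]=\mathbb E_0[g(X_s)]e^{-ps}\mathbf 1_{\{t<\mathsf e\}}$ $P_x$-a.s. (so $\mathsf e$ is exponential of rate $p$, independent of $X$; $\mathsf e=\infty$ a.s. if $p=0$). Let $\alpha\in(0,\infty)$. Let $\psi(\lambda):=\log\mathbb E_0[e^{\lambda X_1}]$, $\lambda\in[0,\infty)$, and $\Phi(q):=\inf\{\lambda\in[0,\infty):\psi(\lambda)>q\}$ for $q\in[0,\infty)$. Standing assumption: if $p=0$, then $X$ drifts to $-\infty$; equivalently $\Phi(p)>0$. The process $Y$ (Lamperti transform). Put $I_t:=\int_0^te^{\alpha X_u}du$ for $t\in[0,\infty]$, $\phi_s:=\inf\{t\in[0,\infty):I_t>s\}$ for $s\in[0,\infty)$, and $Y_s:=e^{X_{\phi_s}}$ for $s\in[0,I_{\mathsf e})$, $Y_s:=0$ for $s\in[I_{\mathsf e},\infty)$. For $y\in(0,\infty)$ let $Q_y:=P_{\log y}$, with expectation $\mathbb E^Q_y$. $\overline X$ and $\overline Y$ are the running suprema of $X$ and $Y$ (with $\overline Y_\infty$ the overall supremum of $Y$). $L:=\sup\{s\in[0,\infty):\overline Y_s=Y_s\}$, $G:=\sup\{t\in[0,\mathsf e):\overline X_t=X_t\}$. Under the standing assumption, a.s., $\overline Y_\infty=e^{\overline X_{\mathsf e}}$ and $L=I_G$ are finite. Power series. For $z\in[0,\infty)$, $\mathcal I^{p,\alpha}(z):=\sum_{k=0}^\infty b_kz^k$ with $b_k:=\bigl(\prod_{l=1}^k(\psi(\Phi(p)+l\alpha)-p)\bigr)^{-1}$,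 $k\in\mathbb N_0$. *)

theory Defs
  imports "HOL-Probability.Probability"
begin

section \<open>Path functionals\<close>

text \<open>A path is a function \<open>w :: real \<Rightarrow> real\<close> of which only the restriction to \<open>[0,\<infinity>)\<close> matters.
  Times that may be infinite have type \<open>ennreal\<close>.\<close>

definition cadlag :: "(real \<Rightarrow> real) \<Rightarrow> bool" where
  "cadlag w \<longleftrightarrow> (\<forall>t\<ge>0. (w \<longlongrightarrow> w t) (at_right t)) \<and> (\<forall>t>0. \<exists>l. (w \<longlongrightarrow> l) (at_left t))"

definition no_positive_jumps :: "(real \<Rightarrow> real) \<Rightarrow> bool" where
  "no_positive_jumps w \<longleftrightarrow> (\<forall>t>0. \<forall>l. (w \<longlongrightarrow> l) (at_left t) \<longrightarrow> w t \<le> l)"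

definition nonmonotone :: "(real \<Rightarrow> real) \<Rightarrow> bool" where
  "nonmonotone w \<longleftrightarrow> \<not> mono_on {0..} w \<and> \<not> antimono_on {0..} w"

text \<open>The set of real times in \<open>[0,t]\<close>, which is \<open>[0,\<infinity>)\<close> for \<open>t = \<infinity>\<close>.\<close>

definition times_upto :: "ennreal \<Rightarrow> real set" where
  "times_upto t = {u. 0 \<le> u \<and> ennreal u \<le> t}"

definition run_sup :: "(real \<Rightarrow> real) \<Rightarrow> ennreal \<Rightarrow> ereal" where
  "run_sup w t = (SUP u\<in>times_upto t. ereal (w u))"

definition exp_functional :: "real \<Rightarrow> (real \<Rightarrow> real) \<Rightarrow> ennreal \<Rightarrow> ennreal" where
  "exp_functional \<alpha> w t = (\<integral>\<^sup>+ u \<in> times_upto t. ennreal (exp (\<alpha> * w u)) \<partial>lborel)"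

definition time_change :: "real \<Rightarrow> (real \<Rightarrow> real) \<Rightarrow> real \<Rightarrow> ennreal" where
  "time_change \<alpha> w s = Inf {ennreal t | t. 0 \<le> t \<and> exp_functional \<alpha> w (ennreal t) > ennreal s}"

text \<open>The Lamperti transform of \<open>w\<close> killed at \<open>\<zeta>\<close>. In the first branch the time change is finite,
  so \<open>enn2real\<close> is harmless there.\<close>

definition lamperti :: "real \<Rightarrow> (real \<Rightarrow> real) \<Rightarrow> ennreal \<Rightarrow> real \<Rightarrow> real" where
  "lamperti \<alpha> w \<zeta> s =
     (if ennreal s < exp_functional \<alpha> w \<zeta> then exp (w (enn2real (time_change \<alpha> w s))) else 0)"

text \<open>The supremum of the times in \<open>[0,\<zeta>)\<close> at which the path equals its running supremum.
  With \<open>\<zeta> = \<infinity>\<close> all times in \<open>[0,\<infinity>)\<close> are considered.\<close>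

definition last_sup_time :: "(real \<Rightarrow> real) \<Rightarrow> ennreal \<Rightarrow> ennreal" where
  "last_sup_time w \<zeta> =
     Sup {ennreal t | t. 0 \<le> t \<and> ennreal t < \<zeta> \<and> run_sup w (ennreal t) = ereal (w t)}"

section \<open>Spectrally negative Levy processes\<close>

text \<open>The filtration is indexed by \<open>ennreal\<close>, so that the library's \<open>stopping_time\<close> applies to random
  times with values in \<open>[0,\<infinity>]\<close>. No condition links \<open>F \<infinity>\<close> to the probabilities: a filtration
  indexed by \<open>[0,\<infinity>)\<close> extends, for instance, by taking the ambient sigma-algebra at \<open>\<infinity>\<close>.\<close>

locale spectrally_negative_levy = filtration \<Omega> F
  for \<Omega> :: "'a set" and F :: "ennreal \<Rightarrow> 'a measure" +
  fixes P :: "real \<Rightarrow> 'a measure" and X :: "real \<Rightarrow> 'a \<Rightarrow> real"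
  assumes prob: "prob_space (P x)"
    and same_sets: "sets (P x) = sets (P 0)"
    and subalg: "0 \<le> t \<Longrightarrow> subalgebra (P x) (F (ennreal t))"
    and adapted: "0 \<le> t \<Longrightarrow> X t \<in> borel_measurable (F (ennreal t))"
    and cadlag_paths: "\<omega> \<in> \<Omega> \<Longrightarrow> cadlag (\<lambda>t. X t \<omega>)"
    and no_pos_jumps: "AE \<omega> in P x. no_positive_jumps (\<lambda>t. X t \<omega>)"
    and nonmonotone_paths: "AE \<omega> in P x. nonmonotone (\<lambda>t. X t \<omega>)"
    and stationary_increments: "0 \<le> s \<Longrightarrow> 0 \<le> t \<Longrightarrow>
      distr (P x) borel (\<lambda>\<omega>. X (t + s) \<omega> - X t \<omega>) = distr (P x) borel (\<lambda>\<omega>. X s \<omega> - X 0 \<omega>)"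
    and independent_increments: "0 \<le> s \<Longrightarrow> 0 \<le> t \<Longrightarrow>
      prob_space.indep_set (P x) (sets (F (ennreal t)))
        (sets (vimage_algebra \<Omega> (\<lambda>\<omega>. X (t + s) \<omega> - X t \<omega>) borel))"
    and start: "AE \<omega> in P 0. X 0 \<omega> = 0"
    and translation:
      "distr (P x) (\<Pi>\<^sub>M t\<in>{0..}. borel) (\<lambda>\<omega>. \<lambda>t\<in>{0..}. X t \<omega>) =
       distr (P 0) (\<Pi>\<^sub>M t\<in>{0..}. borel) (\<lambda>\<omega>. \<lambda>t\<in>{0..}. x + X t \<omega>)"

locale killed_spectrally_negative_levy = spectrally_negative_levy \<Omega> F P X
  for \<Omega> :: "'a set" and F :: "ennreal \<Rightarrow> 'a measure"
    and P :: "real \<Rightarrow> 'a measure" and X :: "real \<Rightarrow> 'a \<Rightarrow> real" +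
  fixes \<e> :: "'a \<Rightarrow> ennreal" and p :: real
  assumes stopping: "stopping_time F \<e>"
    and killing_pos: "AE \<omega> in P x. 0 < \<e> \<omega>"
    and rate_nonneg: "0 \<le> p"
    and killing: "0 \<le> s \<Longrightarrow> 0 \<le> t \<Longrightarrow> g \<in> borel_measurable borel \<Longrightarrow>
      AE \<omega> in P x.
        nn_cond_exp (P x) (F (ennreal t))
          (\<lambda>\<omega>. (g (X (t + s) \<omega> - X t \<omega>) :: ennreal) * indicator {\<omega>. \<e> \<omega> > ennreal (t + s)} \<omega>) \<omega> =
        (\<integral>\<^sup>+ \<omega>'. g (X s \<omega>') \<partial>P 0) * ennreal (exp (- p * s)) * indicator {\<omega>. ennreal t < \<e> \<omega>} \<omega>"

section \<open>Laplace exponent, its right inverse, and the power series\<close>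

definition laplace_exponent :: "(real \<Rightarrow> 'a measure) \<Rightarrow> (real \<Rightarrow> 'a \<Rightarrow> real) \<Rightarrow> real \<Rightarrow> real" where
  "laplace_exponent P X l = ln (\<integral>\<omega>. exp (l * X 1 \<omega>) \<partial>P 0)"

definition right_inverse :: "(real \<Rightarrow> real) \<Rightarrow> real \<Rightarrow> real" where
  "right_inverse \<psi> q = Inf {l. 0 \<le> l \<and> \<psi> l > q}"

definition series_coeff :: "(real \<Rightarrow> real) \<Rightarrow> real \<Rightarrow> real \<Rightarrow> nat \<Rightarrow> real" where
  "series_coeff \<psi> p \<alpha> k = inverse (\<Prod>l=1..k. \<psi> (right_inverse \<psi> p + real l * \<alpha>) - p)"

definition power_series :: "(real \<Rightarrow> real) \<Rightarrow> real \<Rightarrow> real \<Rightarrow> real \<Rightarrow> real" where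
  "power_series \<psi> p \<alpha> z = (\<Sum>k. series_coeff \<psi> p \<alpha> k * z ^ k)"

section \<open>Conditioning on a random variable\<close>

text \<open>The completion is needed because \<open>last_sup_time\<close> of a measurable process with cadlag paths
  need not be measurable for the uncompleted sigma-algebra (it involves a projection of a set of
  times), and \<open>real_cond_exp\<close> of a non-measurable function is \<open>0\<close>. The conditioning sigma-algebra
  itself is not completed.\<close>

definition cond_exp_given ::
  "'a measure \<Rightarrow> ('a \<Rightarrow> real) \<Rightarrow> ('a \<Rightarrow> 'b::topological_space) \<Rightarrow> 'a \<Rightarrow> real" where
  "cond_exp_given M f Z = real_cond_exp (completion M) (vimage_algebra (space M) Z borel) f"

end

theory Submission imports Defs begin

text \<open>
  Let \<open>\<rho>(y) = I(\<gamma> e\<^sup>\<alpha>\<^sup>y)\<close> and let \<open>\<tau>\<^sub>a\<close> be the first passage time above \<open>a\<close>. Since \<open>X\<close> has no positive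
  jumps, stopping the exponential martingales at \<open>\<tau>\<^sub>a\<close> involves no overshoot. The strong Markov
  property is avoided: optional stopping is carried out along dyadic skeletons, whose overshoot over
  \<open>a\<close> vanishes in the limit. Summing the resulting identities for the exponents \<open>\<Phi> + k\<alpha>\<close> with the
  weights \<open>b\<^sub>k \<gamma>\<^sup>k\<close> gives an equation for the resolvent of the process killed at \<open>\<tau>\<^sub>a\<close>, and from it
  \<open>E\<^sub>x[exp(- \<gamma> I\<^sub>\<tau>\<^sub>a); \<tau>\<^sub>b < e] = exp(- \<Phi> (b - x)) \<rho>(x) / \<rho>(a)\<close> for \<open>x \<le> a \<le> b\<close>. Almost surely the
  suprema of the killed path before and after a dyadic time differ, so
  \<open>\<tau>\<^sub>a\<close> increases to \<open>G\<close> as \<open>a\<close> increases to the overall supremum. Slicing the range of the supremum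
  finely and using the identity on each slice gives the conditional expectation. The statement for
  \<open>Y\<close> is pathwise: the clock \<open>I\<close> is a strictly increasing continuous time change.
\<close>

section \<open>Killing and exponential moments\<close>

text \<open>Formally, the generator of X minus p maps f(y) = exp(\<Phi> y) \<rho>(y) to \<gamma>
  exp(\<alpha> y) f(y): on exp((\<Phi> + k\<alpha>) y) it acts as multiplication by \<psi>(\<Phi> +
  k\<alpha>) - p, and the b_k are exactly the coefficients for which this shifts the series by one
  exponent. Generators are replaced by integrated identities for single exponentials. The factor
  exp(-\<gamma> I) enters through its own density in time: 1 - exp(-\<gamma> I_t) is the integral of
  a bounded adapted rate, which is used as a weight in the identities at each fixed time and then
  integrated out. Hence conditioning takes place at deterministic times only, the form in which the
  killing hypothesis is given. Two obstacles shape the preparations. Exponential moments of X_1 are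
  no hypothesis and must be extracted from the absence of positive jumps; and the overshoot of a
  skeleton is unbounded, so its disappearance in the limit rests on second moments. G is not visibly
  measurable. It is reached by a monotone limit over passage levels, which is correct only if the
  supremum is not attained again after having been approached before.\<close>

lemma upward_uniform_cadlag:
  assumes w: "cadlag w" "no_positive_jumps w" and "0 < T" "0 < \<epsilon>"
  obtains d where "0 < d" "\<And>u v. 0 \<le> u \<Longrightarrow> u \<le> v \<Longrightarrow> v \<le> T \<Longrightarrow> v - u < d \<Longrightarrow> w v - w u \<le> \<epsilon>"
proof -
  \<comment> \<open>A cadlag path has no modulus of continuity, but its jumps are downward here, so
    its upward oscillation behaves like that of a continuous path: every time c has a ball on which
    increments are at most \<epsilon>, and a Lebesgue number of the resulting cover of [0,T] is the
    required d.\<close>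
  have "\<exists>d>0. \<forall>u v. 0 \<le> u \<longrightarrow> u \<le> v \<longrightarrow> u \<in> ball c d \<longrightarrow> v \<in> ball c d \<longrightarrow> w v - w u \<le> \<epsilon>"
    if c: "0 \<le> c" for c
  proof -
    have "(w \<longlongrightarrow> w c) (at_right c)" using w c by (auto simp: cadlag_def)
    then have "\<forall>\<^sub>F v in at_right c. dist (w v) (w c) < \<epsilon>/2"
      by (rule tendstoD) (use \<open>0 < \<epsilon>\<close> in auto)
    then obtain b where b: "b > c" "\<And>v. c < v \<Longrightarrow> v < b \<Longrightarrow> dist (w v) (w c) < \<epsilon>/2"
      by (auto simp: eventually_at_right_field)
    have R: "\<bar>w v - w c\<bar> < \<epsilon>/2" if "c \<le> v" "v < b" for v
      using b(2)[of v] that \<open>0 < \<epsilon>\<close> by (cases "v = c") (auto simp: dist_real_def)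
    show ?thesis
    proof (cases "c = 0")
      case True
      show ?thesis
      proof (intro exI conjI allI impI)
        show "0 < b - c" using b by simp
        fix u v assume "0 \<le> u" "u \<le> v" "u \<in> ball c (b - c)" "v \<in> ball c (b - c)"
        then have "c \<le> u" "u < b" "c \<le> v" "v < b" using True by (auto simp: dist_real_def)
        with R[of u] R[of v] show "w v - w u \<le> \<epsilon>" by linarith
      qed
    next
      case False
      with c have "0 < c" by simp
      then obtain l where l: "(w \<longlongrightarrow> l) (at_left c)" using w by (auto simp: cadlag_def)
      have wl: "w c \<le> l" using w(2) l \<open>0 < c\<close> by (auto simp: no_positive_jumps_def)
      have "\<forall>\<^sub>F v in at_left c. dist (w v) l < \<epsilon>/2"
        by (rule tendstoD[OF l]) (use \<open>0 < \<epsilon>\<close> in auto)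
      then obtain a where a: "a < c" "\<And>v. a < v \<Longrightarrow> v < c \<Longrightarrow> \<bar>w v - l\<bar> < \<epsilon>/2"
        by (auto simp: eventually_at_left_field dist_real_def)
      show ?thesis
      proof (intro exI conjI allI impI)
        show "0 < min (b - c) (c - a)" using a b by simp
        fix u v assume uv: "0 \<le> u" "u \<le> v" "u \<in> ball c (min (b - c) (c - a))" "v \<in> ball c (min (b - c) (c - a))"
        then have *: "a < u" "v < b" "u < b" "a < v" by (auto simp: dist_real_def)
        show "w v - w u \<le> \<epsilon>"
        proof (cases "c \<le> u")
          case True
          with R[of u] R[of v] * uv show ?thesis by linarith
        next
          case F: False
          show ?thesis
          proof (cases "c \<le> v")
            \<comment> \<open>The only pair that straddles c: w u is close to the left limit l, w v
              is close to \<open>w c\<close>, and the jump \<open>w c - l\<close> is not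
              positive.\<close>
            case True with F a(2)[of u] R[of v] * wl show ?thesis by linarith
          next
            case False with F a(2)[of u] a(2)[of v] * show ?thesis by linarith
          qed
        qed
      qed
    qed
  qed
  then obtain d where d: "\<And>c. 0 \<le> c \<Longrightarrow> d c > 0" "\<And>c u v. 0 \<le> c \<Longrightarrow> 0 \<le> u \<Longrightarrow> u \<le> v \<Longrightarrow>
      u \<in> ball c (d c) \<Longrightarrow> v \<in> ball c (d c) \<Longrightarrow> w v - w u \<le> \<epsilon>" by metis
  have "compact {0..T}" by simp
  moreover have "{0..T} \<subseteq> \<Union>((\<lambda>c. ball c (d c)) ` {0..T})" using d(1) by force
  ultimately obtain e where e: "0 < e" "\<And>x. x \<in> {0..T} \<Longrightarrow> \<exists>G\<in>(\<lambda>c. ball c (d c)) ` {0..T}. ball x e \<subseteq> G"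
    by (rule Heine_Borel_lemma) auto
  show ?thesis
  proof (rule that[OF e(1)])
    fix u v assume uv: "0 \<le> u" "u \<le> v" "v \<le> T" "v - u < e"
    obtain c where c: "c \<in> {0..T}" "ball u e \<subseteq> ball c (d c)" using e(2)[of u] uv by auto
    have "u \<in> ball u e" "v \<in> ball u e" using uv e(1) by (auto simp: dist_real_def)
    then have "u \<in> ball c (d c)" "v \<in> ball c (d c)" using c(2) by blast+
    with c d(2)[of c u v] uv show "w v - w u \<le> \<epsilon>" by auto
  qed
qed

context spectrally_negative_levy begin

sublocale P: prob_space "P x" for x by (rule prob)

lemma space_P [simp]: "space (P x) = \<Omega>"
  using subalg[of 0 x] space_F by (simp add: subalgebra_def)

lemma measurable_F_imp_P: "0 \<le> t \<Longrightarrow> f \<in> measurable (F (ennreal t)) N \<Longrightarrow> f \<in> measurable (P x) N"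
  using measurable_from_subalg[OF subalg] .

lemma X_measurable_F: "0 \<le> s \<Longrightarrow> s \<le> t \<Longrightarrow> X s \<in> borel_measurable (F (ennreal t))"
  using measurable_from_subalg[of "F (ennreal t)" "F (ennreal s)"] adapted[of s] sets_F_mono space_F
  by (auto simp: subalgebra_def ennreal_leI)

lemma X_measurable [measurable]: "0 \<le> t \<Longrightarrow> X t \<in> borel_measurable (P x)"
  using measurable_F_imp_P adapted by blast

lemma X_right_continuous: "\<omega> \<in> \<Omega> \<Longrightarrow> 0 \<le> t \<Longrightarrow> ((\<lambda>u. X u \<omega>) \<longlongrightarrow> X t \<omega>) (at_right t)"
  using cadlag_paths by (auto simp: cadlag_def)

lemma start_at: "AE \<omega> in P x. X 0 \<omega> = x"
proof -
  let ?M = "\<Pi>\<^sub>M t\<in>{0..}. (borel :: real measure)"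
  have [measurable]: "(\<lambda>\<omega>. \<lambda>t\<in>{0..}. X t \<omega>) \<in> measurable (P y) ?M"
       "(\<lambda>\<omega>. \<lambda>t\<in>{0..}. x + X t \<omega>) \<in> measurable (P y) ?M" for y
    by (intro measurable_restrict; simp)+
  have "AE \<omega> in P 0. x + X 0 \<omega> = x" using start by simp
  then have "AE f in distr (P 0) ?M (\<lambda>\<omega>. \<lambda>t\<in>{0..}. x + X t \<omega>). f 0 = x"
    by (subst AE_distr_iff) auto
  then have "AE f in distr (P x) ?M (\<lambda>\<omega>. \<lambda>t\<in>{0..}. X t \<omega>). f 0 = x"
    unfolding translation[of x] .
  then show ?thesis by (subst (asm) AE_distr_iff) auto
qed

end

section \<open>Survival events and the one-step identity at deterministic times\<close>

context killed_spectrally_negative_levy begin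

definition alive :: "real \<Rightarrow> 'a set" where "alive t = {\<omega>. ennreal t < \<e> \<omega>}"

lemma alive_antimono: "s \<le> t \<Longrightarrow> alive t \<subseteq> alive s"
  by (auto simp: alive_def intro: le_less_trans ennreal_leI)

lemma alive_measurable_F: "0 \<le> s \<Longrightarrow> s \<le> t \<Longrightarrow> Measurable.pred (F (ennreal t)) (\<lambda>\<omega>. \<omega> \<in> alive s)"
proof -
  assume "0 \<le> s" "s \<le> t"
  have "Measurable.pred (F (ennreal s)) (\<lambda>\<omega>. \<omega> \<in> alive s)"
    unfolding alive_def using stopping_timeD2[OF stopping] by simp
  then show ?thesis using sets_F_mono[of "ennreal s" "ennreal t"] \<open>s \<le> t\<close> space_F
    by (auto simp: pred_def intro!: ennreal_leI)
qed

lemma alive_measurable [measurable]: "0 \<le> t \<Longrightarrow> Measurable.pred (P x) (\<lambda>\<omega>. \<omega> \<in> alive t)"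
  using measurable_F_imp_P[OF _ alive_measurable_F[of t t]] by auto

lemma sets_alive [measurable]: "0 \<le> t \<Longrightarrow> {\<omega>\<in>\<Omega>. \<omega> \<in> alive t} \<in> sets (P x)"
  using alive_measurable[of t x] by (simp add: pred_def)

lemma alive_0: "AE \<omega> in P x. \<omega> \<in> alive 0"
  using killing_pos[of x] by (simp add: alive_def)

text \<open>The killing hypothesis tested against a weight Z that is measurable at time t. All later
  arguments of Markov type go through this integrated form.\<close>

lemma killing_nn:
  fixes g :: "real \<Rightarrow> ennreal"
  assumes st: "0 \<le> s" "0 \<le> t" and [measurable]: "g \<in> borel_measurable borel"
    and Z: "Z \<in> borel_measurable (F (ennreal t))"
  shows "(\<integral>\<^sup>+\<omega>. Z \<omega> * (g (X (t + s) \<omega> - X t \<omega>) * indicator (alive (t + s)) \<omega>) \<partial>P x) =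
     (\<integral>\<^sup>+\<omega>. g (X s \<omega>) \<partial>P 0) * ennreal (exp (- p * s)) * (\<integral>\<^sup>+\<omega>. Z \<omega> * indicator (alive t) \<omega> \<partial>P x)"
proof -
  interpret S: finite_measure_subalgebra "P x" "F (ennreal t)"
    by unfold_locales (use subalg st in auto)
  let ?h = "\<lambda>\<omega>. g (X (t + s) \<omega> - X t \<omega>) * indicator (alive (t + s)) \<omega>"
  have [measurable]: "X (t + s) \<in> borel_measurable (P x)" "X t \<in> borel_measurable (P x)"
    "Measurable.pred (P x) (\<lambda>\<omega>. \<omega> \<in> alive (t + s))" "Measurable.pred (P x) (\<lambda>\<omega>. \<omega> \<in> alive t)"
    using st by auto
  have [measurable]: "Z \<in> borel_measurable (P x)" using Z st measurable_F_imp_P by blast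
  have "(\<integral>\<^sup>+\<omega>. Z \<omega> * ?h \<omega> \<partial>P x) = (\<integral>\<^sup>+\<omega>. Z \<omega> * nn_cond_exp (P x) (F (ennreal t)) ?h \<omega> \<partial>P x)"
    by (rule S.nn_cond_exp_intg[symmetric]) (use Z in auto)
  also have "\<dots> = (\<integral>\<^sup>+\<omega>. (\<integral>\<^sup>+\<omega>. g (X s \<omega>) \<partial>P 0) * ennreal (exp (- p * s)) * (Z \<omega> * indicator (alive t) \<omega>) \<partial>P x)"
    by (intro nn_integral_cong_AE)
       (use killing[OF st assms(3), of x] in \<open>auto simp: alive_def ac_simps\<close>)
  also have "\<dots> = (\<integral>\<^sup>+\<omega>. g (X s \<omega>) \<partial>P 0) * ennreal (exp (- p * s)) * (\<integral>\<^sup>+\<omega>. Z \<omega> * indicator (alive t) \<omega> \<partial>P x)"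
    by (rule nn_integral_cmult) simp
  finally show ?thesis .
qed

lemma prob_alive: "0 \<le> t \<Longrightarrow> emeasure (P x) {\<omega>\<in>\<Omega>. \<omega> \<in> alive t} = ennreal (exp (- p * t))"
proof -
  assume t: "0 \<le> t"
  have "emeasure (P x) {\<omega>\<in>\<Omega>. \<omega> \<in> alive t} = (\<integral>\<^sup>+\<omega>. indicator {\<omega>\<in>\<Omega>. \<omega> \<in> alive t} \<omega> \<partial>P x)"
    using sets_alive[OF t, of x] by simp
  also have "\<dots> = (\<integral>\<^sup>+\<omega>. 1 * (1 * indicator (alive (0 + t)) \<omega>) \<partial>P x)"
    by (intro nn_integral_cong) (auto simp: indicator_def)
  also have "\<dots> = (\<integral>\<^sup>+\<omega>. 1 \<partial>P 0) * ennreal (exp (- p * t)) * (\<integral>\<^sup>+\<omega>. 1 * indicator (alive 0) \<omega> \<partial>P x)"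
    using t by (intro killing_nn) auto
  also have "(\<integral>\<^sup>+\<omega>. 1 * indicator (alive 0) \<omega> \<partial>P x) = (\<integral>\<^sup>+\<omega>. 1 \<partial>P x)"
    by (intro nn_integral_cong_AE) (use alive_0[of x] in auto)
  finally show ?thesis by (simp add: P.emeasure_space_1[simplified])
qed

text \<open>Valued in \<open>ennreal\<close> because finiteness for nonnegative l is a result
  (\<open>mgf_finite\<close>), not a hypothesis.\<close>

definition mgf :: "real \<Rightarrow> real \<Rightarrow> ennreal" where
  "mgf l s = (\<integral>\<^sup>+\<omega>. ennreal (exp (l * X s \<omega>)) \<partial>P 0)"

text \<open>The factor exp(l X_t) is measurable at time t and is absorbed into Z, which leaves only
  the increment for \<open>killing_nn\<close>.\<close>

lemma killing_exp:
  assumes st: "0 \<le> s" "0 \<le> t" and Z: "Z \<in> borel_measurable (F (ennreal t))"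
  shows "(\<integral>\<^sup>+\<omega>. Z \<omega> * (ennreal (exp (l * X (t + s) \<omega>)) * indicator (alive (t + s)) \<omega>) \<partial>P x) =
     mgf l s * ennreal (exp (- p * s)) * (\<integral>\<^sup>+\<omega>. Z \<omega> * (ennreal (exp (l * X t \<omega>)) * indicator (alive t) \<omega>) \<partial>P x)"
proof -
  have [measurable]: "X t \<in> borel_measurable (F (ennreal t))" using st adapted by auto
  have "(\<integral>\<^sup>+\<omega>. Z \<omega> * (ennreal (exp (l * X (t + s) \<omega>)) * indicator (alive (t + s)) \<omega>) \<partial>P x) =
     (\<integral>\<^sup>+\<omega>. (Z \<omega> * ennreal (exp (l * X t \<omega>))) * (ennreal (exp (l * (X (t + s) \<omega> - X t \<omega>))) * indicator (alive (t + s)) \<omega>) \<partial>P x)"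
  proof (intro nn_integral_cong)
    fix \<omega>
    have "exp (l * X (t + s) \<omega>) = exp (l * X t \<omega>) * exp (l * (X (t + s) \<omega> - X t \<omega>))"
      by (simp add: exp_add[symmetric] algebra_simps)
    then show "Z \<omega> * (ennreal (exp (l * X (t + s) \<omega>)) * indicator (alive (t + s)) \<omega>) =
      (Z \<omega> * ennreal (exp (l * X t \<omega>))) * (ennreal (exp (l * (X (t + s) \<omega> - X t \<omega>))) * indicator (alive (t + s)) \<omega>)"
      by (simp add: ennreal_mult mult.assoc)
  qed
  also have "\<dots> = (\<integral>\<^sup>+\<omega>. ennreal (exp (l * X s \<omega>)) \<partial>P 0) * ennreal (exp (- p * s)) *
     (\<integral>\<^sup>+\<omega>. (Z \<omega> * ennreal (exp (l * X t \<omega>))) * indicator (alive t) \<omega> \<partial>P x)"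
    by (rule killing_nn) (use st Z in measurable)
  finally show ?thesis by (simp add: mgf_def ac_simps)
qed

lemma mgf_0: "mgf l 0 = 1"
  unfolding mgf_def using start
  by (subst nn_integral_cong_AE[where v="\<lambda>_. 1"]) (auto simp: P.emeasure_space_1[simplified])

lemma mgf_alive: "0 \<le> s \<Longrightarrow>
  (\<integral>\<^sup>+\<omega>. ennreal (exp (l * X s \<omega>)) * indicator (alive s) \<omega> \<partial>P 0) = mgf l s * ennreal (exp (- p * s))"
proof -
  assume s: "0 \<le> s"
  have "(\<integral>\<^sup>+\<omega>. ennreal (exp (l * X 0 \<omega>)) * indicator (alive 0) \<omega> \<partial>P 0) = (\<integral>\<^sup>+\<omega>. 1 \<partial>P 0)"
    by (intro nn_integral_cong_AE) (use alive_0[of 0] start in auto)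
  then show ?thesis using killing_exp[of s 0 "\<lambda>_. 1" 0 l] s by (simp add: P.emeasure_space_1[simplified])
qed

text \<open>The product rule is read off on the survival event, where \<open>killing_exp\<close>
  applies; the survival probability exp(-p (t + s)) is neither 0 nor infinite and cancels.\<close>

lemma mgf_add:
  assumes "0 \<le> s" "0 \<le> t" shows "mgf l (t + s) = mgf l t * mgf l s"
proof -
  have "mgf l (t + s) * ennreal (exp (- p * (t + s))) = mgf l s * ennreal (exp (- p * s)) * (mgf l t * ennreal (exp (- p * t)))"
    using killing_exp[of s t "\<lambda>_. 1" 0 l] assms mgf_alive[of t l] mgf_alive[of "t + s" l] by simp
  also have "\<dots> = mgf l t * mgf l s * (ennreal (exp (- p * s)) * ennreal (exp (- p * t)))"
    by (simp add: ac_simps)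
  also have "ennreal (exp (- p * s)) * ennreal (exp (- p * t)) = ennreal (exp (- p * (t + s)))"
    by (simp add: ennreal_mult[symmetric] exp_add[symmetric] algebra_simps)
  finally show ?thesis
    using ennreal_mult_cancel_left[of "ennreal (exp (- p * (t + s)))" "mgf l (t + s)" "mgf l t * mgf l s"]
    by (simp add: mult.commute[of "ennreal (exp (- (p * (t + s))))"])
qed

lemma mgf_pow: "0 \<le> s \<Longrightarrow> mgf l (real k * s) = mgf l s ^ k"
proof (induction k)
  case 0 then show ?case by (simp add: mgf_0)
next
  case (Suc k)
  have "mgf l (real (Suc k) * s) = mgf l (real k * s + s)" by (simp add: algebra_simps)
  with Suc mgf_add[of s "real k * s" l] show ?case by (simp add: mult.commute)
qed

section \<open>Truncated dyadic walks\<close>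

lemma pred_P: "Measurable.pred (P x) Q \<Longrightarrow> {\<omega>\<in>\<Omega>. Q \<omega>} \<in> sets (P x)"
  by (simp add: pred_def)

text \<open>Steps capped at 1 have exponential moments from the outset and overshoot any level by at
  most 1. Since paths have no positive jumps, the cap becomes inactive on a fine enough
  mesh.\<close>

definition trunc_sum :: "real \<Rightarrow> nat \<Rightarrow> 'a \<Rightarrow> real" where
  "trunc_sum d k \<omega> = (\<Sum>i<k. min (X (real i * d + d) \<omega> - X (real i * d) \<omega>) 1)"

definition trunc_below :: "real \<Rightarrow> nat \<Rightarrow> 'a set" where
  "trunc_below d k = {\<omega>. \<forall>j\<le>k. trunc_sum d j \<omega> \<le> 1}"

lemma trunc_sum_measurable_F: "0 \<le> d \<Longrightarrow> j \<le> k \<Longrightarrow> trunc_sum d j \<in> borel_measurable (F (ennreal (real k * d)))"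
proof -
  assume d: "0 \<le> d" and jk: "j \<le> k"
  have *: "real i * d + d \<le> real k * d" if "i < j" for i
  proof -
    have "real i + 1 \<le> real k" using that jk by linarith
    from mult_right_mono[OF this d] show ?thesis by (simp add: algebra_simps)
  qed
  have **: "real i * d \<le> real k * d" if "i < j" for i
    using *[OF that] d by linarith
  show ?thesis unfolding trunc_sum_def
    by (intro borel_measurable_sum borel_measurable_min borel_measurable_diff X_measurable_F)
       (use d * ** in auto)
qed

lemma trunc_below_measurable_F:
  "0 \<le> d \<Longrightarrow> Measurable.pred (F (ennreal (real k * d))) (\<lambda>\<omega>. \<omega> \<in> trunc_below d k)"
proof -
  assume d: "0 \<le> d"
  have "Measurable.pred (F (ennreal (real k * d))) (\<lambda>\<omega>. trunc_sum d j \<omega> \<le> 1)" if "j \<in> {..k}" for j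
  proof -
    have [measurable]: "trunc_sum d j \<in> borel_measurable (F (ennreal (real k * d)))"
      using trunc_sum_measurable_F[OF d] that by simp
    show ?thesis by measurable
  qed
  then have "Measurable.pred (F (ennreal (real k * d))) (\<lambda>\<omega>. \<forall>j\<in>{..k}. trunc_sum d j \<omega> \<le> 1)"
    by (intro pred_intros_finite) auto
  then show ?thesis by (simp only: trunc_below_def mem_Collect_eq Ball_def atMost_iff)
qed

lemma trunc_sum_le: "trunc_sum d k \<omega> \<le> X (real k * d) \<omega> - X 0 \<omega>"
proof (induction k)
  case (Suc k)
  have "X (real (Suc k) * d) \<omega> = X (real k * d + d) \<omega>" by (simp add: algebra_simps)
  with Suc show ?case by (simp add: trunc_sum_def)
qed (simp add: trunc_sum_def)

lemma trunc_sum_eq: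
  "(\<And>i. i < k \<Longrightarrow> X (real i * d + d) \<omega> - X (real i * d) \<omega> \<le> 1) \<Longrightarrow>
   trunc_sum d k \<omega> = X (real k * d) \<omega> - X 0 \<omega>"
proof (induction k)
  case (Suc k)
  have "X (real (Suc k) * d) \<omega> = X (real k * d + d) \<omega>" by (simp add: algebra_simps)
  with Suc show ?case by (simp add: trunc_sum_def)
qed (simp add: trunc_sum_def)

lemma trunc_below_Suc: "\<omega> \<in> trunc_below d (Suc k) \<longleftrightarrow> \<omega> \<in> trunc_below d k \<and> trunc_sum d (Suc k) \<omega> \<le> 1"
  by (auto simp: trunc_below_def le_Suc_eq)

text \<open>The factor \<open>r\<close> is the mean of one truncated step. Decomposing at the first passage of the
  truncated walk over level 1, where the overshoot is at most 1, bounds \<open>r ^ m\<close> independently of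
  the number of steps.\<close>

lemma trunc_step:
  assumes d: "0 \<le> d" and Z: "Z \<in> borel_measurable (F (ennreal (real k * d)))"
  shows "(\<integral>\<^sup>+\<omega>. Z \<omega> * (ennreal (exp (l * trunc_sum d (Suc k) \<omega>)) * indicator (alive (real (Suc k) * d)) \<omega>) \<partial>P 0) =
    (\<integral>\<^sup>+\<omega>. ennreal (exp (l * min (X d \<omega>) 1)) \<partial>P 0) * ennreal (exp (- p * d)) *
    (\<integral>\<^sup>+\<omega>. Z \<omega> * (ennreal (exp (l * trunc_sum d k \<omega>)) * indicator (alive (real k * d)) \<omega>) \<partial>P 0)"
proof -
  let ?t = "real k * d"
  have S: "real (Suc k) * d = ?t + d" by (simp add: algebra_simps)
  have [measurable]: "trunc_sum d k \<in> borel_measurable (F (ennreal ?t))"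
    using trunc_sum_measurable_F[OF d order_refl] .
  note [measurable] = Z
  have "(\<integral>\<^sup>+\<omega>. Z \<omega> * (ennreal (exp (l * trunc_sum d (Suc k) \<omega>)) * indicator (alive (real (Suc k) * d)) \<omega>) \<partial>P 0) =
    (\<integral>\<^sup>+\<omega>. (Z \<omega> * ennreal (exp (l * trunc_sum d k \<omega>))) * (ennreal (exp (l * min (X (?t + d) \<omega> - X ?t \<omega>) 1)) * indicator (alive (?t + d)) \<omega>) \<partial>P 0)"
    by (intro nn_integral_cong)
       (simp only: S, simp add: trunc_sum_def distrib_left exp_add ennreal_mult mult.assoc)
  also have "\<dots> = (\<integral>\<^sup>+\<omega>. ennreal (exp (l * min (X d \<omega>) 1)) \<partial>P 0) * ennreal (exp (- p * d)) *
     (\<integral>\<^sup>+\<omega>. (Z \<omega> * ennreal (exp (l * trunc_sum d k \<omega>))) * indicator (alive ?t) \<omega> \<partial>P 0)"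
    by (rule killing_nn[where g="\<lambda>y. ennreal (exp (l * min y 1))"]) (use d in auto)
  finally show ?thesis by (simp add: mult.assoc)
qed

lemma alive_0_exp_trunc: "(\<integral>\<^sup>+\<omega>. ennreal (exp (l * trunc_sum d 0 \<omega>)) * indicator (alive 0) \<omega> \<partial>P 0) = 1"
proof -
  have "(\<integral>\<^sup>+\<omega>. ennreal (exp (l * trunc_sum d 0 \<omega>)) * indicator (alive 0) \<omega> \<partial>P 0) = (\<integral>\<^sup>+\<omega>. 1 \<partial>P 0)"
    by (intro nn_integral_cong_AE) (use alive_0[of 0] in \<open>auto simp: trunc_sum_def\<close>)
  then show ?thesis by (simp add: P.emeasure_space_1[simplified])
qed

lemma trunc_pow:
  assumes d: "0 \<le> d"
  shows "(\<integral>\<^sup>+\<omega>. ennreal (exp (l * trunc_sum d k \<omega>)) * indicator (alive (real k * d)) \<omega> \<partial>P 0) =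
    ((\<integral>\<^sup>+\<omega>. ennreal (exp (l * min (X d \<omega>) 1)) \<partial>P 0) * ennreal (exp (- p * d))) ^ k"
proof (induction k)
  case 0 then show ?case using alive_0_exp_trunc by simp
next
  case (Suc k)
  then show ?case using trunc_step[OF d, of "\<lambda>_. 1" k l] by simp
qed

text \<open>The power \<open>r ^ m\<close> occurs on both sides. The inequality becomes a bound once
  the probability on the right is small enough for that term to be absorbed, which
  \<open>mgf_finite_small\<close> achieves by shortening the time interval.\<close>

lemma trunc_pow_le:
  assumes d: "0 \<le> d" and l: "0 \<le> l"
  defines "r \<equiv> (\<integral>\<^sup>+\<omega>. ennreal (exp (l * min (X d \<omega>) 1)) \<partial>P 0)"
  assumes r1: "1 \<le> r"
  shows "(r * ennreal (exp (- p * d))) ^ m \<le>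
    ennreal (exp l) + ennreal (exp (2 * l)) * r ^ m * emeasure (P 0) {\<omega>\<in>\<Omega>. \<omega> \<notin> trunc_below d m}"
proof -
  define r' where "r' = r * ennreal (exp (- p * d))"
  \<comment> \<open>V k is the exponential mass still at or below level 1 after k steps, and U k the
    mass that first exceeds it at step k + 1. One step multiplies by r', so r' * V k splits into V
    (Suc k) and U k, and \<open>pow\<close> iterates this.\<close>
  define V where "V k = (\<integral>\<^sup>+\<omega>. indicator (trunc_below d k) \<omega> *
      (ennreal (exp (l * trunc_sum d k \<omega>)) * indicator (alive (real k * d)) \<omega>) \<partial>P 0)" for k
  define U where "U k = (\<integral>\<^sup>+\<omega>. indicator (trunc_below d k - trunc_below d (Suc k)) \<omega> *
      (ennreal (exp (l * trunc_sum d (Suc k) \<omega>)) * indicator (alive (real (Suc k) * d)) \<omega>) \<partial>P 0)" for k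
  have [measurable]: "Measurable.pred (P 0) (\<lambda>\<omega>. \<omega> \<in> trunc_below d k)"
       "trunc_sum d k \<in> borel_measurable (P 0)" 
       "Measurable.pred (P 0) (\<lambda>\<omega>. \<omega> \<in> alive (real k * d))" for k
    using d measurable_F_imp_P[OF _ trunc_below_measurable_F[of d k]]
      measurable_F_imp_P[OF _ trunc_sum_measurable_F[of d k k]]
      alive_measurable[of "real k * d" 0] by auto
  have [measurable]: "(\<lambda>\<omega>. indicator (trunc_below d k) \<omega> :: ennreal) \<in> borel_measurable (F (ennreal (real k * d)))" for k
    using trunc_below_measurable_F[OF d, of k] by measurable
  have step: "V (Suc k) + U k = r' * V k" for k
  proof -
    have "V (Suc k) + U k = (\<integral>\<^sup>+\<omega>. indicator (trunc_below d (Suc k)) \<omega> *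
      (ennreal (exp (l * trunc_sum d (Suc k) \<omega>)) * indicator (alive (real (Suc k) * d)) \<omega>) +
      indicator (trunc_below d k - trunc_below d (Suc k)) \<omega> *
      (ennreal (exp (l * trunc_sum d (Suc k) \<omega>)) * indicator (alive (real (Suc k) * d)) \<omega>) \<partial>P 0)"
      unfolding V_def U_def by (rule nn_integral_add[symmetric]) measurable
    also have "\<dots> = (\<integral>\<^sup>+\<omega>. indicator (trunc_below d k) \<omega> *
      (ennreal (exp (l * trunc_sum d (Suc k) \<omega>)) * indicator (alive (real (Suc k) * d)) \<omega>) \<partial>P 0)"
      by (intro nn_integral_cong) (auto simp: indicator_def trunc_below_Suc)
    also have "\<dots> = r' * V k"
      unfolding r'_def r_def V_def by (rule trunc_step) (use d in auto)
    finally show ?thesis .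
  qed
  have V0: "V 0 = 1"
  proof -
    have "V 0 = (\<integral>\<^sup>+\<omega>. ennreal (exp (l * trunc_sum d 0 \<omega>)) * indicator (alive 0) \<omega> \<partial>P 0)"
      unfolding V_def by (intro nn_integral_cong) (auto simp: trunc_below_def trunc_sum_def)
    then show ?thesis using alive_0_exp_trunc by simp
  qed
  have pow: "r' ^ k = V k + (\<Sum>i<k. U i * r' ^ (k - 1 - i))" for k
  proof (induction k)
    case 0 then show ?case by (simp add: V0)
  next
    case (Suc k)
    have "r' ^ Suc k = r' * V k + (\<Sum>i<k. U i * (r' * r' ^ (k - 1 - i)))"
      by (simp add: Suc distrib_left sum_distrib_left ac_simps)
    also have "(\<Sum>i<k. U i * (r' * r' ^ (k - 1 - i))) = (\<Sum>i<k. U i * r' ^ (Suc k - 1 - i))"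
      by (intro sum.cong refl) (simp add: power_Suc[symmetric] Suc_diff_Suc del: power_Suc)
    finally show ?case unfolding step[symmetric] by (simp add: add.assoc)
  qed
  have V_le: "V m \<le> ennreal (exp l)"
  proof -
    have "V m \<le> (\<integral>\<^sup>+\<omega>. ennreal (exp l) \<partial>P 0)"
      unfolding V_def by (intro nn_integral_mono)
        (auto simp: indicator_def trunc_below_def intro!: ennreal_leI mult_left_le[OF _ l])
    then show ?thesis by (simp add: P.emeasure_space_1[simplified])
  qed
  have U_le: "U i \<le> ennreal (exp (2 * l)) * emeasure (P 0) {\<omega>\<in>\<Omega>. \<omega> \<in> trunc_below d i - trunc_below d (Suc i)}" for i
  proof -
    have "U i \<le> (\<integral>\<^sup>+\<omega>. ennreal (exp (2 * l)) * indicator {\<omega>\<in>\<Omega>. \<omega> \<in> trunc_below d i - trunc_below d (Suc i)} \<omega> \<partial>P 0)"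
      unfolding U_def
    proof (intro nn_integral_mono)
      fix \<omega> assume "\<omega> \<in> space (P 0)"
      show "indicator (trunc_below d i - trunc_below d (Suc i)) \<omega> *
           (ennreal (exp (l * trunc_sum d (Suc i) \<omega>)) * indicator (alive (real (Suc i) * d)) \<omega>)
         \<le> ennreal (exp (2 * l)) * indicator {\<omega> \<in> \<Omega>. \<omega> \<in> trunc_below d i - trunc_below d (Suc i)} \<omega>"
      proof (cases "\<omega> \<in> trunc_below d i")
        case True
        then have "trunc_sum d i \<omega> \<le> 1" by (auto simp: trunc_below_def)
        then have "trunc_sum d (Suc i) \<omega> \<le> 2" by (simp add: trunc_sum_def)
        then have "l * trunc_sum d (Suc i) \<omega> \<le> 2 * l" using mult_left_mono[OF _ l] by fastforce
        then show ?thesis using \<open>\<omega> \<in> space (P 0)\<close> by (auto simp: indicator_def intro!: ennreal_leI)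
      qed auto
    qed
    also have "\<dots> = ennreal (exp (2 * l)) * emeasure (P 0) {\<omega>\<in>\<Omega>. \<omega> \<in> trunc_below d i - trunc_below d (Suc i)}"
      by (rule nn_integral_cmult_indicator, rule pred_P, measurable)
    finally show ?thesis .
  qed
  \<comment> \<open>Here \<open>1 \<le> r\<close> enters: it allows every power of r' to be replaced
    by the same \<open>r ^ m\<close>, after which the first-crossing probabilities can be added
    up.\<close>
  have rr: "r' ^ j \<le> r ^ m" if "j \<le> m" for j
  proof -
    have "ennreal (exp (- p * d)) \<le> 1" using d rate_nonneg by (subst ennreal_1[symmetric], intro ennreal_leI) simp
    then have "r' \<le> r" unfolding r'_def using mult_left_mono[of _ 1 r] by fastforce
    then have "r' ^ j \<le> r ^ j" by (intro power_mono) auto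
    also have "\<dots> \<le> r ^ m" using r1 that by (rule power_increasing[rotated])
    finally show ?thesis .
  qed
  have "(\<Sum>i<m. U i * r' ^ (m - 1 - i)) \<le>
      (\<Sum>i<m. ennreal (exp (2 * l)) * emeasure (P 0) {\<omega>\<in>\<Omega>. \<omega> \<in> trunc_below d i - trunc_below d (Suc i)} * r ^ m)"
    by (intro sum_mono mult_mono U_le rr) auto
  also have "\<dots> = ennreal (exp (2 * l)) * r ^ m * (\<Sum>i<m. emeasure (P 0) {\<omega>\<in>\<Omega>. \<omega> \<in> trunc_below d i - trunc_below d (Suc i)})"
    by (simp add: sum_distrib_left ac_simps)
  also have "(\<Sum>i<m. emeasure (P 0) {\<omega>\<in>\<Omega>. \<omega> \<in> trunc_below d i - trunc_below d (Suc i)}) =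
     emeasure (P 0) (\<Union>i<m. {\<omega>\<in>\<Omega>. \<omega> \<in> trunc_below d i - trunc_below d (Suc i)})"
  proof (rule sum_emeasure)
    show "disjoint_family_on (\<lambda>i. {\<omega> \<in> \<Omega>. \<omega> \<in> trunc_below d i - trunc_below d (Suc i)}) {..<m}"
    proof -
      have mono: "\<omega> \<in> trunc_below d j \<Longrightarrow> i \<le> j \<Longrightarrow> \<omega> \<in> trunc_below d i" for \<omega> i j
        by (auto simp: trunc_below_def)
      have False if "i \<noteq> j" "\<omega> \<in> trunc_below d i - trunc_below d (Suc i)" "\<omega> \<in> trunc_below d j - trunc_below d (Suc j)" for i j \<omega>
        using that mono[of \<omega> j "Suc i"] mono[of \<omega> i "Suc j"] by (cases "i < j") auto
      then show ?thesis unfolding disjoint_family_on_def by blast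
    qed
  qed (simp, rule image_subsetI, rule pred_P, measurable)
  also have "\<dots> \<le> emeasure (P 0) {\<omega>\<in>\<Omega>. \<omega> \<notin> trunc_below d m}"
  proof (rule emeasure_mono)
    show "(\<Union>i<m. {\<omega>\<in>\<Omega>. \<omega> \<in> trunc_below d i - trunc_below d (Suc i)}) \<subseteq> {\<omega>\<in>\<Omega>. \<omega> \<notin> trunc_below d m}"
      by (auto simp: trunc_below_def) (meson Suc_leI le_trans)
  qed (intro pred_P, measurable)
  finally have "(\<Sum>i<m. U i * r' ^ (m - 1 - i)) \<le> ennreal (exp (2 * l)) * r ^ m * emeasure (P 0) {\<omega>\<in>\<Omega>. \<omega> \<notin> trunc_below d m}"
    by (simp add: mult_left_mono)
  with V_le show ?thesis unfolding r'_def[symmetric] pow[of m] by (rule add_mono)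
qed

end

text \<open>The \<open>Suc\<close> keeps the approximation strictly above u even when u is itself
  dyadic, so limits along it are limits from the right.\<close>

definition dyadic_above :: "nat \<Rightarrow> real \<Rightarrow> real" where
  "dyadic_above n u = real (Suc (nat \<lfloor>u * 2 ^ n\<rfloor>)) / 2 ^ n"

lemma dyadic_above_bounds:
  assumes "0 \<le> u" shows "u < dyadic_above n u" "dyadic_above n u \<le> u + 1 / 2 ^ n"
proof -
  have "0 \<le> u * 2 ^ n" using assms by simp
  then have *: "real (nat \<lfloor>u * 2 ^ n\<rfloor>) = of_int \<lfloor>u * 2 ^ n\<rfloor>" by simp
  have "u * 2 ^ n < real (Suc (nat \<lfloor>u * 2 ^ n\<rfloor>))" "real (Suc (nat \<lfloor>u * 2 ^ n\<rfloor>)) \<le> u * 2 ^ n + 1"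
    using * by linarith+
  then show "u < dyadic_above n u" "dyadic_above n u \<le> u + 1 / 2 ^ n"
    by (auto simp: dyadic_above_def field_simps)
qed

lemma LIMSEQ_half_pow: "(\<lambda>n. c / 2 ^ n :: real) \<longlonglongrightarrow> 0"
  using tendsto_mult[OF tendsto_const[of c] LIMSEQ_realpow_zero[of "1/2"]]
  by (simp add: power_divide)

lemma filterlim_dyadic_above:
  assumes "0 \<le> u" shows "filterlim (\<lambda>n. dyadic_above n u) (at_right u) sequentially"
proof -
  have "(\<lambda>n. dyadic_above n u) \<longlonglongrightarrow> u"
  proof (rule tendsto_sandwich[of "\<lambda>_. u" _ _ "\<lambda>n. u + 1 / 2 ^ n"])
    show "(\<lambda>n. u + 1 / 2 ^ n) \<longlonglongrightarrow> u"
      using tendsto_add[OF tendsto_const[of u] LIMSEQ_half_pow[of 1]] by simp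
  qed (use dyadic_above_bounds[OF assms] in \<open>auto intro!: always_eventually less_imp_le\<close>)
  then show ?thesis
    using dyadic_above_bounds(1)[OF assms]
    by (auto simp: filterlim_at intro!: always_eventually) (metis less_irrefl)
qed

lemma antimono_on_dyadicI:
  assumes w: "\<And>t. 0 \<le> t \<Longrightarrow> (w \<longlongrightarrow> w t) (at_right t)"
    and mono: "\<And>n i. w (real (Suc i) / 2 ^ n) \<le> w (real i / 2 ^ n)"
  shows "antimono_on {0..} (w :: real \<Rightarrow> real)"
proof (rule monotone_onI)
  fix s t :: real assume st: "s \<in> {0..}" "t \<in> {0..}" "s \<le> t"
  have anti: "w (real j / 2 ^ n) \<le> w (real i / 2 ^ n)" if "i \<le> j" for i j n
    using lift_Suc_antimono_le[of "\<lambda>i. w (real i / 2 ^ n)", OF mono that] .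
  have "(\<lambda>n. w (dyadic_above n s)) \<longlonglongrightarrow> w s" "(\<lambda>n. w (dyadic_above n t)) \<longlonglongrightarrow> w t"
    using filterlim_compose[OF w filterlim_dyadic_above] st by auto
  moreover have "w (dyadic_above n t) \<le> w (dyadic_above n s)" for n
    unfolding dyadic_above_def
    by (rule anti) (use st in \<open>auto intro!: nat_mono floor_mono mult_right_mono\<close>)
  ultimately show "w t \<le> w s" by (meson LIMSEQ_le)
qed

section \<open>Finiteness of exponential moments\<close>

context killed_spectrally_negative_levy begin

definition early_passage :: "nat \<Rightarrow> 'a set" where
  "early_passage j = {\<omega>\<in>\<Omega>. \<exists>n i. real i / 2 ^ n \<le> 1 / 2 ^ j \<and> 1 < X (real i / 2 ^ n) \<omega>}"

lemma sets_early_passage [measurable]: "early_passage j \<in> sets (P x)"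
  unfolding early_passage_def by (intro pred_P) measurable

text \<open>The events decrease in j, and a path that starts at 0 and is right continuous there
  leaves them eventually; continuity from above does the rest.\<close>

lemma early_passage_tendsto: "(\<lambda>j. measure (P 0) (early_passage j)) \<longlonglongrightarrow> 0"
proof -
  have dec: "decseq early_passage"
  proof (rule decseq_SucI)
    fix j
    have "(1::real) / 2 ^ Suc j \<le> 1 / 2 ^ j" by (simp add: field_simps)
    then show "early_passage (Suc j) \<subseteq> early_passage j"
      unfolding early_passage_def using order_trans by blast
  qed
  have "(\<lambda>j. measure (P 0) (early_passage j)) \<longlonglongrightarrow> measure (P 0) (\<Inter>j. early_passage j)"
    by (rule P.finite_Lim_measure_decseq) (use dec in auto)
  moreover have "AE \<omega> in P 0. \<omega> \<notin> (\<Inter>j. early_passage j)"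
    using start AE_space
  proof eventually_elim
    case (elim \<omega>)
    have "\<forall>\<^sub>F u in at_right 0. X u \<omega> < 1"
      using X_right_continuous[of \<omega> 0] elim by (auto intro: order_tendstoD(2)[of _ 0])
    then obtain b where b: "0 < b" "\<And>u. 0 < u \<Longrightarrow> u < b \<Longrightarrow> X u \<omega> < 1"
      by (auto simp: eventually_at_right_field)
    obtain j where j: "1 / 2 ^ j < b"
      using order_tendstoD(2)[OF LIMSEQ_half_pow[of 1] b(1)] by (auto simp: eventually_sequentially)
    have "\<omega> \<notin> early_passage j"
    proof
      assume "\<omega> \<in> early_passage j"
      then obtain n i where ni: "real i / 2 ^ n \<le> 1 / 2 ^ j" "1 < X (real i / 2 ^ n) \<omega>"
        by (auto simp: early_passage_def)
      show False
      proof (cases "i = 0")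
        case False
        then have "0 < real i / 2 ^ n" by simp
        with b(2)[of "real i / 2 ^ n"] ni j show False by linarith
      qed (use ni elim in simp)
    qed
    then show ?case by auto
  qed
  then have "measure (P 0) (\<Inter>j. early_passage j) = 0"
    by (subst P.prob_eq_0) auto
  ultimately show ?thesis by simp
qed

text \<open>Capping only lowers the walk, so a crossing by the walk is a crossing by X. The 2^n
  steps of length 2^-(j+n) fill exactly the interval [0, 2^-j].\<close>

lemma trunc_below_early_passage:
  "emeasure (P 0) {\<omega>\<in>\<Omega>. \<omega> \<notin> trunc_below (1 / 2 ^ (j + n)) (2 ^ n)} \<le> emeasure (P 0) (early_passage j)"
proof (rule emeasure_mono_AE)
  show "AE \<omega> in P 0. \<omega> \<in> {\<omega>\<in>\<Omega>. \<omega> \<notin> trunc_below (1 / 2 ^ (j + n)) (2 ^ n)} \<longrightarrow> \<omega> \<in> early_passage j"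
    using start
  proof eventually_elim
    case (elim \<omega>)
    show ?case
    proof
      assume "\<omega> \<in> {\<omega>\<in>\<Omega>. \<omega> \<notin> trunc_below (1 / 2 ^ (j + n)) (2 ^ n)}"
      then obtain k where k: "\<omega> \<in> \<Omega>" "k \<le> 2 ^ n" "1 < trunc_sum (1 / 2 ^ (j + n)) k \<omega>"
        by (auto simp: trunc_below_def not_le)
      have "1 < X (real k / 2 ^ (j + n)) \<omega>"
        using k(3) trunc_sum_le[of "1 / 2 ^ (j + n)" k \<omega>] elim by simp
      moreover have "real k / 2 ^ (j + n) \<le> 1 / 2 ^ j"
      proof -
        have "real k \<le> 2 ^ n" using k(2) by (metis of_nat_le_iff of_nat_numeral of_nat_power)
        then show ?thesis by (simp add: power_add field_simps)
      qed
      ultimately show "\<omega> \<in> early_passage j" unfolding early_passage_def using k(1) by blast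
    qed
  qed
qed simp

text \<open>The index j is fixed so that the crossing probability q is below exp(-p - 2l) / 2. Then
  the term exp(2l) r^m q of \<open>trunc_pow_le\<close> is at most half of exp(-p) r^m and is
  absorbed on the left, leaving the bound 2 exp(l + p) for every mesh. Fatou's lemma then removes
  the truncation.\<close>

lemma mgf_finite_small:
  assumes l: "0 \<le> l" shows "\<exists>j. mgf l (1 / 2 ^ j) < \<top>"
proof -
  have "0 < exp (- p - 2 * l) / 2" by simp
  from order_tendstoD(2)[OF early_passage_tendsto this]
  obtain j where j: "measure (P 0) (early_passage j) < exp (- p - 2 * l) / 2"
    by (auto simp: eventually_sequentially)
  define q where "q = measure (P 0) (early_passage j)"
  define d where "d n = (1::real) / 2 ^ (j + n)" for n
  define r where "r n = (\<integral>\<^sup>+\<omega>. ennreal (exp (l * min (X (d n) \<omega>) 1)) \<partial>P 0)" for n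
  have d0: "0 \<le> d n" for n by (simp add: d_def)
  have dm: "real (2 ^ n) * d n = 1 / 2 ^ j" for n by (simp add: d_def power_add)
  let ?C = "2 * exp (l + p)"
  have bound: "(r n * ennreal (exp (- p * d n))) ^ (2 ^ n) \<le> ennreal ?C" for n
  proof -
    have "r n \<le> (\<integral>\<^sup>+\<omega>. ennreal (exp l) \<partial>P 0)"
      unfolding r_def by (intro nn_integral_mono ennreal_leI) (use l in \<open>auto intro!: mult_left_le\<close>)
    then have "r n \<le> ennreal (exp l)" by (simp add: P.emeasure_space_1[simplified])
    then obtain \<rho> where \<rho>: "r n = ennreal \<rho>" "0 \<le> \<rho>"
      by (cases "r n") (auto simp: top_unique)
    have e1: "exp (- p * d n) \<le> 1" using rate_nonneg d0 by simp
    have C1: "1 \<le> ?C"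
    proof -
      have "1 \<le> exp (l + p)" using l rate_nonneg by simp
      then show ?thesis by linarith
    qed
    have lhs: "(r n * ennreal (exp (- p * d n))) ^ (2 ^ n) = ennreal (\<rho> ^ (2 ^ n) * exp (- p / 2 ^ j))"
    proof -
      have "exp (- p * d n) ^ (2 ^ n) = exp (real (2 ^ n) * (- p * d n))" by (rule exp_of_nat_mult[symmetric])
      also have "real (2 ^ n) * (- p * d n) = - p * (real (2 ^ n) * d n)" by simp
      also have "\<dots> = - p / 2 ^ j" by (simp only: dm) simp
      finally show ?thesis using \<rho> by (simp add: ennreal_mult[symmetric] ennreal_power power_mult_distrib)
    qed
    have ep: "exp (- p / 2 ^ j) \<le> 1" "exp (- p) \<le> exp (- p / 2 ^ j)"
      using rate_nonneg by (auto simp: field_simps mult_le_cancel_left1)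
    show ?thesis
    proof (cases "\<rho> \<le> 1")
      case True
      have "\<rho> ^ (2 ^ n) * exp (- p / 2 ^ j) \<le> 1 * 1"
        by (intro mult_mono power_le_one) (use True \<rho> ep in auto)
      then show ?thesis unfolding lhs using C1 by (intro ennreal_leI) linarith
    next
      case False
      then have "1 \<le> r n" using \<rho> by simp
      then have "(r n * ennreal (exp (- p * d n))) ^ (2 ^ n) \<le> ennreal (exp l) + ennreal (exp (2 * l)) * r n ^ (2 ^ n) *
          emeasure (P 0) {\<omega>\<in>\<Omega>. \<omega> \<notin> trunc_below (d n) (2 ^ n)}"
        unfolding r_def by (intro trunc_pow_le d0 l)
      also have "\<dots> \<le> ennreal (exp l) + ennreal (exp (2 * l)) * r n ^ (2 ^ n) * emeasure (P 0) (early_passage j)"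
        unfolding d_def by (intro add_left_mono mult_left_mono trunc_below_early_passage) auto
      also have "\<dots> = ennreal (exp l + exp (2 * l) * \<rho> ^ (2 ^ n) * q)"
        using \<rho> by (simp add: P.emeasure_eq_measure q_def ennreal_power ennreal_mult ennreal_plus)
      finally have "\<rho> ^ (2 ^ n) * exp (- p / 2 ^ j) \<le> exp l + exp (2 * l) * \<rho> ^ (2 ^ n) * q"
        unfolding lhs by (subst (asm) ennreal_le_iff) (use \<rho> in \<open>auto simp: q_def\<close>)
      moreover have "\<rho> ^ (2 ^ n) * exp (- p) \<le> \<rho> ^ (2 ^ n) * exp (- p / 2 ^ j)"
        using ep \<rho> by (intro mult_left_mono) auto
      moreover have "exp (2 * l) * \<rho> ^ (2 ^ n) * q \<le> exp (2 * l) * \<rho> ^ (2 ^ n) * (exp (- p - 2 * l) / 2)"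
        using j \<rho> by (intro mult_left_mono) (auto simp: q_def)
      moreover have "exp (2 * l) * \<rho> ^ (2 ^ n) * (exp (- p - 2 * l) / 2) = \<rho> ^ (2 ^ n) * exp (- p) / 2"
        by (simp add: exp_diff)
      ultimately have "\<rho> ^ (2 ^ n) * exp (- p) \<le> 2 * exp l" by linarith
      then have "\<rho> ^ (2 ^ n) \<le> ?C"
        by (simp add: exp_minus exp_add field_simps)
      moreover have "\<rho> ^ (2 ^ n) * exp (- p / 2 ^ j) \<le> \<rho> ^ (2 ^ n)"
        using ep \<rho> by (intro mult_left_le) auto
      ultimately show ?thesis unfolding lhs by (intro ennreal_leI) linarith
    qed
  qed
  let ?t = "1 / 2 ^ j :: real"
  let ?u = "\<lambda>n \<omega>. ennreal (exp (l * trunc_sum (d n) (2 ^ n) \<omega>)) * indicator (alive (real (2 ^ n) * d n)) \<omega>"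
  have [measurable]: "trunc_sum (d n) k \<in> borel_measurable (P 0)" for n k
    using measurable_F_imp_P[OF _ trunc_sum_measurable_F[of "d n" k k]] d0 by simp
  have [measurable]: "Measurable.pred (P 0) (\<lambda>\<omega>. \<omega> \<in> alive (real (2 ^ n) * d n))" for n
    using d0 by (intro alive_measurable) simp
  have lim: "AE \<omega> in P 0. ennreal (exp (l * X ?t \<omega>)) * indicator (alive ?t) \<omega> = liminf (\<lambda>n. ?u n \<omega>)"
    using start AE_space no_pos_jumps
  proof eventually_elim
    case (elim \<omega>)
    \<comment> \<open>Increments over times shorter than \<delta> are at most 1, so on a fine mesh
      no step is capped and the truncated sum telescopes to X itself.\<close>
    obtain \<delta> where \<delta>: "0 < \<delta>" "\<And>u v. 0 \<le> u \<Longrightarrow> u \<le> v \<Longrightarrow> v \<le> 1 \<Longrightarrow> v - u < \<delta> \<Longrightarrow> X v \<omega> - X u \<omega> \<le> 1"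
      using upward_uniform_cadlag[OF cadlag_paths[OF elim(2)[unfolded space_P]] elim(3), of 1 1] by auto
    have "(\<lambda>n. d n) \<longlonglongrightarrow> 0"
      using LIMSEQ_half_pow[of "1 / 2 ^ j"] by (simp add: d_def power_add)
    from order_tendstoD(2)[OF this \<delta>(1)]
    have "\<forall>\<^sub>F n in sequentially. ?u n \<omega> = ennreal (exp (l * X ?t \<omega>)) * indicator (alive ?t) \<omega>"
    proof eventually_elim
      case (elim n)
      have "trunc_sum (d n) (2 ^ n) \<omega> = X (real (2 ^ n) * d n) \<omega> - X 0 \<omega>"
      proof (rule trunc_sum_eq, rule \<delta>(2))
        fix i :: nat assume "i < 2 ^ n"
        then have "real (Suc i) \<le> real (2 ^ n)" by (subst of_nat_le_iff) simp
        then have "real (Suc i) * d n \<le> real (2 ^ n) * d n" using d0 by (rule mult_right_mono)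
        also have "\<dots> \<le> 1" unfolding dm by simp
        finally show "real i * d n + d n \<le> 1" by (simp add: algebra_simps)
      qed (use d0 elim in auto)
      then show ?case using \<open>X 0 \<omega> = 0\<close> by (simp only: dm) simp
    qed
    then have "(\<lambda>n. ?u n \<omega>) \<longlonglongrightarrow> ennreal (exp (l * X ?t \<omega>)) * indicator (alive ?t) \<omega>"
      by (rule tendsto_eventually)
    from lim_imp_Liminf[OF sequentially_bot this] show ?case by (rule sym)
  qed
  have "mgf l ?t * ennreal (exp (- p * ?t)) = (\<integral>\<^sup>+\<omega>. ennreal (exp (l * X ?t \<omega>)) * indicator (alive ?t) \<omega> \<partial>P 0)"
    by (rule mgf_alive[symmetric]) simp
  also have "\<dots> = (\<integral>\<^sup>+\<omega>. liminf (\<lambda>n. ?u n \<omega>) \<partial>P 0)" by (rule nn_integral_cong_AE) (rule lim)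
  also have "\<dots> \<le> liminf (\<lambda>n. \<integral>\<^sup>+\<omega>. ?u n \<omega> \<partial>P 0)" by (rule nn_integral_liminf) measurable
  also have "\<dots> \<le> ennreal ?C"
    by (rule Liminf_le[OF sequentially_bot]) (use bound in \<open>auto simp only: trunc_pow[OF d0] r_def intro!: always_eventually\<close>)
  finally have "mgf l ?t * ennreal (exp (- p * ?t)) < \<top>" by (simp add: le_less_trans)
  then have "mgf l ?t < \<top>"
    by (auto simp: ennreal_mult_less_top)
  then show ?thesis by blast
qed

text \<open>Finiteness passes from one dyadic time to time 1 by taking a power, and from time 1 to
  every 2^-n by taking a root.\<close>

lemma mgf_finite: assumes l: "0 \<le> l" shows "mgf l (1 / 2 ^ n) < \<top>"
proof -
  obtain j where j: "mgf l (1 / 2 ^ j) < \<top>" using mgf_finite_small[OF l] by auto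
  have pw: "mgf l 1 = mgf l (1 / 2 ^ i) ^ (2 ^ i)" for i
    using mgf_pow[of "1 / 2 ^ i" l "2 ^ i"] by simp
  have "mgf l 1 < \<top>" unfolding pw[of j] using j by (simp add: power_less_top_ennreal)
  then show ?thesis unfolding pw[of n] by (simp add: power_less_top_ennreal)
qed

abbreviation "\<psi> \<equiv> laplace_exponent P X"

text \<open>At time 1 this inverts the logarithm in the definition of \<psi>, for which the moment
  must be finite and nonzero. At time 2^-n the value is the unique nonnegative root of order
  2^n.\<close>

lemma mgf_eq:
  assumes l: "0 \<le> l" shows "mgf l (1 / 2 ^ n) = ennreal (exp (\<psi> l / 2 ^ n))"
proof -
  have pw: "mgf l 1 = mgf l (1 / 2 ^ i) ^ (2 ^ i)" for i
    using mgf_pow[of "1 / 2 ^ i" l "2 ^ i"] by simp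
  have "mgf l 1 \<noteq> 0"
    unfolding mgf_def by (subst nn_integral_0_iff_AE) (auto simp: P.AE_False)
  moreover have "mgf l 1 < \<top>" using mgf_finite[OF l, of 0] by simp
  moreover have "(\<integral>\<omega>. exp (l * X 1 \<omega>) \<partial>P 0) = enn2real (mgf l 1)"
    unfolding mgf_def by (rule integral_eq_nn_integral) auto
  ultimately have m1: "mgf l 1 = ennreal (exp (\<psi> l))"
    unfolding laplace_exponent_def
    by (cases "mgf l 1") (auto simp: less_le)
  obtain r where r: "mgf l (1 / 2 ^ n) = ennreal r" "0 \<le> r"
    using mgf_finite[OF l, of n] by (cases "mgf l (1 / 2 ^ n)") auto
  have "ennreal (r ^ (2 ^ n)) = ennreal (exp (\<psi> l))"
    using pw[of n] m1 r by (simp add: ennreal_power)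
  then have "r ^ (2 ^ n) = exp (\<psi> l)" using r by (subst (asm) ennreal_inj) auto
  also have "\<dots> = exp (\<psi> l / 2 ^ n) ^ (2 ^ n)" by (simp add: exp_of_nat_mult[symmetric])
  finally have "r = exp (\<psi> l / 2 ^ n)" by (rule power_eq_imp_eq_base) (use r in auto)
  with r show ?thesis by simp
qed

end

section \<open>The Laplace exponent and its right inverse\<close>

context killed_spectrally_negative_levy begin

lemma psi_0: "\<psi> 0 = 0"
  by (simp add: laplace_exponent_def P.prob_space[simplified])

lemma integrable_exp_X1: "0 \<le> l \<Longrightarrow> integrable (P 0) (\<lambda>\<omega>. exp (l * X 1 \<omega>))"
  using mgf_finite[of l 0] by (intro integrableI_nonneg) (auto simp: mgf_def)

lemma exp_psi: "0 \<le> l \<Longrightarrow> exp (\<psi> l) = (\<integral>\<omega>. exp (l * X 1 \<omega>) \<partial>P 0)"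
proof -
  assume l: "0 \<le> l"
  have "ennreal (\<integral>\<omega>. exp (l * X 1 \<omega>) \<partial>P 0) = mgf l 1"
    unfolding mgf_def by (rule nn_integral_eq_integral[symmetric]) (use integrable_exp_X1[OF l] in auto)
  with mgf_eq[OF l, of 0] show ?thesis by (simp add: ennreal_inj)
qed

text \<open>Pointwise convexity of l -> exp(l y) makes the exponential of \<psi> convex. That is
  weaker than convexity of \<psi>, but it makes the sublevel sets intervals, as
  \<open>psi_above_Phi\<close> requires.\<close>

lemma psi_quasiconvex:
  assumes "0 \<le> a" "a \<le> m" "m \<le> b" "\<psi> a \<le> q" "\<psi> b \<le> q"
  shows "\<psi> m \<le> q"
proof (cases "a = b")
  case False
  with assms have ab: "a < b" by simp
  define \<theta> where "\<theta> = (b - m) / (b - a)"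
  have "\<theta> * (b - a) = b - m" using ab by (simp add: \<theta>_def)
  then have \<theta>: "0 \<le> \<theta>" "\<theta> \<le> 1" "\<theta> * a + (1 - \<theta>) * b = m"
    using assms ab by (simp add: \<theta>_def, simp add: \<theta>_def, simp add: algebra_simps)
  have "exp (m * y) \<le> \<theta> * exp (a * y) + (1 - \<theta>) * exp (b * y)" for y
  proof -
    have "exp (\<theta> *\<^sub>R (a * y) + (1 - \<theta>) *\<^sub>R (b * y)) \<le> \<theta> * exp (a * y) + (1 - \<theta>) * exp (b * y)"
      using convex_onD[OF exp_convex, of "1 - \<theta>" "a * y" "b * y"] \<theta> by simp
    moreover have "\<theta> *\<^sub>R (a * y) + (1 - \<theta>) *\<^sub>R (b * y) = m * y"
      unfolding \<theta>(3)[symmetric] by (simp add: algebra_simps)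
    ultimately show ?thesis by simp
  qed
  then have "(\<integral>\<omega>. exp (m * X 1 \<omega>) \<partial>P 0) \<le>
      (\<integral>\<omega>. \<theta> * exp (a * X 1 \<omega>) + (1 - \<theta>) * exp (b * X 1 \<omega>) \<partial>P 0)"
    using assms by (intro integral_mono Bochner_Integration.integrable_add integrable_mult_right integrable_exp_X1) auto
  also have "\<dots> = \<theta> * exp (\<psi> a) + (1 - \<theta>) * exp (\<psi> b)"
    using assms by (subst Bochner_Integration.integral_add) (auto simp: exp_psi integrable_exp_X1)
  also have "\<dots> \<le> \<theta> * exp q + (1 - \<theta>) * exp q"
    using assms \<theta> by (intro add_mono mult_left_mono) auto
  finally have "exp (\<psi> m) \<le> exp q" using assms by (simp add: exp_psi algebra_simps)
  then show ?thesis by simp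
qed (use assms in simp)

text \<open>Dominated convergence with 1 + exp(B X_1), where B bounds the exponents: the summand 1
  covers negative X_1, the exponential covers positive X_1.\<close>

lemma psi_tendsto:
  assumes l: "\<And>i. 0 \<le> l i" and lim: "l \<longlonglongrightarrow> L"
  shows "(\<lambda>i. \<psi> (l i)) \<longlonglongrightarrow> \<psi> L"
proof -
  have L: "0 \<le> L" using LIMSEQ_le_const[OF lim] l by blast
  obtain B where B: "\<And>i. l i \<le> B"
    using convergent_imp_Bseq[of l] lim unfolding convergent_def Bseq_def by (metis abs_le_D1 real_norm_def)
  have B0: "0 \<le> B" using l B order_trans by blast
  have "(\<lambda>i. \<integral>\<omega>. exp (l i * X 1 \<omega>) \<partial>P 0) \<longlonglongrightarrow> (\<integral>\<omega>. exp (L * X 1 \<omega>) \<partial>P 0)"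
  proof (rule integral_dominated_convergence[where w="\<lambda>\<omega>. 1 + exp (B * X 1 \<omega>)"])
    show "integrable (P 0) (\<lambda>\<omega>. 1 + exp (B * X 1 \<omega>))"
      using integrable_exp_X1[OF B0] by simp
    show "AE \<omega> in P 0. (\<lambda>i. exp (l i * X 1 \<omega>)) \<longlonglongrightarrow> exp (L * X 1 \<omega>)"
      by (intro always_eventually allI tendsto_intros lim)
    show "AE \<omega> in P 0. norm (exp (l i * X 1 \<omega>)) \<le> 1 + exp (B * X 1 \<omega>)" for i
    proof (intro always_eventually allI)
      fix \<omega>
      show "norm (exp (l i * X 1 \<omega>)) \<le> 1 + exp (B * X 1 \<omega>)"
      proof (cases "0 \<le> X 1 \<omega>")
        case True
        then have "l i * X 1 \<omega> \<le> B * X 1 \<omega>" using B by (intro mult_right_mono) auto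
        then have "exp (l i * X 1 \<omega>) \<le> exp (B * X 1 \<omega>)" by simp
        then show ?thesis unfolding real_norm_def abs_exp_cancel by linarith
      next
        case False
        then have "exp (l i * X 1 \<omega>) \<le> 1" using l[of i] by (simp add: mult_nonneg_nonpos)
        then show ?thesis by (simp add: add_increasing2)
      qed
    qed
  qed auto
  then have "(\<lambda>i. exp (\<psi> (l i))) \<longlonglongrightarrow> exp (\<psi> L)" using l L by (simp add: exp_psi)
  then have "(\<lambda>i. ln (exp (\<psi> (l i)))) \<longlonglongrightarrow> ln (exp (\<psi> L))" by (intro tendsto_ln) auto
  then show ?thesis by simp
qed

text \<open>If X_1 were almost surely at most 0, the 2^n increments over a dyadic partition of [0,1]
  could not all be positive. On the survival event the probability of that is c^(2^n), so c = 0 and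
  each increment is almost surely at most 0. All dyadic increments are then nonpositive together,
  and by right continuity the path decreases, against non-monotonicity.\<close>

lemma prob_X1_pos: "emeasure (P 0) {\<omega>\<in>\<Omega>. 0 < X 1 \<omega>} \<noteq> 0"
proof
  assume 0: "emeasure (P 0) {\<omega>\<in>\<Omega>. 0 < X 1 \<omega>} = 0"
  have X1: "AE \<omega> in P 0. X 1 \<omega> \<le> 0"
    by (rule AE_I[OF _ 0]) (auto intro: pred_P)
  have small: "AE \<omega> in P 0. X (1 / 2 ^ n) \<omega> \<le> 0" for n
  proof -
    let ?d = "1 / 2 ^ n :: real"
    let ?g = "\<lambda>y::real. indicator {0<..} y :: ennreal"
    let ?Z = "\<lambda>k \<omega>. \<Prod>i<k. ?g (X (real i * ?d + ?d) \<omega> - X (real i * ?d) \<omega>)"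
    have Zm: "?Z k \<in> borel_measurable (F (ennreal (real k * ?d)))" for k
    proof (rule borel_measurable_prod_ennreal)
      fix i assume "i \<in> {..<k}"
      then have "real i + 1 \<le> real k" by auto
      then have "(real i + 1) * ?d \<le> real k * ?d" by (rule mult_right_mono) simp
      then have "real i * ?d + ?d \<le> real k * ?d" by (simp only: distrib_right mult_1)
      moreover have "0 \<le> real i * ?d" "real i * ?d \<le> real i * ?d + ?d" by auto
      ultimately have [measurable]: "X (real i * ?d + ?d) \<in> borel_measurable (F (ennreal (real k * ?d)))"
        "X (real i * ?d) \<in> borel_measurable (F (ennreal (real k * ?d)))"
        by (intro X_measurable_F; linarith)+
      show "(\<lambda>\<omega>. ?g (X (real i * ?d + ?d) \<omega> - X (real i * ?d) \<omega>)) \<in> borel_measurable (F (ennreal (real k * ?d)))"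
        by measurable
    qed
    define c where "c = (\<integral>\<^sup>+\<omega>. ?g (X ?d \<omega>) \<partial>P 0) * ennreal (exp (- p * ?d))"
    have pow: "(\<integral>\<^sup>+\<omega>. ?Z k \<omega> * indicator (alive (real k * ?d)) \<omega> \<partial>P 0) = c ^ k" for k
    proof (induction k)
      case 0
      have "(\<integral>\<^sup>+\<omega>. indicator (alive 0) \<omega> \<partial>P 0) = (\<integral>\<^sup>+\<omega>. 1 \<partial>P 0)"
        by (intro nn_integral_cong_AE) (use alive_0[of 0] in auto)
      then show ?case by (simp add: P.emeasure_space_1[simplified])
    next
      case (Suc k)
      have S: "real (Suc k) * ?d = real k * ?d + ?d" by (simp add: field_simps)
      have "(\<integral>\<^sup>+\<omega>. ?Z (Suc k) \<omega> * indicator (alive (real (Suc k) * ?d)) \<omega> \<partial>P 0) =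
        (\<integral>\<^sup>+\<omega>. ?Z k \<omega> * (?g (X (real k * ?d + ?d) \<omega> - X (real k * ?d) \<omega>) * indicator (alive (real k * ?d + ?d)) \<omega>) \<partial>P 0)"
        unfolding S by (simp add: mult.assoc)
      also have "\<dots> = c * (\<integral>\<^sup>+\<omega>. ?Z k \<omega> * indicator (alive (real k * ?d)) \<omega> \<partial>P 0)"
        unfolding c_def by (rule killing_nn) (use Zm in auto)
      finally show ?case using Suc by simp
    qed
    have "c ^ (2 ^ n) = (\<integral>\<^sup>+\<omega>. ?Z (2 ^ n) \<omega> * indicator (alive (real (2 ^ n) * ?d)) \<omega> \<partial>P 0)"
      by (rule pow[symmetric])
    also have "\<dots> = (\<integral>\<^sup>+\<omega>. 0 \<partial>P 0)"
    proof (rule nn_integral_cong_AE)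
      show "AE \<omega> in P 0. ?Z (2 ^ n) \<omega> * indicator (alive (real (2 ^ n) * ?d)) \<omega> = 0"
        using X1 start
      proof eventually_elim
        case (elim \<omega>)
        have "\<exists>i<2 ^ n. X (real i * ?d + ?d) \<omega> - X (real i * ?d) \<omega> \<le> 0"
        proof (rule ccontr)
          assume "\<not> ?thesis"
          then have *: "X (real i * ?d) \<omega> < X (real i * ?d + ?d) \<omega>" if "i < 2 ^ n" for i
            using that by (meson diff_le_0_iff_le not_le)
          have "0 < k \<Longrightarrow> k \<le> 2 ^ n \<Longrightarrow> 0 < X (real k * ?d) \<omega>" for k
          proof (induction k)
            case (Suc k)
            have S: "real (Suc k) * ?d = real k * ?d + ?d" by (simp add: field_simps)
            show ?case using Suc *[of k] elim unfolding S by (cases "k = 0") auto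
          qed simp
          from this[of "2 ^ n"] elim show False by simp
        qed
        then obtain i where i: "i < 2 ^ n" "X (real i * ?d + ?d) \<omega> - X (real i * ?d) \<omega> \<le> 0" by blast
        have "?Z (2 ^ n) \<omega> = 0"
          by (rule prod_zero) (use i in \<open>auto intro!: bexI[of _ i] simp: indicator_def\<close>)
        then show ?case by (simp only: mult_zero_left)
      qed
    qed
    finally have "c = 0" by simp
    then have "(\<integral>\<^sup>+\<omega>. ?g (X ?d \<omega>) \<partial>P 0) = 0" by (simp add: c_def)
    then have "AE \<omega> in P 0. ?g (X ?d \<omega>) = 0" by (subst (asm) nn_integral_0_iff_AE) auto
    then show ?thesis by eventually_elim (auto simp: indicator_def split: if_splits)
  qed
  have step: "AE \<omega> in P 0. X (real (Suc i) / 2 ^ n) \<omega> \<le> X (real i / 2 ^ n) \<omega>" for i n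
  proof -
    have "AE \<omega> in P 0. X (1 / 2 ^ n) \<omega> - X 0 \<omega> \<le> 0"
      using small[of n] start by eventually_elim simp
    then have "AE y in distr (P 0) borel (\<lambda>\<omega>. X (1 / 2 ^ n) \<omega> - X 0 \<omega>). y \<le> 0"
      by (subst AE_distr_iff) auto
    then have "AE y in distr (P 0) borel (\<lambda>\<omega>. X (real i / 2 ^ n + 1 / 2 ^ n) \<omega> - X (real i / 2 ^ n) \<omega>). y \<le> 0"
      by (subst stationary_increments) auto
    then have "AE \<omega> in P 0. X (real i / 2 ^ n + 1 / 2 ^ n) \<omega> - X (real i / 2 ^ n) \<omega> \<le> 0"
      by (subst (asm) AE_distr_iff) auto
    then show ?thesis by eventually_elim (simp add: add_divide_distrib[symmetric] add.commute)
  qed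
  have "AE \<omega> in P 0. \<forall>n i. X (real (Suc i) / 2 ^ n) \<omega> \<le> X (real i / 2 ^ n) \<omega>"
    unfolding AE_all_countable using step by blast
  then have "AE \<omega> in P 0. False"
    using nonmonotone_paths[of 0] AE_space
  proof eventually_elim
    case (elim \<omega>)
    have "antimono_on {0..} (\<lambda>t. X t \<omega>)"
      by (rule antimono_on_dyadicI) (use elim X_right_continuous in auto)
    then show False using elim by (simp add: nonmonotone_def)
  qed
  then show False by (simp add: P.AE_False)
qed

text \<open>X_1 exceeds some \<eta> > 0 with positive probability b, and restricting the moment to
  that event gives \<psi>(l) \<ge> \<eta> l + ln b.\<close>

lemma psi_at_top: "filterlim \<psi> at_top at_top"
proof -
  have "\<exists>\<eta>>0. emeasure (P 0) {\<omega>\<in>\<Omega>. \<eta> < X 1 \<omega>} \<noteq> 0"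
  proof (rule ccontr)
    assume "\<not> ?thesis"
    then have z: "emeasure (P 0) {\<omega>\<in>\<Omega>. 1 / Suc n < X 1 \<omega>} = 0" for n
      by (metis of_nat_0_less_iff zero_less_Suc zero_less_divide_1_iff)
    have "emeasure (P 0) (\<Union>n. {\<omega>\<in>\<Omega>. 1 / Suc n < X 1 \<omega>}) = 0"
      by (rule emeasure_UN_eq_0[OF z]) (auto intro!: pred_P)
    moreover have "(\<Union>n. {\<omega>\<in>\<Omega>. 1 / Suc n < X 1 \<omega>}) = {\<omega>\<in>\<Omega>. 0 < X 1 \<omega>}"
    proof safe
      fix \<omega> n assume "1 / real (Suc n) < X 1 \<omega>"
      moreover have "0 < 1 / real (Suc n)" by simp
      ultimately show "0 < X 1 \<omega>" by linarith
    next
      fix \<omega> assume "\<omega> \<in> \<Omega>" "0 < X 1 \<omega>"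
      moreover obtain n where "1 / real (Suc n) < X 1 \<omega>" using nat_approx_posE[OF \<open>0 < X 1 \<omega>\<close>] by auto
      ultimately show "\<omega> \<in> (\<Union>n. {\<omega>\<in>\<Omega>. 1 / real (Suc n) < X 1 \<omega>})" by blast
    qed
    ultimately show False using prob_X1_pos by simp
  qed
  then obtain \<eta> where \<eta>: "0 < \<eta>" "emeasure (P 0) {\<omega>\<in>\<Omega>. \<eta> < X 1 \<omega>} \<noteq> 0" by auto
  define b where "b = measure (P 0) {\<omega>\<in>\<Omega>. \<eta> < X 1 \<omega>}"
  have S: "{\<omega>\<in>\<Omega>. \<eta> < X 1 \<omega>} \<in> sets (P 0)" by (intro pred_P) measurable
  have b: "0 < b" using \<eta>(2) by (simp add: b_def P.emeasure_eq_measure zero_less_measure_iff)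
  have lower: "\<eta> * l + ln b \<le> \<psi> l" if l: "0 \<le> l" for l
  proof -
    have "exp (l * \<eta>) * b = (\<integral>\<omega>. exp (l * \<eta>) * indicator {\<omega>\<in>\<Omega>. \<eta> < X 1 \<omega>} \<omega> \<partial>P 0)"
      using S by (simp add: b_def Int_absorb2 sets.sets_into_space)
    also have "\<dots> \<le> (\<integral>\<omega>. exp (l * X 1 \<omega>) \<partial>P 0)"
    proof (rule integral_mono)
      show "integrable (P 0) (\<lambda>\<omega>. exp (l * \<eta>) * indicator {\<omega>\<in>\<Omega>. \<eta> < X 1 \<omega>} \<omega>)"
        using S by (intro integrable_mult_right integrable_real_indicator) (auto simp: P.emeasure_finite less_top[symmetric])
    qed (use l integrable_exp_X1 in \<open>auto simp: indicator_def intro: mult_left_mono\<close>)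
    finally have "exp (l * \<eta>) * b \<le> exp (\<psi> l)" using l by (simp add: exp_psi)
    then have "ln (exp (l * \<eta>) * b) \<le> ln (exp (\<psi> l))" using b by (subst ln_le_cancel_iff) auto
    then show ?thesis using b by (simp add: ln_mult mult.commute)
  qed
  have "filterlim (\<lambda>l. ln b + \<eta> * l) at_top at_top"
    by (intro filterlim_tendsto_add_at_top[OF tendsto_const] filterlim_tendsto_pos_mult_at_top[OF tendsto_const \<eta>(1)] filterlim_ident)
  then show ?thesis
    by (rule filterlim_at_top_mono) (use eventually_ge_at_top[of 0] in \<open>eventually_elim, use lower in \<open>simp add: add.commute\<close>\<close>)
qed

abbreviation "\<Phi> \<equiv> right_inverse \<psi> p"

lemma Phi_set: "{l. 0 \<le> l \<and> p < \<psi> l} \<noteq> {}" "bdd_below {l. 0 \<le> l \<and> p < \<psi> l}"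
proof -
  have "\<forall>\<^sub>F l in at_top. p < \<psi> l \<and> 0 \<le> l"
    using psi_at_top eventually_ge_at_top[of 0] by (auto simp: filterlim_at_top_dense eventually_conj_iff)
  then show "{l. 0 \<le> l \<and> p < \<psi> l} \<noteq> {}" using eventually_happens'[OF trivial_limit_at_top_linorder] by auto
qed (auto intro!: bdd_belowI)

lemma Phi_nonneg: "0 \<le> \<Phi>"
  unfolding right_inverse_def by (rule cInf_greatest[OF Phi_set(1)]) auto

lemma psi_le_below_Phi: "0 \<le> l \<Longrightarrow> l < \<Phi> \<Longrightarrow> \<psi> l \<le> p"
  using cInf_lower[OF _ Phi_set(2), of l] unfolding right_inverse_def by force

text \<open>Continuity of \<psi> from both sides: the infimum is a limit of points where \<psi>
  exceeds p, and points below it have \<psi> at most p. If \<Phi> = 0 there is nothing below, and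
  the upper bound is \<psi>(0) = 0 \<le> p.\<close>

lemma psi_Phi: "\<psi> \<Phi> = p"
proof (rule antisym)
  have "\<Phi> \<in> closure {l. 0 \<le> l \<and> p < \<psi> l}"
    unfolding right_inverse_def using Phi_set by (rule closure_contains_Inf)
  then obtain l where l: "\<And>i. 0 \<le> l i" "\<And>i. p < \<psi> (l i)" "l \<longlonglongrightarrow> \<Phi>"
    by (auto simp: closure_sequential)
  show "p \<le> \<psi> \<Phi>"
    using LIMSEQ_le_const[OF psi_tendsto[OF l(1,3)]] l(2) less_imp_le by blast
  show "\<psi> \<Phi> \<le> p"
  proof (cases "\<Phi> = 0")
    case True
    then show ?thesis using psi_0 rate_nonneg by simp
  next
    case False
    with Phi_nonneg have pos: "0 < \<Phi>" by simp
    let ?l = "\<lambda>n. \<Phi> - (\<Phi> / 2) / 2 ^ n"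
    have l: "0 \<le> ?l n" "?l n < \<Phi>" for n
    proof -
      have "\<Phi> / 2 / 2 ^ n \<le> \<Phi> / 2 / 1" using pos by (intro divide_left_mono) auto
      then show "0 \<le> ?l n" "?l n < \<Phi>" using pos by auto
    qed
    have "?l \<longlonglongrightarrow> \<Phi>" using tendsto_diff[OF tendsto_const LIMSEQ_half_pow[of "\<Phi> / 2"]] by simp
    from LIMSEQ_le_const2[OF psi_tendsto[OF l(1) this]] show ?thesis
      using psi_le_below_Phi[OF l] by blast
  qed
qed

text \<open>Otherwise \<Phi> and l would both lie in the sublevel set of p while some m between
  them, supplied by the infimum, would not.\<close>

lemma psi_above_Phi: assumes "\<Phi> < l" shows "p < \<psi> l"
proof (rule ccontr)
  assume "\<not> p < \<psi> l"
  then have le: "\<psi> l \<le> p" by simp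
  have "Inf {l. 0 \<le> l \<and> p < \<psi> l} < l" using assms unfolding right_inverse_def .
  from cInf_lessD[OF Phi_set(1) this]
  obtain m where m: "0 \<le> m" "p < \<psi> m" "m < l" by auto
  have "\<Phi> \<le> m" unfolding right_inverse_def by (rule cInf_lower[OF _ Phi_set(2)]) (use m in auto)
  from psi_quasiconvex[OF Phi_nonneg this, of l p] m le psi_Phi show False by simp
qed

lemma Phi_pos_if: "0 < p \<Longrightarrow> 0 < \<Phi>"
  using psi_Phi psi_0 Phi_nonneg by (cases "\<Phi> = 0") auto

end

section \<open>Progressive measurability of passage events\<close>

text \<open>The approximation by \<open>dyadic_above\<close> uses countably many times and is
  jointly measurable; right continuity carries this to the limit. The clamp \<open>max 0\<close>
  makes the time variable range over the whole line.\<close>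

lemma right_continuous_joint_measurable:
  fixes f :: "real \<Rightarrow> 'a \<Rightarrow> real"
  assumes meas: "\<And>u. 0 \<le> u \<Longrightarrow> f u \<in> borel_measurable M"
    and rc: "\<And>\<omega> u. \<omega> \<in> space M \<Longrightarrow> 0 \<le> u \<Longrightarrow> ((\<lambda>u. f u \<omega>) \<longlongrightarrow> f u \<omega>) (at_right u)"
  shows "(\<lambda>z. f (max 0 (fst z)) (snd z)) \<in> borel_measurable (borel \<Otimes>\<^sub>M M)"
proof (rule borel_measurable_LIMSEQ_real)
  show "(\<lambda>n. f (dyadic_above n (max 0 (fst z))) (snd z)) \<longlonglongrightarrow> f (max 0 (fst z)) (snd z)"
    if "z \<in> space (borel \<Otimes>\<^sub>M M)" for z
    using that by (intro filterlim_compose[OF rc filterlim_dyadic_above]) (auto simp: space_pair_measure)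
  show "(\<lambda>z. f (dyadic_above n (max 0 (fst z))) (snd z)) \<in> borel_measurable (borel \<Otimes>\<^sub>M M)" for n
  proof -
    have "(\<lambda>z :: real \<times> 'a. (\<lambda>i. \<lambda>z. f (real (Suc i) / 2 ^ n) (snd z)) (nat \<lfloor>max 0 (fst z) * 2 ^ n\<rfloor>) z) \<in> borel_measurable (borel \<Otimes>\<^sub>M M)"
    proof (rule measurable_compose_countable[where f="\<lambda>i z. f (real (Suc i) / 2 ^ n) (snd z)"
        and g="\<lambda>z :: real \<times> 'a. nat \<lfloor>max 0 (fst z) * 2 ^ n\<rfloor>"])
      show "(\<lambda>z. f (real (Suc i) / 2 ^ n) (snd z)) \<in> borel_measurable (borel \<Otimes>\<^sub>M M)" for i
        using meas[of "real (Suc i) / 2 ^ n"] by measurable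
    qed measurable
    then show ?thesis by (simp add: dyadic_above_def)
  qed
qed

lemma indicator_less_ennreal_right_continuous:
  assumes "0 \<le> u"
  shows "((\<lambda>u. indicator {\<omega>. ennreal u < e \<omega>} \<omega> :: real) \<longlongrightarrow> indicator {\<omega>. ennreal u < e \<omega>} \<omega>) (at_right u)"
proof (rule tendsto_eventually, cases "ennreal u < e \<omega>")
  case True
  have "(ennreal \<longlongrightarrow> ennreal u) (at_right u)"
    by (intro tendsto_ennrealI) (rule tendsto_ident_at)
  from order_tendstoD(2)[OF this True]
  show "\<forall>\<^sub>F v in at_right u. indicator {\<omega>. ennreal v < e \<omega>} \<omega> = (indicator {\<omega>. ennreal u < e \<omega>} \<omega> :: real)"
    by eventually_elim (use True in simp)
next
  case False
  have "\<forall>\<^sub>F v in at_right u. u < v" by (simp add: eventually_at_right_less)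
  then show "\<forall>\<^sub>F v in at_right u. indicator {\<omega>. ennreal v < e \<omega>} \<omega> = (indicator {\<omega>. ennreal u < e \<omega>} \<omega> :: real)"
  proof eventually_elim
    case (elim v)
    then have "\<not> ennreal v < e \<omega>" using False assms
      by (meson ennreal_leI le_less_trans less_imp_le)
    with False show ?case by simp
  qed
qed

context killed_spectrally_negative_levy begin

lemma alive_right_continuous:
  "0 \<le> u \<Longrightarrow> ((\<lambda>u. indicator (alive u) \<omega> :: real) \<longlongrightarrow> indicator (alive u) \<omega>) (at_right u)"
  unfolding alive_def by (rule indicator_less_ennreal_right_continuous)

text \<open>The event that passage above a, counted from time s, has not happened by u. For u < s
  the interval is empty and the event is everything.\<close>

definition stays :: "real \<Rightarrow> real \<Rightarrow> real \<Rightarrow> 'a set" where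
  "stays a s u = {\<omega>. \<forall>v\<in>{s..u}. X v \<omega> \<le> a}"

definition passes :: "real \<Rightarrow> real \<Rightarrow> 'a set" where
  "passes a s = {\<omega>. \<exists>u\<ge>s. \<omega> \<in> alive u \<and> a < X u \<omega>}"

text \<open>Progressive measurability at each horizon v. Clamping the time to [0,v] allows the
  product with the full Borel line in place of a trace on [0,v].\<close>

definition progressive :: "(real \<Rightarrow> 'a \<Rightarrow> real) \<Rightarrow> bool" where
  "progressive g \<longleftrightarrow> (\<forall>v\<ge>0. (\<lambda>z. g (min (max 0 (fst z)) v) (snd z)) \<in> borel_measurable (borel \<Otimes>\<^sub>M F (ennreal v)))"

lemma progressive_right_continuous:
  assumes meas: "\<And>u. 0 \<le> u \<Longrightarrow> f u \<in> borel_measurable (F (ennreal u))"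
    and rc: "\<And>\<omega> u. \<omega> \<in> \<Omega> \<Longrightarrow> 0 \<le> u \<Longrightarrow> ((\<lambda>u. f u \<omega>) \<longlongrightarrow> f u \<omega>) (at_right u)"
  shows "progressive f"
  unfolding progressive_def
proof (intro allI impI)
  fix v :: real assume v: "0 \<le> v"
  show "(\<lambda>z. f (min (max 0 (fst z)) v) (snd z)) \<in> borel_measurable (borel \<Otimes>\<^sub>M F (ennreal v))"
  proof (rule right_continuous_joint_measurable)
    fix u :: real assume u: "0 \<le> u"
    have "sets (F (ennreal (min u v))) \<subseteq> sets (F (ennreal v))"
      by (intro sets_F_mono ennreal_leI) simp
    then have "subalgebra (F (ennreal v)) (F (ennreal (min u v)))"
      by (simp add: subalgebra_def space_F)
    then show "f (min u v) \<in> borel_measurable (F (ennreal v))"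
      using meas[of "min u v"] u v measurable_from_subalg by auto
    fix \<omega> assume "\<omega> \<in> space (F (ennreal v))"
    then have \<omega>: "\<omega> \<in> \<Omega>" by (simp add: space_F)
    show "((\<lambda>u. f (min u v) \<omega>) \<longlongrightarrow> f (min u v) \<omega>) (at_right u)"
    proof (cases "u < v")
      case True
      then have "\<forall>\<^sub>F t in at_right u. t < v" by (meson eventually_at_right_field)
      then have "\<forall>\<^sub>F t in at_right u. f t \<omega> = f (min t v) \<omega>"
        by eventually_elim (simp add: min_absorb1)
      with rc[OF \<omega> u] show ?thesis using True by (simp add: tendsto_cong min_absorb1)
    next
      case False
      have "\<forall>\<^sub>F t in at_right u. f (min t v) \<omega> = f (min u v) \<omega>"
        using eventually_at_right_less[of u] by eventually_elim (use False in \<open>simp add: min_absorb2\<close>)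
      then show ?thesis by (rule tendsto_eventually)
    qed
  qed
qed

lemma progressive_X: "progressive X"
  by (rule progressive_right_continuous) (use adapted X_right_continuous in auto)

lemma progressive_alive: "progressive (\<lambda>u. indicator (alive u))"
proof (rule progressive_right_continuous)
  show "indicator (alive u) \<in> borel_measurable (F (ennreal u))" if "0 \<le> u" for u
    using alive_measurable_F[OF that order_refl] by measurable
qed (rule alive_right_continuous)

lemma progressive_mult: "progressive f \<Longrightarrow> progressive g \<Longrightarrow> progressive (\<lambda>u \<omega>. f u \<omega> * g u \<omega>)"
  unfolding progressive_def by (auto intro!: borel_measurable_times)

lemma progressive_compose: "progressive f \<Longrightarrow> h \<in> borel_measurable borel \<Longrightarrow> progressive (\<lambda>u \<omega>. h (f u \<omega>))"
  unfolding progressive_def by auto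

text \<open>Right continuity makes an excess over a persist just after v, hence at skeleton times.
  This reduces passage events to countably many times.\<close>

lemma dense_passage:
  assumes \<omega>: "\<omega> \<in> \<Omega>" and s: "0 \<le> s" "s \<le> v" and v: "a < X v \<omega>" and t: "v < t"
  shows "\<forall>\<^sub>F n in sequentially. v < s + dyadic_above n (v - s) \<and> s + dyadic_above n (v - s) < t \<and>
     a < X (s + dyadic_above n (v - s)) \<omega>"
proof -
  have lim: "filterlim (\<lambda>n. s + dyadic_above n (v - s)) (at_right v) sequentially"
  proof -
    have "(\<lambda>n. dyadic_above n (v - s)) \<longlonglongrightarrow> v - s"
      using filterlim_dyadic_above[of "v - s"] s by (simp add: filterlim_at)
    from tendsto_add[OF tendsto_const[of s] this]
    have "(\<lambda>n. s + dyadic_above n (v - s)) \<longlonglongrightarrow> v" by simp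
    moreover have "v < s + dyadic_above n (v - s)" for n
      using dyadic_above_bounds(1)[of "v - s" n] s by simp
    ultimately show ?thesis
      by (auto simp: filterlim_at intro!: always_eventually) (metis less_irrefl)
  qed
  have "\<forall>\<^sub>F u in at_right v. v < u \<and> u < t \<and> a < X u \<omega>"
    using order_tendstoD(1)[OF X_right_continuous[OF \<omega>, of v] v] s t
    by (auto simp: eventually_conj_iff eventually_at_right_less intro: eventually_at_right_field[THEN iffD2])
  then show ?thesis using lim by (rule eventually_compose_filterlim)
qed

text \<open>Skeleton points before u detect an excess at any v < u. The time u is listed separately,
  because points approaching it from the right lie outside the interval.\<close>

lemma stays_iff:
  assumes "\<omega> \<in> \<Omega>" "0 \<le> s" "s \<le> u"
  shows "\<omega> \<in> stays a s u \<longleftrightarrow> X u \<omega> \<le> a \<and> (\<forall>n k. s + real k / 2 ^ n < u \<longrightarrow> X (s + real k / 2 ^ n) \<omega> \<le> a)"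
proof
  assume "\<omega> \<in> stays a s u"
  then show "X u \<omega> \<le> a \<and> (\<forall>n k. s + real k / 2 ^ n < u \<longrightarrow> X (s + real k / 2 ^ n) \<omega> \<le> a)"
    using assms by (auto simp: stays_def)
next
  assume R: "X u \<omega> \<le> a \<and> (\<forall>n k. s + real k / 2 ^ n < u \<longrightarrow> X (s + real k / 2 ^ n) \<omega> \<le> a)"
  have False if v: "s \<le> v" "v < u" "a < X v \<omega>" for v
  proof -
    obtain n where "s + dyadic_above n (v - s) < u" "a < X (s + dyadic_above n (v - s)) \<omega>"
      using dense_passage[OF assms(1,2) v(1,3,2)] by (auto simp: eventually_sequentially)
    then show False using R unfolding dyadic_above_def by (meson not_le)
  qed
  then show "\<omega> \<in> stays a s u" using R by (auto simp: stays_def not_le[symmetric]) (metis less_le not_le)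
qed

text \<open>This indicator is not right continuous, as X may exceed a immediately after u, so
  measurability comes from the countable description in \<open>stays_iff\<close>. Clamping the
  skeleton times at v keeps them measurable at the horizon.\<close>

lemma progressive_stays: assumes s: "0 \<le> s" shows "progressive (\<lambda>u. indicator (stays a s u))"
  unfolding progressive_def
proof (intro allI impI)
  fix v :: real assume v: "0 \<le> v"
  let ?N = "(borel :: real measure) \<Otimes>\<^sub>M F (ennreal v)"
  let ?u = "\<lambda>z :: real \<times> 'a. min (max 0 (fst z)) v"
  have [measurable]: "(\<lambda>z. X (?u z) (snd z)) \<in> borel_measurable ?N"
    using progressive_X v by (simp add: progressive_def)
  have [measurable]: "X (min v (s + real k / 2 ^ n)) \<in> borel_measurable (F (ennreal v))" for k n
    using s v by (intro X_measurable_F) auto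
  have "Measurable.pred ?N (\<lambda>z. s \<le> ?u z \<longrightarrow> X (?u z) (snd z) \<le> a \<and>
     (\<forall>n k. s + real k / 2 ^ n < ?u z \<longrightarrow> X (min v (s + real k / 2 ^ n)) (snd z) \<le> a))"
    by measurable
  also have "?this \<longleftrightarrow> Measurable.pred ?N (\<lambda>z. snd z \<in> stays a s (?u z))"
  proof (rule measurable_cong)
    fix z assume "z \<in> space ?N"
    then have \<omega>: "snd z \<in> \<Omega>" by (auto simp: space_pair_measure space_F)
    have eq: "s + real k / 2 ^ n < ?u z \<Longrightarrow> min v (s + real k / 2 ^ n) = s + real k / 2 ^ n" for k n by auto
    show "(s \<le> ?u z \<longrightarrow> X (?u z) (snd z) \<le> a \<and>
     (\<forall>n k. s + real k / 2 ^ n < ?u z \<longrightarrow> X (min v (s + real k / 2 ^ n)) (snd z) \<le> a)) = (snd z \<in> stays a s (?u z))"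
    proof (cases "s \<le> ?u z")
      case True
      then show ?thesis unfolding stays_iff[OF \<omega> s True] using eq by metis
    next
      case False
      then show ?thesis by (auto simp: stays_def)
    qed
  qed
  finally have [measurable]: "Measurable.pred ?N (\<lambda>z. snd z \<in> stays a s (?u z))" .
  show "(\<lambda>z. indicator (stays a s (?u z)) (snd z)) \<in> borel_measurable ?N"
    by measurable
qed

lemma progressive_adapted:
  assumes "progressive g" "0 \<le> v" shows "g v \<in> borel_measurable (F (ennreal v))"
proof -
  have m: "(\<lambda>z. g (min (max 0 (fst z)) v) (snd z)) \<in> borel_measurable (borel \<Otimes>\<^sub>M F (ennreal v))"
    using assms by (simp add: progressive_def)
  have "(\<lambda>\<omega>. (v, \<omega>)) \<in> measurable (F (ennreal v)) (borel \<Otimes>\<^sub>M F (ennreal v))" by measurable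
  from measurable_compose[OF this m] show ?thesis using assms(2) by (simp cong: measurable_cong)
qed

lemma progressive_horizon_P:
  assumes "progressive g" "0 \<le> v"
  shows "(\<lambda>z. g (min (max 0 (fst z)) v) (snd z)) \<in> borel_measurable (borel \<Otimes>\<^sub>M P x)"
proof -
  have "snd \<in> measurable (borel \<Otimes>\<^sub>M P x) (F (ennreal v))"
    using measurable_compose[OF measurable_snd measurable_from_subalg[OF subalg[OF assms(2)] measurable_ident]] by simp
  then have "(\<lambda>z. (fst z, snd z)) \<in> measurable ((borel :: real measure) \<Otimes>\<^sub>M P x) (borel \<Otimes>\<^sub>M F (ennreal v))"
    by (intro measurable_Pair measurable_fst)
  from measurable_compose[OF this] assms show ?thesis by (auto simp: progressive_def)
qed

lemma progressive_measurable_P: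
  assumes "progressive g"
  shows "(\<lambda>z. g (max 0 (fst z)) (snd z)) \<in> borel_measurable (borel \<Otimes>\<^sub>M P x)"
proof (rule borel_measurable_LIMSEQ_real)
  show "(\<lambda>z. g (min (max 0 (fst z)) (real n)) (snd z)) \<in> borel_measurable (borel \<Otimes>\<^sub>M P x)" for n
    by (rule progressive_horizon_P[OF assms]) simp
  show "(\<lambda>n. g (min (max 0 (fst z)) (real n)) (snd z)) \<longlonglongrightarrow> g (max 0 (fst z)) (snd z)" for z :: "real \<times> 'a"
  proof (rule tendsto_eventually)
    obtain m where "max 0 (fst z) \<le> real m" using real_arch_simple by blast
    then show "\<forall>\<^sub>F n in sequentially. g (min (max 0 (fst z)) (real n)) (snd z) = g (max 0 (fst z)) (snd z)"
      by (intro eventually_sequentiallyI[of m]) (simp add: min_absorb1)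
  qed
qed

lemma passes_iff:
  assumes "\<omega> \<in> \<Omega>" "0 \<le> s"
  shows "\<omega> \<in> passes a s \<longleftrightarrow> (\<exists>n k. \<omega> \<in> alive (s + real k / 2 ^ n) \<and> a < X (s + real k / 2 ^ n) \<omega>)"
proof
  assume "\<omega> \<in> passes a s"
  then obtain u where u: "s \<le> u" "\<omega> \<in> alive u" "a < X u \<omega>" by (auto simp: passes_def)
  have "((\<lambda>u. indicator (alive u) \<omega> :: real) \<longlongrightarrow> 1) (at_right u)"
    using alive_right_continuous[of u \<omega>] u assms by simp
  then have "\<forall>\<^sub>F v in at_right u. 0 < (indicator (alive v) \<omega> :: real)" by (rule order_tendstoD) simp
  then obtain t where t: "u < t" "\<And>v. u < v \<Longrightarrow> v < t \<Longrightarrow> \<omega> \<in> alive v"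
    by (auto simp: eventually_at_right_field indicator_def split: if_splits)
  obtain n where "u < s + dyadic_above n (u - s)" "s + dyadic_above n (u - s) < t" "a < X (s + dyadic_above n (u - s)) \<omega>"
    using dense_passage[OF assms(1,2) u(1,3) t(1)] by (auto simp: eventually_sequentially)
  then show "\<exists>n k. \<omega> \<in> alive (s + real k / 2 ^ n) \<and> a < X (s + real k / 2 ^ n) \<omega>"
    using t(2) unfolding dyadic_above_def by blast
next
  assume "\<exists>n k. \<omega> \<in> alive (s + real k / 2 ^ n) \<and> a < X (s + real k / 2 ^ n) \<omega>"
  then show "\<omega> \<in> passes a s"
    unfolding passes_def by (force intro: exI[of _ "s + real _ / 2 ^ _"])
qed

lemma passes_measurable [measurable]: "0 \<le> s \<Longrightarrow> Measurable.pred (P x) (\<lambda>\<omega>. \<omega> \<in> passes a s)"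
proof -
  assume s: "0 \<le> s"
  have [measurable]: "Measurable.pred (P x) (\<lambda>\<omega>. \<omega> \<in> alive (s + real k / 2 ^ n))"
     "X (s + real k / 2 ^ n) \<in> borel_measurable (P x)" for n k
    using s by auto
  have "Measurable.pred (P x) (\<lambda>\<omega>. \<exists>n k. \<omega> \<in> alive (s + real k / 2 ^ n) \<and> a < X (s + real k / 2 ^ n) \<omega>)"
    by measurable
  then show ?thesis by (subst measurable_cong[OF passes_iff]) (use s in auto)
qed

end

section \<open>Stopping at first passage along dyadic skeletons\<close>

text \<open>Uniform integrability in elementary form: cutting f at height c costs at most f^2 / c
  pointwise, hence at most K / c in the mean, uniformly in n.\<close>

lemma (in finite_measure) tendsto_integral_L2_bounded:
  fixes f :: "nat \<Rightarrow> 'a \<Rightarrow> real"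
  assumes [measurable]: "\<And>n. f n \<in> borel_measurable M" "g \<in> borel_measurable M"
    and lim: "AE x in M. (\<lambda>n. f n x) \<longlonglongrightarrow> g x"
    and nn: "\<And>n x. 0 \<le> f n x"
    and int: "\<And>n. integrable M (f n)" "\<And>n. integrable M (\<lambda>x. (f n x)\<^sup>2)" 
    and K: "\<And>n. (\<integral>x. (f n x)\<^sup>2 \<partial>M) \<le> K"
    and g: "AE x in M. g x \<le> C" "\<And>x. 0 \<le> g x"
  shows "(\<lambda>n. \<integral>x. f n x \<partial>M) \<longlonglongrightarrow> (\<integral>x. g x \<partial>M)"
proof (rule LIMSEQ_I)
  fix e :: real assume e: "0 < e"
  have "0 \<le> (\<integral>x. (f 0 x)\<^sup>2 \<partial>M)" by (rule Bochner_Integration.integral_nonneg) simp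
  with K[of 0] have K0: "0 \<le> K" by linarith
  \<comment> \<open>Large enough that the cut leaves the limit g unchanged (C \<le> c) and costs
    less than e / 2; K + 1 makes the second inequality strict also when K = 0.\<close>
  define c where "c = max (max C 1) (2 * (K + 1) / e)"
  have c: "C \<le> c" "1 \<le> c" "0 < c" by (auto simp: c_def)
  have "2 * (K + 1) / e \<le> c" by (simp add: c_def)
  then have "2 * (K + 1) \<le> c * e" using e by (simp add: field_simps)
  then have Kc: "K / c < e / 2" using c by (simp add: field_simps)
  have bdd: "integrable M (\<lambda>x. min (f n x) c)" for n
    using c nn by (intro integrable_const_bound[where B=c]) auto
  have "(\<lambda>n. \<integral>x. min (f n x) c \<partial>M) \<longlonglongrightarrow> (\<integral>x. g x \<partial>M)"
  proof (rule integral_dominated_convergence[where w="\<lambda>_. c"])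
    show "AE x in M. (\<lambda>n. min (f n x) c) \<longlonglongrightarrow> g x"
      using lim g(1)
    proof eventually_elim
      case (elim x)
      from tendsto_min[OF elim(1) tendsto_const[of c]] show ?case using elim(2) c by (simp add: min_absorb1)
    qed
  qed (use c nn in \<open>auto intro!: AE_I2\<close>)
  from LIMSEQ_D[OF this, of "e / 2"] e
  obtain N where N: "\<And>n. N \<le> n \<Longrightarrow> \<bar>(\<integral>x. min (f n x) c \<partial>M) - (\<integral>x. g x \<partial>M)\<bar> < e / 2" by auto
  have close: "\<bar>(\<integral>x. f n x \<partial>M) - (\<integral>x. min (f n x) c \<partial>M)\<bar> \<le> K / c" for n
  proof -
    have pt: "f n x - min (f n x) c \<le> (f n x)\<^sup>2 / c" for x
    proof (cases "f n x \<le> c")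
      case False
      then have "f n x * c \<le> f n x * f n x" using nn by (intro mult_left_mono) auto
      then have "f n x \<le> (f n x)\<^sup>2 / c" using c by (simp add: field_simps power2_eq_square)
      then show ?thesis using False c by simp
    qed (use c in simp)
    have "(\<integral>x. f n x \<partial>M) - (\<integral>x. min (f n x) c \<partial>M) = (\<integral>x. f n x - min (f n x) c \<partial>M)"
      by (rule Bochner_Integration.integral_diff[symmetric]) (use int bdd in auto)
    also have "\<dots> \<le> (\<integral>x. (f n x)\<^sup>2 / c \<partial>M)"
      by (intro integral_mono pt) (use int bdd in auto)
    also have "\<dots> \<le> K / c" using K[of n] c by (simp add: divide_right_mono)
    finally have "(\<integral>x. f n x \<partial>M) - (\<integral>x. min (f n x) c \<partial>M) \<le> K / c" .
    moreover have "(\<integral>x. min (f n x) c \<partial>M) \<le> (\<integral>x. f n x \<partial>M)"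
      by (intro integral_mono bdd int) auto
    ultimately show ?thesis by simp
  qed
  show "\<exists>N. \<forall>n\<ge>N. norm ((\<integral>x. f n x \<partial>M) - (\<integral>x. g x \<partial>M)) < e"
  proof (intro exI[of _ N] allI impI)
    fix n assume "N \<le> n"
    from N[OF this] close[of n] Kc show "norm ((\<integral>x. f n x \<partial>M) - (\<integral>x. g x \<partial>M)) < e"
      unfolding real_norm_def by linarith
  qed
qed

lemma set_integral_step_function:
  fixes g :: "nat \<Rightarrow> real"
  shows "set_integrable lborel {s..<s + real m / 2 ^ n} (\<lambda>u. g (nat \<lfloor>(u - s) * 2 ^ n\<rfloor>))"
    and "(LINT u:{s..<s + real m / 2 ^ n}|lborel. g (nat \<lfloor>(u - s) * 2 ^ n\<rfloor>)) = (\<Sum>k<m. g k) / 2 ^ n"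
proof (induction m)
  case 0
  { case 1 show ?case by (simp add: set_integrable_def) }
  { case 2 show ?case by (simp add: set_lebesgue_integral_def) }
next
  case (Suc m)
  let ?A = "{s..<s + real m / 2 ^ n}" and ?B = "{s + real m / 2 ^ n..<s + real (Suc m) / 2 ^ n}"
  have un: "{s..<s + real (Suc m) / 2 ^ n} = ?A \<union> ?B"
    by (rule ivl_disj_un_two(3)[symmetric]) (auto simp: divide_right_mono)
  have disj: "?A \<inter> ?B = {}" by auto
  have eq: "g (nat \<lfloor>(u - s) * 2 ^ n\<rfloor>) = g m" if "u \<in> ?B" for u
  proof -
    have "\<lfloor>(u - s) * 2 ^ n\<rfloor> = int m" using that by (intro floor_unique) (auto simp: field_simps)
    then show ?thesis by simp
  qed
  have B: "set_integrable lborel ?B (\<lambda>u. g (nat \<lfloor>(u - s) * 2 ^ n\<rfloor>))"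
    "(LINT u:?B|lborel. g (nat \<lfloor>(u - s) * 2 ^ n\<rfloor>)) = g m / 2 ^ n"
  proof -
    have le: "s + real m / 2 ^ n \<le> s + real (Suc m) / 2 ^ n" by (simp add: divide_right_mono)
    have "integrable lborel (indicat_real ?B)"
      using emeasure_lborel_Ico[OF le] by (intro integrable_real_indicator) auto
    then have "set_integrable lborel ?B (\<lambda>u. g m)"
      unfolding set_integrable_def scaleR_conv_of_real of_real_eq_id id_apply by (rule integrable_mult_left)
    then show "set_integrable lborel ?B (\<lambda>u. g (nat \<lfloor>(u - s) * 2 ^ n\<rfloor>))"
      by (subst set_integrable_cong[OF refl refl eq]) auto
    have "(LINT u:?B|lborel. g (nat \<lfloor>(u - s) * 2 ^ n\<rfloor>)) = (LINT u:?B|lborel. g m)"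
      by (rule set_lebesgue_integral_cong) (use eq in auto)
    also have "\<dots> = g m / 2 ^ n" by (simp add: set_lebesgue_integral_def measure_lborel_Ico[OF le, simplified]) (simp add: field_simps)
    finally show "(LINT u:?B|lborel. g (nat \<lfloor>(u - s) * 2 ^ n\<rfloor>)) = g m / 2 ^ n" .
  qed
  { case 1 show ?case unfolding un by (rule set_integrable_Un[OF Suc(1) B(1)]) auto }
  { case 2 show ?case unfolding un using set_integral_Un[OF disj Suc(1) B(1)] Suc(2) B(2)
      by (simp add: add_divide_distrib) }
qed

lemma exp_minus_1_scaled_tendsto: "(\<lambda>n. (exp (c / 2 ^ n) - 1) * 2 ^ n :: real) \<longlonglongrightarrow> c"
proof (cases "c = 0")
  case False
  have "filterlim (\<lambda>n. c / 2 ^ n) (at 0) sequentially"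
    using LIMSEQ_half_pow[of c] False by (auto simp: filterlim_at)
  from tendsto_mult[OF filterlim_compose[OF lim_exp_minus_1 this] tendsto_const[of c]]
  moreover have "(exp (c / 2 ^ n) - 1) / (c / 2 ^ n) * c = (exp (c / 2 ^ n) - 1) * 2 ^ n" for n
    using False by (simp add: field_simps)
  ultimately show ?thesis by simp
qed simp

lemma exp_minus_1_scaled_bound: "\<bar>exp (c / 2 ^ n) - 1\<bar> * 2 ^ n \<le> \<bar>c\<bar> * exp \<bar>c\<bar>" for c :: real
proof -
  define z where "z = \<bar>c\<bar> / 2 ^ n"
  have z: "0 \<le> z" "z \<le> \<bar>c\<bar>"
  proof -
    have "\<bar>c\<bar> / 2 ^ n \<le> \<bar>c\<bar> / 1" by (intro divide_left_mono) auto
    then show "0 \<le> z" "z \<le> \<bar>c\<bar>" by (auto simp: z_def)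
  qed
  have "exp y - 1 \<le> y * exp y" for y :: real
  proof -
    have "exp y * (1 - y) \<le> exp y * exp (- y)"
      using exp_ge_add_one_self[of "- y"] by (intro mult_left_mono) auto
    then show ?thesis by (simp add: exp_minus algebra_simps)
  qed
  note E = this
  have "\<bar>exp (c / 2 ^ n) - 1\<bar> \<le> z * exp z"
  proof (cases "0 \<le> c")
    case True
    then show ?thesis using E[of z] by (simp add: z_def)
  next
    case False
    then have eq: "c / 2 ^ n = - z" by (simp add: z_def)
    have "1 - exp (- z) \<le> z" using exp_ge_add_one_self[of "- z"] by simp
    also have "z \<le> z * exp z" using z by (simp add: mult_le_cancel_left1)
    finally show ?thesis unfolding eq using z by simp
  qed
  also have "\<dots> \<le> z * exp \<bar>c\<bar>" using z by (intro mult_left_mono) auto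
  finally have "\<bar>exp (c / 2 ^ n) - 1\<bar> * 2 ^ n \<le> z * exp \<bar>c\<bar> * 2 ^ n" by (rule mult_right_mono) simp
  then show ?thesis by (simp add: z_def)
qed

section \<open>First passage and its skeleton counterparts\<close>

context killed_spectrally_negative_levy begin

text \<open>\<tau> is the infimum of the times after s at which X exceeds a. The left limit there is
  at most a and jumps are not upward, so X \<tau> \<le> a; right continuity and nearby exceeding
  times give the reverse. The level is thus crossed continuously, and exceeding times accumulate at
  \<tau> from the right.\<close>

lemma first_passage:
  assumes \<omega>: "\<omega> \<in> \<Omega>" and np: "no_positive_jumps (\<lambda>t. X t \<omega>)"
    and s: "0 \<le> s" "X s \<omega> \<le> a" and u: "s \<le> u" "a < X u \<omega>"
  obtains \<tau> where "s \<le> \<tau>" "\<tau> < u" "X \<tau> \<omega> = a" "\<omega> \<in> stays a s \<tau>"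
    "\<And>t. \<tau> < t \<Longrightarrow> \<exists>v>\<tau>. v < t \<and> a < X v \<omega>"
proof -
  define S where "S = {v. s \<le> v \<and> a < X v \<omega>}"
  have S: "u \<in> S" "bdd_below S" using u by (auto simp: S_def intro!: bdd_belowI)
  define \<tau> where "\<tau> = Inf S"
  have s\<tau>: "s \<le> \<tau>" unfolding \<tau>_def by (rule cInf_greatest) (use S in \<open>auto simp: S_def\<close>)
  have low: "X v \<omega> \<le> a" if "s \<le> v" "v < \<tau>" for v
  proof (rule ccontr)
    assume "\<not> X v \<omega> \<le> a"
    then have "v \<in> S" using that by (simp add: S_def)
    from cInf_lower[OF this S(2)] that show False by (simp add: \<tau>_def)
  qed
  have le: "X \<tau> \<omega> \<le> a"
  proof (cases "\<tau> = s")
    case False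
    with s\<tau> s have pos: "0 < \<tau>" "s < \<tau>" by auto
    then obtain l where l: "((\<lambda>t. X t \<omega>) \<longlongrightarrow> l) (at_left \<tau>)" using cadlag_paths[OF \<omega>] by (auto simp: cadlag_def)
    have "X \<tau> \<omega> \<le> l" using np l pos by (auto simp: no_positive_jumps_def)
    also have "l \<le> a"
    proof (rule tendsto_upperbound[OF l])
      show "\<forall>\<^sub>F t in at_left \<tau>. X t \<omega> \<le> a"
        unfolding eventually_at_left_field using low pos by (intro exI[of _ s]) auto
    qed simp
    finally show ?thesis .
  qed (use s in simp)
  have right: "\<exists>v>\<tau>. v < t \<and> a < X v \<omega>" if "\<tau> < t" for t
  proof -
    have "S \<noteq> {}" using S by auto
    from cInf_lessD[OF this that[unfolded \<tau>_def]] obtain v where "v \<in> S" "v < t" by auto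
    moreover have "\<tau> \<le> v" unfolding \<tau>_def using \<open>v \<in> S\<close> S(2) by (rule cInf_lower)
    moreover have "v \<noteq> \<tau>" using le \<open>v \<in> S\<close> by (auto simp: S_def)
    ultimately have "\<tau> < v" "v < t" "a < X v \<omega>" by (auto simp: S_def)
    then show ?thesis by blast
  qed
  have ge: "a \<le> X \<tau> \<omega>"
  proof (rule ccontr)
    assume "\<not> ?thesis"
    then have "\<forall>\<^sub>F v in at_right \<tau>. X v \<omega> < a"
      using order_tendstoD(2)[OF X_right_continuous[OF \<omega>, of \<tau>], of a] s s\<tau> by auto
    then obtain t where "\<tau> < t" "\<And>v. \<tau> < v \<Longrightarrow> v < t \<Longrightarrow> X v \<omega> < a" by (auto simp: eventually_at_right_field)
    with right[of t] show False by force
  qed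
  have "\<tau> \<le> u" unfolding \<tau>_def using S by (rule cInf_lower)
  moreover have "\<tau> \<noteq> u" using le u by auto
  ultimately have "\<tau> < u" by simp
  moreover have "\<omega> \<in> stays a s \<tau>" using low le by (auto simp: stays_def) (metis less_le)
  ultimately show ?thesis using that[of \<tau>] s\<tau> antisym[OF le ge] right by blast
qed

text \<open>The exponential functional of a path that is alive and has not passed a since s. On that
  event it is at most exp(l a), which supplies the dominating functions below.\<close>

definition surv :: "real \<Rightarrow> real \<Rightarrow> real \<Rightarrow> real \<Rightarrow> 'a \<Rightarrow> real" where
  "surv l a s u \<omega> = indicator (stays a s u) \<omega> * (exp (l * X u \<omega>) * indicator (alive u) \<omega>)"

lemma progressive_surv: "0 \<le> s \<Longrightarrow> progressive (surv l a s)"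
  unfolding surv_def
  by (intro progressive_mult progressive_stays progressive_alive progressive_compose[OF progressive_X, of "\<lambda>y. exp (l * y)"]) auto

lemma surv_bounds: "0 \<le> l \<Longrightarrow> s \<le> u \<Longrightarrow> 0 \<le> surv l a s u \<omega> \<and> surv l a s u \<omega> \<le> exp (l * a)"
  by (auto simp: surv_def indicator_def stays_def intro!: mult_left_mono)

definition dstays :: "real \<Rightarrow> real \<Rightarrow> nat \<Rightarrow> nat \<Rightarrow> 'a set" where
  "dstays a s n k = {\<omega>. \<forall>j\<in>{..k}. X (s + real j / 2 ^ n) \<omega> \<le> a}"

definition dsurv :: "real \<Rightarrow> real \<Rightarrow> real \<Rightarrow> nat \<Rightarrow> nat \<Rightarrow> 'a \<Rightarrow> real" where
  "dsurv l a s n k \<omega> = indicator (dstays a s n k) \<omega> *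
     (exp (l * X (s + real k / 2 ^ n) \<omega>) * indicator (alive (s + real k / 2 ^ n)) \<omega>)"

text \<open>The value of exp(l X) at the first skeleton time above a, when this is step k + 1.
  Because of the overshoot it may exceed exp(l a).\<close>

definition dpass :: "real \<Rightarrow> real \<Rightarrow> real \<Rightarrow> nat \<Rightarrow> nat \<Rightarrow> 'a \<Rightarrow> real" where
  "dpass l a s n k \<omega> = indicator (dstays a s n k - dstays a s n (Suc k)) \<omega> *
     (exp (l * X (s + real (Suc k) / 2 ^ n) \<omega>) * indicator (alive (s + real (Suc k) / 2 ^ n)) \<omega>)"

lemma dstays_measurable_F:
  assumes "0 \<le> s" shows "Measurable.pred (F (ennreal (s + real k / 2 ^ n))) (\<lambda>\<omega>. \<omega> \<in> dstays a s n k)"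
proof -
  have "Measurable.pred (F (ennreal (s + real k / 2 ^ n))) (\<lambda>\<omega>. X (s + real j / 2 ^ n) \<omega> \<le> a)" if "j \<in> {..k}" for j
  proof -
    have [measurable]: "X (s + real j / 2 ^ n) \<in> borel_measurable (F (ennreal (s + real k / 2 ^ n)))"
      using assms that by (intro X_measurable_F) (auto simp: divide_right_mono)
    show ?thesis by measurable
  qed
  then show ?thesis unfolding dstays_def mem_Collect_eq by (intro pred_intros_finite) auto
qed

lemma dstays_measurable [measurable]: "0 \<le> s \<Longrightarrow> Measurable.pred (P x) (\<lambda>\<omega>. \<omega> \<in> dstays a s n k)"
  by (rule measurable_F_imp_P[OF _ dstays_measurable_F]) auto

lemma dstays_Suc: "\<omega> \<in> dstays a s n (Suc k) \<longleftrightarrow> \<omega> \<in> dstays a s n k \<and> X (s + real (Suc k) / 2 ^ n) \<omega> \<le> a"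
  by (auto simp: dstays_def atMost_Suc)

lemma dstays_antimono: "j \<le> k \<Longrightarrow> \<omega> \<in> dstays a s n k \<Longrightarrow> \<omega> \<in> dstays a s n j"
  by (auto simp: dstays_def)

lemma dsurv_measurable [measurable]: "0 \<le> s \<Longrightarrow> dsurv l a s n k \<in> borel_measurable (P x)"
proof -
  assume s: "0 \<le> s"
  then have [measurable]: "X (s + real k / 2 ^ n) \<in> borel_measurable (P x)"
    "Measurable.pred (P x) (\<lambda>\<omega>. \<omega> \<in> alive (s + real k / 2 ^ n))"
    "Measurable.pred (P x) (\<lambda>\<omega>. \<omega> \<in> dstays a s n k)" by auto
  show ?thesis unfolding dsurv_def by measurable
qed

lemma dpass_measurable [measurable]: "0 \<le> s \<Longrightarrow> dpass l a s n k \<in> borel_measurable (P x)"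
proof -
  assume s: "0 \<le> s"
  then have [measurable]: "X (s + real (Suc k) / 2 ^ n) \<in> borel_measurable (P x)"
    "Measurable.pred (P x) (\<lambda>\<omega>. \<omega> \<in> alive (s + real (Suc k) / 2 ^ n))"
    "Measurable.pred (P x) (\<lambda>\<omega>. \<omega> \<in> dstays a s n j)" for j by auto
  show ?thesis unfolding dpass_def by measurable
qed

lemma dsurv_bounds: "0 \<le> l \<Longrightarrow> 0 \<le> dsurv l a s n k \<omega> \<and> dsurv l a s n k \<omega> \<le> exp (l * a)"
  by (auto simp: dsurv_def indicator_def dstays_def intro!: mult_left_mono)

lemma dpass_nonneg: "0 \<le> dpass l a s n k \<omega>"
  by (auto simp: dpass_def)

lemma integrable_bounded_mult:
  assumes "Z \<in> borel_measurable (P x)" "\<And>\<omega>. 0 \<le> Z \<omega> \<and> Z \<omega> \<le> K"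
    "f \<in> borel_measurable (P x)" "\<And>\<omega>. 0 \<le> f \<omega> \<and> f \<omega> \<le> (C::real)"
  shows "integrable (P x) (\<lambda>\<omega>. Z \<omega> * f \<omega> :: real)"
proof (rule P.integrable_const_bound[where B="K * C"])
  have K: "0 \<le> K" using assms(2)[of undefined] by linarith
  show "AE \<omega> in P x. norm (Z \<omega> * f \<omega>) \<le> K * C"
    using assms(2,4) K by (auto simp: abs_mult intro!: mult_mono)
qed (use assms in auto)

text \<open>Given no passage up to step k, a step of length 2^-n multiplies the mean of exp(l X) on
  survival by exp((\<psi>(l) - p) / 2^n), and step k + 1 is either still below a or the passage
  step. Integrability of the unbounded \<open>dpass\<close> comes out of the same identity.\<close>

lemma skeleton_step:
  assumes s: "0 \<le> s" and l: "0 \<le> l" and Z: "Z \<in> borel_measurable (F (ennreal s))" "\<And>\<omega>. 0 \<le> Z \<omega> \<and> Z \<omega> \<le> K"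
  shows "integrable (P x) (\<lambda>\<omega>. Z \<omega> * dsurv l a s n k \<omega>)" (is ?A)
    and "integrable (P x) (\<lambda>\<omega>. Z \<omega> * dpass l a s n k \<omega>)" (is ?B)
    and "(\<integral>\<omega>. Z \<omega> * dsurv l a s n (Suc k) \<omega> \<partial>P x) + (\<integral>\<omega>. Z \<omega> * dpass l a s n k \<omega> \<partial>P x)
      = exp ((\<psi> l - p) / 2 ^ n) * (\<integral>\<omega>. Z \<omega> * dsurv l a s n k \<omega> \<partial>P x)" (is ?C)
proof -
  have ZP: "Z \<in> borel_measurable (P x)" using Z measurable_F_imp_P s by blast
  have A: "integrable (P x) (\<lambda>\<omega>. Z \<omega> * dsurv l a s n k \<omega>)" for k
    by (rule integrable_bounded_mult[OF ZP Z(2) dsurv_measurable[OF s] dsurv_bounds[OF l]])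
  then show ?A .
  let ?t = "s + real k / 2 ^ n"
  have St: "s + real (Suc k) / 2 ^ n = ?t + 1 / 2 ^ n" by (simp add: field_simps)
  have sub: "subalgebra (F (ennreal ?t)) (F (ennreal s))"
    using sets_F_mono[of "ennreal s" "ennreal ?t"] by (simp add: subalgebra_def space_F ennreal_leI)
  have [measurable]: "Z \<in> borel_measurable (F (ennreal ?t))" by (rule measurable_from_subalg[OF sub Z(1)])
  have [measurable]: "Measurable.pred (F (ennreal ?t)) (\<lambda>\<omega>. \<omega> \<in> dstays a s n k)" by (rule dstays_measurable_F[OF s])
  define h where "h \<omega> = Z \<omega> * indicator (dstays a s n k) \<omega> *
      (exp (l * X (s + real (Suc k) / 2 ^ n) \<omega>) * indicator (alive (s + real (Suc k) / 2 ^ n)) \<omega>)" for \<omega>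
  have h_eq: "h \<omega> = Z \<omega> * dsurv l a s n (Suc k) \<omega> + Z \<omega> * dpass l a s n k \<omega>" for \<omega>
    by (auto simp: h_def dsurv_def dpass_def dstays_Suc indicator_def)
  have [measurable]: "h \<in> borel_measurable (P x)"
    unfolding h_eq[abs_def] using ZP dsurv_measurable[OF s] dpass_measurable[OF s] by measurable
  have h0: "0 \<le> h \<omega>" for \<omega> unfolding h_def using Z(2) by simp
  have "(\<integral>\<^sup>+\<omega>. ennreal (h \<omega>) \<partial>P x) = (\<integral>\<^sup>+\<omega>. ennreal (Z \<omega> * indicator (dstays a s n k) \<omega>) *
      (ennreal (exp (l * X (?t + 1 / 2 ^ n) \<omega>)) * indicator (alive (?t + 1 / 2 ^ n)) \<omega>) \<partial>P x)"
    unfolding h_def St using Z(2) by (intro nn_integral_cong) (auto simp: ennreal_mult indicator_def)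
  also have "\<dots> = mgf l (1 / 2 ^ n) * ennreal (exp (- p * (1 / 2 ^ n))) * (\<integral>\<^sup>+\<omega>. ennreal (Z \<omega> * indicator (dstays a s n k) \<omega>) *
      (ennreal (exp (l * X ?t \<omega>)) * indicator (alive ?t) \<omega>) \<partial>P x)"
  proof (rule killing_exp)
    show "(\<lambda>\<omega>. ennreal (Z \<omega> * indicator (dstays a s n k) \<omega>)) \<in> borel_measurable (F (ennreal ?t))" by measurable
  qed (use s in auto)
  also have "mgf l (1 / 2 ^ n) * ennreal (exp (- p * (1 / 2 ^ n))) = ennreal (exp ((\<psi> l - p) / 2 ^ n))"
    by (simp add: mgf_eq[OF l] ennreal_mult[symmetric] exp_add[symmetric] diff_divide_distrib)
  also have "(\<integral>\<^sup>+\<omega>. ennreal (Z \<omega> * indicator (dstays a s n k) \<omega>) *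
      (ennreal (exp (l * X ?t \<omega>)) * indicator (alive ?t) \<omega>) \<partial>P x) = (\<integral>\<^sup>+\<omega>. ennreal (Z \<omega> * dsurv l a s n k \<omega>) \<partial>P x)"
    unfolding dsurv_def using Z(2) by (intro nn_integral_cong) (auto simp: ennreal_mult indicator_def)
  also have "\<dots> = ennreal (\<integral>\<omega>. Z \<omega> * dsurv l a s n k \<omega> \<partial>P x)"
    by (rule nn_integral_eq_integral[OF A]) (use Z(2) dsurv_bounds[OF l] in auto)
  finally have nn: "(\<integral>\<^sup>+\<omega>. ennreal (h \<omega>) \<partial>P x) =
      ennreal (exp ((\<psi> l - p) / 2 ^ n) * (\<integral>\<omega>. Z \<omega> * dsurv l a s n k \<omega> \<partial>P x))"
    by (simp add: ennreal_mult')
  have hint: "integrable (P x) h"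
    by (rule integrableI_nonneg) (use h0 nn in auto)
  have "integrable (P x) (\<lambda>\<omega>. h \<omega> - Z \<omega> * dsurv l a s n (Suc k) \<omega>)" by (intro Bochner_Integration.integrable_diff hint A)
  then show B: ?B by (simp add: h_eq)
  have "ennreal (\<integral>\<omega>. h \<omega> \<partial>P x) = ennreal (exp ((\<psi> l - p) / 2 ^ n) * (\<integral>\<omega>. Z \<omega> * dsurv l a s n k \<omega> \<partial>P x))"
    unfolding nn[symmetric] by (rule nn_integral_eq_integral[symmetric, OF hint]) (use h0 in auto)
  then have "(\<integral>\<omega>. h \<omega> \<partial>P x) = exp ((\<psi> l - p) / 2 ^ n) * (\<integral>\<omega>. Z \<omega> * dsurv l a s n k \<omega> \<partial>P x)"
    by (subst (asm) ennreal_inj) (use Z(2) dsurv_bounds[OF l] h0 in \<open>auto intro!: Bochner_Integration.integral_nonneg mult_nonneg_nonneg\<close>)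
  then show ?C unfolding h_eq[abs_def] by (simp add: Bochner_Integration.integral_add[OF A B])
qed

lemma skeleton_identity:
  assumes s: "0 \<le> s" and l: "0 \<le> l" and Z: "Z \<in> borel_measurable (F (ennreal s))" "\<And>\<omega>. 0 \<le> Z \<omega> \<and> Z \<omega> \<le> K"
  shows "(\<Sum>k<m. \<integral>\<omega>. Z \<omega> * dpass l a s n k \<omega> \<partial>P x) + (\<integral>\<omega>. Z \<omega> * dsurv l a s n m \<omega> \<partial>P x)
      = (\<integral>\<omega>. Z \<omega> * dsurv l a s n 0 \<omega> \<partial>P x) + (exp ((\<psi> l - p) / 2 ^ n) - 1) * (\<Sum>k<m. \<integral>\<omega>. Z \<omega> * dsurv l a s n k \<omega> \<partial>P x)"
proof (induction m)
  case (Suc m)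
  show ?case unfolding sum.lessThan_Suc distrib_left
    using Suc skeleton_step(3)[OF assms, of x a n m]
      left_diff_distrib[of "exp ((\<psi> l - p) / 2 ^ n)" 1 "\<integral>\<omega>. Z \<omega> * dsurv l a s n m \<omega> \<partial>P x"]
    by linarith
qed simp

text \<open>A path has at most one passage step, so cross terms vanish, and squaring an exponential
  doubles l. A second moment thereby becomes a first moment of the same kind.\<close>

lemma sum_dpass_power2: "(\<Sum>k<m. dpass l a s n k \<omega>)\<^sup>2 = (\<Sum>k<m. dpass (2 * l) a s n k \<omega>)"
proof (induction m)
  case (Suc m)
  have "(\<Sum>k<m. dpass l a s n k \<omega>) * dpass l a s n m \<omega> = (\<Sum>k<m. dpass l a s n k \<omega> * dpass l a s n m \<omega>)"
    by (rule sum_distrib_right)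
  also have "\<dots> = 0"
  proof (rule sum.neutral, intro ballI)
    fix k assume "k \<in> {..<m}"
    then show "dpass l a s n k \<omega> * dpass l a s n m \<omega> = 0"
      using dstays_antimono[of "Suc k" m \<omega> a s n] by (auto simp: dpass_def indicator_def)
  qed
  finally have "(\<Sum>k<Suc m. dpass l a s n k \<omega>)\<^sup>2 = (\<Sum>k<m. dpass l a s n k \<omega>)\<^sup>2 + (dpass l a s n m \<omega>)\<^sup>2"
    by (simp add: power2_sum)
  moreover have "(dpass l a s n m \<omega>)\<^sup>2 = dpass (2 * l) a s n m \<omega>"
    by (auto simp: dpass_def indicator_def power2_eq_square exp_add[symmetric])
  ultimately show ?case using Suc by simp
qed simp

end

lemma filterlim_skeleton:
  assumes "s \<le> u" shows "filterlim (\<lambda>n. s + dyadic_above n (u - s)) (at_right u) sequentially"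
proof -
  have "(\<lambda>n. dyadic_above n (u - s)) \<longlonglongrightarrow> u - s"
    using filterlim_dyadic_above[of "u - s"] assms by (simp add: filterlim_at)
  from tendsto_add[OF tendsto_const[of s] this]
  have "(\<lambda>n. s + dyadic_above n (u - s)) \<longlonglongrightarrow> u" by simp
  moreover have "u < s + dyadic_above n (u - s)" for n
    using dyadic_above_bounds(1)[of "u - s" n] assms by simp
  ultimately show ?thesis
    by (auto simp: filterlim_at intro!: always_eventually) (metis less_irrefl)
qed

section \<open>Limits of the skeleton quantities as the mesh vanishes\<close>

context killed_spectrally_negative_levy begin

definition passes_by :: "real \<Rightarrow> real \<Rightarrow> real \<Rightarrow> 'a set" where
  "passes_by a s T = {\<omega>. \<exists>u\<ge>s. u \<le> s + T \<and> \<omega> \<in> alive u \<and> a < X u \<omega>}"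

lemma alive_nhd:
  assumes "0 \<le> u" "\<omega> \<in> alive u" obtains t where "u < t" "\<And>v. v < t \<Longrightarrow> \<omega> \<in> alive v"
proof -
  have "((\<lambda>u. indicator (alive u) \<omega> :: real) \<longlongrightarrow> 1) (at_right u)"
    using alive_right_continuous[of u \<omega>] assms by simp
  then have "\<forall>\<^sub>F v in at_right u. 0 < (indicator (alive v) \<omega> :: real)" by (rule order_tendstoD) simp
  then obtain t where t: "u < t" "\<And>v. u < v \<Longrightarrow> v < t \<Longrightarrow> \<omega> \<in> alive v"
    by (auto simp: eventually_at_right_field indicator_def split: if_splits)
  show ?thesis
  proof (rule that[OF t(1)])
    fix v assume "v < t"
    then show "\<omega> \<in> alive v" using t(2)[of v] alive_antimono[of v u] assms(2) by (cases "u < v") auto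
  qed
qed

lemma passes_by_iff:
  assumes "\<omega> \<in> \<Omega>" "0 \<le> s"
  shows "\<omega> \<in> passes_by a s (real T) \<longleftrightarrow>
    (\<exists>n. \<exists>k\<in>{..T * 2 ^ n}. \<omega> \<in> alive (s + real k / 2 ^ n) \<and> a < X (s + real k / 2 ^ n) \<omega>)"
proof
  assume "\<omega> \<in> passes_by a s (real T)"
  then obtain u where u: "s \<le> u" "u \<le> s + T" "\<omega> \<in> alive u" "a < X u \<omega>" by (auto simp: passes_by_def)
  show "\<exists>n. \<exists>k\<in>{..T * 2 ^ n}. \<omega> \<in> alive (s + real k / 2 ^ n) \<and> a < X (s + real k / 2 ^ n) \<omega>"
  proof (cases "u = s + T")
    \<comment> \<open>T is a natural number, so the horizon is itself a skeleton point, already at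
      mesh 1.\<close>
    case True
    then show ?thesis using u by (intro exI[of _ 0] bexI[of _ T]) auto
  next
    case False
    have "0 \<le> u" using u assms by simp
    from alive_nhd[OF this u(3)] obtain t where t: "u < t" "\<And>v. v < t \<Longrightarrow> \<omega> \<in> alive v" by blast
    have "u < min t (s + T)" using t False u by simp
    from eventually_happens'[OF sequentially_bot dense_passage[OF assms u(1,4) this]]
    obtain n where n: "s + dyadic_above n (u - s) < t" "s + dyadic_above n (u - s) < s + T" "a < X (s + dyadic_above n (u - s)) \<omega>"
      by auto
    define k where "k = Suc (nat \<lfloor>(u - s) * 2 ^ n\<rfloor>)"
    have k: "dyadic_above n (u - s) = real k / 2 ^ n" by (simp add: dyadic_above_def k_def)
    have "real k < real (T * 2 ^ n)" using n(2) unfolding k by (simp add: divide_less_eq)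
    then have "k \<le> T * 2 ^ n" by linarith
    then show ?thesis using n(1,3) t(2) unfolding k by blast
  qed
next
  assume "\<exists>n. \<exists>k\<in>{..T * 2 ^ n}. \<omega> \<in> alive (s + real k / 2 ^ n) \<and> a < X (s + real k / 2 ^ n) \<omega>"
  then obtain n k where nk: "k \<le> T * 2 ^ n" "\<omega> \<in> alive (s + real k / 2 ^ n)" "a < X (s + real k / 2 ^ n) \<omega>" by auto
  have "real k \<le> real (T * 2 ^ n)" using nk(1) by linarith
  then have "real k / 2 ^ n \<le> T" by (simp add: divide_le_eq)
  then show "\<omega> \<in> passes_by a s (real T)" unfolding passes_by_def using nk
    by (intro CollectI exI[of _ "s + real k / 2 ^ n"]) auto
qed

lemma passes_by_measurable [measurable]:
  assumes s: "0 \<le> s" shows "Measurable.pred (P x) (\<lambda>\<omega>. \<omega> \<in> passes_by a s (real T))"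
proof -
  have [measurable]: "Measurable.pred (P x) (\<lambda>\<omega>. \<omega> \<in> alive (s + real k / 2 ^ n))"
     "X (s + real k / 2 ^ n) \<in> borel_measurable (P x)" for n k
    using s by auto
  have "Measurable.pred (P x) (\<lambda>\<omega>. \<exists>n. \<exists>k\<in>{..T * 2 ^ n}. \<omega> \<in> alive (s + real k / 2 ^ n) \<and> a < X (s + real k / 2 ^ n) \<omega>)"
    by measurable
  then show ?thesis by (subst measurable_cong[OF passes_by_iff]) (use s in auto)
qed

lemma not_dstays_eventually:
  assumes \<omega>: "\<omega> \<in> \<Omega>" and s: "0 \<le> s" "s \<le> v" and v: "a < X v \<omega>" and t: "v < t"
  shows "\<forall>\<^sub>F n in sequentially. \<forall>k. t \<le> s + real k / 2 ^ n \<longrightarrow> \<omega> \<notin> dstays a s n k"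
  using dense_passage[OF assms]
proof eventually_elim
  case (elim n)
  show ?case
  proof (intro allI impI)
    fix k assume k: "t \<le> s + real k / 2 ^ n"
    define j where "j = Suc (nat \<lfloor>(v - s) * 2 ^ n\<rfloor>)"
    have j: "dyadic_above n (v - s) = real j / 2 ^ n" by (simp add: dyadic_above_def j_def)
    have "real j / 2 ^ n < real k / 2 ^ n" using elim k unfolding j by linarith
    then have "j \<le> k" by (simp add: divide_less_cancel)
    then show "\<omega> \<notin> dstays a s n k" using elim unfolding j dstays_def by (auto simp: not_le)
  qed
qed

lemma stays_imp_dstays: "\<omega> \<in> stays a s v \<Longrightarrow> s + real k / 2 ^ n \<le> v \<Longrightarrow> \<omega> \<in> dstays a s n k"
proof -
  assume v: "\<omega> \<in> stays a s v" "s + real k / 2 ^ n \<le> v"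
  show ?thesis unfolding dstays_def
  proof (intro CollectI ballI)
    fix j assume "j \<in> {..k}"
    then have "real j / 2 ^ n \<le> real k / 2 ^ n" by (simp add: divide_right_mono)
    with v show "X (s + real j / 2 ^ n) \<omega> \<le> a" by (auto simp: stays_def)
  qed
qed

text \<open>Skeleton times approach u from the right, so convergence could fail where X stays at or
  below a until u and exceeds a right afterwards. The last hypothesis excludes that case; it
  concerns at most one u on each path.\<close>

lemma dsurv_tendsto:
  assumes \<omega>: "\<omega> \<in> \<Omega>" and s: "0 \<le> s" "s \<le> u"
    and good: "\<omega> \<in> stays a s u \<Longrightarrow> \<exists>v>u. \<omega> \<in> stays a s v"
  shows "(\<lambda>n. dsurv l a s n (Suc (nat \<lfloor>(u - s) * 2 ^ n\<rfloor>)) \<omega>) \<longlonglongrightarrow> surv l a s u \<omega>"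
proof -
  let ?k = "\<lambda>n. Suc (nat \<lfloor>(u - s) * 2 ^ n\<rfloor>)"
  have time: "s + real (?k n) / 2 ^ n = s + dyadic_above n (u - s)" for n by (simp add: dyadic_above_def)
  have lim: "filterlim (\<lambda>n. s + dyadic_above n (u - s)) (at_right u) sequentially"
    by (rule filterlim_skeleton[OF s(2)])
  have u0: "0 \<le> u" using s by simp
  have "(\<lambda>n. X (s + real (?k n) / 2 ^ n) \<omega>) \<longlonglongrightarrow> X u \<omega>"
    unfolding time by (rule filterlim_compose[OF X_right_continuous[OF \<omega> u0] lim])
  moreover have "(\<lambda>n. indicator (alive (s + real (?k n) / 2 ^ n)) \<omega> :: real) \<longlonglongrightarrow> indicator (alive u) \<omega>"
    unfolding time by (rule filterlim_compose[OF alive_right_continuous[OF u0] lim])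
  moreover have "(\<lambda>n. indicator (dstays a s n (?k n)) \<omega> :: real) \<longlonglongrightarrow> indicator (stays a s u) \<omega>"
  proof (rule tendsto_eventually, cases "\<omega> \<in> stays a s u")
    case True
    then obtain v where v: "u < v" "\<omega> \<in> stays a s v" using good by blast
    then have "\<forall>\<^sub>F t in at_right u. t < v" by (meson eventually_at_right_field)
    then have "\<forall>\<^sub>F n in sequentially. s + dyadic_above n (u - s) < v" using lim by (rule eventually_compose_filterlim)
    then show "\<forall>\<^sub>F n in sequentially. indicator (dstays a s n (?k n)) \<omega> = (indicator (stays a s u) \<omega> :: real)"
    proof eventually_elim
      case (elim n)
      have "\<omega> \<in> dstays a s n (?k n)" by (rule stays_imp_dstays[OF v(2)]) (use elim in \<open>simp only: time\<close>)
      then show ?case using True by simp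
    qed
  next
    case False
    then obtain v where v: "s \<le> v" "v \<le> u" "a < X v \<omega>" by (auto simp: stays_def not_le)
    have "v < s + dyadic_above n (u - s)" for n using dyadic_above_bounds(1)[of "u - s" n] v s by simp
    show "\<forall>\<^sub>F n in sequentially. indicator (dstays a s n (?k n)) \<omega> = (indicator (stays a s u) \<omega> :: real)"
      using dense_passage[OF \<omega> s(1) v(1,3) less_add_one]
    proof eventually_elim
      case (elim n)
      have "nat \<lfloor>(v - s) * 2 ^ n\<rfloor> \<le> nat \<lfloor>(u - s) * 2 ^ n\<rfloor>"
        using v by (intro nat_mono floor_mono mult_right_mono) auto
      then have "\<omega> \<notin> dstays a s n (?k n)"
        using elim unfolding dyadic_above_def dstays_def
        by (auto simp: not_le simp del: of_nat_Suc intro!: bexI[of _ "Suc (nat \<lfloor>(v - s) * 2 ^ n\<rfloor>)"])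
      then show ?case using False by simp
    qed
  qed
  ultimately show ?thesis unfolding dsurv_def surv_def by (intro tendsto_intros)
qed

text \<open>The skeleton ends exactly at s + T and never looks beyond it, so no exceptional time
  arises and the indicators agree from some mesh on.\<close>

lemma dsurv_end_tendsto:
  assumes \<omega>: "\<omega> \<in> \<Omega>" and s: "0 \<le> s"
  shows "(\<lambda>n. dsurv l a s n (T * 2 ^ n) \<omega>) \<longlonglongrightarrow> surv l a s (s + real T) \<omega>"
proof (rule tendsto_eventually)
  have time: "s + real (T * 2 ^ n) / 2 ^ n = s + real T" for n by simp
  have "\<forall>\<^sub>F n in sequentially. \<omega> \<in> dstays a s n (T * 2 ^ n) \<longleftrightarrow> \<omega> \<in> stays a s (s + real T)"
  proof (cases "\<omega> \<in> stays a s (s + real T)")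
    case True
    then show ?thesis using stays_imp_dstays[OF True] by (intro always_eventually allI) simp
  next
    case False
    then obtain v where v: "s \<le> v" "v \<le> s + real T" "a < X v \<omega>" by (auto simp: stays_def not_le)
    show ?thesis
    proof (cases "v = s + real T")
      case True
      have "\<omega> \<notin> dstays a s n (T * 2 ^ n)" for n
      proof
        assume "\<omega> \<in> dstays a s n (T * 2 ^ n)"
        then have "X (s + real (T * 2 ^ n) / 2 ^ n) \<omega> \<le> a" unfolding dstays_def by blast
        then show False using v True unfolding time by simp
      qed
      then show ?thesis using False by simp
    next
      case F: False
      then have "v < s + real T" using v by simp
      from not_dstays_eventually[OF \<omega> s v(1,3) this] show ?thesis
        by eventually_elim (use False time in auto)
    qed
  qed
  then show "\<forall>\<^sub>F n in sequentially. dsurv l a s n (T * 2 ^ n) \<omega> = surv l a s (s + real T) \<omega>"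
    by eventually_elim (simp add: dsurv_def surv_def indicator_def time)
qed

lemma surv_measurable_time:
  assumes \<omega>: "\<omega> \<in> \<Omega>" and s: "0 \<le> s" "s \<le> t"
  shows "(\<lambda>u. indicator {t..} u * surv l a s u \<omega>) \<in> borel_measurable borel"
proof -
  have "(\<lambda>u. (u, \<omega>)) \<in> measurable borel (borel \<Otimes>\<^sub>M P 0)" using \<omega> by (intro measurable_Pair) auto
  from measurable_compose[OF this progressive_measurable_P[OF progressive_surv[OF s(1), of l a], of 0]]
  have [measurable]: "(\<lambda>u. surv l a s (max 0 u) \<omega>) \<in> borel_measurable borel" by simp
  have "(\<lambda>u. indicator {t..} u * surv l a s (max 0 u) \<omega>) \<in> borel_measurable borel" by measurable
  also have "(\<lambda>u. indicator {t..} u * surv l a s (max 0 u) \<omega>) = (\<lambda>u. indicator {t..} u * surv l a s u \<omega>)"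
    using s by (auto simp: fun_eq_iff indicator_def max_def)
  finally show ?thesis .
qed

lemma dsurv_sum_tendsto:
  assumes \<omega>: "\<omega> \<in> \<Omega>" and s: "0 \<le> s" and l: "0 \<le> l"
  shows "(\<lambda>n. (\<Sum>k<T * 2 ^ n. dsurv l a s n k \<omega>) / 2 ^ n) \<longlonglongrightarrow> (LINT u:{s..<s + real T}|lborel. surv l a s u \<omega>)"
proof -
  let ?A = "{s..<s + real T}"
  let ?g = "\<lambda>n u. dsurv l a s n (Suc (nat \<lfloor>(u - s) * 2 ^ n\<rfloor>)) \<omega>"
  have time: "s + real (T * 2 ^ n) / 2 ^ n = s + real T" for n by simp
  have step: "(LINT u:?A|lborel. ?g n u) = (\<Sum>k<T * 2 ^ n. dsurv l a s n (Suc k) \<omega>) / 2 ^ n" for n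
    using set_integral_step_function(2)[of s "T * 2 ^ n" n "\<lambda>k. dsurv l a s n (Suc k) \<omega>"] unfolding time .
  have "(\<lambda>n. LINT u:?A|lborel. ?g n u) \<longlonglongrightarrow> (LINT u:?A|lborel. surv l a s u \<omega>)"
    unfolding set_lebesgue_integral_def
  proof (rule integral_dominated_convergence[where w="\<lambda>u. indicator ?A u * exp (l * a)"])
    have "(\<lambda>u. indicator ?A u * (indicator {s..} u * surv l a s u \<omega>)) \<in> borel_measurable borel"
      using surv_measurable_time[OF \<omega> s order_refl] by measurable
    also have "(\<lambda>u. indicator ?A u * (indicator {s..} u * surv l a s u \<omega>)) = (\<lambda>u. indicator ?A u *\<^sub>R surv l a s u \<omega>)"
      by (auto simp: fun_eq_iff indicator_def)
    finally show "(\<lambda>u. indicator ?A u *\<^sub>R surv l a s u \<omega>) \<in> borel_measurable lborel" by simp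
    show "(\<lambda>u. indicator ?A u *\<^sub>R ?g n u) \<in> borel_measurable lborel" for n
      using set_integral_step_function(1)[of s "T * 2 ^ n" n "\<lambda>k. dsurv l a s n (Suc k) \<omega>"]
      unfolding time set_integrable_def by (rule borel_measurable_integrable)
    show "integrable lborel (\<lambda>u. indicator ?A u * exp (l * a))"
      by (intro integrable_mult_left integrable_real_indicator) (auto simp: emeasure_lborel_Ico)
    show "AE u in lborel. norm (indicator ?A u *\<^sub>R ?g n u) \<le> indicator ?A u * exp (l * a)" for n
      using dsurv_bounds[OF l] by (intro always_eventually allI) (auto simp: indicator_def)
    \<comment> \<open>The time after which X exceeds a at once. Two such times would contradict each
      other, so the set is null for Lebesgue measure.\<close>
    define bad where "bad = {u. s \<le> u \<and> \<omega> \<in> stays a s u \<and> (\<forall>v>u. \<omega> \<notin> stays a s v)}"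
    have "u = v" if "u \<in> bad" "v \<in> bad" for u v
    proof (rule ccontr)
      assume "u \<noteq> v"
      then consider "u < v" | "v < u" by linarith
      then show False using that by cases (auto simp: bad_def)
    qed
    then have "finite bad" by (metis finite.simps finite_subset insertI1 subsetI singletonI equals0I)
    then have "AE u in lborel. u \<notin> bad" by (intro AE_not_in finite_imp_null_set_lborel)
    then show "AE u in lborel. (\<lambda>n. indicator ?A u *\<^sub>R ?g n u) \<longlonglongrightarrow> indicator ?A u *\<^sub>R surv l a s u \<omega>"
    proof eventually_elim
      case (elim u)
      show ?case
      proof (cases "u \<in> ?A")
        case True
        then have "(\<lambda>n. ?g n u) \<longlonglongrightarrow> surv l a s u \<omega>"
          using elim by (intro dsurv_tendsto[OF \<omega> s]) (auto simp: bad_def)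
        then show ?thesis using True by simp
      qed simp
    qed
  qed
  then have main: "(\<lambda>n. (\<Sum>k<T * 2 ^ n. dsurv l a s n (Suc k) \<omega>) / 2 ^ n) \<longlonglongrightarrow> (LINT u:?A|lborel. surv l a s u \<omega>)"
    unfolding step .
  \<comment> \<open>The integral sees the right end points, index k + 1, while the sum to be treated
    starts at k = 0. The difference is one bounded boundary term divided by 2^n.\<close>
  have "(\<lambda>n. (dsurv l a s n 0 \<omega> - dsurv l a s n (T * 2 ^ n) \<omega>) / 2 ^ n) \<longlonglongrightarrow> 0"
  proof (rule tendsto_rabs_zero_cancel, rule tendsto_sandwich[of "\<lambda>_. 0"])
    show "\<forall>\<^sub>F n in sequentially. \<bar>(dsurv l a s n 0 \<omega> - dsurv l a s n (T * 2 ^ n) \<omega>) / 2 ^ n\<bar> \<le> exp (l * a) / 2 ^ n"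
    proof (intro always_eventually allI)
      fix n
      have "\<bar>dsurv l a s n 0 \<omega> - dsurv l a s n (T * 2 ^ n) \<omega>\<bar> \<le> exp (l * a)"
        using dsurv_bounds[OF l, of a s n 0 \<omega>] dsurv_bounds[OF l, of a s n "T * 2 ^ n" \<omega>] by linarith
      then show "\<bar>(dsurv l a s n 0 \<omega> - dsurv l a s n (T * 2 ^ n) \<omega>) / 2 ^ n\<bar> \<le> exp (l * a) / 2 ^ n"
        by (simp add: divide_right_mono)
    qed
  qed (auto intro: LIMSEQ_half_pow)
  from tendsto_add[OF main this]
  have "(\<lambda>n. ((\<Sum>k<T * 2 ^ n. dsurv l a s n (Suc k) \<omega>) + (dsurv l a s n 0 \<omega> - dsurv l a s n (T * 2 ^ n) \<omega>)) / 2 ^ n)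
      \<longlonglongrightarrow> (LINT u:?A|lborel. surv l a s u \<omega>)" by (simp add: add_divide_distrib)
  moreover have "(\<Sum>k<m. dsurv l a s n (Suc k) \<omega>) + (dsurv l a s n 0 \<omega> - dsurv l a s n m \<omega>) =
      (\<Sum>k<m. dsurv l a s n k \<omega>)" for n m
    by (induction m) auto
  ultimately show ?thesis by (simp only:)
qed

text \<open>At most one summand survives, namely exp(l X) at the first skeleton time \<sigma> above
  a. These times decrease to the true passage time in the limit, where X equals a, so right
  continuity makes the overshoot vanish and leaves exp(l a).\<close>

lemma dpass_sum_tendsto:
  assumes \<omega>: "\<omega> \<in> \<Omega>" and np: "no_positive_jumps (\<lambda>t. X t \<omega>)" and s: "0 \<le> s"
  shows "(\<lambda>n. \<Sum>k<T * 2 ^ n. dpass l a s n k \<omega>) \<longlonglongrightarrow>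
    exp (l * a) * (indicator {\<omega>. X s \<omega> \<le> a} \<omega> * indicator (passes_by a s (real T)) \<omega>)"
proof (cases "X s \<omega> \<le> a \<and> \<omega> \<in> passes_by a s (real T)")
  case False
  have "dpass l a s n k \<omega> = 0" if "k < T * 2 ^ n" for n k
  proof (rule ccontr)
    assume "dpass l a s n k \<omega> \<noteq> 0"
    then have *: "\<omega> \<in> dstays a s n k" "\<omega> \<notin> dstays a s n (Suc k)" "\<omega> \<in> alive (s + real (Suc k) / 2 ^ n)"
      by (auto simp: dpass_def indicator_def split: if_splits)
    then have p: "a < X (s + real (Suc k) / 2 ^ n) \<omega>" by (simp only: dstays_Suc not_le) simp
    have "X (s + real 0 / 2 ^ n) \<omega> \<le> a" using *(1) unfolding dstays_def by blast
    then have "X s \<omega> \<le> a" by simp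
    moreover have "real (Suc k) / 2 ^ n \<le> real T"
    proof -
      have "real (Suc k) \<le> real (T * 2 ^ n)" using that by linarith
      then show ?thesis by (simp add: divide_le_eq)
    qed
    then have "\<omega> \<in> passes_by a s (real T)" unfolding passes_by_def using * p
      by (intro CollectI exI[of _ "s + real (Suc k) / 2 ^ n"]) auto
    ultimately show False using False by simp
  qed
  then have "(\<Sum>k<T * 2 ^ n. dpass l a s n k \<omega>) = 0" for n by (intro sum.neutral) auto
  then show ?thesis using False by (auto simp: indicator_def)
next
  case True
  then obtain u where u: "s \<le> u" "u \<le> s + T" "\<omega> \<in> alive u" "a < X u \<omega>" by (auto simp: passes_by_def)
  obtain \<tau> where \<tau>: "s \<le> \<tau>" "\<tau> < u" "X \<tau> \<omega> = a" "\<omega> \<in> stays a s \<tau>"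
    "\<And>t. \<tau> < t \<Longrightarrow> \<exists>v>\<tau>. v < t \<and> a < X v \<omega>"
    using first_passage[OF \<omega> np s _ u(1,4)] True by blast
  define k0 where "k0 n = (LEAST k. a < X (s + real k / 2 ^ n) \<omega>)" for n
  define \<sigma> where "\<sigma> n = s + real (k0 n) / 2 ^ n" for n
  have ev: "\<forall>\<^sub>F n in sequentially. \<tau> < \<sigma> n \<and> \<sigma> n < t \<and> a < X (\<sigma> n) \<omega>" if t: "\<tau> < t" for t
  proof -
    obtain v where v: "\<tau> < v" "v < t" "a < X v \<omega>" using \<tau>(5)[OF t] by blast
    have sv: "s \<le> v" using v \<tau> by simp
    show ?thesis using dense_passage[OF \<omega> s sv v(3,2)]
    proof eventually_elim
      case (elim n)
      define k where "k = Suc (nat \<lfloor>(v - s) * 2 ^ n\<rfloor>)"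
      have k: "dyadic_above n (v - s) = real k / 2 ^ n" by (simp add: dyadic_above_def k_def)
      have "a < X (s + real k / 2 ^ n) \<omega>" using elim unfolding k by simp
      then have le: "k0 n \<le> k" and pass: "a < X (\<sigma> n) \<omega>" unfolding k0_def \<sigma>_def by (auto intro: Least_le LeastI)
      have "real (k0 n) / 2 ^ n \<le> real k / 2 ^ n" using le by (simp add: divide_right_mono)
      then have "\<sigma> n < t" using elim unfolding k \<sigma>_def by linarith
      moreover have "\<tau> < \<sigma> n"
      proof (rule ccontr)
        assume "\<not> \<tau> < \<sigma> n"
        then have "X (\<sigma> n) \<omega> \<le> a" using \<tau>(4) by (auto simp: stays_def \<sigma>_def)
        then show False using pass by simp
      qed
      ultimately show ?case using pass by simp
    qed
  qed
  have lim: "filterlim \<sigma> (at_right \<tau>) sequentially"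
  proof -
    have "\<sigma> \<longlonglongrightarrow> \<tau>"
    proof (rule order_tendstoI)
      fix y assume "y < \<tau>"
      show "\<forall>\<^sub>F n in sequentially. y < \<sigma> n" using ev[OF \<tau>(2)] by eventually_elim (use \<open>y < \<tau>\<close> in simp)
    next
      fix y assume "\<tau> < y"
      from ev[OF this] show "\<forall>\<^sub>F n in sequentially. \<sigma> n < y" by eventually_elim simp
    qed
    moreover have "\<forall>\<^sub>F n in sequentially. \<sigma> n \<in> {\<tau><..} \<and> \<sigma> n \<noteq> \<tau>" using ev[OF \<tau>(2)] by eventually_elim auto
    ultimately show ?thesis by (simp add: filterlim_at)
  qed
  have \<tau>0: "0 \<le> \<tau>" using \<tau> s by simp
  have alive\<tau>: "\<omega> \<in> alive \<tau>" using alive_antimono[of \<tau> u] \<tau> u by auto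
  have eq: "\<forall>\<^sub>F n in sequentially. exp (l * X (\<sigma> n) \<omega>) * indicator (alive (\<sigma> n)) \<omega> = (\<Sum>k<T * 2 ^ n. dpass l a s n k \<omega>)"
    using ev[OF \<tau>(2)]
  proof eventually_elim
    case (elim n)
    have low: "X (s + real j / 2 ^ n) \<omega> \<le> a" if "j < k0 n" for j
      using not_less_Least[of j "\<lambda>k. a < X (s + real k / 2 ^ n) \<omega>"] that unfolding k0_def by simp
    have "k0 n \<noteq> 0" using elim True by (metis \<sigma>_def add.right_neutral div_0 not_le of_nat_0)
    then obtain k where k: "k0 n = Suc k" using not0_implies_Suc by blast
    \<comment> \<open>The skeleton crosses before u \<le> s + T, so the crossing step, whose index
      is k0 - 1, lies in the range of the sum.\<close>
    have "real (k0 n) / 2 ^ n < real T" using elim u unfolding \<sigma>_def by linarith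
    then have "real (k0 n) < real (T * 2 ^ n)" by (simp add: divide_less_eq)
    then have "k < T * 2 ^ n" using k by linarith
    have iff: "\<omega> \<in> dstays a s n j \<longleftrightarrow> j < k0 n" for j
    proof
      assume "\<omega> \<in> dstays a s n j"
      then show "j < k0 n" using elim unfolding dstays_def \<sigma>_def by (metis (no_types, lifting) atMost_iff mem_Collect_eq not_le)
    next
      assume "j < k0 n"
      then show "\<omega> \<in> dstays a s n j" unfolding dstays_def using low by auto
    qed
    have z: "dpass l a s n j \<omega> = 0" if "j \<noteq> k" for j
      using that by (auto simp: dpass_def iff k indicator_def)
    have "(\<Sum>j<T * 2 ^ n. dpass l a s n j \<omega>) = (\<Sum>j\<in>{k}. dpass l a s n j \<omega>)"
      by (rule sum.mono_neutral_right) (use \<open>k < T * 2 ^ n\<close> z in auto)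
    also have "\<dots> = exp (l * X (\<sigma> n) \<omega>) * indicator (alive (\<sigma> n)) \<omega>"
      by (simp add: dpass_def iff k \<sigma>_def indicator_def)
    finally show ?case by simp
  qed
  have "(\<lambda>n. exp (l * X (\<sigma> n) \<omega>) * indicator (alive (\<sigma> n)) \<omega>) \<longlonglongrightarrow> exp (l * X \<tau> \<omega>) * indicator (alive \<tau>) \<omega>"
    by (intro tendsto_intros filterlim_compose[OF X_right_continuous[OF \<omega> \<tau>0] lim]
        filterlim_compose[OF alive_right_continuous[OF \<tau>0] lim])
  then have "(\<lambda>n. \<Sum>k<T * 2 ^ n. dpass l a s n k \<omega>) \<longlonglongrightarrow> exp (l * X \<tau> \<omega>) * indicator (alive \<tau>) \<omega>"
    by (rule Lim_transform_eventually[OF _ eq])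
  then show ?thesis using True alive\<tau> \<tau>(3) by simp
qed

lemma set_lebesgue_integral_surv_bounds:
  assumes \<omega>: "\<omega> \<in> \<Omega>" and s: "0 \<le> s" and l: "0 \<le> l"
  shows "0 \<le> (LINT u:{s..<s + real T}|lborel. surv l a s u \<omega>)"
    and "(LINT u:{s..<s + real T}|lborel. surv l a s u \<omega>) \<le> exp (l * a) * real T"
proof -
  show "0 \<le> (LINT u:{s..<s + real T}|lborel. surv l a s u \<omega>)"
    unfolding set_lebesgue_integral_def
    by (intro Bochner_Integration.integral_nonneg) (auto simp: surv_def indicator_def)
  have le: "(\<Sum>k<T * 2 ^ n. dsurv l a s n k \<omega>) / 2 ^ n \<le> exp (l * a) * real T" for n
  proof -
    have "(\<Sum>k<T * 2 ^ n. dsurv l a s n k \<omega>) \<le> real (card {..<T * 2 ^ n}) * exp (l * a)"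
      by (rule sum_bounded_above) (use dsurv_bounds[OF l] in auto)
    then show ?thesis by (simp add: divide_le_eq mult.commute mult.left_commute)
  qed
  show "(LINT u:{s..<s + real T}|lborel. surv l a s u \<omega>) \<le> exp (l * a) * real T"
    by (rule LIMSEQ_le_const2[OF dsurv_sum_tendsto[OF \<omega> s l]]) (use le in auto)
qed

lemma set_lebesgue_integral_surv_measurable:
  assumes s: "0 \<le> s" and l: "0 \<le> l"
  shows "(\<lambda>\<omega>. LINT u:{s..<s + real T}|lborel. surv l a s u \<omega>) \<in> borel_measurable (P x)"
proof (rule borel_measurable_LIMSEQ_real)
  show "(\<lambda>\<omega>. (\<Sum>k<T * 2 ^ n. dsurv l a s n k \<omega>) / 2 ^ n) \<in> borel_measurable (P x)" for n
    using dsurv_measurable[OF s] by measurable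
qed (use dsurv_sum_tendsto[OF _ s l] in auto)

lemma surv_measurable: "0 \<le> s \<Longrightarrow> 0 \<le> u \<Longrightarrow> surv l a s u \<in> borel_measurable (P x)"
  using measurable_F_imp_P[OF _ progressive_adapted[OF progressive_surv]] by blast

lemma expectation_dsurv_le:
  assumes s: "0 \<le> s" and l: "0 \<le> l" and Z: "Z \<in> borel_measurable (P x)" "\<And>\<omega>. 0 \<le> Z \<omega> \<and> Z \<omega> \<le> K"
  shows "0 \<le> (\<integral>\<omega>. Z \<omega> * dsurv l a s n k \<omega> \<partial>P x) \<and> (\<integral>\<omega>. Z \<omega> * dsurv l a s n k \<omega> \<partial>P x) \<le> K * exp (l * a)"
proof
  show "0 \<le> (\<integral>\<omega>. Z \<omega> * dsurv l a s n k \<omega> \<partial>P x)"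
    using Z(2) dsurv_bounds[OF l] by (intro Bochner_Integration.integral_nonneg mult_nonneg_nonneg) auto
  have "(\<integral>\<omega>. Z \<omega> * dsurv l a s n k \<omega> \<partial>P x) \<le> (\<integral>\<omega>. K * exp (l * a) \<partial>P x)"
  proof (rule integral_mono)
    show "integrable (P x) (\<lambda>\<omega>. Z \<omega> * dsurv l a s n k \<omega>)"
      by (rule integrable_bounded_mult[OF Z dsurv_measurable[OF s] dsurv_bounds[OF l]])
    show "Z \<omega> * dsurv l a s n k \<omega> \<le> K * exp (l * a)" for \<omega>
      using Z(2)[of \<omega>] dsurv_bounds[OF l, of a s n k \<omega>] by (intro mult_mono) auto
  qed simp
  then show "(\<integral>\<omega>. Z \<omega> * dsurv l a s n k \<omega> \<partial>P x) \<le> K * exp (l * a)" by (simp add: P.prob_space[simplified])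
qed

text \<open>The overshoot of the skeleton over \<open>a\<close> is unbounded; its second moment is controlled by the
  skeleton identity with \<open>2 * l\<close> in place of \<open>l\<close>.\<close>

lemma expectation_dpass_tendsto:
  assumes s: "0 \<le> s" and l: "0 \<le> l" and Z: "Z \<in> borel_measurable (F (ennreal s))" "\<And>\<omega>. 0 \<le> Z \<omega> \<and> Z \<omega> \<le> K"
  shows "(\<lambda>n. \<Sum>k<T * 2 ^ n. \<integral>\<omega>. Z \<omega> * dpass l a s n k \<omega> \<partial>P x) \<longlonglongrightarrow>
    (\<integral>\<omega>. Z \<omega> * (exp (l * a) * (indicator {\<omega>. X s \<omega> \<le> a} \<omega> * indicator (passes_by a s (real T)) \<omega>)) \<partial>P x)"
proof -
  have ZP [measurable]: "Z \<in> borel_measurable (P x)" using Z measurable_F_imp_P s by blast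
  note [measurable] = dpass_measurable[OF s] passes_by_measurable[OF s] X_measurable[OF s]
  have l2: "0 \<le> 2 * l" using l by simp
  define f where "f n \<omega> = Z \<omega> * (\<Sum>k<T * 2 ^ n. dpass l a s n k \<omega>)" for n \<omega>
  \<comment> \<open>From the skeleton identity at exponent 2l: the initial term is at most K
    exp(2la), and the drift term is bounded by \<open>exp_minus_1_scaled_bound\<close> times T K
    exp(2la), uniformly in the mesh.\<close>
  define C where "C = K * exp (2 * l * a) + \<bar>\<psi> (2 * l) - p\<bar> * exp \<bar>\<psi> (2 * l) - p\<bar> * (real T * (K * exp (2 * l * a)))"
  have K0: "0 \<le> K" using Z(2)[of undefined] by linarith
  have int1: "integrable (P x) (f n)" for n
    unfolding f_def sum_distrib_left by (intro Bochner_Integration.integrable_sum skeleton_step(2)[OF s l Z])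
  have int2: "integrable (P x) (\<lambda>\<omega>. Z \<omega> * (\<Sum>k<T * 2 ^ n. dpass (2 * l) a s n k \<omega>))" for n
    unfolding sum_distrib_left by (intro Bochner_Integration.integrable_sum skeleton_step(2)[OF s l2 Z])
  have sq: "(f n \<omega>)\<^sup>2 = Z \<omega> * (Z \<omega> * (\<Sum>k<T * 2 ^ n. dpass (2 * l) a s n k \<omega>))" for n \<omega>
    unfolding f_def power_mult_distrib sum_dpass_power2 by (simp add: power2_eq_square)
  have sqle: "(f n \<omega>)\<^sup>2 \<le> K * (Z \<omega> * (\<Sum>k<T * 2 ^ n. dpass (2 * l) a s n k \<omega>))" for n \<omega>
    unfolding sq using Z(2)[of \<omega>] by (intro mult_right_mono mult_nonneg_nonneg sum_nonneg dpass_nonneg) auto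
  have fm [measurable]: "f n \<in> borel_measurable (P x)" for n unfolding f_def by measurable
  have int3: "integrable (P x) (\<lambda>\<omega>. (f n \<omega>)\<^sup>2)" for n
    by (rule Bochner_Integration.integrable_bound[OF integrable_mult_right[OF int2[of n], of K]])
       (use sqle order_trans[OF sqle abs_ge_self] in auto)
  have second: "(\<integral>\<omega>. (f n \<omega>)\<^sup>2 \<partial>P x) \<le> K * C" for n
  proof -
    have "(\<integral>\<omega>. (f n \<omega>)\<^sup>2 \<partial>P x) \<le> (\<integral>\<omega>. K * (Z \<omega> * (\<Sum>k<T * 2 ^ n. dpass (2 * l) a s n k \<omega>)) \<partial>P x)"
      by (intro integral_mono int3 integrable_mult_right int2 sqle)
    also have "\<dots> = K * (\<integral>\<omega>. Z \<omega> * (\<Sum>k<T * 2 ^ n. dpass (2 * l) a s n k \<omega>) \<partial>P x)"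
      by (rule integral_mult_right_zero)
    also have "(\<integral>\<omega>. Z \<omega> * (\<Sum>k<T * 2 ^ n. dpass (2 * l) a s n k \<omega>) \<partial>P x) =
        (\<Sum>k<T * 2 ^ n. \<integral>\<omega>. Z \<omega> * dpass (2 * l) a s n k \<omega> \<partial>P x)"
      unfolding sum_distrib_left by (rule Bochner_Integration.integral_sum) (rule skeleton_step(2)[OF s l2 Z])
    also have "(\<Sum>k<T * 2 ^ n. \<integral>\<omega>. Z \<omega> * dpass (2 * l) a s n k \<omega> \<partial>P x) \<le> C"
    proof -
      let ?b = "\<lambda>k. \<integral>\<omega>. Z \<omega> * dsurv (2 * l) a s n k \<omega> \<partial>P x"
      let ?r = "exp ((\<psi> (2 * l) - p) / 2 ^ n) - 1"
      have b: "0 \<le> ?b k \<and> ?b k \<le> K * exp (2 * l * a)" for k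
        by (rule expectation_dsurv_le[OF s l2 ZP Z(2)])
      have "(\<Sum>k<T * 2 ^ n. ?b k) \<le> real (card {..<T * 2 ^ n}) * (K * exp (2 * l * a))"
        by (rule sum_bounded_above) (use b in auto)
      then have S: "(\<Sum>k<T * 2 ^ n. ?b k) \<le> real T * 2 ^ n * (K * exp (2 * l * a))" by simp
      have "?r * (\<Sum>k<T * 2 ^ n. ?b k) \<le> \<bar>?r\<bar> * (real T * 2 ^ n * (K * exp (2 * l * a)))"
        using S b by (intro mult_mono) (auto intro!: sum_nonneg)
      also have "\<dots> = (\<bar>?r\<bar> * 2 ^ n) * (real T * (K * exp (2 * l * a)))" by simp
      also have "\<dots> \<le> (\<bar>\<psi> (2 * l) - p\<bar> * exp \<bar>\<psi> (2 * l) - p\<bar>) * (real T * (K * exp (2 * l * a)))"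
        using K0 by (intro mult_right_mono exp_minus_1_scaled_bound) auto
      finally have "?r * (\<Sum>k<T * 2 ^ n. ?b k) \<le> (\<bar>\<psi> (2 * l) - p\<bar> * exp \<bar>\<psi> (2 * l) - p\<bar>) * (real T * (K * exp (2 * l * a)))" .
      then show ?thesis
        using skeleton_identity[OF s l2 Z, where m="T * 2 ^ n" and x=x and a=a and n=n] b[of 0] b[of "T * 2 ^ n"]
        unfolding C_def by linarith
    qed
    finally show ?thesis using K0 by (simp add: mult_left_mono)
  qed
  have "(\<lambda>n. \<integral>\<omega>. f n \<omega> \<partial>P x) \<longlonglongrightarrow>
    (\<integral>\<omega>. Z \<omega> * (exp (l * a) * (indicator {\<omega>. X s \<omega> \<le> a} \<omega> * indicator (passes_by a s (real T)) \<omega>)) \<partial>P x)"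
  proof (rule P.tendsto_integral_L2_bounded[where K="K * C" and C="K * exp (l * a)"])
    show "AE \<omega> in P x. (\<lambda>n. f n \<omega>) \<longlonglongrightarrow> Z \<omega> * (exp (l * a) * (indicator {\<omega>. X s \<omega> \<le> a} \<omega> * indicator (passes_by a s (real T)) \<omega>))"
      using no_pos_jumps[of x] AE_space
      by eventually_elim (auto simp: f_def intro!: tendsto_mult tendsto_const dpass_sum_tendsto[OF _ _ s])
    show "0 \<le> f n \<omega>" for n \<omega> unfolding f_def using Z(2)[of \<omega>] by (intro mult_nonneg_nonneg sum_nonneg dpass_nonneg) auto
    show "AE \<omega> in P x. Z \<omega> * (exp (l * a) * (indicator {\<omega>. X s \<omega> \<le> a} \<omega> * indicator (passes_by a s (real T)) \<omega>)) \<le> K * exp (l * a)"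
      using Z(2) K0 by (intro always_eventually allI mult_mono) (auto simp: indicator_def)
    show "(\<lambda>\<omega>. Z \<omega> * (exp (l * a) * (indicator {\<omega>. X s \<omega> \<le> a} \<omega> * indicator (passes_by a s (real T)) \<omega>))) \<in> borel_measurable (P x)"
      by measurable
  qed (use int1 int3 second Z(2) in \<open>auto simp: indicator_def\<close>)
  moreover have "(\<integral>\<omega>. f n \<omega> \<partial>P x) = (\<Sum>k<T * 2 ^ n. \<integral>\<omega>. Z \<omega> * dpass l a s n k \<omega> \<partial>P x)" for n
    unfolding f_def sum_distrib_left by (rule Bochner_Integration.integral_sum) (rule skeleton_step(2)[OF s l Z])
  ultimately show ?thesis by simp
qed

text \<open>The limit of \<open>skeleton_identity\<close>: the step factor minus 1, multiplied by
  2^n, tends to \<psi>(l) - p, while the sums divided by 2^n tend to the time integral. The result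
  is optional stopping at passage above a, on the horizon T.\<close>

lemma stopped_identity_horizon:
  assumes s: "0 \<le> s" and l: "0 \<le> l" and Z: "Z \<in> borel_measurable (F (ennreal s))" "\<And>\<omega>. 0 \<le> Z \<omega> \<and> Z \<omega> \<le> K"
  shows "(\<integral>\<omega>. Z \<omega> * (exp (l * a) * (indicator {\<omega>. X s \<omega> \<le> a} \<omega> * indicator (passes_by a s (real T)) \<omega>)) \<partial>P x)
     + (\<integral>\<omega>. Z \<omega> * surv l a s (s + real T) \<omega> \<partial>P x)
    = (\<integral>\<omega>. Z \<omega> * surv l a s s \<omega> \<partial>P x)
     + (\<psi> l - p) * (\<integral>\<omega>. Z \<omega> * (LINT u:{s..<s + real T}|lborel. surv l a s u \<omega>) \<partial>P x)"
proof -
  have ZP [measurable]: "Z \<in> borel_measurable (P x)" using Z measurable_F_imp_P s by blast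
  have K0: "0 \<le> K" using Z(2)[of undefined] by linarith
  note [measurable] = dsurv_measurable[OF s]
  have L1: "(\<lambda>n. \<integral>\<omega>. Z \<omega> * dsurv l a s n (T * 2 ^ n) \<omega> \<partial>P x) \<longlonglongrightarrow> (\<integral>\<omega>. Z \<omega> * surv l a s (s + real T) \<omega> \<partial>P x)"
  proof (rule integral_dominated_convergence[where w="\<lambda>_. K * exp (l * a)"])
    show "(\<lambda>\<omega>. Z \<omega> * surv l a s (s + real T) \<omega>) \<in> borel_measurable (P x)"
      using s by (intro borel_measurable_times ZP surv_measurable) auto
    show "AE \<omega> in P x. (\<lambda>n. Z \<omega> * dsurv l a s n (T * 2 ^ n) \<omega>) \<longlonglongrightarrow> Z \<omega> * surv l a s (s + real T) \<omega>"
      using AE_space by eventually_elim (auto intro!: tendsto_mult tendsto_const dsurv_end_tendsto[OF _ s])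
    show "AE \<omega> in P x. norm (Z \<omega> * dsurv l a s n (T * 2 ^ n) \<omega>) \<le> K * exp (l * a)" for n
      using Z(2) K0 dsurv_bounds[OF l] by (auto simp: abs_mult intro!: always_eventually mult_mono)
  qed auto
  let ?S = "\<lambda>n \<omega>. (\<Sum>k<T * 2 ^ n. dsurv l a s n k \<omega>) / 2 ^ n"
  have L2: "(\<lambda>n. \<integral>\<omega>. Z \<omega> * ?S n \<omega> \<partial>P x) \<longlonglongrightarrow> (\<integral>\<omega>. Z \<omega> * (LINT u:{s..<s + real T}|lborel. surv l a s u \<omega>) \<partial>P x)"
  proof (rule integral_dominated_convergence[where w="\<lambda>_. K * (exp (l * a) * real T)"])
    show "(\<lambda>\<omega>. Z \<omega> * (LINT u:{s..<s + real T}|lborel. surv l a s u \<omega>)) \<in> borel_measurable (P x)"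
      by (intro borel_measurable_times ZP set_lebesgue_integral_surv_measurable[OF s l])
    show "AE \<omega> in P x. (\<lambda>n. Z \<omega> * ?S n \<omega>) \<longlonglongrightarrow> Z \<omega> * (LINT u:{s..<s + real T}|lborel. surv l a s u \<omega>)"
      using AE_space by eventually_elim (intro tendsto_mult tendsto_const dsurv_sum_tendsto[OF _ s l], simp)
    show "AE \<omega> in P x. norm (Z \<omega> * ?S n \<omega>) \<le> K * (exp (l * a) * real T)" for n
    proof (intro always_eventually allI)
      fix \<omega>
      have S0: "0 \<le> (\<Sum>k<T * 2 ^ n. dsurv l a s n k \<omega>)" using dsurv_bounds[OF l] by (intro sum_nonneg) auto
      have "(\<Sum>k<T * 2 ^ n. dsurv l a s n k \<omega>) \<le> real (card {..<T * 2 ^ n}) * exp (l * a)"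
        by (rule sum_bounded_above) (use dsurv_bounds[OF l] in auto)
      then have "?S n \<omega> \<le> exp (l * a) * real T" by (simp add: divide_le_eq mult.commute mult.left_commute)
      then show "norm (Z \<omega> * ?S n \<omega>) \<le> K * (exp (l * a) * real T)"
        unfolding real_norm_def abs_mult using Z(2)[of \<omega>] K0 S0 by (intro mult_mono) auto
    qed
  qed auto
  have eqS: "(\<Sum>k<T * 2 ^ n. \<integral>\<omega>. Z \<omega> * dsurv l a s n k \<omega> \<partial>P x) = 2 ^ n * (\<integral>\<omega>. Z \<omega> * ?S n \<omega> \<partial>P x)" for n
  proof -
    have "(\<Sum>k<T * 2 ^ n. \<integral>\<omega>. Z \<omega> * dsurv l a s n k \<omega> \<partial>P x) = (\<integral>\<omega>. (\<Sum>k<T * 2 ^ n. Z \<omega> * dsurv l a s n k \<omega>) \<partial>P x)"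
      by (rule Bochner_Integration.integral_sum[symmetric]) (rule skeleton_step(1)[OF s l Z])
    also have "\<dots> = (\<integral>\<omega>. 2 ^ n * (Z \<omega> * ?S n \<omega>) \<partial>P x)"
      by (intro Bochner_Integration.integral_cong refl) (simp add: sum_distrib_left[symmetric])
    also have "\<dots> = 2 ^ n * (\<integral>\<omega>. Z \<omega> * ?S n \<omega> \<partial>P x)" by (rule integral_mult_right_zero)
    finally show ?thesis .
  qed
  have start: "dsurv l a s n 0 \<omega> = surv l a s s \<omega>" for n \<omega>
    by (simp add: dsurv_def surv_def dstays_def stays_def)
  have id: "(\<Sum>k<T * 2 ^ n. \<integral>\<omega>. Z \<omega> * dpass l a s n k \<omega> \<partial>P x) + (\<integral>\<omega>. Z \<omega> * dsurv l a s n (T * 2 ^ n) \<omega> \<partial>P x) =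
    (\<integral>\<omega>. Z \<omega> * surv l a s s \<omega> \<partial>P x) + ((exp ((\<psi> l - p) / 2 ^ n) - 1) * 2 ^ n) * (\<integral>\<omega>. Z \<omega> * ?S n \<omega> \<partial>P x)" for n
    using skeleton_identity[OF s l Z, where m="T * 2 ^ n" and x=x and a=a and n=n]
    unfolding eqS start mult.assoc .
  have "(\<lambda>n. (\<Sum>k<T * 2 ^ n. \<integral>\<omega>. Z \<omega> * dpass l a s n k \<omega> \<partial>P x) + (\<integral>\<omega>. Z \<omega> * dsurv l a s n (T * 2 ^ n) \<omega> \<partial>P x))
    \<longlonglongrightarrow> (\<integral>\<omega>. Z \<omega> * (exp (l * a) * (indicator {\<omega>. X s \<omega> \<le> a} \<omega> * indicator (passes_by a s (real T)) \<omega>)) \<partial>P x)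
     + (\<integral>\<omega>. Z \<omega> * surv l a s (s + real T) \<omega> \<partial>P x)"
    by (intro tendsto_add expectation_dpass_tendsto[OF s l Z] L1)
  moreover have "(\<lambda>n. (\<integral>\<omega>. Z \<omega> * surv l a s s \<omega> \<partial>P x) + ((exp ((\<psi> l - p) / 2 ^ n) - 1) * 2 ^ n) * (\<integral>\<omega>. Z \<omega> * ?S n \<omega> \<partial>P x))
    \<longlonglongrightarrow> (\<integral>\<omega>. Z \<omega> * surv l a s s \<omega> \<partial>P x)
     + (\<psi> l - p) * (\<integral>\<omega>. Z \<omega> * (LINT u:{s..<s + real T}|lborel. surv l a s u \<omega>) \<partial>P x)"
    by (intro tendsto_add tendsto_mult tendsto_const exp_minus_1_scaled_tendsto L2)
  ultimately show ?thesis unfolding id by (rule LIMSEQ_unique)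
qed

end

section \<open>Passage identities for transient processes\<close>

text \<open>By \<open>upward_uniform_cadlag\<close> the path climbs at most 1 over any time shorter
  than d, and finitely many such times cover [0,T].\<close>

lemma cadlag_bdd_above:
  assumes w: "cadlag w" "no_positive_jumps w" and T: "0 < T"
  obtains B where "\<And>t. 0 \<le> t \<Longrightarrow> t \<le> T \<Longrightarrow> w t \<le> B"
proof -
  obtain d where d: "0 < d" "\<And>u v. 0 \<le> u \<Longrightarrow> u \<le> v \<Longrightarrow> v \<le> T \<Longrightarrow> v - u < d \<Longrightarrow> w v - w u \<le> 1"
    using upward_uniform_cadlag[OF w T zero_less_one] by blast
  have step: "w t \<le> w 0 + real (Suc n)" if "0 \<le> t" "t \<le> T" "t < real (Suc n) * d" for t n
    using that
  proof (induction n arbitrary: t)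
    case 0
    then show ?case using d(2)[of 0 t] by simp
  next
    case (Suc n)
    show ?case
    proof (cases "t < real (Suc n) * d")
      case True
      with Suc show ?thesis by fastforce
    next
      case False
      \<comment> \<open>Cutting [0,t] into n + 2 equal pieces keeps the last piece shorter than d
        and puts v in the range of the induction hypothesis.\<close>
      define v where "v = t - t / real (Suc (Suc n))"
      have N: "0 < real (Suc (Suc n))" by simp
      have q: "t / real (Suc (Suc n)) < d" "0 \<le> t / real (Suc (Suc n))"
        using Suc.prems by (auto simp: divide_less_eq mult.commute)
      have "v = t * (real (Suc n) / real (Suc (Suc n)))" by (simp add: v_def field_simps)
      also have "\<dots> < real (Suc n) * d"
      proof -
        have "t / real (Suc (Suc n)) * real (Suc n) < d * real (Suc n)" using q(1) by (intro mult_strict_right_mono) auto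
        then show ?thesis by (simp add: field_simps)
      qed
      finally have v: "v < real (Suc n) * d" .
      have "v \<le> t" using q by (simp add: v_def)
      have "0 \<le> v" using Suc.prems by (simp add: v_def field_simps)
      have "w t - w v \<le> 1" using d(2)[OF \<open>0 \<le> v\<close> \<open>v \<le> t\<close> Suc.prems(2)] q by (simp add: v_def)
      moreover have "w v \<le> w 0 + real (Suc n)" using Suc.IH[OF \<open>0 \<le> v\<close> _ v] \<open>v \<le> t\<close> Suc.prems by simp
      ultimately show ?thesis by simp
    qed
  qed
  obtain n where "T < real n * d" using reals_Archimedean3[OF d(1)] by blast
  then have n: "T < real (Suc n) * d" using d(1) by (simp add: distrib_right)
  show ?thesis by (rule that[of "w 0 + real (Suc n)"], rule step) (use n in auto)
qed

section \<open>Consequences of drift to minus infinity or killing\<close>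

locale transient_killed_levy = killed_spectrally_negative_levy +
  assumes drift: "p = 0 \<Longrightarrow> AE \<omega> in P x. filterlim (\<lambda>t. X t \<omega>) at_bot at_top"
begin

lemma AE_not_alive: assumes p: "0 < p" shows "AE \<omega> in P x. \<exists>n::nat. \<omega> \<notin> alive (real n)"
proof -
  have "measure (P x) {\<omega>\<in>\<Omega>. \<forall>n::nat. \<omega> \<in> alive (real n)} \<le> exp (- p * real n)" for n :: nat
  proof -
    have "measure (P x) {\<omega>\<in>\<Omega>. \<forall>n::nat. \<omega> \<in> alive (real n)} \<le> measure (P x) {\<omega>\<in>\<Omega>. \<omega> \<in> alive (real n)}"
      by (rule P.finite_measure_mono) auto
    also have "\<dots> = exp (- p * real n)" using prob_alive[of "real n" x] by (simp add: measure_def)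
    finally show ?thesis .
  qed
  moreover have "(\<lambda>n. exp (- p * real n)) \<longlonglongrightarrow> 0"
  proof -
    have "(\<lambda>n. exp (- p) ^ n) \<longlonglongrightarrow> 0" using p by (intro LIMSEQ_realpow_zero) auto
    then show ?thesis by (simp add: exp_of_nat_mult[symmetric] mult.commute)
  qed
  ultimately have "measure (P x) {\<omega>\<in>\<Omega>. \<forall>n::nat. \<omega> \<in> alive (real n)} \<le> 0"
    by (intro LIMSEQ_le_const[where X="\<lambda>n. exp (- p * real n)"]) auto
  then have "measure (P x) {\<omega>\<in>\<Omega>. \<forall>n::nat. \<omega> \<in> alive (real n)} = 0"
    using measure_nonneg antisym by blast
  moreover have "{\<omega>\<in>\<Omega>. \<forall>n::nat. \<omega> \<in> alive (real n)} \<in> sets (P x)"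
  proof (rule pred_P)
    have [measurable]: "Measurable.pred (P x) (\<lambda>\<omega>. \<omega> \<in> alive (real n))" for n :: nat by simp
    show "Measurable.pred (P x) (\<lambda>\<omega>. \<forall>n::nat. \<omega> \<in> alive (real n))" by measurable
  qed
  ultimately show ?thesis by (intro AE_I[where N="{\<omega>\<in>\<Omega>. \<forall>n::nat. \<omega> \<in> alive (real n)}"]) (auto simp: P.emeasure_eq_measure)
qed

text \<open>For p = 0 the drift sends exp(l X) to 0, which is where l > 0 enters; for p > 0 the path
  is eventually dead.\<close>

lemma surv_vanishes:
  assumes l: "0 < l" shows "AE \<omega> in P x. (\<lambda>T. surv l a s (s + real T) \<omega>) \<longlonglongrightarrow> 0"
proof (cases "p = 0")
  case True
  show ?thesis using drift[OF True, of x]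
  proof eventually_elim
    case (elim \<omega>)
    have "filterlim (\<lambda>T. s + real T) at_top sequentially"
      by (intro filterlim_tendsto_add_at_top[OF tendsto_const] filterlim_real_sequentially)
    from filterlim_compose[OF elim this] have "filterlim (\<lambda>T. X (s + real T) \<omega>) at_bot sequentially" .
    then have "filterlim (\<lambda>T. l * X (s + real T) \<omega>) at_bot sequentially"
      using filterlim_tendsto_pos_mult_at_bot[OF tendsto_const l] by blast
    then have *: "(\<lambda>T. exp (l * X (s + real T) \<omega>)) \<longlonglongrightarrow> 0"
      by (rule filterlim_compose[OF exp_at_bot])
    show ?case
      by (rule tendsto_sandwich[OF _ _ tendsto_const *]) (auto simp: surv_def indicator_def)
  qed
next
  case False
  then have "0 < p" using rate_nonneg by simp
  from AE_not_alive[OF this, of x] show ?thesis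
  proof eventually_elim
    case (elim \<omega>)
    then obtain n :: nat where n: "\<omega> \<notin> alive (real n)" by blast
    obtain m :: nat where m: "real n - s \<le> real m" using real_arch_simple by blast
    show ?case
    proof (rule tendsto_eventually, rule eventually_sequentiallyI[of m])
      fix T assume "m \<le> T"
      then have "real n \<le> s + real T" using m by linarith
      then have "\<omega> \<notin> alive (s + real T)" using alive_antimono n by blast
      then show "surv l a s (s + real T) \<omega> = 0" by (simp add: surv_def)
    qed
  qed
qed

lemma expectation_surv_vanishes:
  assumes s: "0 \<le> s" and l: "0 < l" and Z: "Z \<in> borel_measurable (P x)" "\<And>\<omega>. 0 \<le> Z \<omega> \<and> Z \<omega> \<le> K"
  shows "(\<lambda>T. \<integral>\<omega>. Z \<omega> * surv l a s (s + real T) \<omega> \<partial>P x) \<longlonglongrightarrow> 0"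
proof -
  have K0: "0 \<le> K" using Z(2)[of undefined] by linarith
  have "(\<lambda>T. \<integral>\<omega>. Z \<omega> * surv l a s (s + real T) \<omega> \<partial>P x) \<longlonglongrightarrow> (\<integral>\<omega>. 0 \<partial>P x)"
  proof (rule integral_dominated_convergence[where w="\<lambda>_. K * exp (l * a)"])
    show "(\<lambda>\<omega>. Z \<omega> * surv l a s (s + real T) \<omega>) \<in> borel_measurable (P x)" for T
      using s by (intro borel_measurable_times Z surv_measurable) auto
    show "AE \<omega> in P x. (\<lambda>T. Z \<omega> * surv l a s (s + real T) \<omega>) \<longlonglongrightarrow> 0"
      using surv_vanishes[OF l, of a s x] by eventually_elim (auto intro: tendsto_mult_right_zero)
    show "AE \<omega> in P x. norm (Z \<omega> * surv l a s (s + real T) \<omega>) \<le> K * exp (l * a)" for T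
      using Z(2) K0 surv_bounds[of l s "s + real T" a] l
      by (auto simp: abs_mult intro!: always_eventually mult_mono)
  qed auto
  then show ?thesis by simp
qed

lemma passes_by_tendsto: "(\<lambda>T. indicator (passes_by a s (real T)) \<omega> :: real) \<longlonglongrightarrow> indicator (passes a s) \<omega>"
proof (rule tendsto_eventually, cases "\<omega> \<in> passes a s")
  case True
  then obtain u where u: "s \<le> u" "\<omega> \<in> alive u" "a < X u \<omega>" by (auto simp: passes_def)
  obtain m :: nat where m: "u - s \<le> real m" using real_arch_simple by blast
  show "\<forall>\<^sub>F T in sequentially. indicator (passes_by a s (real T)) \<omega> = (indicator (passes a s) \<omega> :: real)"
  proof (rule eventually_sequentiallyI[of m])
    fix T assume "m \<le> T"
    then have "\<omega> \<in> passes_by a s (real T)" using u m unfolding passes_by_def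
      by (intro CollectI exI[of _ u]) auto
    then show "indicator (passes_by a s (real T)) \<omega> = (indicator (passes a s) \<omega> :: real)" using True by simp
  qed
next
  case False
  then have "\<omega> \<notin> passes_by a s (real T)" for T by (auto simp: passes_by_def passes_def)
  then show "\<forall>\<^sub>F T in sequentially. indicator (passes_by a s (real T)) \<omega> = (indicator (passes a s) \<omega> :: real)"
    using False by simp
qed

lemma expectation_passes_by_tendsto:
  fixes c :: real
  assumes s: "0 \<le> s" and Z: "Z \<in> borel_measurable (P x)" "\<And>\<omega>. 0 \<le> Z \<omega> \<and> Z \<omega> \<le> K"
  shows "(\<lambda>T. \<integral>\<omega>. Z \<omega> * (c * (indicator {\<omega>. X s \<omega> \<le> a} \<omega> * indicator (passes_by a s (real T)) \<omega>)) \<partial>P x)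
     \<longlonglongrightarrow> (\<integral>\<omega>. Z \<omega> * (c * (indicator {\<omega>. X s \<omega> \<le> a} \<omega> * indicator (passes a s) \<omega>)) \<partial>P x)"
proof (rule integral_dominated_convergence[where w="\<lambda>_. K * \<bar>c\<bar>"])
  have K0: "0 \<le> K" using Z(2)[of undefined] by linarith
  note [measurable] = Z(1) passes_by_measurable[OF s] passes_measurable[OF s] X_measurable[OF s]
  show "(\<lambda>\<omega>. Z \<omega> * (c * (indicator {\<omega>. X s \<omega> \<le> a} \<omega> * indicator (passes a s) \<omega>))) \<in> borel_measurable (P x)"
    by measurable
  show "(\<lambda>\<omega>. Z \<omega> * (c * (indicator {\<omega>. X s \<omega> \<le> a} \<omega> * indicator (passes_by a s (real T)) \<omega>))) \<in> borel_measurable (P x)" for T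
    by measurable
  show "AE \<omega> in P x. (\<lambda>T. Z \<omega> * (c * (indicator {\<omega>. X s \<omega> \<le> a} \<omega> * indicator (passes_by a s (real T)) \<omega>)))
     \<longlonglongrightarrow> Z \<omega> * (c * (indicator {\<omega>. X s \<omega> \<le> a} \<omega> * indicator (passes a s) \<omega>))"
    by (intro always_eventually allI tendsto_mult tendsto_const passes_by_tendsto)
  show "AE \<omega> in P x. norm (Z \<omega> * (c * (indicator {\<omega>. X s \<omega> \<le> a} \<omega> * indicator (passes_by a s (real T)) \<omega>))) \<le> K * \<bar>c\<bar>" for T
    using Z(2) K0 by (auto simp: abs_mult indicator_def intro!: always_eventually mult_mono)
qed auto

text \<open>For p = 0 and \<Phi> = 0 the drift term of the stopped identity is nonnegative for each
  l > 0, so the passage probability of a is at least exp(-l a). Letting l tend to 0, every positive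
  level is passed almost surely, which is impossible for a path that is bounded above on compacts
  and drifts to minus infinity.\<close>

lemma Phi_pos: "0 < \<Phi>"
proof (cases "0 < p")
  case True then show ?thesis by (rule Phi_pos_if)
next
  case False
  with rate_nonneg have p0: "p = 0" by simp
  show ?thesis
  proof (rule ccontr)
    assume "\<not> 0 < \<Phi>"
    then have Phi0: "\<Phi> = 0" using Phi_nonneg by simp
    have Z: "(\<lambda>_. 1) \<in> borel_measurable (F (ennreal 0))" "(\<lambda>_. 1) \<in> borel_measurable (P 0)"
       "\<And>\<omega>::'a. 0 \<le> (1::real) \<and> (1::real) \<le> 1" by auto
    have pass: "AE \<omega> in P 0. \<omega> \<in> passes a 0" if a: "0 < a" for a
    proof -
      let ?q = "measure (P 0) {\<omega>\<in>\<Omega>. \<omega> \<in> passes a 0}"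
      have "1 \<le> exp (l * a) * ?q" if l: "0 < l" for l
      proof -
        have c: "0 \<le> \<psi> l - p" using psi_above_Phi[of l] l Phi0 by simp
        have l0: "0 \<le> l" using l by simp
        have "(\<integral>\<omega>. 1 * surv l a 0 0 \<omega> \<partial>P 0) = (\<integral>\<omega>. 1 \<partial>P 0)"
          using alive_0[of 0] start a
          by (intro integral_cong_AE) (auto simp: surv_def stays_def intro!: surv_measurable[of 0 0 l a 0, unfolded surv_def[abs_def]])
        then have start1: "(\<integral>\<omega>. 1 * surv l a 0 0 \<omega> \<partial>P 0) = 1" by (simp add: P.prob_space[simplified])
        have ge: "1 \<le> (\<integral>\<omega>. 1 * (exp (l * a) * (indicator {\<omega>. X 0 \<omega> \<le> a} \<omega> * indicator (passes_by a 0 (real T)) \<omega>)) \<partial>P 0)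
            + (\<integral>\<omega>. 1 * surv l a 0 (0 + real T) \<omega> \<partial>P 0)" for T
        proof -
          have "0 \<le> (\<integral>\<omega>. 1 * (LINT u:{0..<0 + real T}|lborel. surv l a 0 u \<omega>) \<partial>P 0)"
            by (intro Bochner_Integration.integral_nonneg_AE) (use AE_space set_lebesgue_integral_surv_bounds(1)[OF _ order_refl l0] in auto)
          with c have "0 \<le> (\<psi> l - p) * (\<integral>\<omega>. 1 * (LINT u:{0..<0 + real T}|lborel. surv l a 0 u \<omega>) \<partial>P 0)"
            by (rule mult_nonneg_nonneg)
          then show ?thesis using stopped_identity_horizon[OF order_refl l0 Z(1,3), where a=a and T=T and x=0] start1 by linarith
        qed
        have "1 \<le> (\<integral>\<omega>. 1 * (exp (l * a) * (indicator {\<omega>. X 0 \<omega> \<le> a} \<omega> * indicator (passes a 0) \<omega>)) \<partial>P 0) + 0"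
          by (rule LIMSEQ_le_const[OF tendsto_add[OF expectation_passes_by_tendsto[OF order_refl Z(2,3)] expectation_surv_vanishes[OF order_refl l Z(2,3)]]])
             (use ge in blast)
        also have "(\<integral>\<omega>. 1 * (exp (l * a) * (indicator {\<omega>. X 0 \<omega> \<le> a} \<omega> * indicator (passes a 0) \<omega>)) \<partial>P 0)
           \<le> (\<integral>\<omega>. exp (l * a) * indicator {\<omega>\<in>\<Omega>. \<omega> \<in> passes a 0} \<omega> \<partial>P 0)"
        proof (rule integral_mono_AE')
          show "integrable (P 0) (\<lambda>\<omega>. exp (l * a) * indicator {\<omega>\<in>\<Omega>. \<omega> \<in> passes a 0} \<omega>)"
            by (intro integrable_mult_right integrable_real_indicator pred_P passes_measurable) (auto simp: P.emeasure_finite less_top[symmetric])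
        qed (use AE_space in \<open>auto simp: indicator_def\<close>)
        also have "\<dots> = exp (l * a) * ?q"
          by (simp add: Int_absorb2 sets.sets_into_space)
        finally show ?thesis by simp
      qed
      from this[of "1 / 2 ^ n" for n] have "1 \<le> exp (a / 2 ^ n) * ?q" for n by simp
      moreover have "(\<lambda>n. exp (a / 2 ^ n) * ?q) \<longlonglongrightarrow> exp 0 * ?q"
        by (intro tendsto_mult tendsto_exp LIMSEQ_half_pow tendsto_const)
      ultimately have "1 \<le> exp 0 * ?q" using LIMSEQ_le_const by blast
      then have "?q = 1" using P.prob_le_1[of 0 "{\<omega>\<in>\<Omega>. \<omega> \<in> passes a 0}"] by simp
      from P.AE_prob_1[OF this] show ?thesis by eventually_elim simp
    qed
    have "AE \<omega> in P 0. \<forall>n::nat. \<omega> \<in> passes (real (Suc n)) 0"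
      unfolding AE_all_countable using pass by simp
    then have "AE \<omega> in P 0. False"
      using drift[OF p0, of 0] no_pos_jumps[of 0] AE_space
    proof eventually_elim
      case (elim \<omega>)
      have "\<forall>\<^sub>F t in at_top. X t \<omega> \<le> 0" using elim(2) by (auto simp: filterlim_at_bot)
      then obtain T where T: "\<And>t. T \<le> t \<Longrightarrow> X t \<omega> \<le> 0" by (auto simp: eventually_at_top_linorder)
      obtain B where B: "\<And>t. 0 \<le> t \<Longrightarrow> t \<le> max T 1 \<Longrightarrow> X t \<omega> \<le> B"
        using cadlag_bdd_above[OF cadlag_paths[OF elim(4)[unfolded space_P]] elim(3), of "max T 1"]
        by (metis less_max_iff_disj zero_less_one)
      obtain n :: nat where n: "B \<le> real n" using real_arch_simple by blast
      obtain u where u: "0 \<le> u" "real (Suc n) < X u \<omega>" using elim(1) by (force simp: passes_def)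
      show False
      proof (cases "T \<le> u")
        case True with T[of u] u show False by simp
      next
        case False
        then have "u \<le> max T 1" by linarith
        with B[of u] u n show False by simp
      qed
    qed
    then show False by (simp add: P.AE_False)
  qed
qed

end

text \<open>No absolute continuity is needed: the two sides differ on \<open>[s,t]\<close> by at most
  \<open>B\<^sup>2 (t - s)\<^sup>2\<close>, which telescopes to \<open>0\<close> along refining partitions.\<close>

lemma one_minus_exp_neg_integral:
  fixes f :: "real \<Rightarrow> real"
  assumes [measurable]: "f \<in> borel_measurable borel" and f: "\<And>u. 0 \<le> f u" "\<And>u. f u \<le> B"
  defines "J \<equiv> \<lambda>v. LINT u:{0..v}|lborel. f u"
  assumes v: "0 \<le> v"
  shows "1 - exp (- J v) = (LINT u:{0..v}|lborel. f u * exp (- J u))"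
    and "\<And>s t. 0 \<le> s \<Longrightarrow> s \<le> t \<Longrightarrow> J s \<le> J t \<and> J t \<le> J s + B * (t - s)"
    and "J \<in> borel_measurable borel"
proof -
  have B0: "0 \<le> B" using f order_trans by blast
  have int: "set_integrable lborel A (\<lambda>u. f u * g u)"
    if [measurable]: "A \<in> sets borel" "g \<in> borel_measurable borel" and "A \<subseteq> {a..b}" and g: "\<And>u. \<bar>g u\<bar> \<le> 1" for A g a b
    unfolding set_integrable_def
  proof (rule Bochner_Integration.integrable_bound[where f="\<lambda>u. B * indicator {a..b} u"])
    show "integrable lborel (\<lambda>u. B * indicat_real {a..b} u)"
      by (intro integrable_mult_right integrable_real_indicator) (auto simp: emeasure_lborel_Icc_eq)
    show "AE u in lborel. norm (indicat_real A u *\<^sub>R (f u * g u)) \<le> norm (B * indicat_real {a..b} u)"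
    proof (intro always_eventually allI)
      fix u
      have "\<bar>f u\<bar> * \<bar>g u\<bar> \<le> B * 1" using f[of u] g[of u] B0 by (intro mult_mono) auto
      then show "norm (indicat_real A u *\<^sub>R (f u * g u)) \<le> norm (B * indicat_real {a..b} u)"
        using \<open>A \<subseteq> {a..b}\<close> B0 by (auto simp: indicator_def abs_mult)
    qed
  qed measurable
  have len: "(LINT u:{s<..t}|lborel. c) = c * (t - s)" if "s \<le> t" for s t c :: real
    using that by (simp add: set_lebesgue_integral_def measure_lborel_Ioc)
  have icst: "set_integrable lborel {s<..t} (\<lambda>u. c)" for s t c :: real
    unfolding set_integrable_def by (cases "s \<le> t") (auto intro!: integrable_real_indicator simp: emeasure_lborel_Ioc)
  have split: "(LINT u:{0..t}|lborel. f u * g u) = (LINT u:{0..s}|lborel. f u * g u) + (LINT u:{s<..t}|lborel. f u * g u)"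
    if [measurable]: "g \<in> borel_measurable borel" and st: "0 \<le> s" "s \<le> t" and g: "\<And>u. \<bar>g u\<bar> \<le> 1" for g s t
  proof -
    have "{0..t} = {0..s} \<union> {s<..t}" using st by auto
    moreover have "(LINT u:{0..s} \<union> {s<..t}|lborel. f u * g u) = (LINT u:{0..s}|lborel. f u * g u) + (LINT u:{s<..t}|lborel. f u * g u)"
    proof (rule set_integral_Un)
      show "set_integrable lborel {0..s} (\<lambda>u. f u * g u)" by (rule int[of _ _ 0 s]) (use g in auto)
      show "set_integrable lborel {s<..t} (\<lambda>u. f u * g u)" by (rule int[of _ _ s t]) (use g in auto)
    qed auto
    ultimately show ?thesis by simp
  qed
  have int1: "set_integrable lborel {s<..t} f" for s t
  proof -
    have "{s<..t} \<subseteq> {s..t}" by auto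
    then show ?thesis using int[of "{s<..t}" "\<lambda>_. 1" s t] by simp
  qed
  have Jdiff: "J t - J s = (LINT u:{s<..t}|lborel. f u)" if "0 \<le> s" "s \<le> t" for s t
    using split[of "\<lambda>_. 1" s t] that by (simp add: J_def)
  have Jb: "J s \<le> J t \<and> J t \<le> J s + B * (t - s)" if "0 \<le> s" "s \<le> t" for s t
  proof -
    have "0 \<le> (LINT u:{s<..t}|lborel. f u)"
      unfolding set_lebesgue_integral_def using f by (intro Bochner_Integration.integral_nonneg) auto
    moreover have "(LINT u:{s<..t}|lborel. f u) \<le> (LINT u:{s<..t}|lborel. B)"
      by (intro set_integral_mono int1 icst f)
    ultimately show ?thesis using Jdiff[OF that] len[OF that(2), of B] by linarith
  qed
  then show "\<And>s t. 0 \<le> s \<Longrightarrow> s \<le> t \<Longrightarrow> J s \<le> J t \<and> J t \<le> J s + B * (t - s)" .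
  have J0: "J v = 0" if "v \<le> 0" for v
  proof (cases "v = 0")
    case True
    have "(LINT u:{0..0}|lborel. f u) = (LINT u:{0::real}|lborel. f u)" by simp
    also have "\<dots> = 0" unfolding set_lebesgue_integral_def
      by (rule integral_eq_zero_AE) (use AE_lborel_singleton[of 0] in \<open>auto elim!: eventually_mono\<close>)
    finally show ?thesis using True by (simp add: J_def)
  qed (use that in \<open>simp add: J_def set_lebesgue_integral_def\<close>)
  have "mono J"
  proof (rule monoI)
    fix s t :: real assume "s \<le> t"
    then show "J s \<le> J t" using Jb[of s t] Jb[of 0 t] J0[of s] J0[of 0] J0[of t] by (cases "0 \<le> s"; cases "0 \<le> t") auto
  qed
  then show Jm [measurable]: "J \<in> borel_measurable borel" by (rule borel_measurable_mono)
  have Jnn: "0 \<le> J u" for u using Jb[of 0 u] J0[of u] J0[of 0] by (cases "0 \<le> u") auto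
  define D where "D v = exp (- J v) + (LINT u:{0..v}|lborel. f u * exp (- J u))" for v
  have Dd: "\<bar>D t - D s\<bar> \<le> (B * (t - s))\<^sup>2" if st: "0 \<le> s" "s \<le> t" for s t
  proof -
    let ?x = "J t - J s"
    have x: "0 \<le> ?x" "?x \<le> B * (t - s)" using Jb[OF st] by auto
    have bd: "\<bar>exp (- J u)\<bar> \<le> 1" for u using Jnn by simp
    have I: "set_integrable lborel {s<..t} (\<lambda>u. f u * exp (- J u))"
      by (rule int[of _ _ s t]) (use bd in auto)
    let ?H = "LINT u:{s<..t}|lborel. f u * exp (- J u)"
    have H: "D t - D s = ?H - (exp (- J s) - exp (- J t))"
      using split[of "\<lambda>u. exp (- J u)", OF _ st bd] by (simp add: D_def)
    have up: "?H \<le> exp (- J s) * ?x"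
    proof -
      have "?H \<le> (LINT u:{s<..t}|lborel. exp (- J s) * f u)"
        by (intro set_integral_mono I set_integrable_mult_right int1)
           (use Jb st f in \<open>auto simp: mult.commute[of "f _"] intro!: mult_right_mono\<close>)
      then show ?thesis using Jdiff[OF st] by simp
    qed
    have lo: "exp (- J t) * ?x \<le> ?H"
    proof -
      have "(LINT u:{s<..t}|lborel. exp (- J t) * f u) \<le> ?H"
        by (intro set_integral_mono I set_integrable_mult_right int1)
           (use Jb st f in \<open>auto simp: mult.commute[of "f _"] intro!: mult_right_mono\<close>)
      then show ?thesis using Jdiff[OF st] by simp
    qed
    have e: "exp (- J s) = exp (- J t) * exp ?x" "exp (- J t) = exp (- J s) * exp (- ?x)"
      by (simp_all add: exp_add[symmetric])
    have lo2: "exp (- J t) * ?x \<le> exp (- J s) - exp (- J t)"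
    proof -
      have "exp (- J t) * (1 + ?x) \<le> exp (- J t) * exp ?x" by (intro mult_left_mono) auto
      then show ?thesis using e(1) by (simp add: algebra_simps)
    qed
    have up2: "exp (- J s) - exp (- J t) \<le> exp (- J s) * ?x"
    proof -
      have "exp (- J s) * (1 + - ?x) \<le> exp (- J s) * exp (- ?x)" by (intro mult_left_mono) auto
      then show ?thesis using e(2) by (simp add: algebra_simps)
    qed
    \<comment> \<open>Both the integral and the difference of exponentials lie between exp(-J t) x
      and exp(-J s) x, where x is the increment of J, so they differ by at most the distance of
      these two bounds.\<close>
    have "\<bar>D t - D s\<bar> \<le> exp (- J s) * ?x - exp (- J t) * ?x" unfolding H using up lo lo2 up2 by linarith
    also have "\<dots> = (exp (- J s) - exp (- J t)) * ?x" by (simp add: algebra_simps)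
    also have "\<dots> \<le> (exp (- J s) * ?x) * ?x" using up2 x by (intro mult_right_mono) auto
    also have "\<dots> \<le> (1 * ?x) * ?x" using Jnn[of s] x by (intro mult_right_mono) auto
    also have "\<dots> \<le> (B * (t - s))\<^sup>2" unfolding power2_eq_square using x by (auto intro!: mult_mono)
    finally show ?thesis .
  qed
  have tele: "\<bar>D v - D 0\<bar> \<le> (B * v)\<^sup>2 / 2 ^ n" for n
  proof -
    define \<delta> where "\<delta> = v / 2 ^ n"
    have \<delta>: "0 \<le> \<delta>" using v by (simp add: \<delta>_def)
    have "\<bar>D (real k * \<delta>) - D 0\<bar> \<le> real k * (B * \<delta>)\<^sup>2" for k
    proof (induction k)
      case (Suc k)
      have "real k * \<delta> \<le> real (Suc k) * \<delta>" using \<delta> by (intro mult_right_mono) auto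
      from Dd[OF _ this] \<delta> have "\<bar>D (real (Suc k) * \<delta>) - D (real k * \<delta>)\<bar> \<le> (B * \<delta>)\<^sup>2"
        by (simp add: algebra_simps)
      then show ?case using Suc by (simp add: algebra_simps)
    qed simp
    from this[of "2 ^ n"] show ?thesis by (simp add: \<delta>_def power2_eq_square)
  qed
  have "\<bar>D v - D 0\<bar> \<le> 0"
    by (rule LIMSEQ_le_const[OF LIMSEQ_half_pow[of "(B * v)\<^sup>2"]]) (use tele in blast)
  moreover have "D 0 = 1"
  proof -
    have "(LINT u:{0..0}|lborel. f u * exp (- J u)) = 0" unfolding set_lebesgue_integral_def
      by (rule integral_eq_zero_AE) (use AE_lborel_singleton[of 0] in \<open>auto elim!: eventually_mono\<close>)
    then show ?thesis using J0[of 0] by (simp add: D_def)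
  qed
  ultimately show "1 - exp (- J v) = (LINT u:{0..v}|lborel. f u * exp (- J u))" by (simp add: D_def)
qed

section \<open>Passage identities on the infinite horizon\<close>

context transient_killed_levy begin

lemma surv_nonneg: "0 \<le> surv l a s u \<omega>"
  by (simp add: surv_def)

lemma surv_joint_measurable:
  assumes "0 \<le> s"
  shows "(\<lambda>z. surv l a s (max 0 (fst z)) (snd z)) \<in> borel_measurable (lborel \<Otimes>\<^sub>M P x)"
  using progressive_measurable_P[OF progressive_surv[OF assms, of l a], of x]
  by (subst measurable_cong_sets[OF sets_pair_measure_cong[OF sets_lborel refl] refl])

text \<open>The horizon T goes to infinity in the stopped identity, and the surviving term vanishes
  because l > 0. With \<open>p \<le> \<psi> l\<close> all terms are nonnegative, so the potential is
  a monotone limit and its finiteness is no prior concern.\<close>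

lemma K_identity:
  assumes s: "0 \<le> s" and l: "0 < l" "p \<le> \<psi> l" and Z: "Z \<in> borel_measurable (F (ennreal s))" "\<And>\<omega>. 0 \<le> Z \<omega> \<and> Z \<omega> \<le> K"
  shows "ennreal (exp (l * a)) * (\<integral>\<^sup>+\<omega>. ennreal (Z \<omega>) * indicator ({\<omega>. X s \<omega> \<le> a} \<inter> passes a s) \<omega> \<partial>P x) =
    (\<integral>\<^sup>+\<omega>. ennreal (Z \<omega> * surv l a s s \<omega>) \<partial>P x) + ennreal (\<psi> l - p) *
    (\<integral>\<^sup>+u. (\<integral>\<^sup>+\<omega>. ennreal (Z \<omega> * surv l a s u \<omega>) \<partial>P x) * indicator {s..} u \<partial>lborel)"
proof -
  interpret PS: pair_sigma_finite lborel "P x" ..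
  have l0: "0 \<le> l" using l by simp
  have ZP [measurable]: "Z \<in> borel_measurable (P x)" using Z measurable_F_imp_P s by blast
  have K0: "0 \<le> K" using Z(2)[of undefined] by linarith
  note [measurable] = surv_joint_measurable[OF s] passes_measurable[OF s] passes_by_measurable[OF s] X_measurable[OF s]
  \<comment> \<open>The clamp \<open>max 0 u\<close> gives a kernel measurable on the whole line;
    the indicators later restrict to u \<ge> s \<ge> 0, where the clamp is the identity.\<close>
  define e where "e u = (\<integral>\<^sup>+\<omega>. ennreal (Z \<omega> * surv l a s (max 0 u) \<omega>) \<partial>P x)" for u
  have [measurable]: "e \<in> borel_measurable lborel" unfolding e_def
    by (rule P.borel_measurable_nn_integral) (simp add: split_beta')
  let ?c = "\<lambda>T. \<integral>\<omega>. Z \<omega> * (LINT u:{s..<s + real T}|lborel. surv l a s u \<omega>) \<partial>P x"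
  let ?N = "\<lambda>T. \<integral>\<^sup>+u. e u * indicator {s..<s + real T} u \<partial>lborel"
  let ?A = "\<lambda>T. \<integral>\<omega>. Z \<omega> * (exp (l * a) * (indicator {\<omega>. X s \<omega> \<le> a} \<omega> * indicator (passes_by a s (real T)) \<omega>)) \<partial>P x"
  let ?V = "\<lambda>T. \<integral>\<omega>. Z \<omega> * surv l a s (s + real T) \<omega> \<partial>P x"
  let ?Ai = "\<integral>\<omega>. Z \<omega> * (exp (l * a) * (indicator {\<omega>. X s \<omega> \<le> a} \<omega> * indicator (passes a s) \<omega>)) \<partial>P x"
  let ?b = "\<integral>\<omega>. Z \<omega> * surv l a s s \<omega> \<partial>P x"
  have c_eq: "ennreal (?c T) = ?N T" for T
  proof -
    let ?L = "\<lambda>\<omega>. LINT u:{s..<s + real T}|lborel. surv l a s u \<omega>"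
    have "ennreal (?c T) = (\<integral>\<^sup>+\<omega>. ennreal (Z \<omega> * ?L \<omega>) \<partial>P x)"
    proof (rule nn_integral_eq_integral[symmetric])
      show "integrable (P x) (\<lambda>\<omega>. Z \<omega> * ?L \<omega>)"
      proof (rule P.integrable_const_bound[where B="K * (exp (l * a) * real T)"])
        show "AE \<omega> in P x. norm (Z \<omega> * ?L \<omega>) \<le> K * (exp (l * a) * real T)"
          using AE_space
        proof eventually_elim
          case (elim \<omega>)
          then show ?case using set_lebesgue_integral_surv_bounds[OF _ s l0, of \<omega> T a] Z(2)[of \<omega>] K0
            by (auto simp: abs_mult intro!: mult_mono)
        qed
      qed (intro borel_measurable_times ZP set_lebesgue_integral_surv_measurable[OF s l0])
      show "AE \<omega> in P x. 0 \<le> Z \<omega> * ?L \<omega>"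
        using AE_space by eventually_elim (use set_lebesgue_integral_surv_bounds[OF _ s l0] Z(2) in auto)
    qed
    also have "\<dots> = (\<integral>\<^sup>+\<omega>. \<integral>\<^sup>+u. ennreal (Z \<omega> * surv l a s (max 0 u) \<omega>) * indicator {s..<s + real T} u \<partial>lborel \<partial>P x)"
    proof (intro nn_integral_cong)
      fix \<omega> assume "\<omega> \<in> space (P x)"
      then have \<omega>: "\<omega> \<in> \<Omega>" by simp
      have m: "(\<lambda>u. indicator {s..<s + real T} u * surv l a s u \<omega>) \<in> borel_measurable borel"
      proof -
        have "(\<lambda>u. indicator {s..<s + real T} u * (indicator {s..} u * surv l a s u \<omega>)) \<in> borel_measurable borel"
          using surv_measurable_time[OF \<omega> s order_refl] by measurable
        also have "(\<lambda>u. indicator {s..<s + real T} u * (indicator {s..} u * surv l a s u \<omega>)) = (\<lambda>u. indicator {s..<s + real T} u * surv l a s u \<omega>)"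
          by (auto simp: fun_eq_iff indicator_def)
        finally show ?thesis .
      qed
      have i: "integrable lborel (\<lambda>u. indicator {s..<s + real T} u * surv l a s u \<omega>)"
      proof (rule Bochner_Integration.integrable_bound[where f="\<lambda>u. indicator {s..<s + real T} u * exp (l * a)"])
        show "integrable lborel (\<lambda>u. indicator {s..<s + real T} u * exp (l * a))"
          by (intro integrable_mult_left integrable_real_indicator) (auto simp: emeasure_lborel_Ico)
      qed (use m surv_bounds[OF l0, of s _ a \<omega>] in \<open>auto simp: indicator_def\<close>)
      have "?L \<omega> = (\<integral>u. indicator {s..<s + real T} u * surv l a s u \<omega> \<partial>lborel)"
        by (simp add: set_lebesgue_integral_def)
      then have "ennreal (Z \<omega> * ?L \<omega>) = ennreal (\<integral>u. Z \<omega> * (indicator {s..<s + real T} u * surv l a s u \<omega>) \<partial>lborel)" by simp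
      also have "\<dots> = (\<integral>\<^sup>+u. ennreal (Z \<omega> * (indicator {s..<s + real T} u * surv l a s u \<omega>)) \<partial>lborel)"
        by (rule nn_integral_eq_integral[symmetric]) (use i Z(2) surv_nonneg in auto)
      also have "\<dots> = (\<integral>\<^sup>+u. ennreal (Z \<omega> * surv l a s (max 0 u) \<omega>) * indicator {s..<s + real T} u \<partial>lborel)"
      proof (rule nn_integral_cong)
        fix u
        have "max 0 u = u" if "u \<in> {s..<s + real T}" using that s by simp
        then show "ennreal (Z \<omega> * (indicator {s..<s + real T} u * surv l a s u \<omega>)) =
          ennreal (Z \<omega> * surv l a s (max 0 u) \<omega>) * indicator {s..<s + real T} u"
          by (cases "u \<in> {s..<s + real T}") simp_all
      qed
      finally show "ennreal (Z \<omega> * ?L \<omega>) = (\<integral>\<^sup>+u. ennreal (Z \<omega> * surv l a s (max 0 u) \<omega>) * indicator {s..<s + real T} u \<partial>lborel)" .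
    qed
    also have "\<dots> = (\<integral>\<^sup>+u. \<integral>\<^sup>+\<omega>. ennreal (Z \<omega> * surv l a s (max 0 u) \<omega>) * indicator {s..<s + real T} u \<partial>P x \<partial>lborel)"
      by (rule PS.Fubini') (simp add: split_beta')
    also have "\<dots> = ?N T"
    proof (intro nn_integral_cong)
      fix u :: real
      have "surv l a s (max 0 u) \<in> borel_measurable (P x)" using s by (intro surv_measurable) auto
      then show "(\<integral>\<^sup>+\<omega>. ennreal (Z \<omega> * surv l a s (max 0 u) \<omega>) * indicator {s..<s + real T} u \<partial>P x) = e u * indicator {s..<s + real T} u"
        unfolding e_def by (intro nn_integral_multc) measurable
    qed
    finally show ?thesis .
  qed
  have "0 \<le> ?V T" "0 \<le> ?A T" for T
    using Z(2) surv_nonneg by (auto intro!: Bochner_Integration.integral_nonneg mult_nonneg_nonneg)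
  note nn = this
  have b0: "0 \<le> ?b" using Z(2) surv_nonneg by (auto intro!: Bochner_Integration.integral_nonneg mult_nonneg_nonneg)
  have c0: "0 \<le> ?c T" for T
    by (intro Bochner_Integration.integral_nonneg_AE)
       (use AE_space set_lebesgue_integral_surv_bounds(1)[OF _ s l0] Z(2) in \<open>auto elim!: eventually_mono intro!: mult_nonneg_nonneg\<close>)
  have id: "ennreal (?A T + ?V T) = ennreal ?b + ennreal (\<psi> l - p) * ?N T" for T
    unfolding stopped_identity_horizon[OF s l0 Z] c_eq[symmetric] using b0 c0 l
    by (simp add: ennreal_plus ennreal_mult)
  have A_lim: "(\<lambda>T. ennreal (?A T + ?V T)) \<longlonglongrightarrow> ennreal (?Ai + 0)"
    by (intro tendsto_ennrealI tendsto_add expectation_passes_by_tendsto[OF s ZP Z(2)] expectation_surv_vanishes[OF s l(1) ZP Z(2)])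
  have N_lim: "?N \<longlonglongrightarrow> (\<integral>\<^sup>+u. e u * indicator {s..} u \<partial>lborel)"
  proof (rule nn_integral_LIMSEQ)
    show "incseq (\<lambda>T u. e u * indicator {s..<s + real T} u)"
      by (auto simp: incseq_def le_fun_def indicator_def)
    fix u
    obtain m :: nat where m: "u - s < real m" using reals_Archimedean2 by blast
    show "(\<lambda>T. e u * indicator {s..<s + real T} u) \<longlonglongrightarrow> e u * indicator {s..} u"
      by (rule tendsto_eventually, rule eventually_sequentiallyI[of m]) (use m in \<open>auto simp: indicator_def\<close>)
  qed auto
  have R_lim: "(\<lambda>T. ennreal ?b + ennreal (\<psi> l - p) * ?N T) \<longlonglongrightarrow>
     ennreal ?b + ennreal (\<psi> l - p) * (\<integral>\<^sup>+u. e u * indicator {s..} u \<partial>lborel)"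
    by (intro tendsto_add tendsto_const ennreal_tendsto_cmult N_lim) simp
  from LIMSEQ_unique[OF A_lim[unfolded id] R_lim]
  have "ennreal ?Ai = ennreal ?b + ennreal (\<psi> l - p) * (\<integral>\<^sup>+u. e u * indicator {s..} u \<partial>lborel)"
    by (simp only: add_0_right)
  also have "(\<integral>\<^sup>+u. e u * indicator {s..} u \<partial>lborel) =
     (\<integral>\<^sup>+u. (\<integral>\<^sup>+\<omega>. ennreal (Z \<omega> * surv l a s u \<omega>) \<partial>P x) * indicator {s..} u \<partial>lborel)"
    by (intro nn_integral_cong) (use s in \<open>auto simp: e_def indicator_def max_def\<close>)
  also have "ennreal ?b = (\<integral>\<^sup>+\<omega>. ennreal (Z \<omega> * surv l a s s \<omega>) \<partial>P x)"
    by (rule nn_integral_eq_integral[symmetric], rule integrable_bounded_mult[OF ZP Z(2)])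
       (use surv_measurable[OF s s] surv_bounds[OF l0 order_refl] Z(2) surv_nonneg in auto)
  also have "ennreal ?Ai = (\<integral>\<^sup>+\<omega>. ennreal (Z \<omega> * (exp (l * a) * (indicator {\<omega>. X s \<omega> \<le> a} \<omega> * indicator (passes a s) \<omega>))) \<partial>P x)"
    by (rule nn_integral_eq_integral[symmetric], rule integrable_bounded_mult[OF ZP Z(2), where C="exp (l * a)"])
       (use Z(2) in \<open>auto simp: indicator_def\<close>)
  also have "\<dots> = (\<integral>\<^sup>+\<omega>. ennreal (exp (l * a)) * (ennreal (Z \<omega>) * indicator ({\<omega>. X s \<omega> \<le> a} \<inter> passes a s) \<omega>) \<partial>P x)"
    using Z(2) by (intro nn_integral_cong) (auto simp: indicator_def ennreal_mult mult.commute)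
  also have "\<dots> = ennreal (exp (l * a)) * (\<integral>\<^sup>+\<omega>. ennreal (Z \<omega>) * indicator ({\<omega>. X s \<omega> \<le> a} \<inter> passes a s) \<omega> \<partial>P x)"
    by (rule nn_integral_cmult) measurable
  finally show ?thesis .
qed

end

section \<open>The power series and the resolvent identity\<close>

context transient_killed_levy begin

lemma surv_add: "surv (l + m) a s u \<omega> = surv l a s u \<omega> * exp (m * X u \<omega>)"
  by (simp add: surv_def distrib_right exp_add)

end

locale transient_exp_functional = transient_killed_levy +
  fixes \<alpha> \<gamma> :: real
  assumes alpha_pos: "0 < \<alpha>" and gamma_nonneg: "0 \<le> \<gamma>"
begin

abbreviation coeff :: "nat \<Rightarrow> real" where "coeff \<equiv> series_coeff \<psi> p \<alpha>"

definition expo :: "nat \<Rightarrow> real" where "expo k = \<Phi> + real k * \<alpha>"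

lemma psi_expo: "p \<le> \<psi> (expo k)" "0 < k \<Longrightarrow> p < \<psi> (expo k)" "0 < expo k"
proof -
  show "0 < k \<Longrightarrow> p < \<psi> (expo k)" using psi_above_Phi[of "expo k"] alpha_pos by (simp add: expo_def)
  then show "p \<le> \<psi> (expo k)" using psi_Phi by (cases "k = 0") (auto simp: expo_def)
  show "0 < expo k" unfolding expo_def using Phi_pos alpha_pos by (simp add: add_pos_nonneg)
qed

lemma coeff_0: "coeff 0 = 1"
  by (simp add: series_coeff_def)

lemma coeff_pos: "0 < coeff k"
  unfolding series_coeff_def using psi_expo(2) by (auto simp: expo_def intro!: prod_pos)

lemma coeff_Suc: "coeff (Suc k) * (\<psi> (expo (Suc k)) - p) = coeff k"
proof -
  have "\<psi> (expo (Suc k)) - p \<noteq> 0" using psi_expo(2)[of "Suc k"] by simp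
  then show ?thesis by (simp add: series_coeff_def prod.nat_ivl_Suc' expo_def)
qed

text \<open>Consecutive terms have ratio z / (\<psi>(\<Phi> + (k+1)\<alpha>) - p), which tends to 0,
  so the series is entire.\<close>

lemma coeff_summable: "summable (\<lambda>k. coeff k * z ^ k)"
proof -
  have "filterlim (\<lambda>k. expo (Suc k)) at_top sequentially"
    unfolding expo_def
    by (intro filterlim_tendsto_add_at_top[OF tendsto_const] filterlim_at_top_mult_tendsto_pos[OF tendsto_const alpha_pos]
      filterlim_compose[OF filterlim_real_sequentially filterlim_Suc])
  from filterlim_compose[OF psi_at_top this]
  have "\<forall>\<^sub>F k in sequentially. 2 * \<bar>z\<bar> + p + 1 \<le> \<psi> (expo (Suc k))" by (simp add: filterlim_at_top)
  then obtain N where N: "\<And>k. N \<le> k \<Longrightarrow> 2 * \<bar>z\<bar> + p + 1 \<le> \<psi> (expo (Suc k))" by (auto simp: eventually_sequentially)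
  show ?thesis
  proof (rule summable_ratio_test[of "1 / 2" N])
    fix k assume "N \<le> k"
    from N[OF this] have c: "2 * \<bar>z\<bar> \<le> \<psi> (expo (Suc k)) - p" by simp
    have "2 * \<bar>z\<bar> * coeff (Suc k) \<le> (\<psi> (expo (Suc k)) - p) * coeff (Suc k)"
      using c coeff_pos[of "Suc k"] by (intro mult_right_mono) auto
    also have "\<dots> = coeff k" using coeff_Suc[of k] by (simp add: mult.commute)
    finally have "coeff (Suc k) * \<bar>z\<bar> \<le> 1 / 2 * coeff k" by (simp add: mult.commute mult.left_commute)
    then have "coeff (Suc k) * \<bar>z\<bar> * \<bar>z\<bar> ^ k \<le> 1 / 2 * coeff k * \<bar>z\<bar> ^ k" by (intro mult_right_mono) auto
    then show "norm (coeff (Suc k) * z ^ Suc k) \<le> 1 / 2 * norm (coeff k * z ^ k)"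
      using coeff_pos[of "Suc k"] coeff_pos[of k] by (simp add: abs_mult power_abs mult.assoc)
  qed simp
qed

definition rho :: "real \<Rightarrow> real" where "rho y = power_series \<psi> p \<alpha> (\<gamma> * exp (\<alpha> * y))"

lemma rho_sums: "(\<lambda>k. coeff k * \<gamma> ^ k * exp (real k * \<alpha> * y)) sums rho y"
proof -
  have "(\<lambda>k. coeff k * (\<gamma> * exp (\<alpha> * y)) ^ k) sums rho y"
    unfolding rho_def power_series_def using coeff_summable by (rule summable_sums)
  then show ?thesis by (simp add: power_mult_distrib exp_of_nat_mult[symmetric] mult.assoc)
qed

lemma rho_ge_1: "1 \<le> rho y"
proof -
  have "(\<Sum>k<1. coeff k * \<gamma> ^ k * exp (real k * \<alpha> * y)) \<le> rho y"
    unfolding sums_unique[OF rho_sums]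
    by (rule sum_le_suminf) (use rho_sums sums_summable coeff_pos gamma_nonneg in \<open>auto intro!: mult_nonneg_nonneg less_imp_le[OF coeff_pos]\<close>)
  then show ?thesis by (simp add: coeff_0)
qed

lemma isCont_rho: "isCont rho y"
proof -
  have "isCont (\<lambda>z. \<Sum>k. coeff k * z ^ k) (\<gamma> * exp (\<alpha> * y))"
    by (rule isCont_powser_converges_everywhere[OF coeff_summable])
  moreover have "isCont (\<lambda>y. \<gamma> * exp (\<alpha> * y)) y" by (intro continuous_intros)
  ultimately show ?thesis unfolding rho_def[abs_def] power_series_def[abs_def] by (rule isCont_o2[rotated])
qed

lemma rho_measurable [measurable]: "rho \<in> borel_measurable borel"
  by (rule borel_measurable_continuous_onI) (simp add: continuous_at_imp_continuous_on isCont_rho)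

lemma expectation_surv_measurable:
  assumes s: "0 \<le> s" and Z [measurable]: "Z \<in> borel_measurable (P x)"
  shows "(\<lambda>u. (\<integral>\<^sup>+\<omega>. ennreal (Z \<omega> * surv l a s u \<omega>) \<partial>P x) * indicator {s..} u) \<in> borel_measurable lborel"
proof -
  note [measurable] = surv_joint_measurable[OF s]
  have [measurable]: "(\<lambda>u. \<integral>\<^sup>+\<omega>. ennreal (Z \<omega> * surv l a s (max 0 u) \<omega>) \<partial>P x) \<in> borel_measurable lborel"
    by (rule P.borel_measurable_nn_integral) (simp add: split_beta')
  have "(\<lambda>u. (\<integral>\<^sup>+\<omega>. ennreal (Z \<omega> * surv l a s (max 0 u) \<omega>) \<partial>P x) * indicator {s..} u) \<in> borel_measurable lborel"
    by measurable
  also have "(\<lambda>u. (\<integral>\<^sup>+\<omega>. ennreal (Z \<omega> * surv l a s (max 0 u) \<omega>) \<partial>P x) * indicator {s..} u) =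
    (\<lambda>u. (\<integral>\<^sup>+\<omega>. ennreal (Z \<omega> * surv l a s u \<omega>) \<partial>P x) * indicator {s..} u)"
  proof
    fix u
    show "(\<integral>\<^sup>+\<omega>. ennreal (Z \<omega> * surv l a s (max 0 u) \<omega>) \<partial>P x) * indicator {s..} u =
      (\<integral>\<^sup>+\<omega>. ennreal (Z \<omega> * surv l a s u \<omega>) \<partial>P x) * indicator {s..} u"
      using s by (cases "s \<le> u") (simp_all add: max_absorb2)
  qed
  finally show ?thesis .
qed

lemma suminf_split_head_ennreal: "(\<Sum>k. f k) = f 0 + (\<Sum>k. f (Suc k))" for f :: "nat \<Rightarrow> ennreal"
proof -
  have "(\<lambda>k. f (Suc k)) sums (\<Sum>k. f (Suc k))" by (simp add: summable_sums)
  then have "f sums ((\<Sum>k. f (Suc k)) + f 0)" by (rule sums_Suc)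
  from sums_unique[OF this] show ?thesis by (simp add: add.commute)
qed

text \<open>Summing the identities for the exponents \<open>\<Phi> + k\<alpha>\<close> with the weights \<open>b\<^sub>k \<gamma>\<^sup>k\<close>; the recursion
  for \<open>b\<^sub>k\<close> shifts the index of the potential terms by one.\<close>

lemma resolvent_identity:
  assumes s: "0 \<le> s" and Z: "Z \<in> borel_measurable (F (ennreal s))" "\<And>\<omega>. 0 \<le> Z \<omega> \<and> Z \<omega> \<le> K"
  shows "ennreal (rho a) * (\<integral>\<^sup>+\<omega>. ennreal (Z \<omega> * surv \<Phi> a s s \<omega>) \<partial>P x) =
    (\<integral>\<^sup>+\<omega>. ennreal (Z \<omega> * (surv \<Phi> a s s \<omega> * rho (X s \<omega>))) \<partial>P x) +
    (\<integral>\<^sup>+u. (\<integral>\<^sup>+\<omega>. ennreal (Z \<omega> * (\<gamma> * exp (\<alpha> * X u \<omega>) * (surv \<Phi> a s u \<omega> * rho (X u \<omega>)))) \<partial>P x) * indicator {s..} u \<partial>lborel)"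
proof -
  have ZP [measurable]: "Z \<in> borel_measurable (P x)" using Z measurable_F_imp_P s by blast
  define w where "w k = coeff k * \<gamma> ^ k" for k
  define c where "c k = \<psi> (expo k) - p" for k
  have w0: "0 \<le> w k" for k using coeff_pos[of k] gamma_nonneg by (simp add: w_def)
  have c0: "0 \<le> c k" for k using psi_expo(1)[of k] by (simp add: c_def)
  have wc: "w (Suc k) * c (Suc k) = \<gamma> * w k" for k
    using coeff_Suc[of k] by (simp add: w_def c_def mult.assoc mult.left_commute mult.commute)
  have wc0: "w 0 * c 0 = 0" by (simp add: c_def expo_def psi_Phi)
  define A where "A = (\<integral>\<^sup>+\<omega>. ennreal (Z \<omega>) * indicator ({\<omega>. X s \<omega> \<le> a} \<inter> passes a s) \<omega> \<partial>P x)"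
  define S where "S k = (\<integral>\<^sup>+\<omega>. ennreal (Z \<omega> * surv (expo k) a s s \<omega>) \<partial>P x)" for k
  define E where "E k u = (\<integral>\<^sup>+\<omega>. ennreal (Z \<omega> * surv (expo k) a s u \<omega>) \<partial>P x)" for k u
  define N where "N k = (\<integral>\<^sup>+u. E k u * indicator {s..} u \<partial>lborel)" for k
  have Km: "ennreal (exp (expo k * a)) * A = S k + ennreal (c k) * N k" for k
    unfolding A_def S_def N_def E_def c_def by (rule K_identity[OF s psi_expo(3,1) Z])
  have surv_expo: "surv (expo k) a s u \<omega> = surv \<Phi> a s u \<omega> * exp (real k * \<alpha> * X u \<omega>)" for k u \<omega>
    by (simp add: expo_def surv_add)
  have rho_w: "(\<lambda>k. w k * exp (real k * \<alpha> * y)) sums rho y" for y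
    unfolding w_def using rho_sums .
  have [measurable]: "surv (expo k) a s s \<in> borel_measurable (P x)" for k using s by (intro surv_measurable) auto
  have "(\<lambda>k. exp (\<Phi> * a) * (w k * exp (real k * \<alpha> * a))) sums (exp (\<Phi> * a) * rho a)"
    by (rule sums_mult[OF rho_w])
  moreover have "exp (\<Phi> * a) * (w k * exp (real k * \<alpha> * a)) = w k * exp (expo k * a)" for k
    by (simp add: expo_def distrib_right exp_add)
  ultimately have "(\<lambda>k. w k * exp (expo k * a)) sums (exp (\<Phi> * a) * rho a)" by simp
  then have weights: "(\<Sum>k. ennreal (w k * exp (expo k * a))) = ennreal (exp (\<Phi> * a) * rho a)"
    by (rule suminf_ennreal_eq[rotated]) (use w0 in simp)
  \<comment> \<open>For k = 0 the potential term vanishes because \<psi>(\<Phi>) = p, so S 0 equals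
    exp(\<Phi> a) A. This expresses the passage weight A, common to all k, through S 0.\<close>
  have "ennreal (rho a) * S 0 = ennreal (rho a) * (ennreal (exp (\<Phi> * a)) * A)"
    using Km[of 0] by (simp add: c_def expo_def psi_Phi)
  also have "\<dots> = ennreal (exp (\<Phi> * a) * rho a) * A"
    using rho_ge_1[of a] by (simp add: ennreal_mult mult.commute mult.left_commute)
  also have "\<dots> = (\<Sum>k. ennreal (w k * exp (expo k * a)) * A)" unfolding weights[symmetric] by simp
  also have "\<dots> = (\<Sum>k. ennreal (w k) * S k + ennreal (w k * c k) * N k)"
    using w0 c0 by (intro suminf_cong) (simp add: ennreal_mult mult.assoc Km distrib_left)
  also have "\<dots> = (\<Sum>k. ennreal (w k) * S k) + (\<Sum>k. ennreal (w k * c k) * N k)"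
    by (rule suminf_add[symmetric]) auto
  also have "(\<Sum>k. ennreal (w k) * S k) = (\<integral>\<^sup>+\<omega>. (\<Sum>k. ennreal (w k) * ennreal (Z \<omega> * surv (expo k) a s s \<omega>)) \<partial>P x)"
    unfolding S_def by (subst nn_integral_suminf) (auto simp: nn_integral_cmult)
  also have "\<dots> = (\<integral>\<^sup>+\<omega>. ennreal (Z \<omega> * (surv \<Phi> a s s \<omega> * rho (X s \<omega>))) \<partial>P x)"
  proof (intro nn_integral_cong)
    fix \<omega>
    have "(\<lambda>k. Z \<omega> * (surv \<Phi> a s s \<omega> * (w k * exp (real k * \<alpha> * X s \<omega>)))) sums (Z \<omega> * (surv \<Phi> a s s \<omega> * rho (X s \<omega>)))"
      by (intro sums_mult rho_w)
    then have "(\<Sum>k. ennreal (Z \<omega> * (surv \<Phi> a s s \<omega> * (w k * exp (real k * \<alpha> * X s \<omega>))))) = ennreal (Z \<omega> * (surv \<Phi> a s s \<omega> * rho (X s \<omega>)))"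
      by (rule suminf_ennreal_eq[rotated]) (use Z(2) surv_nonneg w0 in auto)
    moreover have "ennreal (w k) * ennreal (Z \<omega> * surv (expo k) a s s \<omega>) =
        ennreal (Z \<omega> * (surv \<Phi> a s s \<omega> * (w k * exp (real k * \<alpha> * X s \<omega>))))" for k
      unfolding surv_expo using w0 Z(2) surv_nonneg
      by (subst ennreal_mult[symmetric]) (auto simp: mult.commute mult.left_commute)
    ultimately show "(\<Sum>k. ennreal (w k) * ennreal (Z \<omega> * surv (expo k) a s s \<omega>)) = ennreal (Z \<omega> * (surv \<Phi> a s s \<omega> * rho (X s \<omega>)))"
      by simp
  qed
  also have "(\<Sum>k. ennreal (w k * c k) * N k) = (\<Sum>k. ennreal (\<gamma> * w k) * N (Suc k))"
    by (subst suminf_split_head_ennreal) (simp add: wc wc0)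
  also have "\<dots> = (\<integral>\<^sup>+u. (\<Sum>k. ennreal (\<gamma> * w k) * (E (Suc k) u * indicator {s..} u)) \<partial>lborel)"
    unfolding N_def E_def using expectation_surv_measurable[OF s ZP]
    by (subst nn_integral_suminf) (auto simp: nn_integral_cmult)
  also have "\<dots> = (\<integral>\<^sup>+u. (\<integral>\<^sup>+\<omega>. ennreal (Z \<omega> * (\<gamma> * exp (\<alpha> * X u \<omega>) * (surv \<Phi> a s u \<omega> * rho (X u \<omega>)))) \<partial>P x) * indicator {s..} u \<partial>lborel)"
  proof (intro nn_integral_cong)
    fix u :: real
    show "(\<Sum>k. ennreal (\<gamma> * w k) * (E (Suc k) u * indicator {s..} u)) =
      (\<integral>\<^sup>+\<omega>. ennreal (Z \<omega> * (\<gamma> * exp (\<alpha> * X u \<omega>) * (surv \<Phi> a s u \<omega> * rho (X u \<omega>)))) \<partial>P x) * indicator {s..} u"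
    proof (cases "s \<le> u")
      case True
      then have [measurable]: "surv (expo k) a s u \<in> borel_measurable (P x)" for k using s by (intro surv_measurable) auto
      have "(\<Sum>k. ennreal (\<gamma> * w k) * E (Suc k) u) = (\<integral>\<^sup>+\<omega>. (\<Sum>k. ennreal (\<gamma> * w k) * ennreal (Z \<omega> * surv (expo (Suc k)) a s u \<omega>)) \<partial>P x)"
        unfolding E_def by (subst nn_integral_suminf) (auto simp: nn_integral_cmult)
      also have "\<dots> = (\<integral>\<^sup>+\<omega>. ennreal (Z \<omega> * (\<gamma> * exp (\<alpha> * X u \<omega>) * (surv \<Phi> a s u \<omega> * rho (X u \<omega>)))) \<partial>P x)"
      proof (intro nn_integral_cong)
        fix \<omega>
        have "(\<lambda>k. Z \<omega> * (\<gamma> * exp (\<alpha> * X u \<omega>) * (surv \<Phi> a s u \<omega> * (w k * exp (real k * \<alpha> * X u \<omega>))))) sums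
           (Z \<omega> * (\<gamma> * exp (\<alpha> * X u \<omega>) * (surv \<Phi> a s u \<omega> * rho (X u \<omega>))))"
          by (intro sums_mult rho_w)
        then have "(\<Sum>k. ennreal (Z \<omega> * (\<gamma> * exp (\<alpha> * X u \<omega>) * (surv \<Phi> a s u \<omega> * (w k * exp (real k * \<alpha> * X u \<omega>)))))) =
           ennreal (Z \<omega> * (\<gamma> * exp (\<alpha> * X u \<omega>) * (surv \<Phi> a s u \<omega> * rho (X u \<omega>))))"
          by (rule suminf_ennreal_eq[rotated]) (use Z(2) surv_nonneg w0 gamma_nonneg in auto)
        moreover have "ennreal (\<gamma> * w k) * ennreal (Z \<omega> * surv (expo (Suc k)) a s u \<omega>) =
           ennreal (Z \<omega> * (\<gamma> * exp (\<alpha> * X u \<omega>) * (surv \<Phi> a s u \<omega> * (w k * exp (real k * \<alpha> * X u \<omega>)))))" for k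
        proof -
          \<comment> \<open>The extra \<alpha> in the exponent with index k + 1 becomes the factor
            exp(\<alpha> X_u) of the clock rate.\<close>
          have "exp (real (Suc k) * \<alpha> * X u \<omega>) = exp (\<alpha> * X u \<omega>) * exp (real k * \<alpha> * X u \<omega>)"
            by (simp add: exp_add[symmetric] algebra_simps)
          then show ?thesis unfolding surv_expo using w0 Z(2) surv_nonneg gamma_nonneg
            by (subst ennreal_mult[symmetric]) (auto simp: mult.commute mult.left_commute)
        qed
        ultimately show "(\<Sum>k. ennreal (\<gamma> * w k) * ennreal (Z \<omega> * surv (expo (Suc k)) a s u \<omega>)) =
           ennreal (Z \<omega> * (\<gamma> * exp (\<alpha> * X u \<omega>) * (surv \<Phi> a s u \<omega> * rho (X u \<omega>))))" by simp
      qed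
      finally show ?thesis using True by simp
    qed simp
  qed
  finally show ?thesis unfolding S_def by (simp add: expo_def)
qed

end

section \<open>The exponential functional at first passage\<close>

context transient_exp_functional begin

text \<open>With exponent \<alpha> and start 0, \<open>surv\<close> is exp(\<alpha> X_u) cut off at
  passage above a and at killing. Hence \<open>cumul\<close> is \<gamma> times the exponential
  functional stopped at the earlier of the two.\<close>

definition intens :: "real \<Rightarrow> real \<Rightarrow> 'a \<Rightarrow> real" where
  "intens a u \<omega> = \<gamma> * surv \<alpha> a 0 u \<omega>"

definition cumul :: "real \<Rightarrow> real \<Rightarrow> 'a \<Rightarrow> real" where
  "cumul a v \<omega> = (LINT u:{0..v}|lborel. intens a (max 0 u) \<omega>)"

text \<open>The density in v of 1 - exp(-cumul), that is, of the ringing time of an additional clock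
  with rate \<open>intens\<close>. It is adapted and bounded, so it is admissible as the weight Z at
  time v.\<close>

definition tilt :: "real \<Rightarrow> real \<Rightarrow> 'a \<Rightarrow> real" where
  "tilt a v \<omega> = intens a v \<omega> * exp (- cumul a v \<omega>)"

lemma intens_bounds: "0 \<le> u \<Longrightarrow> 0 \<le> intens a u \<omega> \<and> intens a u \<omega> \<le> \<gamma> * exp (\<alpha> * a)"
  unfolding intens_def using surv_bounds[of \<alpha> 0 u a \<omega>] alpha_pos gamma_nonneg by (auto intro: mult_left_mono)

lemma progressive_intens: "progressive (intens a)"
  unfolding intens_def[abs_def] by (rule progressive_compose[OF progressive_surv[OF order_refl]]) measurable

lemma intens_measurable_time: "\<omega> \<in> \<Omega> \<Longrightarrow> (\<lambda>u. intens a (max 0 u) \<omega>) \<in> borel_measurable borel"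
proof -
  assume \<omega>: "\<omega> \<in> \<Omega>"
  have "(\<lambda>u. (u, \<omega>)) \<in> measurable borel (borel \<Otimes>\<^sub>M P 0)" using \<omega> by (intro measurable_Pair) auto
  from measurable_compose[OF this progressive_measurable_P[OF progressive_intens[of a], of 0]]
  show ?thesis by simp
qed

lemma cumul_nonneg: "0 \<le> cumul a v \<omega>"
  unfolding cumul_def set_lebesgue_integral_def using intens_bounds
  by (intro Bochner_Integration.integral_nonneg) auto

lemma cumul_facts:
  assumes \<omega>: "\<omega> \<in> \<Omega>"
  shows "0 \<le> v \<Longrightarrow> 1 - exp (- cumul a v \<omega>) = (LINT u:{0..v}|lborel. tilt a (max 0 u) \<omega>)"
    and "0 \<le> s \<Longrightarrow> s \<le> t \<Longrightarrow> cumul a s \<omega> \<le> cumul a t \<omega> \<and> cumul a t \<omega> \<le> cumul a s \<omega> + \<gamma> * exp (\<alpha> * a) * (t - s)"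
    and "(\<lambda>v. cumul a v \<omega>) \<in> borel_measurable borel"
proof -
  note * = one_minus_exp_neg_integral[OF intens_measurable_time[OF \<omega>, of a], where B="\<gamma> * exp (\<alpha> * a)"]
  have b: "0 \<le> intens a (max 0 u) \<omega>" "intens a (max 0 u) \<omega> \<le> \<gamma> * exp (\<alpha> * a)" for u
    using intens_bounds[of "max 0 u" a \<omega>] by auto
  show "(\<lambda>v. cumul a v \<omega>) \<in> borel_measurable borel"
    using *(3)[OF b order_refl] by (simp add: cumul_def)
  show "0 \<le> s \<Longrightarrow> s \<le> t \<Longrightarrow> cumul a s \<omega> \<le> cumul a t \<omega> \<and> cumul a t \<omega> \<le> cumul a s \<omega> + \<gamma> * exp (\<alpha> * a) * (t - s)"
    using *(2)[OF b order_refl] by (simp add: cumul_def)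
  assume v: "0 \<le> v"
  have "1 - exp (- cumul a v \<omega>) = (LINT u:{0..v}|lborel. intens a (max 0 u) \<omega> * exp (- cumul a u \<omega>))"
    using *(1)[OF b v] by (simp add: cumul_def)
  also have "\<dots> = (LINT u:{0..v}|lborel. tilt a (max 0 u) \<omega>)"
    by (rule set_lebesgue_integral_cong) (auto simp: tilt_def max_absorb2)
  finally show "1 - exp (- cumul a v \<omega>) = (LINT u:{0..v}|lborel. tilt a (max 0 u) \<omega>)" .
qed

text \<open>Up to time u the integrand is jointly measurable for F_u, so integration over time gives
  adaptedness; the Lipschitz bound in time gives right continuity.\<close>

lemma progressive_cumul: "progressive (cumul a)"
proof (rule progressive_right_continuous)
  fix u :: real assume u: "0 \<le> u"
  have m: "(\<lambda>z. intens a (min (max 0 (fst z)) u) (snd z)) \<in> borel_measurable (borel \<Otimes>\<^sub>M F (ennreal u))"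
    using progressive_intens u by (simp add: progressive_def)
  have "(\<lambda>z. (snd z, fst z)) \<in> measurable (F (ennreal u) \<Otimes>\<^sub>M lborel) (borel \<Otimes>\<^sub>M F (ennreal u))" by measurable
  from measurable_compose[OF this m]
  have [measurable]: "(\<lambda>z. intens a (min (max 0 (snd z)) u) (fst z)) \<in> borel_measurable (F (ennreal u) \<Otimes>\<^sub>M lborel)" by simp
  have "(\<lambda>\<omega>. \<integral>v. indicator {0..u} v *\<^sub>R intens a (min (max 0 v) u) \<omega> \<partial>lborel) \<in> borel_measurable (F (ennreal u))"
    by (rule lborel.borel_measurable_lebesgue_integral) (simp add: split_beta')
  also have "(\<lambda>\<omega>. \<integral>v. indicator {0..u} v *\<^sub>R intens a (min (max 0 v) u) \<omega> \<partial>lborel) = cumul a u"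
    unfolding cumul_def set_lebesgue_integral_def
    by (intro ext Bochner_Integration.integral_cong refl) (auto simp: indicator_def min_absorb1)
  finally show "cumul a u \<in> borel_measurable (F (ennreal u))" .
next
  fix \<omega> and u :: real assume \<omega>: "\<omega> \<in> \<Omega>" and u: "0 \<le> u"
  show "((\<lambda>u. cumul a u \<omega>) \<longlongrightarrow> cumul a u \<omega>) (at_right u)"
  proof (rule tendsto_sandwich[of "\<lambda>_. cumul a u \<omega>" _ _ "\<lambda>t. cumul a u \<omega> + \<gamma> * exp (\<alpha> * a) * (t - u)"])
    show "\<forall>\<^sub>F t in at_right u. cumul a u \<omega> \<le> cumul a t \<omega>"
      using eventually_at_right_less[of u] by eventually_elim (use cumul_facts(2)[OF \<omega> u] in auto)
    show "\<forall>\<^sub>F t in at_right u. cumul a t \<omega> \<le> cumul a u \<omega> + \<gamma> * exp (\<alpha> * a) * (t - u)"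
      using eventually_at_right_less[of u] by eventually_elim (use cumul_facts(2)[OF \<omega> u] in auto)
    have "((\<lambda>t. cumul a u \<omega> + \<gamma> * exp (\<alpha> * a) * (t - u)) \<longlongrightarrow> cumul a u \<omega> + \<gamma> * exp (\<alpha> * a) * (u - u)) (at_right u)"
      by (intro tendsto_intros)
    then show "((\<lambda>t. cumul a u \<omega> + \<gamma> * exp (\<alpha> * a) * (t - u)) \<longlongrightarrow> cumul a u \<omega>) (at_right u)" by simp
  qed simp
qed

lemma progressive_tilt: "progressive (tilt a)"
  unfolding tilt_def[abs_def]
  by (intro progressive_mult progressive_intens progressive_compose[OF progressive_cumul, of "\<lambda>y. exp (- y)"]) measurable

lemma tilt_bounds: "0 \<le> v \<Longrightarrow> 0 \<le> tilt a v \<omega> \<and> tilt a v \<omega> \<le> \<gamma> * exp (\<alpha> * a)"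
proof
  assume v: "0 \<le> v"
  show "0 \<le> tilt a v \<omega>" unfolding tilt_def using intens_bounds[OF v] by simp
  have "tilt a v \<omega> \<le> (\<gamma> * exp (\<alpha> * a)) * 1"
    unfolding tilt_def using intens_bounds[OF v, of a \<omega>] cumul_nonneg[of a v \<omega>] by (intro mult_mono) auto
  then show "tilt a v \<omega> \<le> \<gamma> * exp (\<alpha> * a)" by simp
qed

lemma tilt_adapted: "0 \<le> v \<Longrightarrow> tilt a v \<in> borel_measurable (F (ennreal v))"
  by (rule progressive_adapted[OF progressive_tilt])

lemma progressive_joint_measurable:
  assumes "progressive g"
  shows "(\<lambda>z. g (max 0 (fst z)) (snd z)) \<in> borel_measurable (lborel \<Otimes>\<^sub>M P x)"
  using progressive_measurable_P[OF assms, of x]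
  by (subst measurable_cong_sets[OF sets_pair_measure_cong[OF sets_lborel refl] refl])

lemma nn_integral_tilt:
  assumes \<omega>: "\<omega> \<in> \<Omega>" and v: "0 \<le> v"
  shows "(\<integral>\<^sup>+u. ennreal (tilt a (max 0 u) \<omega>) * indicator {0..v} u \<partial>lborel) = ennreal (1 - exp (- cumul a v \<omega>))"
proof -
  have [measurable]: "(\<lambda>u. tilt a (max 0 u) \<omega>) \<in> borel_measurable borel"
  proof -
    have "(\<lambda>u. (u, \<omega>)) \<in> measurable borel (borel \<Otimes>\<^sub>M P 0)" using \<omega> by (intro measurable_Pair) auto
    from measurable_compose[OF this progressive_measurable_P[OF progressive_tilt[of a], of 0]]
    show ?thesis by simp
  qed
  have tb: "0 \<le> tilt a (max 0 u) \<omega>" "tilt a (max 0 u) \<omega> \<le> \<gamma> * exp (\<alpha> * a)" for u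
    using tilt_bounds[of "max 0 u" a \<omega>] by auto
  have B0: "0 \<le> \<gamma> * exp (\<alpha> * a)" using gamma_nonneg by simp
  have i: "integrable lborel (\<lambda>u. indicator {0..v} u * tilt a (max 0 u) \<omega>)"
  proof (rule Bochner_Integration.integrable_bound[where f="\<lambda>u. indicator {0..v} u * (\<gamma> * exp (\<alpha> * a))"])
    show "integrable lborel (\<lambda>u. indicator {0..v} u * (\<gamma> * exp (\<alpha> * a)))"
      by (intro integrable_mult_left integrable_real_indicator) (auto simp: emeasure_lborel_Icc_eq)
    show "AE u in lborel. norm (indicator {0..v} u * tilt a (max 0 u) \<omega>) \<le> norm (indicator {0..v} u * (\<gamma> * exp (\<alpha> * a)))"
    proof (intro always_eventually allI)
      fix u
      show "norm (indicator {0..v} u * tilt a (max 0 u) \<omega>) \<le> norm (indicator {0..v} u * (\<gamma> * exp (\<alpha> * a)))"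
      proof (cases "u \<in> {0..v}")
        case True
        with tb[of u] B0 show ?thesis by (simp only: indicator_simps mult_1_left real_norm_def abs_of_nonneg)
      qed simp
    qed
  qed measurable
  have "ennreal (1 - exp (- cumul a v \<omega>)) = ennreal (\<integral>u. indicator {0..v} u * tilt a (max 0 u) \<omega> \<partial>lborel)"
    unfolding cumul_facts(1)[OF \<omega> v] by (simp add: set_lebesgue_integral_def)
  also have "\<dots> = (\<integral>\<^sup>+u. ennreal (indicator {0..v} u * tilt a (max 0 u) \<omega>) \<partial>lborel)"
    by (rule nn_integral_eq_integral[symmetric, OF i]) (use tb in auto)
  also have "\<dots> = (\<integral>\<^sup>+u. ennreal (tilt a (max 0 u) \<omega>) * indicator {0..v} u \<partial>lborel)"
    by (rule nn_integral_cong) (simp split: split_indicator)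
  finally show ?thesis by simp
qed

lemma tilt_stays: "tilt a v \<omega> \<noteq> 0 \<Longrightarrow> \<omega> \<in> stays a 0 v \<and> \<omega> \<in> alive v"
  by (auto simp: tilt_def intens_def surv_def indicator_def split: if_splits)

text \<open>Where the weight is nonzero the path has stayed at or below a on [0,v], so counting
  passage from v or from 0 gives the same event. An identity started at time v can therefore be read
  from time 0.\<close>

lemma tilt_surv:
  assumes "0 \<le> v" "v \<le> u" shows "tilt a v \<omega> * surv l a v u \<omega> = tilt a v \<omega> * surv l a 0 u \<omega>"
proof (cases "tilt a v \<omega> = 0")
  case False
  then have "\<omega> \<in> stays a 0 v" using tilt_stays by blast
  then have "\<omega> \<in> stays a v u \<longleftrightarrow> \<omega> \<in> stays a 0 u" using assms by (force simp: stays_def)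
  then show ?thesis by (simp add: surv_def indicator_def)
qed simp

definition expfun :: "real \<Rightarrow> 'a \<Rightarrow> ennreal" where
  "expfun a \<omega> = (\<integral>\<^sup>+u. ennreal (surv \<alpha> a 0 (max 0 u) \<omega>) * indicator {0..} u \<partial>lborel)"

lemma expfun_measurable [measurable]: "expfun a \<in> borel_measurable (P x)"
proof -
  have m: "(\<lambda>z. surv \<alpha> a 0 (max 0 (fst z)) (snd z)) \<in> borel_measurable (lborel \<Otimes>\<^sub>M P x)"
    by (rule surv_joint_measurable) simp
  have "(\<lambda>z. (snd z, fst z)) \<in> measurable (P x \<Otimes>\<^sub>M lborel) (lborel \<Otimes>\<^sub>M P x)" by measurable
  from measurable_compose[OF this m]
  have [measurable]: "(\<lambda>z. surv \<alpha> a 0 (max 0 (snd z)) (fst z)) \<in> borel_measurable (P x \<Otimes>\<^sub>M lborel)" by simp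
  show ?thesis unfolding expfun_def[abs_def]
    by (rule lborel.borel_measurable_nn_integral) (simp add: split_beta')
qed

lemma passes_not_stays:
  assumes "\<omega> \<in> passes b 0" "a \<le> b"
  obtains T where "0 < T" "\<And>u. T \<le> u \<Longrightarrow> \<omega> \<notin> stays a 0 u"
proof -
  obtain u where u: "0 \<le> u" "b < X u \<omega>" using assms by (auto simp: passes_def)
  have "\<omega> \<notin> stays a 0 t" if "u + 1 \<le> t" for t
  proof
    assume "\<omega> \<in> stays a 0 t"
    then have "X u \<omega> \<le> a" using u that by (auto simp: stays_def)
    with u assms show False by simp
  qed
  with that[of "u + 1"] u show ?thesis by simp
qed

text \<open>A path that passes b \<ge> a violates the staying condition from some time T on. All
  integrands vanish beyond T, and the identity for 1 - exp(-cumul) at T extends to the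
  half-line.\<close>

lemma nn_integral_tilt_passes:
  assumes \<omega>: "\<omega> \<in> \<Omega>" and p: "\<omega> \<in> passes b 0" "a \<le> b"
  shows "(\<integral>\<^sup>+u. ennreal (tilt a (max 0 u) \<omega>) * indicator {0..} u \<partial>lborel) + ennreal (exp (- \<gamma> * enn2real (expfun a \<omega>))) = 1"
    and "expfun a \<omega> < \<top>"
proof -
  obtain T where T: "0 < T" "\<And>u. T \<le> u \<Longrightarrow> \<omega> \<notin> stays a 0 u" using passes_not_stays[OF p] by blast
  have z: "surv l a 0 u \<omega> = 0" "tilt a u \<omega> = 0" if "T \<le> u" for u l
    using T(2)[OF that] by (auto simp: surv_def tilt_def intens_def)
  have t: "(\<integral>\<^sup>+u. ennreal (tilt a (max 0 u) \<omega>) * indicator {0..} u \<partial>lborel) =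
      (\<integral>\<^sup>+u. ennreal (tilt a (max 0 u) \<omega>) * indicator {0..T} u \<partial>lborel)"
    using z by (intro nn_integral_cong) (auto simp: indicator_def)
  have [measurable]: "(\<lambda>u. surv \<alpha> a 0 (max 0 u) \<omega>) \<in> borel_measurable borel"
  proof -
    have "(\<lambda>u. (u, \<omega>)) \<in> measurable borel (borel \<Otimes>\<^sub>M P 0)" using \<omega> by (intro measurable_Pair) auto
    from measurable_compose[OF this progressive_measurable_P[OF progressive_surv[OF order_refl, of \<alpha> a], of 0]]
    show ?thesis by simp
  qed
  have sb: "0 \<le> surv \<alpha> a 0 (max 0 u) \<omega>" "surv \<alpha> a 0 (max 0 u) \<omega> \<le> exp (\<alpha> * a)" for u
    using surv_bounds[of \<alpha> 0 "max 0 u" a \<omega>] alpha_pos by auto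
  have i: "integrable lborel (\<lambda>u. indicator {0..T} u * surv \<alpha> a 0 (max 0 u) \<omega>)"
  proof (rule Bochner_Integration.integrable_bound[where f="\<lambda>u. indicator {0..T} u * exp (\<alpha> * a)"])
    show "integrable lborel (\<lambda>u. indicator {0..T} u * exp (\<alpha> * a))"
      by (intro integrable_mult_left integrable_real_indicator) (auto simp: emeasure_lborel_Icc_eq)
    show "AE u in lborel. norm (indicator {0..T} u * surv \<alpha> a 0 (max 0 u) \<omega>) \<le> norm (indicator {0..T} u * exp (\<alpha> * a))"
    proof (intro always_eventually allI)
      fix u
      show "norm (indicator {0..T} u * surv \<alpha> a 0 (max 0 u) \<omega>) \<le> norm (indicator {0..T} u * exp (\<alpha> * a))"
        using sb[of u] by (cases "u \<in> {0..T}") simp_all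
    qed
  qed measurable
  have "expfun a \<omega> = (\<integral>\<^sup>+u. ennreal (indicator {0..T} u * surv \<alpha> a 0 (max 0 u) \<omega>) \<partial>lborel)"
    unfolding expfun_def using z by (intro nn_integral_cong) (auto simp: indicator_def)
  also have "\<dots> = ennreal (\<integral>u. indicator {0..T} u * surv \<alpha> a 0 (max 0 u) \<omega> \<partial>lborel)"
    by (rule nn_integral_eq_integral[OF i]) (use sb in auto)
  finally have e: "expfun a \<omega> = ennreal (\<integral>u. indicator {0..T} u * surv \<alpha> a 0 (max 0 u) \<omega> \<partial>lborel)" .
  then show "expfun a \<omega> < \<top>" by simp
  have "cumul a T \<omega> = \<gamma> * (\<integral>u. indicator {0..T} u * surv \<alpha> a 0 (max 0 u) \<omega> \<partial>lborel)"
    unfolding cumul_def set_lebesgue_integral_def intens_def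
    by (subst integral_mult_right_zero[symmetric]) (simp add: mult.left_commute)
  also have "(\<integral>u. indicator {0..T} u * surv \<alpha> a 0 (max 0 u) \<omega> \<partial>lborel) = enn2real (expfun a \<omega>)"
    unfolding e using sb by (intro enn2real_ennreal[symmetric] Bochner_Integration.integral_nonneg) auto
  finally have "cumul a T \<omega> = \<gamma> * enn2real (expfun a \<omega>)" .
  then show "(\<integral>\<^sup>+u. ennreal (tilt a (max 0 u) \<omega>) * indicator {0..} u \<partial>lborel) + ennreal (exp (- \<gamma> * enn2real (expfun a \<omega>))) = 1"
    unfolding t using nn_integral_tilt[OF \<omega>, of T a] T(1) cumul_nonneg[of a T \<omega>]
    by (simp add: ennreal_plus[symmetric] del: ennreal_plus)
qed

definition weighted :: "real \<Rightarrow> real \<Rightarrow> 'a \<Rightarrow> real" where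
  "weighted a u \<omega> = \<gamma> * exp (\<alpha> * X u \<omega>) * (surv \<Phi> a 0 u \<omega> * rho (X u \<omega>))"

lemma weighted_nonneg: "0 \<le> weighted a u \<omega>"
  unfolding weighted_def using gamma_nonneg surv_nonneg rho_ge_1[of "X u \<omega>"]
  by (intro mult_nonneg_nonneg) auto

lemma progressive_weighted: "progressive (weighted a)"
  unfolding weighted_def[abs_def]
  by (intro progressive_mult progressive_compose[OF progressive_X, of "\<lambda>y. \<gamma> * exp (\<alpha> * y)"]
      progressive_surv progressive_compose[OF progressive_X rho_measurable]) auto

section \<open>Weighted potentials and the law of the functional at passage\<close>

lemma expectation_at_start:
  assumes "x \<le> a" "h \<in> borel_measurable borel"
  shows "(\<integral>\<^sup>+\<omega>. ennreal (1 * (surv \<Phi> a 0 0 \<omega> * h (X 0 \<omega>))) \<partial>P x) = ennreal (exp (\<Phi> * x) * h x)"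
proof -
  have "(\<integral>\<^sup>+\<omega>. ennreal (1 * (surv \<Phi> a 0 0 \<omega> * h (X 0 \<omega>))) \<partial>P x) = (\<integral>\<^sup>+\<omega>. ennreal (exp (\<Phi> * x) * h x) \<partial>P x)"
  proof (rule nn_integral_cong_AE)
    show "AE \<omega> in P x. ennreal (1 * (surv \<Phi> a 0 0 \<omega> * h (X 0 \<omega>))) = ennreal (exp (\<Phi> * x) * h x)"
      using start_at[of x] alive_0[of x] by eventually_elim (simp add: surv_def stays_def assms)
  qed
  then show ?thesis by (simp add: P.emeasure_space_1[simplified])
qed

lemma one_adapted: "(\<lambda>_::'a. 1::real) \<in> borel_measurable (F (ennreal 0))" "\<And>\<omega>::'a. 0 \<le> (1::real) \<and> (1::real) \<le> 1"
  by auto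

text \<open>The resolvent identity with Z = 1 and s = 0. It evaluates the potential in closed form
  as exp(\<Phi> x) (\<rho>(a) - \<rho>(x)).\<close>

lemma weighted_potential:
  assumes "x \<le> a"
  shows "ennreal (exp (\<Phi> * x) * rho a) = ennreal (exp (\<Phi> * x) * rho x) +
    (\<integral>\<^sup>+u. (\<integral>\<^sup>+\<omega>. ennreal (weighted a u \<omega>) \<partial>P x) * indicator {0..} u \<partial>lborel)"
proof -
  have "ennreal (rho a) * (\<integral>\<^sup>+\<omega>. ennreal (1 * (surv \<Phi> a 0 0 \<omega> * 1)) \<partial>P x) =
     (\<integral>\<^sup>+\<omega>. ennreal (1 * (surv \<Phi> a 0 0 \<omega> * rho (X 0 \<omega>))) \<partial>P x) +
     (\<integral>\<^sup>+u. (\<integral>\<^sup>+\<omega>. ennreal (1 * weighted a u \<omega>) \<partial>P x) * indicator {0..} u \<partial>lborel)"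
    using resolvent_identity[OF order_refl one_adapted, where a=a and x=x] unfolding weighted_def by simp
  moreover have "(\<integral>\<^sup>+\<omega>. ennreal (1 * (surv \<Phi> a 0 0 \<omega> * 1)) \<partial>P x) = ennreal (exp (\<Phi> * x) * 1)"
    using expectation_at_start[OF assms, of "\<lambda>_. 1"] by simp
  moreover have "(\<integral>\<^sup>+\<omega>. ennreal (1 * (surv \<Phi> a 0 0 \<omega> * rho (X 0 \<omega>))) \<partial>P x) = ennreal (exp (\<Phi> * x) * rho x)"
    by (rule expectation_at_start[OF assms rho_measurable])
  ultimately show ?thesis using rho_ge_1[of a] by (simp add: ennreal_mult mult.commute)
qed

text \<open>Multiplied by exp(-\<Phi> b), this is the expectation of 1 - exp(-\<gamma> I), with I
  stopped at passage above a, on the event that b is passed (\<open>tilted_passage\<close>,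
  \<open>nn_integral_tilt_passes\<close>).\<close>

definition tilted_mass :: "real \<Rightarrow> real \<Rightarrow> ennreal" where
  "tilted_mass x a = (\<integral>\<^sup>+v. (\<integral>\<^sup>+\<omega>. ennreal (tilt a v \<omega> * surv \<Phi> a 0 v \<omega>) \<partial>P x) * indicator {0..} v \<partial>lborel)"

lemma tilt_weighted: "tilt a v \<omega> * (surv \<Phi> a 0 v \<omega> * rho (X v \<omega>)) = exp (- cumul a v \<omega>) * weighted a v \<omega>"
  unfolding tilt_def intens_def weighted_def
  by (auto simp: surv_def indicator_def)

lemma expectation_joint_measurable:
  fixes f :: "real \<Rightarrow> 'a \<Rightarrow> real"
  assumes "(\<lambda>z. f (max 0 (fst z)) (snd z)) \<in> borel_measurable (lborel \<Otimes>\<^sub>M P x)"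
  shows "(\<lambda>u. (\<integral>\<^sup>+\<omega>. ennreal (f u \<omega>) \<partial>P x) * indicator {0..} u) \<in> borel_measurable lborel"
proof -
  note [measurable] = assms
  have [measurable]: "(\<lambda>u. \<integral>\<^sup>+\<omega>. ennreal (f (max 0 u) \<omega>) \<partial>P x) \<in> borel_measurable lborel"
    by (rule P.borel_measurable_nn_integral) (simp add: split_beta')
  have "(\<lambda>u. (\<integral>\<^sup>+\<omega>. ennreal (f (max 0 u) \<omega>) \<partial>P x) * indicator {0..} u) \<in> borel_measurable lborel"
    by measurable
  also have "(\<lambda>u. (\<integral>\<^sup>+\<omega>. ennreal (f (max 0 u) \<omega>) \<partial>P x) * indicator {0..} u) = (\<lambda>u. (\<integral>\<^sup>+\<omega>. ennreal (f u \<omega>) \<partial>P x) * indicator {0..} u)"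
  proof
    fix u :: real
    show "(\<integral>\<^sup>+\<omega>. ennreal (f (max 0 u) \<omega>) \<partial>P x) * indicator {0..} u = (\<integral>\<^sup>+\<omega>. ennreal (f u \<omega>) \<partial>P x) * indicator {0..} u"
      by (cases "0 \<le> u") (simp_all add: max_absorb2)
  qed
  finally show ?thesis .
qed

lemma progressive_mult_joint:
  assumes "progressive f" "progressive g"
  shows "(\<lambda>u. (\<integral>\<^sup>+\<omega>. ennreal (f u \<omega> * g u \<omega>) \<partial>P x) * indicator {0..} u) \<in> borel_measurable lborel"
  by (rule expectation_joint_measurable) (rule progressive_joint_measurable[OF progressive_mult[OF assms]])

text \<open>The order of integration is exchanged so that v runs over [0,u] for fixed u and path;
  there the density integrates to 1 - exp(-cumul) at u. The measurability claim is what allows this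
  term to be added to another one under an integral in v.\<close>

lemma double_potential:
  shows "(\<lambda>v. (\<integral>\<^sup>+u. (\<integral>\<^sup>+\<omega>. ennreal (tilt a v \<omega> * weighted a u \<omega>) \<partial>P x) * indicator {v..} u \<partial>lborel) * indicator {0..} v)
      \<in> borel_measurable lborel" (is "?I \<in> _")
   and "(\<integral>\<^sup>+v. (\<integral>\<^sup>+u. (\<integral>\<^sup>+\<omega>. ennreal (tilt a v \<omega> * weighted a u \<omega>) \<partial>P x) * indicator {v..} u \<partial>lborel) * indicator {0..} v \<partial>lborel)
   = (\<integral>\<^sup>+u. (\<integral>\<^sup>+\<omega>. ennreal (weighted a u \<omega> * (1 - exp (- cumul a u \<omega>))) \<partial>P x) * indicator {0..} u \<partial>lborel)"
proof -
  interpret LP: pair_sigma_finite lborel "P x" ..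
  note [measurable] = progressive_joint_measurable[OF progressive_tilt[of a], of x]
    progressive_joint_measurable[OF progressive_weighted[of a], of x]
  let ?T = "\<lambda>v \<omega>. ennreal (tilt a (max 0 v) \<omega>) * indicator {0..} v"
  let ?W = "\<lambda>u \<omega>. ennreal (weighted a (max 0 u) \<omega>)"
  let ?Q = "\<lambda>v u \<omega>. ?T v \<omega> * (?W u \<omega> * (if v \<le> u then 1 else 0))"
  have mT: "(\<lambda>z. ?T (fst (fst z)) (snd z)) \<in> borel_measurable ((lborel \<Otimes>\<^sub>M lborel) \<Otimes>\<^sub>M P x)"
  proof -
    have 1: "(\<lambda>z. (fst (fst z), snd z)) \<in> measurable ((lborel \<Otimes>\<^sub>M lborel) \<Otimes>\<^sub>M P x) (lborel \<Otimes>\<^sub>M P x)" by measurable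
    have 2: "(\<lambda>z. ?T (fst z) (snd z)) \<in> borel_measurable (lborel \<Otimes>\<^sub>M P x)" by measurable
    from measurable_compose[OF 1 2] show ?thesis by simp
  qed
  have mW: "(\<lambda>z. ?W (snd (fst z)) (snd z)) \<in> borel_measurable ((lborel \<Otimes>\<^sub>M lborel) \<Otimes>\<^sub>M P x)"
  proof -
    have 1: "(\<lambda>z. (snd (fst z), snd z)) \<in> measurable ((lborel \<Otimes>\<^sub>M lborel) \<Otimes>\<^sub>M P x) (lborel \<Otimes>\<^sub>M P x)" by measurable
    have 2: "(\<lambda>z. ?W (fst z) (snd z)) \<in> borel_measurable (lborel \<Otimes>\<^sub>M P x)" by measurable
    from measurable_compose[OF 1 2] show ?thesis by simp
  qed
  have mQ: "(\<lambda>z. ?Q (fst (fst z)) (snd (fst z)) (snd z)) \<in> borel_measurable ((lborel \<Otimes>\<^sub>M lborel) \<Otimes>\<^sub>M P x)"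
    by (intro borel_measurable_times_ennreal mT mW) measurable
  have mQi: "(\<lambda>z. \<integral>\<^sup>+\<omega>. ?Q (fst z) (snd z) \<omega> \<partial>P x) \<in> borel_measurable (lborel \<Otimes>\<^sub>M lborel)"
    by (rule P.borel_measurable_nn_integral) (use mQ in \<open>simp add: split_beta'\<close>)
  have mQu: "(\<lambda>z. ?Q (fst z) u (snd z)) \<in> borel_measurable (lborel \<Otimes>\<^sub>M P x)" for u
  proof -
    have "(\<lambda>z. ((fst z, u), snd z)) \<in> measurable (lborel \<Otimes>\<^sub>M P x) ((lborel \<Otimes>\<^sub>M lborel) \<Otimes>\<^sub>M P x)" by measurable
    from measurable_compose[OF this mQ] show ?thesis by simp
  qed
  have IQ: "?I = (\<lambda>v. \<integral>\<^sup>+u. \<integral>\<^sup>+\<omega>. ?Q v u \<omega> \<partial>P x \<partial>lborel)"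
  proof
    fix v :: real
    show "(\<integral>\<^sup>+u. (\<integral>\<^sup>+\<omega>. ennreal (tilt a v \<omega> * weighted a u \<omega>) \<partial>P x) * indicator {v..} u \<partial>lborel) * indicator {0..} v
      = (\<integral>\<^sup>+u. \<integral>\<^sup>+\<omega>. ?Q v u \<omega> \<partial>P x \<partial>lborel)"
    proof (cases "0 \<le> v")
      case True
      have "(\<integral>\<^sup>+u. (\<integral>\<^sup>+\<omega>. ennreal (tilt a v \<omega> * weighted a u \<omega>) \<partial>P x) * indicator {v..} u \<partial>lborel)
        = (\<integral>\<^sup>+u. \<integral>\<^sup>+\<omega>. ?Q v u \<omega> \<partial>P x \<partial>lborel)"
      proof (rule nn_integral_cong)
        fix u :: real
        show "(\<integral>\<^sup>+\<omega>. ennreal (tilt a v \<omega> * weighted a u \<omega>) \<partial>P x) * indicator {v..} u = (\<integral>\<^sup>+\<omega>. ?Q v u \<omega> \<partial>P x)"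
          using True tilt_bounds[OF True, of a] weighted_nonneg
          by (cases "v \<le> u") (auto intro!: nn_integral_cong simp: ennreal_mult max_absorb2)
      qed
      then show ?thesis using True by simp
    qed simp
  qed
  show "?I \<in> borel_measurable lborel"
    unfolding IQ by (rule lborel.borel_measurable_nn_integral) (use mQi in \<open>simp add: split_beta'\<close>)
  have "(\<integral>\<^sup>+v. ?I v \<partial>lborel) = (\<integral>\<^sup>+u. \<integral>\<^sup>+v. \<integral>\<^sup>+\<omega>. ?Q v u \<omega> \<partial>P x \<partial>lborel \<partial>lborel)"
    unfolding IQ by (rule lborel_pair.Fubini'[symmetric]) (use mQi in \<open>simp add: split_beta'\<close>)
  also have "\<dots> = (\<integral>\<^sup>+u. (\<integral>\<^sup>+\<omega>. ennreal (weighted a u \<omega> * (1 - exp (- cumul a u \<omega>))) \<partial>P x) * indicator {0..} u \<partial>lborel)"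
  proof (rule nn_integral_cong)
    fix u :: real
    have "(\<integral>\<^sup>+v. \<integral>\<^sup>+\<omega>. ?Q v u \<omega> \<partial>P x \<partial>lborel) = (\<integral>\<^sup>+\<omega>. \<integral>\<^sup>+v. ?Q v u \<omega> \<partial>lborel \<partial>P x)"
      by (rule LP.Fubini'[symmetric]) (use mQu[of u] in \<open>simp add: split_beta'\<close>)
    also have "\<dots> = (\<integral>\<^sup>+\<omega>. ennreal (weighted a u \<omega> * (1 - exp (- cumul a u \<omega>))) \<partial>P x) * indicator {0..} u"
    proof (cases "0 \<le> u")
      case True
      have "(\<integral>\<^sup>+\<omega>. \<integral>\<^sup>+v. ?Q v u \<omega> \<partial>lborel \<partial>P x) = (\<integral>\<^sup>+\<omega>. ennreal (weighted a u \<omega> * (1 - exp (- cumul a u \<omega>))) \<partial>P x)"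
      proof (rule nn_integral_cong)
        fix \<omega> assume "\<omega> \<in> space (P x)"
        then have \<omega>: "\<omega> \<in> \<Omega>" by simp
        have [measurable]: "(\<lambda>v. tilt a (max 0 v) \<omega>) \<in> borel_measurable lborel"
        proof -
          have "(\<lambda>v. (v, \<omega>)) \<in> measurable lborel (lborel \<Otimes>\<^sub>M P x)" using \<omega> by (intro measurable_Pair) auto
          from measurable_compose[OF this progressive_joint_measurable[OF progressive_tilt[of a], of x]] show ?thesis by simp
        qed
        have "(\<integral>\<^sup>+v. ?Q v u \<omega> \<partial>lborel) = (\<integral>\<^sup>+v. ennreal (weighted a u \<omega>) * (ennreal (tilt a (max 0 v) \<omega>) * indicator {0..u} v) \<partial>lborel)"
          by (rule nn_integral_cong) (use True in \<open>auto simp: indicator_def max_absorb2 mult.commute\<close>)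
        also have "\<dots> = ennreal (weighted a u \<omega>) * ennreal (1 - exp (- cumul a u \<omega>))"
          unfolding nn_integral_tilt[OF \<omega> True, symmetric] by (rule nn_integral_cmult) measurable
        also have "\<dots> = ennreal (weighted a u \<omega> * (1 - exp (- cumul a u \<omega>)))"
          using weighted_nonneg cumul_nonneg by (subst ennreal_mult) auto
        finally show "(\<integral>\<^sup>+v. ?Q v u \<omega> \<partial>lborel) = ennreal (weighted a u \<omega> * (1 - exp (- cumul a u \<omega>)))" .
      qed
      then show ?thesis using True by simp
    next
      case False
      have z: "?Q v u \<omega> = 0" for v \<omega> using False by (auto simp: indicator_def)
      have "(\<integral>\<^sup>+\<omega>. \<integral>\<^sup>+v. ?Q v u \<omega> \<partial>lborel \<partial>P x) = 0" unfolding z by simp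
      then show ?thesis using False by simp
    qed
    finally show "(\<integral>\<^sup>+v. \<integral>\<^sup>+\<omega>. ?Q v u \<omega> \<partial>P x \<partial>lborel) =
       (\<integral>\<^sup>+\<omega>. ennreal (weighted a u \<omega> * (1 - exp (- cumul a u \<omega>))) \<partial>P x) * indicator {0..} u" .
  qed
  finally show "(\<integral>\<^sup>+v. ?I v \<partial>lborel) =
    (\<integral>\<^sup>+u. (\<integral>\<^sup>+\<omega>. ennreal (weighted a u \<omega> * (1 - exp (- cumul a u \<omega>))) \<partial>P x) * indicator {0..} u \<partial>lborel)" .
qed

text \<open>The resolvent identity is applied at every v with Z = \<open>tilt a v\<close> and
  integrated over v. Its initial term contributes \<open>weighted\<close> times exp(-cumul), its
  potential term contributes \<open>weighted\<close> times 1 - exp(-cumul), and the sum no longer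
  contains the functional.\<close>

lemma rho_tilted_mass:
  "ennreal (rho a) * tilted_mass x a = (\<integral>\<^sup>+u. (\<integral>\<^sup>+\<omega>. ennreal (weighted a u \<omega>) \<partial>P x) * indicator {0..} u \<partial>lborel)"
proof -
  have pe: "progressive (\<lambda>u \<omega>. exp (- cumul a u \<omega>))" "progressive (\<lambda>u \<omega>. 1 - exp (- cumul a u \<omega>))"
    using progressive_compose[OF progressive_cumul[of a], of "\<lambda>y. exp (- y)"]
      progressive_compose[OF progressive_cumul[of a], of "\<lambda>y. 1 - exp (- y)"] by auto
  have step: "ennreal (rho a) * (\<integral>\<^sup>+\<omega>. ennreal (tilt a v \<omega> * surv \<Phi> a 0 v \<omega>) \<partial>P x) =
     (\<integral>\<^sup>+\<omega>. ennreal (exp (- cumul a v \<omega>) * weighted a v \<omega>) \<partial>P x) +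
     (\<integral>\<^sup>+u. (\<integral>\<^sup>+\<omega>. ennreal (tilt a v \<omega> * weighted a u \<omega>) \<partial>P x) * indicator {v..} u \<partial>lborel)" if v: "0 \<le> v" for v
  proof -
    have "ennreal (rho a) * (\<integral>\<^sup>+\<omega>. ennreal (tilt a v \<omega> * surv \<Phi> a v v \<omega>) \<partial>P x) =
      (\<integral>\<^sup>+\<omega>. ennreal (tilt a v \<omega> * (surv \<Phi> a v v \<omega> * rho (X v \<omega>))) \<partial>P x) +
      (\<integral>\<^sup>+u. (\<integral>\<^sup>+\<omega>. ennreal (tilt a v \<omega> * (\<gamma> * exp (\<alpha> * X u \<omega>) * (surv \<Phi> a v u \<omega> * rho (X u \<omega>)))) \<partial>P x) * indicator {v..} u \<partial>lborel)"
      by (rule resolvent_identity[OF v tilt_adapted[OF v] tilt_bounds[OF v]])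
    also have "(\<integral>\<^sup>+\<omega>. ennreal (tilt a v \<omega> * (surv \<Phi> a v v \<omega> * rho (X v \<omega>))) \<partial>P x) = (\<integral>\<^sup>+\<omega>. ennreal (exp (- cumul a v \<omega>) * weighted a v \<omega>) \<partial>P x)"
    proof (rule nn_integral_cong)
      fix \<omega>
      show "ennreal (tilt a v \<omega> * (surv \<Phi> a v v \<omega> * rho (X v \<omega>))) = ennreal (exp (- cumul a v \<omega>) * weighted a v \<omega>)"
        unfolding tilt_weighted[symmetric] mult.assoc[symmetric] tilt_surv[OF v order_refl] ..
    qed
    also have "(\<integral>\<^sup>+\<omega>. ennreal (tilt a v \<omega> * surv \<Phi> a v v \<omega>) \<partial>P x) = (\<integral>\<^sup>+\<omega>. ennreal (tilt a v \<omega> * surv \<Phi> a 0 v \<omega>) \<partial>P x)"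
      unfolding tilt_surv[OF v order_refl] ..
    also have "(\<integral>\<^sup>+u. (\<integral>\<^sup>+\<omega>. ennreal (tilt a v \<omega> * (\<gamma> * exp (\<alpha> * X u \<omega>) * (surv \<Phi> a v u \<omega> * rho (X u \<omega>)))) \<partial>P x) * indicator {v..} u \<partial>lborel)
      = (\<integral>\<^sup>+u. (\<integral>\<^sup>+\<omega>. ennreal (tilt a v \<omega> * weighted a u \<omega>) \<partial>P x) * indicator {v..} u \<partial>lborel)"
    proof (rule nn_integral_cong)
      fix u :: real
      show "(\<integral>\<^sup>+\<omega>. ennreal (tilt a v \<omega> * (\<gamma> * exp (\<alpha> * X u \<omega>) * (surv \<Phi> a v u \<omega> * rho (X u \<omega>)))) \<partial>P x) * indicator {v..} u
        = (\<integral>\<^sup>+\<omega>. ennreal (tilt a v \<omega> * weighted a u \<omega>) \<partial>P x) * indicator {v..} u"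
      proof (cases "v \<le> u")
        case True
        have "tilt a v \<omega> * (\<gamma> * exp (\<alpha> * X u \<omega>) * (surv \<Phi> a v u \<omega> * rho (X u \<omega>))) = tilt a v \<omega> * weighted a u \<omega>" for \<omega>
        proof -
          have "tilt a v \<omega> * (\<gamma> * exp (\<alpha> * X u \<omega>) * (surv \<Phi> a v u \<omega> * rho (X u \<omega>)))
            = \<gamma> * exp (\<alpha> * X u \<omega>) * (rho (X u \<omega>) * (tilt a v \<omega> * surv \<Phi> a v u \<omega>))" by (simp add: mult.commute mult.left_commute)
          also have "\<dots> = tilt a v \<omega> * weighted a u \<omega>" unfolding tilt_surv[OF v True] weighted_def by (simp add: mult.commute mult.left_commute)
          finally show ?thesis .
        qed
        then show ?thesis by (simp only:)
      qed simp
    qed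
    finally show ?thesis .
  qed
  have m1: "(\<lambda>v. (\<integral>\<^sup>+\<omega>. ennreal (tilt a v \<omega> * surv \<Phi> a 0 v \<omega>) \<partial>P x) * indicator {0..} v) \<in> borel_measurable lborel"
    by (rule progressive_mult_joint[OF progressive_tilt progressive_surv[OF order_refl]])
  have m2: "(\<lambda>v. (\<integral>\<^sup>+\<omega>. ennreal (exp (- cumul a v \<omega>) * weighted a v \<omega>) \<partial>P x) * indicator {0..} v) \<in> borel_measurable lborel"
    by (rule progressive_mult_joint[OF pe(1) progressive_weighted])
  have m3: "(\<lambda>v. (\<integral>\<^sup>+\<omega>. ennreal (weighted a v \<omega> * (1 - exp (- cumul a v \<omega>))) \<partial>P x) * indicator {0..} v) \<in> borel_measurable lborel"
    by (rule progressive_mult_joint[OF progressive_weighted pe(2)])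
  have m4: "(\<lambda>v. (\<integral>\<^sup>+\<omega>. ennreal (weighted a v \<omega>) \<partial>P x) * indicator {0..} v) \<in> borel_measurable lborel"
    by (rule expectation_joint_measurable[OF progressive_joint_measurable[OF progressive_weighted]])
  let ?I = "\<lambda>v. (\<integral>\<^sup>+u. (\<integral>\<^sup>+\<omega>. ennreal (tilt a v \<omega> * weighted a u \<omega>) \<partial>P x) * indicator {v..} u \<partial>lborel) * indicator {0..} v"
  have "ennreal (rho a) * tilted_mass x a =
     (\<integral>\<^sup>+v. ennreal (rho a) * ((\<integral>\<^sup>+\<omega>. ennreal (tilt a v \<omega> * surv \<Phi> a 0 v \<omega>) \<partial>P x) * indicator {0..} v) \<partial>lborel)"
    unfolding tilted_mass_def by (rule nn_integral_cmult[symmetric, OF m1])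
  also have "\<dots> = (\<integral>\<^sup>+v. (\<integral>\<^sup>+\<omega>. ennreal (exp (- cumul a v \<omega>) * weighted a v \<omega>) \<partial>P x) * indicator {0..} v + ?I v \<partial>lborel)"
    by (rule nn_integral_cong) (auto simp: mult.assoc[symmetric] step distrib_right split: split_indicator)
  also have "\<dots> = (\<integral>\<^sup>+v. (\<integral>\<^sup>+\<omega>. ennreal (exp (- cumul a v \<omega>) * weighted a v \<omega>) \<partial>P x) * indicator {0..} v \<partial>lborel) + (\<integral>\<^sup>+v. ?I v \<partial>lborel)"
    by (rule nn_integral_add[OF m2 double_potential(1)])
  also have "(\<integral>\<^sup>+v. ?I v \<partial>lborel) = (\<integral>\<^sup>+u. (\<integral>\<^sup>+\<omega>. ennreal (weighted a u \<omega> * (1 - exp (- cumul a u \<omega>))) \<partial>P x) * indicator {0..} u \<partial>lborel)"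
    by (rule double_potential(2))
  also have "(\<integral>\<^sup>+v. (\<integral>\<^sup>+\<omega>. ennreal (exp (- cumul a v \<omega>) * weighted a v \<omega>) \<partial>P x) * indicator {0..} v \<partial>lborel) + \<dots> =
    (\<integral>\<^sup>+u. (\<integral>\<^sup>+\<omega>. ennreal (exp (- cumul a u \<omega>) * weighted a u \<omega>) \<partial>P x) * indicator {0..} u +
       (\<integral>\<^sup>+\<omega>. ennreal (weighted a u \<omega> * (1 - exp (- cumul a u \<omega>))) \<partial>P x) * indicator {0..} u \<partial>lborel)"
    by (rule nn_integral_add[symmetric, OF m2 m3])
  also have "\<dots> = (\<integral>\<^sup>+u. (\<integral>\<^sup>+\<omega>. ennreal (weighted a u \<omega>) \<partial>P x) * indicator {0..} u \<partial>lborel)"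
  proof (rule nn_integral_cong)
    fix u :: real
    show "(\<integral>\<^sup>+\<omega>. ennreal (exp (- cumul a u \<omega>) * weighted a u \<omega>) \<partial>P x) * indicator {0..} u +
       (\<integral>\<^sup>+\<omega>. ennreal (weighted a u \<omega> * (1 - exp (- cumul a u \<omega>))) \<partial>P x) * indicator {0..} u =
       (\<integral>\<^sup>+\<omega>. ennreal (weighted a u \<omega>) \<partial>P x) * indicator {0..} u"
    proof (cases "0 \<le> u")
      case True
      have [measurable]: "weighted a u \<in> borel_measurable (P x)" "cumul a u \<in> borel_measurable (P x)"
        using measurable_F_imp_P[OF True progressive_adapted[OF _ True]] progressive_weighted progressive_cumul by auto
      have "(\<integral>\<^sup>+\<omega>. ennreal (exp (- cumul a u \<omega>) * weighted a u \<omega>) \<partial>P x) + (\<integral>\<^sup>+\<omega>. ennreal (weighted a u \<omega> * (1 - exp (- cumul a u \<omega>))) \<partial>P x)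
        = (\<integral>\<^sup>+\<omega>. ennreal (exp (- cumul a u \<omega>) * weighted a u \<omega>) + ennreal (weighted a u \<omega> * (1 - exp (- cumul a u \<omega>))) \<partial>P x)"
        by (rule nn_integral_add[symmetric]) measurable
      also have "\<dots> = (\<integral>\<^sup>+\<omega>. ennreal (weighted a u \<omega>) \<partial>P x)"
        using weighted_nonneg cumul_nonneg
        by (intro nn_integral_cong) (subst ennreal_plus[symmetric], auto simp: right_diff_distrib mult.commute intro!: mult_left_le mult_nonneg_nonneg)
      finally show ?thesis using True by simp
    qed simp
  qed
  finally show ?thesis .
qed

text \<open>For l = \<Phi> the potential term has coefficient \<psi>(\<Phi>) - p = 0. From a
  position X_s below b, the level b is therefore passed before killing with conditional probability
  exp(\<Phi> (X_s - b)).\<close>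

lemma passage_weight:
  assumes s: "0 \<le> s" and Z: "Z \<in> borel_measurable (F (ennreal s))" "\<And>\<omega>. 0 \<le> Z \<omega> \<and> Z \<omega> \<le> K"
  shows "(\<integral>\<^sup>+\<omega>. ennreal (Z \<omega>) * indicator ({\<omega>. X s \<omega> \<le> b} \<inter> passes b s) \<omega> \<partial>P x) =
     ennreal (exp (- \<Phi> * b)) * (\<integral>\<^sup>+\<omega>. ennreal (Z \<omega> * surv \<Phi> b s s \<omega>) \<partial>P x)"
proof -
  let ?A = "\<integral>\<^sup>+\<omega>. ennreal (Z \<omega>) * indicator ({\<omega>. X s \<omega> \<le> b} \<inter> passes b s) \<omega> \<partial>P x"
  have "ennreal (exp (\<Phi> * b)) * ?A = (\<integral>\<^sup>+\<omega>. ennreal (Z \<omega> * surv \<Phi> b s s \<omega>) \<partial>P x)"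
    using K_identity[OF s Phi_pos _ Z, of b x] psi_Phi by simp
  then have "ennreal (exp (- \<Phi> * b)) * (\<integral>\<^sup>+\<omega>. ennreal (Z \<omega> * surv \<Phi> b s s \<omega>) \<partial>P x) =
    ennreal (exp (- \<Phi> * b)) * (ennreal (exp (\<Phi> * b)) * ?A)" by simp
  also have "\<dots> = ennreal (exp (- \<Phi> * b) * exp (\<Phi> * b)) * ?A" by (simp add: ennreal_mult mult.assoc)
  also have "exp (- \<Phi> * b) * exp (\<Phi> * b) = 1" by (simp add: exp_add[symmetric])
  finally show ?thesis by simp
qed

lemma prob_passes:
  assumes "x \<le> b" shows "emeasure (P x) {\<omega>\<in>\<Omega>. \<omega> \<in> passes b 0} = ennreal (exp (- \<Phi> * (b - x)))"
proof -
  have "emeasure (P x) {\<omega>\<in>\<Omega>. \<omega> \<in> passes b 0} = (\<integral>\<^sup>+\<omega>. indicator {\<omega>\<in>\<Omega>. \<omega> \<in> passes b 0} \<omega> \<partial>P x)"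
    by (rule nn_integral_indicator[symmetric], rule pred_P, rule passes_measurable) simp
  also have "\<dots> = (\<integral>\<^sup>+\<omega>. ennreal 1 * indicator ({\<omega>. X 0 \<omega> \<le> b} \<inter> passes b 0) \<omega> \<partial>P x)"
  proof (rule nn_integral_cong_AE)
    show "AE \<omega> in P x. indicator {\<omega>\<in>\<Omega>. \<omega> \<in> passes b 0} \<omega> = (ennreal 1 * indicator ({\<omega>. X 0 \<omega> \<le> b} \<inter> passes b 0) \<omega> :: ennreal)"
      using start_at[of x] AE_space by eventually_elim (use assms in \<open>auto simp: indicator_def\<close>)
  qed
  also have "\<dots> = ennreal (exp (- \<Phi> * b)) * (\<integral>\<^sup>+\<omega>. ennreal (1 * surv \<Phi> b 0 0 \<omega>) \<partial>P x)"
    by (rule passage_weight[OF order_refl one_adapted])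
  also have "(\<integral>\<^sup>+\<omega>. ennreal (1 * surv \<Phi> b 0 0 \<omega>) \<partial>P x) = ennreal (exp (\<Phi> * x))"
    using expectation_at_start[OF assms, of "\<lambda>_. 1"] by simp
  also have "ennreal (exp (- \<Phi> * b)) * ennreal (exp (\<Phi> * x)) = ennreal (exp (- \<Phi> * (b - x)))"
    by (simp add: ennreal_mult[symmetric] exp_add[symmetric] algebra_simps)
  finally show ?thesis .
qed

text \<open>Where the density at v is nonzero the path has stayed at or below a \<le> b, so passing
  b after time 0 means passing b after time v, and \<open>passage_weight\<close> applies at each v
  with the density as Z.\<close>

lemma tilted_passage:
  assumes ab: "a \<le> b"
  shows "(\<integral>\<^sup>+\<omega>. indicator (passes b 0) \<omega> * (\<integral>\<^sup>+v. ennreal (tilt a (max 0 v) \<omega>) * indicator {0..} v \<partial>lborel) \<partial>P x) =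
    ennreal (exp (- \<Phi> * b)) * tilted_mass x a"
proof -
  interpret LP: pair_sigma_finite lborel "P x" ..
  note [measurable] = progressive_joint_measurable[OF progressive_tilt[of a], of x] passes_measurable[of 0 b x]
  have tm: "(\<lambda>v. ennreal (tilt a (max 0 v) \<omega>) * indicator {0..} v) \<in> borel_measurable lborel" if "\<omega> \<in> space (P x)" for \<omega>
  proof -
    have "(\<lambda>v. (v, \<omega>)) \<in> measurable lborel (lborel \<Otimes>\<^sub>M P x)" using that by (intro measurable_Pair) auto
    from measurable_compose[OF this progressive_joint_measurable[OF progressive_tilt[of a], of x]]
    have [measurable]: "(\<lambda>v. tilt a (max 0 v) \<omega>) \<in> borel_measurable lborel" by simp
    show ?thesis by measurable
  qed
  have "(\<integral>\<^sup>+\<omega>. indicator (passes b 0) \<omega> * (\<integral>\<^sup>+v. ennreal (tilt a (max 0 v) \<omega>) * indicator {0..} v \<partial>lborel) \<partial>P x) =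
    (\<integral>\<^sup>+\<omega>. \<integral>\<^sup>+v. indicator (passes b 0) \<omega> * (ennreal (tilt a (max 0 v) \<omega>) * indicator {0..} v) \<partial>lborel \<partial>P x)"
    by (rule nn_integral_cong) (rule nn_integral_cmult[symmetric, OF tm])
  also have "\<dots> = (\<integral>\<^sup>+v. \<integral>\<^sup>+\<omega>. indicator (passes b 0) \<omega> * (ennreal (tilt a (max 0 v) \<omega>) * indicator {0..} v) \<partial>P x \<partial>lborel)"
    by (rule LP.Fubini') (simp add: split_beta')
  also have "\<dots> = (\<integral>\<^sup>+v. ennreal (exp (- \<Phi> * b)) * ((\<integral>\<^sup>+\<omega>. ennreal (tilt a v \<omega> * surv \<Phi> a 0 v \<omega>) \<partial>P x) * indicator {0..} v) \<partial>lborel)"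
  proof (rule nn_integral_cong)
    fix v :: real
    show "(\<integral>\<^sup>+\<omega>. indicator (passes b 0) \<omega> * (ennreal (tilt a (max 0 v) \<omega>) * indicator {0..} v) \<partial>P x) =
       ennreal (exp (- \<Phi> * b)) * ((\<integral>\<^sup>+\<omega>. ennreal (tilt a v \<omega> * surv \<Phi> a 0 v \<omega>) \<partial>P x) * indicator {0..} v)"
    proof (cases "0 \<le> v")
      case True
      have st: "X v \<omega> \<le> b" "\<omega> \<in> passes b 0 \<longleftrightarrow> \<omega> \<in> passes b v" "\<omega> \<in> stays b v v" if "tilt a v \<omega> \<noteq> 0" for \<omega>
      proof -
        have s: "\<omega> \<in> stays a 0 v" using tilt_stays[OF that] by simp
        then show "X v \<omega> \<le> b" "\<omega> \<in> stays b v v" using True ab by (force simp: stays_def)+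
        have low: "X u \<omega> \<le> b" if "0 \<le> u" "u \<le> v" for u using s that ab by (force simp: stays_def)
        show "\<omega> \<in> passes b 0 \<longleftrightarrow> \<omega> \<in> passes b v"
          unfolding passes_def mem_Collect_eq using low True by (meson linear not_le order_trans)
      qed
      have "(\<integral>\<^sup>+\<omega>. indicator (passes b 0) \<omega> * (ennreal (tilt a (max 0 v) \<omega>) * indicator {0..} v) \<partial>P x)
         = (\<integral>\<^sup>+\<omega>. ennreal (tilt a v \<omega>) * indicator ({\<omega>. X v \<omega> \<le> b} \<inter> passes b v) \<omega> \<partial>P x)"
      proof (rule nn_integral_cong)
        fix \<omega>
        show "indicator (passes b 0) \<omega> * (ennreal (tilt a (max 0 v) \<omega>) * indicator {0..} v)
          = ennreal (tilt a v \<omega>) * indicator ({\<omega>. X v \<omega> \<le> b} \<inter> passes b v) \<omega>"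
          using True st[of \<omega>] by (cases "tilt a v \<omega> = 0") (auto simp: indicator_def max_absorb2)
      qed
      also have "\<dots> = ennreal (exp (- \<Phi> * b)) * (\<integral>\<^sup>+\<omega>. ennreal (tilt a v \<omega> * surv \<Phi> b v v \<omega>) \<partial>P x)"
        by (rule passage_weight[OF True tilt_adapted[OF True] tilt_bounds[OF True]])
      also have "(\<integral>\<^sup>+\<omega>. ennreal (tilt a v \<omega> * surv \<Phi> b v v \<omega>) \<partial>P x) = (\<integral>\<^sup>+\<omega>. ennreal (tilt a v \<omega> * surv \<Phi> a 0 v \<omega>) \<partial>P x)"
      proof (rule nn_integral_cong)
        fix \<omega>
        show "ennreal (tilt a v \<omega> * surv \<Phi> b v v \<omega>) = ennreal (tilt a v \<omega> * surv \<Phi> a 0 v \<omega>)"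
          using st(3)[of \<omega>] tilt_stays[of a v \<omega>] by (cases "tilt a v \<omega> = 0") (auto simp: surv_def)
      qed
      finally show ?thesis using True by simp
    qed simp
  qed
  also have "\<dots> = ennreal (exp (- \<Phi> * b)) * tilted_mass x a"
    unfolding tilted_mass_def
    by (rule nn_integral_cmult) (rule progressive_mult_joint[OF progressive_tilt progressive_surv[OF order_refl]])
  finally show ?thesis .
qed

text \<open>Two equations determine the answer. With D the tilted mass, R = exp(-\<Phi> (b - x)) -
  exp(-\<Phi> b) D on the event of passing b, and \<rho>(a) D = exp(\<Phi> x) (\<rho>(a) -
  \<rho>(x)) from the weighted potential; D is eliminated.\<close>

theorem expectation_exp_functional_passage:
  assumes xa: "x \<le> a" and ab: "a \<le> b"
  shows "(\<integral>\<^sup>+\<omega>. indicator (passes b 0) \<omega> * ennreal (exp (- \<gamma> * enn2real (expfun a \<omega>))) \<partial>P x) =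
    ennreal (exp (- \<Phi> * (b - x)) * (rho x / rho a))"
proof -
  note [measurable] = passes_measurable[of 0 b x] expfun_measurable[of a x]
  let ?R = "\<integral>\<^sup>+\<omega>. indicator (passes b 0) \<omega> * ennreal (exp (- \<gamma> * enn2real (expfun a \<omega>))) \<partial>P x"
  let ?T = "\<lambda>\<omega>. \<integral>\<^sup>+v. ennreal (tilt a (max 0 v) \<omega>) * indicator {0..} v \<partial>lborel"
  have Tm [measurable]: "?T \<in> borel_measurable (P x)"
  proof -
    have "(\<lambda>z. (snd z, fst z)) \<in> measurable (P x \<Otimes>\<^sub>M lborel) (lborel \<Otimes>\<^sub>M P x)" by measurable
    from measurable_compose[OF this progressive_joint_measurable[OF progressive_tilt[of a], of x]]
    have [measurable]: "(\<lambda>z. tilt a (max 0 (snd z)) (fst z)) \<in> borel_measurable (P x \<Otimes>\<^sub>M lborel)" by simp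
    show ?thesis by (rule lborel.borel_measurable_nn_integral) (simp add: split_beta')
  qed
  have "ennreal (exp (- \<Phi> * b)) * tilted_mass x a + ?R =
    (\<integral>\<^sup>+\<omega>. indicator (passes b 0) \<omega> * ?T \<omega> + indicator (passes b 0) \<omega> * ennreal (exp (- \<gamma> * enn2real (expfun a \<omega>))) \<partial>P x)"
    unfolding tilted_passage[OF ab, symmetric] by (rule nn_integral_add[symmetric]) measurable
  also have "\<dots> = (\<integral>\<^sup>+\<omega>. indicator {\<omega>\<in>\<Omega>. \<omega> \<in> passes b 0} \<omega> \<partial>P x)"
    by (rule nn_integral_cong) (use nn_integral_tilt_passes(1)[OF _ _ ab] in \<open>auto simp: indicator_def\<close>)
  also have "\<dots> = emeasure (P x) {\<omega>\<in>\<Omega>. \<omega> \<in> passes b 0}"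
    by (rule nn_integral_indicator, rule pred_P) measurable
  also have "\<dots> = ennreal (exp (- \<Phi> * (b - x)))" using xa ab by (intro prob_passes) simp
  finally have 1: "ennreal (exp (- \<Phi> * b)) * tilted_mass x a + ?R = ennreal (exp (- \<Phi> * (b - x)))" .
  have 2: "ennreal (exp (\<Phi> * x) * rho a) = ennreal (exp (\<Phi> * x) * rho x) + ennreal (rho a) * tilted_mass x a"
    unfolding rho_tilted_mass by (rule weighted_potential[OF xa])
  have ra: "1 \<le> rho a" "1 \<le> rho x" by (rule rho_ge_1)+
  \<comment> \<open>Both masses are shown finite here so that the elimination can be done by
    subtraction in the reals.\<close>
  have "ennreal (rho a) * tilted_mass x a \<le> ennreal (exp (\<Phi> * x) * rho a)" unfolding 2 by (rule add_increasing) auto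
  then have "ennreal (rho a) * tilted_mass x a < \<top>" by (rule le_less_trans) simp
  then have "tilted_mass x a < \<top>" using ra by (auto simp: ennreal_mult_less_top)
  then obtain D where D: "tilted_mass x a = ennreal D" "0 \<le> D" by (cases "tilted_mass x a") auto
  have "?R \<le> ennreal (exp (- \<Phi> * (b - x)))" unfolding 1[symmetric] by (rule add_increasing) auto
  then have "?R < \<top>" by (rule le_less_trans) simp
  then obtain R where R: "?R = ennreal R" "0 \<le> R" by (cases ?R) auto
  have e1: "exp (- \<Phi> * b) * D + R = exp (- \<Phi> * (b - x))"
    using 1 D R by (simp add: ennreal_mult[symmetric] ennreal_plus[symmetric] del: ennreal_plus)
  have e2: "exp (\<Phi> * x) * rho a = exp (\<Phi> * x) * rho x + rho a * D"
    using 2 D ra by (simp add: ennreal_mult[symmetric] ennreal_plus[symmetric] ennreal_inj del: ennreal_plus)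
  have split: "exp (- \<Phi> * (b - x)) = exp (- \<Phi> * b) * exp (\<Phi> * x)"
    by (simp add: exp_add[symmetric] algebra_simps)
  have R_eq: "R = exp (- \<Phi> * b) * (exp (\<Phi> * x) - D)"
    using e1[unfolded split] right_diff_distrib[of "exp (- \<Phi> * b)" "exp (\<Phi> * x)" D] by linarith
  have "rho a * R = exp (- \<Phi> * b) * (exp (\<Phi> * x) * rho a - rho a * D)"
    unfolding R_eq by (simp add: algebra_simps)
  also have "\<dots> = exp (- \<Phi> * (b - x)) * rho x" unfolding e2 split by simp
  finally have "R = exp (- \<Phi> * (b - x)) * (rho x / rho a)" using ra by (simp add: field_simps)
  then show ?thesis using R by simp
qed

text \<open>Seen from time q, the supremum above the present position is exponential with rate
  \<Phi>. Starting below a, it ends in the gap of width \<delta> with probability at most 1 -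
  exp(-\<Phi> \<delta>); starting inside the gap, it fails to leave it with at most the same
  probability.\<close>

lemma passes_gap:
  assumes q: "0 \<le> q" and D: "D \<in> sets (F (ennreal q))" "\<And>\<omega>. \<omega> \<in> D \<Longrightarrow> \<omega> \<in> alive q \<and> X q \<omega> \<le> a + \<delta>" and \<delta>: "0 \<le> \<delta>"
  shows "measure (P x) (D \<inter> {\<omega>\<in>\<Omega>. \<omega> \<in> passes a q} \<inter> {\<omega>\<in>\<Omega>. \<omega> \<notin> passes (a + \<delta>) q}) \<le> (1 - exp (- \<Phi> * \<delta>)) * measure (P x) D"
proof -
  have DP [measurable]: "D \<in> sets (P x)" using D subalg[OF q, of x] by (auto simp: subalgebra_def)
  have pm [measurable]: "{\<omega>\<in>\<Omega>. \<omega> \<in> passes b q} \<in> sets (P x)" for b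
    by (rule pred_P, rule passes_measurable[OF q])
  have Xm [measurable]: "X q \<in> borel_measurable (F (ennreal q))" using q adapted by simp
  have XP [measurable]: "X q \<in> borel_measurable (P x)" using q by simp
  have Dsub: "D \<subseteq> \<Omega>" using sets.sets_into_space[OF D(1)] space_F by auto
  have pw: "measure (P x) (C \<inter> {\<omega>\<in>\<Omega>. \<omega> \<in> passes b q}) = (\<integral>\<omega>. indicator C \<omega> * exp (\<Phi> * (X q \<omega> - b)) \<partial>P x)"
    and pi: "integrable (P x) (\<lambda>\<omega>. indicator C \<omega> * exp (\<Phi> * (X q \<omega> - b)))"
    if C: "C \<in> sets (F (ennreal q))" "\<And>\<omega>. \<omega> \<in> C \<Longrightarrow> \<omega> \<in> alive q \<and> X q \<omega> \<le> b" for C b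
  proof -
    have CP [measurable]: "C \<in> sets (P x)" using C subalg[OF q, of x] by (auto simp: subalgebra_def)
    have Csub: "C \<subseteq> \<Omega>" using sets.sets_into_space[OF C(1)] space_F by auto
    have CZ: "(\<lambda>\<omega>. indicator C \<omega> :: real) \<in> borel_measurable (F (ennreal q))" "\<And>\<omega>. 0 \<le> (indicator C \<omega> :: real) \<and> indicator C \<omega> \<le> (1::real)"
      using C(1) by (auto simp: indicator_def)
    show i: "integrable (P x) (\<lambda>\<omega>. indicator C \<omega> * exp (\<Phi> * (X q \<omega> - b)))"
    proof (rule P.integrable_const_bound[where B=1])
      show "AE \<omega> in P x. norm (indicator C \<omega> * exp (\<Phi> * (X q \<omega> - b))) \<le> 1"
        using C(2) Phi_pos by (intro always_eventually allI) (auto simp: indicator_def mult_nonneg_nonpos)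
    qed measurable
    have "emeasure (P x) (C \<inter> {\<omega>\<in>\<Omega>. \<omega> \<in> passes b q}) = (\<integral>\<^sup>+\<omega>. indicator (C \<inter> {\<omega>\<in>\<Omega>. \<omega> \<in> passes b q}) \<omega> \<partial>P x)"
      by (rule nn_integral_indicator[symmetric]) measurable
    also have "\<dots> = (\<integral>\<^sup>+\<omega>. ennreal (indicator C \<omega>) * indicator ({\<omega>. X q \<omega> \<le> b} \<inter> passes b q) \<omega> \<partial>P x)"
      by (rule nn_integral_cong) (use C(2) Csub in \<open>auto simp: indicator_def\<close>)
    also have "\<dots> = ennreal (exp (- \<Phi> * b)) * (\<integral>\<^sup>+\<omega>. ennreal (indicator C \<omega> * surv \<Phi> b q q \<omega>) \<partial>P x)"
      by (rule passage_weight[OF q CZ])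
    also have "\<dots> = (\<integral>\<^sup>+\<omega>. ennreal (exp (- \<Phi> * b)) * ennreal (indicator C \<omega> * surv \<Phi> b q q \<omega>) \<partial>P x)"
      using surv_measurable[OF q q, of \<Phi> b x] by (intro nn_integral_cmult[symmetric]) measurable
    also have "\<dots> = (\<integral>\<^sup>+\<omega>. ennreal (indicator C \<omega> * exp (\<Phi> * (X q \<omega> - b))) \<partial>P x)"
    proof (rule nn_integral_cong)
      fix \<omega>
      show "ennreal (exp (- \<Phi> * b)) * ennreal (indicator C \<omega> * surv \<Phi> b q q \<omega>) = ennreal (indicator C \<omega> * exp (\<Phi> * (X q \<omega> - b)))"
      proof (cases "\<omega> \<in> C")
        case True
        then have "surv \<Phi> b q q \<omega> = exp (\<Phi> * X q \<omega>)" using C(2)[OF True] by (simp add: surv_def stays_def)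
        then show ?thesis using True by (simp add: ennreal_mult[symmetric] exp_add[symmetric] algebra_simps)
      qed simp
    qed
    also have "\<dots> = ennreal (\<integral>\<omega>. indicator C \<omega> * exp (\<Phi> * (X q \<omega> - b)) \<partial>P x)"
      by (rule nn_integral_eq_integral[OF i]) simp
    finally show "measure (P x) (C \<inter> {\<omega>\<in>\<Omega>. \<omega> \<in> passes b q}) = (\<integral>\<omega>. indicator C \<omega> * exp (\<Phi> * (X q \<omega> - b)) \<partial>P x)"
      by (simp add: measure_def Bochner_Integration.integral_nonneg)
  qed
  let ?e = "exp (- \<Phi> * \<delta>)"
  have e: "0 < ?e" "?e \<le> 1" using Phi_pos \<delta> by auto
  \<comment> \<open>The positions below the gap and inside it need different estimates: on C1 both
    passage probabilities have the exponential form and are subtracted, on C2 only that of the upper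
    level does.\<close>
  define C1 where "C1 = {\<omega>\<in>D. X q \<omega> \<le> a}"
  define C2 where "C2 = {\<omega>\<in>D. a < X q \<omega>}"
  have "C1 = D \<inter> {\<omega>\<in>space (F (ennreal q)). X q \<omega> \<le> a}" "C2 = D \<inter> {\<omega>\<in>space (F (ennreal q)). a < X q \<omega>}"
    using Dsub by (auto simp: C1_def C2_def space_F)
  moreover have "{\<omega>\<in>space (F (ennreal q)). X q \<omega> \<le> a} \<in> sets (F (ennreal q))"
    "{\<omega>\<in>space (F (ennreal q)). a < X q \<omega>} \<in> sets (F (ennreal q))" by measurable
  ultimately have CF: "C1 \<in> sets (F (ennreal q))" "C2 \<in> sets (F (ennreal q))" using D(1) by auto
  then have [measurable]: "C1 \<in> sets (P x)" "C2 \<in> sets (P x)" using subalg[OF q, of x] by (auto simp: subalgebra_def)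
  have sub: "\<omega> \<in> passes (a + \<delta>) q \<Longrightarrow> \<omega> \<in> passes a q" for \<omega> using \<delta> by (force simp: passes_def)
  have b1: "\<omega> \<in> C1 \<Longrightarrow> \<omega> \<in> alive q \<and> X q \<omega> \<le> a" "\<omega> \<in> C1 \<Longrightarrow> \<omega> \<in> alive q \<and> X q \<omega> \<le> a + \<delta>"
    "\<omega> \<in> C2 \<Longrightarrow> \<omega> \<in> alive q \<and> X q \<omega> \<le> a + \<delta>" for \<omega>
    using D(2)[of \<omega>] by (auto simp: C1_def C2_def)
  have C\<Omega>: "C1 \<inter> \<Omega> = C1" "C2 \<inter> \<Omega> = C2" using Dsub by (auto simp: C1_def C2_def)
  have shift: "exp (\<Phi> * (y - (a + \<delta>))) = ?e * exp (\<Phi> * (y - a))" for y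
    by (simp add: exp_add[symmetric] algebra_simps)
  let ?N = "{\<omega>\<in>\<Omega>. \<omega> \<notin> passes (a + \<delta>) q}"
  have m1: "measure (P x) (C1 \<inter> {\<omega>\<in>\<Omega>. \<omega> \<in> passes a q} \<inter> ?N) \<le> (1 - ?e) * measure (P x) C1"
  proof -
    have "C1 \<inter> {\<omega>\<in>\<Omega>. \<omega> \<in> passes a q} \<inter> ?N = (C1 \<inter> {\<omega>\<in>\<Omega>. \<omega> \<in> passes a q}) - (C1 \<inter> {\<omega>\<in>\<Omega>. \<omega> \<in> passes (a + \<delta>) q})" by auto
    then have "measure (P x) (C1 \<inter> {\<omega>\<in>\<Omega>. \<omega> \<in> passes a q} \<inter> ?N) =
        measure (P x) (C1 \<inter> {\<omega>\<in>\<Omega>. \<omega> \<in> passes a q}) - measure (P x) (C1 \<inter> {\<omega>\<in>\<Omega>. \<omega> \<in> passes (a + \<delta>) q})"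
      using sub by (subst P.finite_measure_Diff[symmetric]) auto
    also have "\<dots> = (\<integral>\<omega>. indicator C1 \<omega> * exp (\<Phi> * (X q \<omega> - a)) \<partial>P x) - (\<integral>\<omega>. ?e * (indicator C1 \<omega> * exp (\<Phi> * (X q \<omega> - a))) \<partial>P x)"
    proof -
      have p1: "measure (P x) (C1 \<inter> {\<omega>\<in>\<Omega>. \<omega> \<in> passes a q}) = (\<integral>\<omega>. indicator C1 \<omega> * exp (\<Phi> * (X q \<omega> - a)) \<partial>P x)"
        by (rule pw[OF CF(1)]) (rule b1(1))
      have p2: "measure (P x) (C1 \<inter> {\<omega>\<in>\<Omega>. \<omega> \<in> passes (a + \<delta>) q}) = (\<integral>\<omega>. indicator C1 \<omega> * exp (\<Phi> * (X q \<omega> - (a + \<delta>))) \<partial>P x)"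
        by (rule pw[OF CF(1)]) (rule b1(2))
      show ?thesis unfolding p1 p2 shift by (simp only: mult.left_commute)
    qed
    also have "\<dots> = (1 - ?e) * (\<integral>\<omega>. indicator C1 \<omega> * exp (\<Phi> * (X q \<omega> - a)) \<partial>P x)"
      unfolding integral_mult_right_zero by (simp only: left_diff_distrib mult_1_left)
    also have "\<dots> \<le> (1 - ?e) * (\<integral>\<omega>. indicator C1 \<omega> \<partial>P x)"
    proof (intro mult_left_mono integral_mono pi[OF CF(1) b1(1)])
      show "indicator C1 \<omega> * exp (\<Phi> * (X q \<omega> - a)) \<le> indicator C1 \<omega>" for \<omega>
        using b1(1)[of \<omega>] Phi_pos by (auto simp: indicator_def mult_nonneg_nonpos)
    qed (use e in \<open>auto intro!: integrable_real_indicator simp: P.emeasure_finite less_top[symmetric]\<close>)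
    finally show ?thesis by (simp add: C\<Omega>)
  qed
  have m2: "measure (P x) (C2 \<inter> ?N) \<le> (1 - ?e) * measure (P x) C2"
  proof -
    have "C2 \<subseteq> \<Omega>" using Dsub by (auto simp: C2_def)
    then have "C2 \<inter> ?N = C2 - (C2 \<inter> {\<omega>\<in>\<Omega>. \<omega> \<in> passes (a + \<delta>) q})" by auto
    then have "measure (P x) (C2 \<inter> ?N) = measure (P x) C2 - measure (P x) (C2 \<inter> {\<omega>\<in>\<Omega>. \<omega> \<in> passes (a + \<delta>) q})"
      by (simp only:, intro P.finite_measure_Diff) auto
    also have "\<dots> = measure (P x) C2 - (\<integral>\<omega>. indicator C2 \<omega> * exp (\<Phi> * (X q \<omega> - (a + \<delta>))) \<partial>P x)"
    proof -
      have "measure (P x) (C2 \<inter> {\<omega>\<in>\<Omega>. \<omega> \<in> passes (a + \<delta>) q}) = (\<integral>\<omega>. indicator C2 \<omega> * exp (\<Phi> * (X q \<omega> - (a + \<delta>))) \<partial>P x)"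
        by (rule pw[OF CF(2)]) (rule b1(3))
      then show ?thesis by (simp only:)
    qed
    also have "\<dots> \<le> measure (P x) C2 - (\<integral>\<omega>. ?e * indicator C2 \<omega> \<partial>P x)"
    proof (intro diff_left_mono integral_mono pi[OF CF(2) b1(3)])
      show "integrable (P x) (\<lambda>\<omega>. ?e * indicator C2 \<omega>)"
        by (intro integrable_mult_right integrable_real_indicator) (auto simp: P.emeasure_finite less_top[symmetric])
      show "?e * indicator C2 \<omega> \<le> indicator C2 \<omega> * exp (\<Phi> * (X q \<omega> - (a + \<delta>)))" for \<omega>
      proof (cases "\<omega> \<in> C2")
        case True
        then have "1 \<le> exp (\<Phi> * (X q \<omega> - a))" using Phi_pos by (simp add: C2_def)
        then show ?thesis using True unfolding shift by simp
      qed simp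
    qed
    finally show ?thesis by (simp add: C\<Omega> algebra_simps)
  qed
  have "D \<inter> {\<omega>\<in>\<Omega>. \<omega> \<in> passes a q} \<inter> ?N \<subseteq> (C1 \<inter> {\<omega>\<in>\<Omega>. \<omega> \<in> passes a q} \<inter> ?N) \<union> (C2 \<inter> ?N)"
    by (auto simp: C1_def C2_def)
  have Nm [measurable]: "?N \<in> sets (P x)" by (rule pred_P, rule pred_intros_logic, rule passes_measurable[OF q])
  have "measure (P x) (D \<inter> {\<omega>\<in>\<Omega>. \<omega> \<in> passes a q} \<inter> ?N) \<le> measure (P x) ((C1 \<inter> {\<omega>\<in>\<Omega>. \<omega> \<in> passes a q} \<inter> ?N) \<union> (C2 \<inter> ?N))"
    by (rule P.finite_measure_mono) (auto simp: C1_def[symmetric] C2_def[symmetric], auto simp: C1_def C2_def)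
  also have "\<dots> \<le> measure (P x) (C1 \<inter> {\<omega>\<in>\<Omega>. \<omega> \<in> passes a q} \<inter> ?N) + measure (P x) (C2 \<inter> ?N)"
    by (rule measure_Un_le) auto
  also have "\<dots> \<le> (1 - ?e) * (measure (P x) C1 + measure (P x) C2)" using m1 m2 by (simp add: distrib_left)
  also have "measure (P x) C1 + measure (P x) C2 = measure (P x) D"
  proof -
    have "measure (P x) (C1 \<union> C2) = measure (P x) C1 + measure (P x) C2"
      by (rule P.finite_measure_Union) (auto simp: C1_def C2_def[symmetric], auto simp: C1_def C2_def)
    moreover have "C1 \<union> C2 = D" by (auto simp: C1_def C2_def)
    ultimately show ?thesis by simp
  qed
  finally show ?thesis .
qed

end

section \<open>The overall supremum and the exponential functional up to its time\<close>

context transient_exp_functional begin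

text \<open>Taken over times strictly before killing, whereas \<open>run_sup\<close> at \<e>
  includes time \<e> itself. This version is determined by the passage events and hence measurable;
  \<open>run_sup_eq_Mx\<close> compares the two.\<close>

definition Mx :: "'a \<Rightarrow> ereal" where
  "Mx \<omega> = (SUP u\<in>{u. 0 \<le> u \<and> \<omega> \<in> alive u}. ereal (X u \<omega>))"

lemma passes_iff_Mx: "\<omega> \<in> passes a 0 \<longleftrightarrow> ereal a < Mx \<omega>"
  unfolding passes_def Mx_def less_SUP_iff by auto

lemma Mx_measurable [measurable]: "Mx \<in> borel_measurable (P x)"
proof (rule borel_measurableI_greater)
  fix a :: ereal
  show "{\<omega> \<in> space (P x). a < Mx \<omega>} \<in> sets (P x)"
  proof (cases a)
    case (real r)
    have "{\<omega> \<in> \<Omega>. \<omega> \<in> passes r 0} \<in> sets (P x)" by (rule pred_P, rule passes_measurable) simp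
    then show ?thesis using real by (simp add: passes_iff_Mx)
  next
    case MInf
    have "-\<infinity> < Mx \<omega> \<longleftrightarrow> \<omega> \<in> alive 0" for \<omega>
      unfolding Mx_def less_SUP_iff using alive_antimono[of 0] by auto
    then show ?thesis using MInf by simp
  qed simp
qed

text \<open>On survival to q, the supremum of X over [0,q] lies in the half-open interval from
  k/2^n, excluded, to (k+1)/2^n, included. Half-openness makes the cells disjoint, so their
  probabilities add up to at most 1.\<close>

definition tie_cell :: "real \<Rightarrow> nat \<Rightarrow> int \<Rightarrow> 'a set" where
  "tie_cell q n k = {\<omega>\<in>\<Omega>. \<omega> \<in> alive q \<and> \<omega> \<in> stays (of_int k / 2 ^ n + 1 / 2 ^ n) 0 q \<and> \<omega> \<notin> stays (of_int k / 2 ^ n) 0 q}"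

text \<open>On \<open>tie q n k\<close> the suprema before and after \<open>q\<close> lie in the same cell of mesh \<open>2\<^sup>-\<^sup>n\<close>, up to
  boundary points.\<close>

definition tie :: "real \<Rightarrow> nat \<Rightarrow> int \<Rightarrow> 'a set" where
  "tie q n k = tie_cell q n k \<inter> {\<omega>\<in>\<Omega>. \<omega> \<in> passes (of_int k / 2 ^ n) q} \<inter>
     {\<omega>\<in>\<Omega>. \<omega> \<notin> passes (of_int k / 2 ^ n + 1 / 2 ^ n) q}"

lemma stays_measurable_F: "0 \<le> q \<Longrightarrow> Measurable.pred (F (ennreal q)) (\<lambda>\<omega>. \<omega> \<in> stays a 0 q)"
proof -
  assume "0 \<le> q"
  from progressive_adapted[OF progressive_stays[OF order_refl] this, of a]
  have [measurable]: "indicat_real (stays a 0 q) \<in> borel_measurable (F (ennreal q))" .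
  have "Measurable.pred (F (ennreal q)) (\<lambda>\<omega>. indicat_real (stays a 0 q) \<omega> = 1)" by measurable
  then show ?thesis by (simp add: indicator_eq_1_iff)
qed

lemma tie_cell_sets: "0 \<le> q \<Longrightarrow> tie_cell q n k \<in> sets (F (ennreal q))"
proof -
  assume q: "0 \<le> q"
  note [measurable] = stays_measurable_F[OF q] alive_measurable_F[OF q order_refl]
  have "Measurable.pred (F (ennreal q)) (\<lambda>\<omega>. \<omega> \<in> alive q \<and> \<omega> \<in> stays (of_int k / 2 ^ n + 1 / 2 ^ n) 0 q \<and> \<omega> \<notin> stays (of_int k / 2 ^ n) 0 q)"
    by measurable
  then show ?thesis by (simp add: pred_def tie_cell_def space_F)
qed

lemma tie_cell_disjoint: "k \<noteq> j \<Longrightarrow> tie_cell q n k \<inter> tie_cell q n j = {}"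
proof -
  have "tie_cell q n k \<inter> tie_cell q n j = {}" if "k < j" for k j
  proof -
    have "of_int (k + 1) / 2 ^ n \<le> (of_int j / 2 ^ n :: real)"
      using that by (intro divide_right_mono) (auto simp: of_int_le_iff simp del: of_int_add)
    then have le: "of_int k / 2 ^ n + 1 / 2 ^ n \<le> (of_int j / 2 ^ n :: real)" by (simp add: add_divide_distrib)
    have "\<omega> \<in> stays (of_int k / 2 ^ n + 1 / 2 ^ n) 0 q \<Longrightarrow> \<omega> \<in> stays (of_int j / 2 ^ n) 0 q" for \<omega>
      using le by (force simp: stays_def)
    then show ?thesis by (auto simp: tie_cell_def)
  qed
  then show "k \<noteq> j \<Longrightarrow> tie_cell q n k \<inter> tie_cell q n j = {}" by (metis Int_commute linorder_neqE)
qed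

text \<open>By \<open>passes_gap\<close> each cell carries a tie with at most the fraction 1 -
  exp(-\<Phi> / 2^n) of its mass. Summing over the disjoint cells bounds the probability of any tie
  at mesh 2^-n by that number, which tends to 0.\<close>

lemma AE_no_tie:
  assumes q: "0 \<le> q" shows "AE \<omega> in P x. \<exists>n. \<forall>k. \<omega> \<notin> tie q n k"
proof -
  \<comment> \<open>\<open>int_decode\<close> enumerates the cells by natural numbers, so that
    countable sums over them are series.\<close>
  define A where "A n = (\<Union>i. tie q n (int_decode i))" for n
  have cP: "tie_cell q n k \<in> sets (P x)" for n k
    using tie_cell_sets[OF q] subalg[OF q, of x] by (auto simp: subalgebra_def)
  have pm: "{\<omega>\<in>\<Omega>. \<omega> \<in> passes b q} \<in> sets (P x)" "{\<omega>\<in>\<Omega>. \<omega> \<notin> passes b q} \<in> sets (P x)" for b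
    using passes_measurable[OF q, of b x] by (auto intro!: pred_P pred_intros_logic)
  have tP: "tie q n k \<in> sets (P x)" for n k unfolding tie_def by (intro sets.Int cP pm)
  have AP: "A n \<in> sets (P x)" for n unfolding A_def using tP by auto
  have bound: "measure (P x) (A n) \<le> 1 - exp (- \<Phi> * (1 / 2 ^ n))" for n
  proof -
    let ?e = "1 - exp (- \<Phi> * (1 / 2 ^ n))"
    have e0: "0 \<le> ?e" using Phi_pos by simp
    have "emeasure (P x) (A n) \<le> (\<Sum>i. emeasure (P x) (tie q n (int_decode i)))"
      unfolding A_def using tP by (intro emeasure_subadditive_countably) auto
    also have "\<dots> \<le> (\<Sum>i. ennreal ?e * emeasure (P x) (tie_cell q n (int_decode i)))"
    proof (intro suminf_le summableI)
      fix i
      let ?k = "int_decode i"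
      have "measure (P x) (tie q n ?k) \<le> ?e * measure (P x) (tie_cell q n ?k)"
        unfolding tie_def
      proof (rule passes_gap[OF q tie_cell_sets[OF q]])
        fix \<omega> assume "\<omega> \<in> tie_cell q n ?k"
        then show "\<omega> \<in> alive q \<and> X q \<omega> \<le> of_int ?k / 2 ^ n + 1 / 2 ^ n"
          using q by (auto simp: tie_cell_def stays_def)
      qed simp
      then show "emeasure (P x) (tie q n ?k) \<le> ennreal ?e * emeasure (P x) (tie_cell q n ?k)"
        using e0 by (simp add: P.emeasure_eq_measure ennreal_mult[symmetric] ennreal_leI)
    qed
    also have "\<dots> = ennreal ?e * (\<Sum>i. emeasure (P x) (tie_cell q n (int_decode i)))" by simp
    also have "(\<Sum>i. emeasure (P x) (tie_cell q n (int_decode i))) = emeasure (P x) (\<Union>i. tie_cell q n (int_decode i))"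
    proof (rule suminf_emeasure)
      show "disjoint_family (\<lambda>i. tie_cell q n (int_decode i))"
        unfolding disjoint_family_on_def using tie_cell_disjoint by (metis int_decode_inverse)
    qed (use cP in auto)
    also have "ennreal ?e * \<dots> \<le> ennreal ?e * 1" by (intro mult_left_mono P.emeasure_le_1) auto
    finally show ?thesis using e0 by (simp add: P.emeasure_eq_measure)
  qed
  have "measure (P x) (\<Inter>n. A n) = 0"
  proof -
    have le: "measure (P x) (\<Inter>n. A n) \<le> 1 - exp (- \<Phi> / 2 ^ n)" for n
    proof -
      have "measure (P x) (\<Inter>n. A n) \<le> measure (P x) (A n)" using AP by (intro P.finite_measure_mono) auto
      then show ?thesis using bound[of n] by simp
    qed
    have "(\<lambda>n. 1 - exp (- \<Phi> / 2 ^ n)) \<longlonglongrightarrow> 1 - exp 0"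
      by (intro tendsto_intros LIMSEQ_half_pow)
    then have "measure (P x) (\<Inter>n. A n) \<le> 1 - exp 0" by (rule LIMSEQ_le_const) (use le in blast)
    then show ?thesis by (simp add: measure_le_0_iff)
  qed
  then have "AE \<omega> in P x. \<omega> \<notin> (\<Inter>n. A n)" using AP by (subst P.prob_eq_0[symmetric]) auto
  then show ?thesis
  proof eventually_elim
    case (elim \<omega>)
    then obtain n where "\<And>i. \<omega> \<notin> tie q n (int_decode i)" by (auto simp: A_def)
    then have "\<omega> \<notin> tie q n k" for k by (metis int_encode_inverse)
    then show ?case by blast
  qed
qed

text \<open>If the supremum m is already approached on [0,q] and is attained at some t \<ge> q, then
  m lies in the same cell before and after q, whatever the mesh.\<close>

lemma tieI:
  assumes \<omega>: "\<omega> \<in> \<Omega>" and q: "0 \<le> q" "\<omega> \<in> alive q"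
    and st: "\<omega> \<in> stays m 0 q" "\<And>r. r < m \<Longrightarrow> \<omega> \<notin> stays r 0 q"
    and t: "q \<le> t" "\<omega> \<in> alive t" "X t \<omega> = m" and max: "\<And>u. 0 \<le> u \<Longrightarrow> \<omega> \<in> alive u \<Longrightarrow> X u \<omega> \<le> m"
  shows "\<exists>k. \<omega> \<in> tie q n k"
proof -
  \<comment> \<open>Ceiling minus 1 puts m into the half-open cell also when m is a multiple of
    2^-n.\<close>
  define k where "k = \<lceil>m * 2 ^ n\<rceil> - 1"
  have "of_int k < m * 2 ^ n" "m * 2 ^ n \<le> of_int k + 1" unfolding k_def by linarith+
  then have k: "of_int k / 2 ^ n < m" "m \<le> of_int k / 2 ^ n + 1 / 2 ^ n" by (simp_all add: field_simps)
  have "\<omega> \<in> stays (of_int k / 2 ^ n + 1 / 2 ^ n) 0 q" using st(1) k(2) by (force simp: stays_def)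
  moreover have "\<omega> \<in> passes (of_int k / 2 ^ n) q" unfolding passes_def using t k(1) by auto
  moreover have "\<omega> \<notin> passes (of_int k / 2 ^ n + 1 / 2 ^ n) q"
    unfolding passes_def using max k(2) q(1) by (auto simp: not_less) (meson order_trans)
  ultimately show ?thesis using \<omega> q st(2)[OF k(1)] unfolding tie_def tie_cell_def by blast
qed

lemma expfun_mono: "a \<le> a' \<Longrightarrow> expfun a \<omega> \<le> expfun a' \<omega>"
  unfolding expfun_def
proof (rule nn_integral_mono)
  fix u :: real assume "a \<le> a'"
  then have "\<omega> \<in> stays a 0 (max 0 u) \<Longrightarrow> \<omega> \<in> stays a' 0 (max 0 u)" by (force simp: stays_def)
  then show "ennreal (surv \<alpha> a 0 (max 0 u) \<omega>) * indicator {0..} u \<le> ennreal (surv \<alpha> a' 0 (max 0 u) \<omega>) * indicator {0..} u"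
    by (intro mult_right_mono ennreal_leI) (auto simp: surv_def indicator_def)
qed

text \<open>The limit of \<open>expfun a\<close> as a increases to the supremum, along rational
  levels so that it is measurable. It is the measurable representative of the functional up to G
  (\<open>exp_functional_G\<close>); the value 0 for the other levels does not affect a supremum in
  \<open>ennreal\<close>.\<close>

definition expI :: "'a \<Rightarrow> ennreal" where
  "expI \<omega> = (SUP r\<in>\<rat>. if ereal r < Mx \<omega> then expfun r \<omega> else 0)"

lemma expI_measurable [measurable]: "expI \<in> borel_measurable (P x)"
  unfolding expI_def[abs_def] by (intro borel_measurable_SUP countable_rat) measurable

lemma expfun_le_expI:
  assumes "ereal a < Mx \<omega>" shows "expfun a \<omega> \<le> expI \<omega>"
proof -
  obtain y where y: "ereal a < ereal y" "ereal y < Mx \<omega>"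
    using ereal_dense2[OF assms] by (metis ereal_dense2 assms)
  then have "a < y" by simp
  then obtain r where r: "r \<in> \<rat>" "a < r" "r < y" using Rats_dense_in_real by blast
  have rM: "ereal r < Mx \<omega>" using r(3) y(2) by (metis ereal_less(2) less_ereal.simps(1) less_trans)
  have "expfun a \<omega> \<le> expfun r \<omega>" using r by (intro expfun_mono) simp
  also have "\<dots> \<le> expI \<omega>" unfolding expI_def using r(1) rM by (intro SUP_upper2[of r]) auto
  finally show ?thesis .
qed

lemma expfun_tendsto:
  assumes "\<And>n. ereal (a n) < Mx \<omega>" "\<And>r. ereal r < Mx \<omega> \<Longrightarrow> \<forall>\<^sub>F n in sequentially. r < a n"
  shows "(\<lambda>n. expfun (a n) \<omega>) \<longlonglongrightarrow> expI \<omega>"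
proof (rule order_tendstoI)
  fix y assume "y < expI \<omega>"
  then obtain r where r: "r \<in> \<rat>" "y < (if ereal r < Mx \<omega> then expfun r \<omega> else 0)"
    unfolding expI_def less_SUP_iff by blast
  then have rM: "ereal r < Mx \<omega>" "y < expfun r \<omega>" by (auto split: if_splits)
  from assms(2)[OF rM(1)] show "\<forall>\<^sub>F n in sequentially. y < expfun (a n) \<omega>"
    by eventually_elim (use rM(2) expfun_mono[of r _ \<omega>] in \<open>meson less_imp_le less_le_trans\<close>)
next
  fix y assume "expI \<omega> < y"
  then have "expfun (a n) \<omega> < y" for n using expfun_le_expI[OF assms(1)[of n]] by (rule le_less_trans[rotated])
  then show "\<forall>\<^sub>F n in sequentially. expfun (a n) \<omega> < y" by simp
qed

text \<open>The suprema can differ only through the value at time \<e>. That value is at most its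
  left limit, which is approached along alive times; being alive at 0 ensures that there are times
  to the left.\<close>

lemma run_sup_eq_Mx:
  assumes \<omega>: "\<omega> \<in> \<Omega>" and np: "no_positive_jumps (\<lambda>t. X t \<omega>)" and al: "\<omega> \<in> alive 0"
  shows "run_sup (\<lambda>t. X t \<omega>) (\<e> \<omega>) = Mx \<omega>"
proof (rule antisym)
  show "Mx \<omega> \<le> run_sup (\<lambda>t. X t \<omega>) (\<e> \<omega>)"
    unfolding Mx_def run_sup_def times_upto_def alive_def by (rule SUP_subset_mono) auto
  show "run_sup (\<lambda>t. X t \<omega>) (\<e> \<omega>) \<le> Mx \<omega>"
    unfolding run_sup_def
  proof (rule SUP_least)
    fix u assume "u \<in> times_upto (\<e> \<omega>)"
    then have u: "0 \<le> u" "ennreal u \<le> \<e> \<omega>" by (auto simp: times_upto_def)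
    have up: "ereal (X v \<omega>) \<le> Mx \<omega>" if "0 \<le> v" "\<omega> \<in> alive v" for v
      unfolding Mx_def using that by (intro SUP_upper) auto
    show "ereal (X u \<omega>) \<le> Mx \<omega>"
    proof (cases "ennreal u = \<e> \<omega>")
      case True
      have "0 < u" using al u True by (cases "u = 0") (auto simp: alive_def)
      then obtain l where l: "((\<lambda>t. X t \<omega>) \<longlongrightarrow> l) (at_left u)" using cadlag_paths[OF \<omega>] by (auto simp: cadlag_def)
      have "X u \<omega> \<le> l" using np l \<open>0 < u\<close> by (auto simp: no_positive_jumps_def)
      also have "ereal l \<le> Mx \<omega>"
      proof (rule tendsto_upperbound)
        show "((\<lambda>t. ereal (X t \<omega>)) \<longlongrightarrow> ereal l) (at_left u)" using l by (rule tendsto_ereal)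
        show "\<forall>\<^sub>F t in at_left u. ereal (X t \<omega>) \<le> Mx \<omega>"
          unfolding eventually_at_left_field
        proof (intro exI[of _ 0] conjI allI impI)
          fix v assume "0 < v" "v < u"
          then show "ereal (X v \<omega>) \<le> Mx \<omega>" using True by (intro up) (auto simp: alive_def True[symmetric] ennreal_lessI)
        qed (use \<open>0 < u\<close> in simp)
      qed simp
      finally show ?thesis by simp
    next
      case False
      then show ?thesis using u by (intro up) (auto simp: alive_def less_le)
    qed
  qed
qed

end

lemma run_sup_eq_end_iff:
  assumes "0 \<le> t"
  shows "run_sup w (ennreal t) = ereal (w t) \<longleftrightarrow> (\<forall>v\<in>{0..t}. w v \<le> w t)"
proof
  have up: "ereal (w v) \<le> run_sup w (ennreal t)" if "0 \<le> v" "v \<le> t" for v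
    unfolding run_sup_def times_upto_def using that by (intro SUP_upper) (auto intro: ennreal_leI)
  show "run_sup w (ennreal t) = ereal (w t) \<Longrightarrow> \<forall>v\<in>{0..t}. w v \<le> w t" using up by fastforce
  assume R: "\<forall>v\<in>{0..t}. w v \<le> w t"
  have "run_sup w (ennreal t) \<le> ereal (w t)"
    unfolding run_sup_def times_upto_def using R \<open>0 \<le> t\<close> by (intro SUP_least) (auto simp: ennreal_le_iff)
  then show "run_sup w (ennreal t) = ereal (w t)" using up[of t] \<open>0 \<le> t\<close> by (intro antisym) auto
qed

section \<open>Record times and the last time at the supremum\<close>

context transient_exp_functional begin

definition Gset :: "'a \<Rightarrow> real set" where
  "Gset \<omega> = {t. 0 \<le> t \<and> \<omega> \<in> alive t \<and> \<omega> \<in> stays (X t \<omega>) 0 t}"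

definition G :: "'a \<Rightarrow> ennreal" where "G \<omega> = last_sup_time (\<lambda>t. X t \<omega>) (\<e> \<omega>)"

lemma G_eq: "G \<omega> = (SUP t\<in>Gset \<omega>. ennreal t)"
proof -
  have "{ennreal t | t. 0 \<le> t \<and> ennreal t < \<e> \<omega> \<and> run_sup (\<lambda>t. X t \<omega>) (ennreal t) = ereal (X t \<omega>)} = ennreal ` Gset \<omega>"
    unfolding Gset_def stays_def alive_def using run_sup_eq_end_iff[of _ "\<lambda>t. X t \<omega>"] by auto
  then show ?thesis unfolding G_def last_sup_time_def by simp
qed

text \<open>The almost sure properties under which all remaining path statements are deterministic.
  Ties are excluded at dyadic times only, which are countably many. A record time satisfies X_t
  \<ge> X_0 while alive, so the last clause bounds the record times.\<close>

definition regular :: "real \<Rightarrow> 'a \<Rightarrow> bool" where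
  "regular x \<omega> \<longleftrightarrow> \<omega> \<in> \<Omega> \<and> no_positive_jumps (\<lambda>t. X t \<omega>) \<and> X 0 \<omega> = x \<and> \<omega> \<in> alive 0 \<and>
     ereal x < Mx \<omega> \<and> Mx \<omega> < \<infinity> \<and> (\<forall>(i::nat) (m::nat). \<exists>n. \<forall>k. \<omega> \<notin> tie (real i / 2 ^ m) n k) \<and>
     (\<exists>T. \<forall>t\<ge>T. \<not> (\<omega> \<in> alive t \<and> X 0 \<omega> \<le> X t \<omega>))"

lemma AE_Mx_gt: "AE \<omega> in P x. ereal x < Mx \<omega>"
proof -
  have "emeasure (P x) {\<omega>\<in>\<Omega>. \<omega> \<in> passes x 0} = 1" using prob_passes[of x x] by simp
  then have "AE \<omega> in P x. \<omega> \<in> {\<omega>\<in>\<Omega>. \<omega> \<in> passes x 0}"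
    by (intro P.AE_prob_1) (simp add: measure_def)
  then show ?thesis by eventually_elim (simp add: passes_iff_Mx)
qed

lemma AE_Mx_less_PInf: "AE \<omega> in P x. Mx \<omega> < \<infinity>"
proof -
  have sets: "{\<omega>\<in>\<Omega>. Mx \<omega> = \<infinity>} \<in> sets (P x)" by (rule pred_P) measurable
  have "measure (P x) {\<omega>\<in>\<Omega>. Mx \<omega> = \<infinity>} \<le> exp (- \<Phi>) ^ n" for n
  proof -
    have "measure (P x) {\<omega>\<in>\<Omega>. Mx \<omega> = \<infinity>} \<le> measure (P x) {\<omega>\<in>\<Omega>. \<omega> \<in> passes (x + real n) 0}"
      by (rule P.finite_measure_mono) (auto simp: passes_iff_Mx intro!: pred_P passes_measurable)
    also have "\<dots> = exp (- \<Phi> * real n)" using prob_passes[of x "x + real n"] by (simp add: measure_def)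
    also have "\<dots> = exp (- \<Phi>) ^ n" by (simp add: exp_of_nat_mult[symmetric] mult.commute)
    finally show ?thesis .
  qed
  moreover have "(\<lambda>n. exp (- \<Phi>) ^ n) \<longlonglongrightarrow> 0" using Phi_pos by (intro LIMSEQ_realpow_zero) auto
  ultimately have "measure (P x) {\<omega>\<in>\<Omega>. Mx \<omega> = \<infinity>} \<le> 0" by (intro LIMSEQ_le_const[where X="\<lambda>n. exp (- \<Phi>) ^ n"]) auto
  then have "measure (P x) {\<omega>\<in>\<Omega>. Mx \<omega> = \<infinity>} = 0" by (simp add: measure_le_0_iff)
  then have "AE \<omega> in P x. \<omega> \<notin> {\<omega>\<in>\<Omega>. Mx \<omega> = \<infinity>}" using sets by (subst P.prob_eq_0[symmetric]) auto
  then show ?thesis using AE_space by eventually_elim auto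
qed

lemma AE_no_late_record: "AE \<omega> in P x. \<exists>T. \<forall>t\<ge>T. \<not> (\<omega> \<in> alive t \<and> X 0 \<omega> \<le> X t \<omega>)"
proof (cases "p = 0")
  case True
  show ?thesis using drift[OF True, of x]
  proof eventually_elim
    case (elim \<omega>)
    then have "\<forall>\<^sub>F t in at_top. X t \<omega> < X 0 \<omega>" by (auto simp: filterlim_at_bot_dense)
    then obtain T where "\<And>t. T \<le> t \<Longrightarrow> X t \<omega> < X 0 \<omega>" by (auto simp: eventually_at_top_linorder)
    then show ?case by (intro exI[of _ T]) (auto simp: not_le)
  qed
next
  case False
  then have "0 < p" using rate_nonneg by simp
  from AE_not_alive[OF this, of x] show ?thesis
  proof eventually_elim
    case (elim \<omega>)
    then obtain n :: nat where "\<omega> \<notin> alive (real n)" by blast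
    then show ?case using alive_antimono[of "real n"] by (intro exI[of _ "real n"]) auto
  qed
qed

lemma AE_regular: "AE \<omega> in P x. regular x \<omega>"
proof -
  have "AE \<omega> in P x. \<forall>(i::nat) (m::nat). \<exists>n. \<forall>k. \<omega> \<notin> tie (real i / 2 ^ m) n k"
    unfolding AE_all_countable by (intro allI AE_no_tie) simp
  then show ?thesis
    using AE_space no_pos_jumps[of x] start_at[of x] alive_0[of x] AE_Mx_gt[of x] AE_Mx_less_PInf[of x] AE_no_late_record[of x]
    by eventually_elim (simp add: regular_def)
qed

text \<open>\<tau> is the first passage time above a. X \<tau> = a makes it a record, and values
  above a occur arbitrarily soon after it, so no later u has stayed below the level.\<close>

lemma record_time:
  assumes reg: "regular x \<omega>" and a: "x \<le> a" "ereal a < Mx \<omega>"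
  obtains \<tau> where "\<tau> \<in> Gset \<omega>" "\<And>u. 0 \<le> u \<Longrightarrow> \<omega> \<in> stays a 0 u \<Longrightarrow> u \<le> \<tau>"
proof -
  have \<omega>: "\<omega> \<in> \<Omega>" and np: "no_positive_jumps (\<lambda>t. X t \<omega>)" and X0: "X 0 \<omega> \<le> a"
    using reg a by (auto simp: regular_def)
  obtain t where t: "0 \<le> t" "\<omega> \<in> alive t" "a < X t \<omega>" using a(2) by (auto simp: passes_iff_Mx[symmetric] passes_def)
  obtain \<tau> where \<tau>: "0 \<le> \<tau>" "\<tau> < t" "X \<tau> \<omega> = a" "\<omega> \<in> stays a 0 \<tau>" "\<And>t. \<tau> < t \<Longrightarrow> \<exists>v>\<tau>. v < t \<and> a < X v \<omega>"
    using first_passage[OF \<omega> np order_refl X0 t(1,3)] by blast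
  show ?thesis
  proof (rule that)
    show "\<tau> \<in> Gset \<omega>" using \<tau> t alive_antimono[of \<tau> t] by (auto simp: Gset_def)
    fix u assume u: "0 \<le> u" "\<omega> \<in> stays a 0 u"
    show "u \<le> \<tau>"
    proof (rule ccontr)
      assume "\<not> u \<le> \<tau>"
      then obtain v where v: "\<tau> < v" "v < u" "a < X v \<omega>" using \<tau>(5)[of u] by auto
      then have "v \<in> {0..u}" using \<tau>(1) by simp
      then have "X v \<omega> \<le> a" using u(2) unfolding stays_def by blast
      with v show False by simp
    qed
  qed
qed

text \<open>Up to the end point, [0,G] is the union over a below the supremum of the times until
  which the path stays at or below a. \<open>dom\<close> gives one inclusion through record times;
  \<open>inner\<close> gives the other and is where the absence of ties enters. Fatou's lemma along
  levels increasing to the supremum then identifies the integrals.\<close>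

lemma exp_functional_G:
  assumes reg: "regular x \<omega>"
  shows "exp_functional \<alpha> (\<lambda>t. X t \<omega>) (G \<omega>) = expI \<omega>" and "expI \<omega> < \<top>" and "G \<omega> < \<top>"
proof -
  have \<omega>: "\<omega> \<in> \<Omega>" and np: "no_positive_jumps (\<lambda>t. X t \<omega>)" and X0: "X 0 \<omega> = x" and al: "\<omega> \<in> alive 0"
    and M: "ereal x < Mx \<omega>" "Mx \<omega> < \<infinity>" and notie: "\<And>i m::nat. \<exists>n. \<forall>k. \<omega> \<notin> tie (real i / 2 ^ m) n k"
    and late: "\<exists>T. \<forall>t\<ge>T. \<not> (\<omega> \<in> alive t \<and> X 0 \<omega> \<le> X t \<omega>)"
    using reg by (auto simp: regular_def)
  obtain m where m: "Mx \<omega> = ereal m" using M by (cases "Mx \<omega>") auto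
  have xm: "x < m" using M m by simp
  have Xm: "X u \<omega> \<le> m" if "0 \<le> u" "\<omega> \<in> alive u" for u
  proof -
    have "ereal (X u \<omega>) \<le> Mx \<omega>" unfolding Mx_def using that by (intro SUP_upper) auto
    then show ?thesis by (simp add: m)
  qed
  obtain T where T: "\<And>t. T \<le> t \<Longrightarrow> \<not> (\<omega> \<in> alive t \<and> X 0 \<omega> \<le> X t \<omega>)" using late by blast
  have GT: "t < T" if "t \<in> Gset \<omega>" for t
    using that T[of t] by (force simp: Gset_def stays_def)
  have "G \<omega> \<le> ennreal (max 0 T)"
    unfolding G_eq using GT by (intro SUP_least ennreal_leI) (meson less_imp_le less_max_iff_disj)
  then show Gfin: "G \<omega> < \<top>" using le_less_trans ennreal_less_top by blast
  obtain g where g: "G \<omega> = ennreal g" "0 \<le> g" using Gfin by (cases "G \<omega>") auto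
  have Gset_le: "t \<le> g" if "t \<in> Gset \<omega>" for t
  proof -
    have "ennreal t \<le> G \<omega>" unfolding G_eq using that by (intro SUP_upper)
    then show ?thesis using g by (simp add: ennreal_le_iff)
  qed
  have below_G: "\<exists>t\<in>Gset \<omega>. u < t" if "0 \<le> u" "u < g" for u
  proof -
    have "ennreal u < G \<omega>" using that g by (simp add: ennreal_less_iff)
    then obtain t where "t \<in> Gset \<omega>" "ennreal u < ennreal t" unfolding G_eq less_SUP_iff by blast
    then show ?thesis using that by (auto simp: ennreal_less_iff)
  qed
  have dom: "u \<le> g" if u: "0 \<le> u" "\<omega> \<in> stays a 0 u" and a: "a < m" for u a
  proof -
    have "X 0 \<omega> \<le> a" using u by (auto simp: stays_def)
    then obtain \<tau> where "\<tau> \<in> Gset \<omega>" "u \<le> \<tau>"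
      using record_time[OF reg, of a] a u X0 m by auto
    then show ?thesis using Gset_le by fastforce
  qed
  have inner: "\<omega> \<in> alive u \<and> (\<exists>r<m. \<omega> \<in> stays r 0 u)" if u: "0 \<le> u" "u < g" for u
  proof -
    obtain t where t: "t \<in> Gset \<omega>" "u < t" using below_G[OF u] by blast
    then have t': "0 \<le> t" "\<omega> \<in> alive t" "\<omega> \<in> stays (X t \<omega>) 0 t" by (auto simp: Gset_def)
    have alu: "\<omega> \<in> alive u" using alive_antimono[of u t] t t' by auto
    have "\<exists>r<m. \<omega> \<in> stays r 0 u"
    proof (cases "X t \<omega> < m")
      case True
      have "\<omega> \<in> stays (X t \<omega>) 0 u" using t' t by (auto simp: stays_def)
      with True show ?thesis by blast
    next
      case False
      then have Xt: "X t \<omega> = m" using Xm[OF t'(1,2)] by simp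
      show ?thesis
      proof (rule ccontr)
        \<comment> \<open>If the path up to u already has supremum m, so does the path up to any q
          between u and t, while X t = m is attained later. A dyadic q there would produce a tie at
          every mesh.\<close>
        assume no: "\<not> ?thesis"
        from order_tendstoD(2)[OF LIMSEQ_half_pow[of 1], of "t - u"] t(2)
        obtain j where j: "1 / 2 ^ j < t - u" by (auto simp: eventually_sequentially)
        define q where "q = dyadic_above j u"
        have q: "u < q" "q < t" using dyadic_above_bounds[OF u(1), of j] j by (auto simp: q_def)
        have q0: "0 \<le> q" using q u by simp
        obtain n where n: "\<And>k. \<omega> \<notin> tie q n k"
          using notie[of "Suc (nat \<lfloor>u * 2 ^ j\<rfloor>)" j] by (auto simp: q_def dyadic_above_def)
        have "\<exists>k. \<omega> \<in> tie q n k"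
        proof (rule tieI[OF \<omega> q0])
          show alq: "\<omega> \<in> alive q" using alive_antimono[of q t] q t' by auto
          show "\<omega> \<in> stays m 0 q" unfolding stays_def
          proof (intro CollectI ballI)
            fix v assume "v \<in> {0..q}"
            then show "X v \<omega> \<le> m" using Xm[of v] alive_antimono[of v q] alq by auto
          qed
          show "\<omega> \<notin> stays r 0 q" if "r < m" for r
          proof
            assume "\<omega> \<in> stays r 0 q"
            then have "\<omega> \<in> stays r 0 u" using q by (auto simp: stays_def)
            then show False using no that by blast
          qed
        qed (use q t' Xt Xm in auto)
        then show False using n by blast
      qed
    qed
    with alu show ?thesis by blast
  qed
  define I where "I = (\<integral>\<^sup>+ u \<in> times_upto (G \<omega>). ennreal (exp (\<alpha> * X u \<omega>)) \<partial>lborel)"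
  have tu: "times_upto (G \<omega>) = {0..g}" unfolding times_upto_def g using g(2) by (auto simp: ennreal_le_iff)
  have le: "expfun r \<omega> \<le> I" if "ereal r < Mx \<omega>" for r
    unfolding expfun_def I_def tu
  proof (rule nn_integral_mono)
    fix u :: real
    show "ennreal (surv \<alpha> r 0 (max 0 u) \<omega>) * indicator {0..} u \<le> ennreal (exp (\<alpha> * X u \<omega>)) * indicator {0..g} u"
      using dom[of u r] that m by (auto simp: indicator_def surv_def max_absorb2)
  qed
  have ge1: "expI \<omega> \<le> I" unfolding expI_def using le by (intro SUP_least) auto
  define a where "a n = m - 1 / 2 ^ n" for n :: nat
  have a: "ereal (a n) < Mx \<omega>" for n by (simp add: a_def m)
  have a_lim: "a \<longlonglongrightarrow> m" unfolding a_def using tendsto_diff[OF tendsto_const LIMSEQ_half_pow[of 1], of m] by simp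
  have a_ev: "\<forall>\<^sub>F n in sequentially. r < a n" if "r < m" for r using order_tendstoD(1)[OF a_lim that] .
  have sm: "(\<lambda>u. surv \<alpha> b 0 (max 0 u) \<omega>) \<in> borel_measurable borel" for b
  proof -
    have "(\<lambda>u. (u, \<omega>)) \<in> measurable borel (borel \<Otimes>\<^sub>M P 0)" using \<omega> by (intro measurable_Pair) auto
    from measurable_compose[OF this progressive_measurable_P[OF progressive_surv[OF order_refl, of \<alpha> b], of 0]]
    show ?thesis by simp
  qed
  have "I \<le> (\<integral>\<^sup>+u. liminf (\<lambda>n. ennreal (surv \<alpha> (a n) 0 (max 0 u) \<omega>) * indicator {0..} u) \<partial>lborel)"
    unfolding I_def tu
  proof (rule nn_integral_mono_AE)
    \<comment> \<open>The path need not be alive at g, which may be the killing time, so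
      \<open>inner\<close> says nothing there; a single point is null.\<close>
    have "AE u in lborel. u \<noteq> g" by (rule AE_lborel_singleton)
    then show "AE u in lborel. ennreal (exp (\<alpha> * X u \<omega>)) * indicator {0..g} u \<le>
       liminf (\<lambda>n. ennreal (surv \<alpha> (a n) 0 (max 0 u) \<omega>) * indicator {0..} u)"
    proof eventually_elim
      case (elim u)
      show ?case
      proof (cases "u \<in> {0..g}")
        case True
        with elim have u: "0 \<le> u" "u < g" by auto
        from inner[OF u] obtain r where r: "\<omega> \<in> alive u" "r < m" "\<omega> \<in> stays r 0 u" by blast
        have "\<forall>\<^sub>F n in sequentially. ennreal (exp (\<alpha> * X u \<omega>)) * indicator {0..g} u \<le> ennreal (surv \<alpha> (a n) 0 (max 0 u) \<omega>) * indicator {0..} u"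
          using a_ev[OF r(2)]
        proof eventually_elim
          case (elim n)
          then have "\<omega> \<in> stays (a n) 0 u" using r(3) by (force simp: stays_def)
          then show ?case using r(1) u by (simp add: surv_def max_absorb2)
        qed
        then show ?thesis by (rule Liminf_bounded)
      qed simp
    qed
  qed
  also have "\<dots> \<le> liminf (\<lambda>n. \<integral>\<^sup>+u. ennreal (surv \<alpha> (a n) 0 (max 0 u) \<omega>) * indicator {0..} u \<partial>lborel)"
    by (rule nn_integral_liminf) (use sm in measurable)
  also have "\<dots> \<le> expI \<omega>"
    by (rule Liminf_le[OF sequentially_bot], rule always_eventually) (use expfun_le_expI[OF a] in \<open>auto simp: expfun_def\<close>)
  finally have "I \<le> expI \<omega>" .
  with ge1 have I_eq: "I = expI \<omega>" by simp
  then show "exp_functional \<alpha> (\<lambda>t. X t \<omega>) (G \<omega>) = expI \<omega>" by (simp add: exp_functional_def I_def)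
  have "I \<le> (\<integral>\<^sup>+u. ennreal (exp (\<alpha> * m)) * indicator {0..g} u \<partial>lborel)"
    unfolding I_def tu
  proof (rule nn_integral_mono_AE)
    have "AE u in lborel. u \<noteq> g" by (rule AE_lborel_singleton)
    then show "AE u in lborel. ennreal (exp (\<alpha> * X u \<omega>)) * indicator {0..g} u \<le> ennreal (exp (\<alpha> * m)) * indicator {0..g} u"
    proof eventually_elim
      case (elim u)
      show ?case
      proof (cases "u \<in> {0..g}")
        case True
        with elim have "\<omega> \<in> alive u" using inner[of u] by auto
        then show ?thesis using True Xm[of u] alpha_pos by (auto intro!: ennreal_leI)
      qed simp
    qed
  qed
  also have "\<dots> = ennreal (exp (\<alpha> * m)) * ennreal g" using g(2) by (simp add: nn_integral_cmult_indicator)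
  also have "\<dots> < \<top>" by (simp add: ennreal_mult[symmetric] g(2) flip: ennreal_mult')
  finally show "expI \<omega> < \<top>" using I_eq by simp
qed

end

section \<open>Conditioning on the supremum\<close>

text \<open>Serves for the functional and the conditioning variable, which are known only to agree
  almost surely with measurable functions.\<close>

lemma measurable_completion_AE_eq:
  assumes f: "f \<in> measurable M N" and g: "g \<in> space M \<rightarrow> space N" and ae: "AE x in M. f x = g x"
  shows "g \<in> measurable (completion M) N"
proof (rule measurableI)
  show "x \<in> space (completion M) \<Longrightarrow> g x \<in> space N" for x using g by auto
  fix A assume A: "A \<in> sets N"
  show "g -` A \<inter> space (completion M) \<in> sets (completion M)"
  proof (rule completion.in_sets_AE)
    show "f -` A \<inter> space M \<in> sets (completion M)" using measurable_sets[OF f A] by simp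
    show "AE x in completion M. x \<in> f -` A \<inter> space M \<longleftrightarrow> x \<in> g -` A \<inter> space (completion M)"
      using AE_completion[OF ae] by eventually_elim auto
  qed auto
qed

context transient_exp_functional begin

definition level :: "real \<Rightarrow> nat \<Rightarrow> nat \<Rightarrow> real" where "level b n k = b + real k / 2 ^ n"

definition band :: "real \<Rightarrow> nat \<Rightarrow> nat \<Rightarrow> 'a set" where
  "band b n k = {\<omega>\<in>\<Omega>. \<omega> \<in> passes (level b n k) 0 \<and> \<omega> \<notin> passes (level b n (Suc k)) 0}"

lemma level_mono: "level b n k < level b n (Suc k)" "b \<le> level b n k"
  by (auto simp: level_def divide_strict_right_mono)

lemma passes_antimono: "a \<le> a' \<Longrightarrow> \<omega> \<in> passes a' 0 \<Longrightarrow> \<omega> \<in> passes a 0"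
  by (force simp: passes_def)

lemma band_sets [measurable]: "band b n k \<in> sets (P x)"
proof -
  have [measurable]: "Measurable.pred (P x) (\<lambda>\<omega>. \<omega> \<in> passes a 0)" for a by (rule passes_measurable) simp
  show ?thesis unfolding band_def by (rule pred_P) measurable
qed

text \<open>The passage identity has two separate levels. The functional stays stopped at the lower
  edge of the slice, while the passed level is taken as either edge; subtracting the two instances
  restricts to paths whose supremum lies in the slice.\<close>

lemma band_expectation:
  assumes xb: "x \<le> b"
  shows "(\<integral>\<^sup>+\<omega>. indicator (band b n k) \<omega> * ennreal (exp (- \<gamma> * enn2real (expfun (level b n k) \<omega>))) \<partial>P x) =
    ennreal (rho x / rho (level b n k)) * emeasure (P x) (band b n k)"
proof -
  have [measurable]: "Measurable.pred (P x) (\<lambda>\<omega>. \<omega> \<in> passes a 0)" for a by (rule passes_measurable) simp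
  let ?a = "level b n k" and ?a' = "level b n (Suc k)"
  have le: "x \<le> ?a" "?a \<le> ?a'" using level_mono[of b n k] xb by auto
  define E where "E c = exp (- \<Phi> * (c - x))" for c
  define \<theta> where "\<theta> = rho x / rho ?a"
  have \<theta>0: "0 \<le> \<theta>" using rho_ge_1[of x] rho_ge_1[of ?a] by (simp add: \<theta>_def)
  have E: "0 \<le> E c" for c by (simp add: E_def)
  have EE: "E ?a' \<le> E ?a" using le Phi_pos by (simp add: E_def)
  \<comment> \<open>Used twice, with the exponential functional and with the constant 1. Both
    expectations are proportional to E ?a - E ?a', so their ratio is \<theta>.\<close>
  have gen: "(\<integral>\<^sup>+\<omega>. indicator (band b n k) \<omega> * ennreal (h \<omega>) \<partial>P x) = ennreal (c * (E ?a - E ?a'))"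
    if [measurable]: "h \<in> borel_measurable (P x)" and c: "0 \<le> c"
      and h: "\<And>d. ?a \<le> d \<Longrightarrow> (\<integral>\<^sup>+\<omega>. indicator (passes d 0) \<omega> * ennreal (h \<omega>) \<partial>P x) = ennreal (E d * c)" for h c
  proof -
    have "(\<integral>\<^sup>+\<omega>. indicator (passes ?a 0) \<omega> * ennreal (h \<omega>) \<partial>P x) =
       (\<integral>\<^sup>+\<omega>. indicator (band b n k) \<omega> * ennreal (h \<omega>) + indicator (passes ?a' 0) \<omega> * ennreal (h \<omega>) \<partial>P x)"
      by (rule nn_integral_cong) (use passes_antimono[OF le(2)] in \<open>auto simp: band_def indicator_def\<close>)
    also have "\<dots> = (\<integral>\<^sup>+\<omega>. indicator (band b n k) \<omega> * ennreal (h \<omega>) \<partial>P x) + (\<integral>\<^sup>+\<omega>. indicator (passes ?a' 0) \<omega> * ennreal (h \<omega>) \<partial>P x)"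
      by (rule nn_integral_add) measurable
    finally have eq: "ennreal (E ?a * c) = (\<integral>\<^sup>+\<omega>. indicator (band b n k) \<omega> * ennreal (h \<omega>) \<partial>P x) + ennreal (E ?a' * c)"
      using h[OF order_refl] h[OF le(2)] by simp
    then have "(\<integral>\<^sup>+\<omega>. indicator (band b n k) \<omega> * ennreal (h \<omega>) \<partial>P x) \<le> ennreal (E ?a * c)"
      by (metis add_increasing2 order_refl zero_le)
    then obtain r where r: "(\<integral>\<^sup>+\<omega>. indicator (band b n k) \<omega> * ennreal (h \<omega>) \<partial>P x) = ennreal r" "0 \<le> r"
      by (cases "\<integral>\<^sup>+\<omega>. indicator (band b n k) \<omega> * ennreal (h \<omega>) \<partial>P x") (auto simp: top_unique)
    have "E ?a * c = r + E ?a' * c"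
      using eq r c E by (simp add: ennreal_plus[symmetric] ennreal_inj del: ennreal_plus)
    then have "r = c * (E ?a - E ?a')" by (simp add: algebra_simps)
    with r show ?thesis by simp
  qed
  have "(\<integral>\<^sup>+\<omega>. indicator (band b n k) \<omega> * ennreal (exp (- \<gamma> * enn2real (expfun ?a \<omega>))) \<partial>P x) = ennreal (\<theta> * (E ?a - E ?a'))"
  proof (rule gen[OF _ \<theta>0])
    show "(\<integral>\<^sup>+\<omega>. indicator (passes d 0) \<omega> * ennreal (exp (- \<gamma> * enn2real (expfun ?a \<omega>))) \<partial>P x) = ennreal (E d * \<theta>)"
      if "?a \<le> d" for d
      unfolding E_def \<theta>_def by (rule expectation_exp_functional_passage[OF le(1) that])
  qed measurable
  moreover have "(\<integral>\<^sup>+\<omega>. indicator (band b n k) \<omega> * ennreal 1 \<partial>P x) = ennreal (1 * (E ?a - E ?a'))"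
  proof (rule gen)
    fix d assume "?a \<le> d"
    have "(\<integral>\<^sup>+\<omega>. indicator (passes d 0) \<omega> * ennreal 1 \<partial>P x) = (\<integral>\<^sup>+\<omega>. indicator {\<omega>\<in>\<Omega>. \<omega> \<in> passes d 0} \<omega> \<partial>P x)"
      by (rule nn_integral_cong) (auto simp: indicator_def)
    also have "\<dots> = ennreal (E d)"
      using prob_passes[of x d] le \<open>?a \<le> d\<close> by (subst nn_integral_indicator) (auto simp: E_def intro!: pred_P)
    finally show "(\<integral>\<^sup>+\<omega>. indicator (passes d 0) \<omega> * ennreal 1 \<partial>P x) = ennreal (E d * 1)" by simp
  qed auto
  ultimately show ?thesis using \<theta>0 EE by (simp add: \<theta>_def[symmetric] ennreal_mult)
qed

lemma band_exists:
  assumes \<omega>: "\<omega> \<in> \<Omega>" and m: "Mx \<omega> = ereal m" "b < m"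
  obtains k where "\<omega> \<in> band b n k" "level b n k < m" "m - 1 / 2 ^ n \<le> level b n k" "\<And>j. \<omega> \<in> band b n j \<Longrightarrow> j = k"
proof -
  define k where "k = nat (\<lceil>(m - b) * 2 ^ n\<rceil> - 1)"
  have "0 < (m - b) * 2 ^ n" using m by simp
  then have "0 < \<lceil>(m - b) * 2 ^ n\<rceil>" by simp
  then have "real k = of_int \<lceil>(m - b) * 2 ^ n\<rceil> - 1" by (simp add: k_def)
  then have "real k < (m - b) * 2 ^ n" "(m - b) * 2 ^ n \<le> real k + 1" by linarith+
  then have k: "level b n k < m" "m \<le> level b n (Suc k)" by (auto simp: level_def field_simps)
  have lS: "level b n (Suc j) = level b n j + 1 / 2 ^ n" for j by (simp add: level_def field_simps)
  have iff: "\<omega> \<in> band b n j \<longleftrightarrow> level b n j < m \<and> m \<le> level b n (Suc j)" for j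
    using \<omega> m by (auto simp: band_def passes_iff_Mx not_less)
  have mono: "i \<le> j \<Longrightarrow> level b n i \<le> level b n j" for i j by (simp add: level_def divide_right_mono)
  show ?thesis
  proof (rule that)
    show "\<omega> \<in> band b n k" using k iff by simp
    show "level b n k < m" by (rule k)
    show "m - 1 / 2 ^ n \<le> level b n k" using k(2) lS[of k] by simp
    fix j assume "\<omega> \<in> band b n j"
    then have j: "level b n j < m" "m \<le> level b n (Suc j)" using iff by auto
    show "j = k"
    proof (rule ccontr)
      assume "j \<noteq> k"
      then consider "Suc j \<le> k" | "Suc k \<le> j" by linarith
      then show False using mono[of "Suc j" k] mono[of "Suc k" j] j k by cases auto
    qed
  qed
qed

lemma suminf_band:
  assumes "\<And>j. \<omega> \<in> band b n j \<Longrightarrow> j = k" "\<omega> \<in> band b n k"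
  shows "(\<Sum>j. indicator (band b n j) \<omega> * (f j :: ennreal)) = f k"
proof -
  have "(\<Sum>j. indicator (band b n j) \<omega> * f j) = (\<Sum>j\<in>{k}. indicator (band b n j) \<omega> * f j)"
    by (rule suminf_finite) (use assms(1) in \<open>auto simp: indicator_def\<close>)
  then show ?thesis using assms(2) by simp
qed

lemma suminf_band_bound:
  assumes "\<omega> \<in> \<Omega>" "Mx \<omega> = ereal m" "\<And>j. f j \<le> (c :: ennreal)"
  shows "(\<Sum>j. indicator (band b n j) \<omega> * f j) \<le> c"
proof (cases "b < m")
  case True
  obtain k where k: "\<omega> \<in> band b n k" "\<And>j. \<omega> \<in> band b n j \<Longrightarrow> j = k" using band_exists[OF assms(1,2) True, of n] by blast
  have "(\<Sum>j. indicator (band b n j) \<omega> * f j) = f k"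
    by (rule suminf_band[OF _ k(1)]) (rule k(2))
  then show ?thesis using assms(3)[of k] by (simp only:)
next
  case False
  have "\<omega> \<notin> band b n j" for j
    using level_mono(2)[of b n j] False assms(2) by (auto simp: band_def passes_iff_Mx)
  then show ?thesis by (simp add: indicator_def)
qed

text \<open>On each slice the identity holds with the lower edge in place of the supremum. As the
  mesh shrinks the edge tends to the supremum from strictly below, so the stopped functionals tend
  to \<open>expI\<close>, \<rho> converges by continuity, and both sums are dominated by
  constants.\<close>

lemma ray_identity:
  assumes xb: "x \<le> b"
  shows "(\<integral>\<^sup>+\<omega>. indicator (passes b 0) \<omega> * ennreal (exp (- \<gamma> * enn2real (expI \<omega>))) \<partial>P x) =
    (\<integral>\<^sup>+\<omega>. indicator (passes b 0) \<omega> * ennreal (rho x / rho (real_of_ereal (Mx \<omega>))) \<partial>P x)"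
proof -
  have [measurable]: "Measurable.pred (P x) (\<lambda>\<omega>. \<omega> \<in> passes a 0)" for a by (rule passes_measurable) simp
  define u where "u n \<omega> = (\<Sum>k. indicator (band b n k) \<omega> * ennreal (exp (- \<gamma> * enn2real (expfun (level b n k) \<omega>))))" for n \<omega>
  define v where "v n \<omega> = (\<Sum>k. indicator (band b n k) \<omega> * ennreal (rho x / rho (level b n k)))" for n \<omega>
  have [measurable]: "u n \<in> borel_measurable (P x)" "v n \<in> borel_measurable (P x)" for n
    unfolding u_def v_def by measurable
  have uv: "(\<integral>\<^sup>+\<omega>. u n \<omega> \<partial>P x) = (\<integral>\<^sup>+\<omega>. v n \<omega> \<partial>P x)" for n
  proof -
    have "(\<integral>\<^sup>+\<omega>. u n \<omega> \<partial>P x) = (\<Sum>k. \<integral>\<^sup>+\<omega>. indicator (band b n k) \<omega> * ennreal (exp (- \<gamma> * enn2real (expfun (level b n k) \<omega>))) \<partial>P x)"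
      unfolding u_def by (rule nn_integral_suminf) measurable
    also have "\<dots> = (\<Sum>k. \<integral>\<^sup>+\<omega>. indicator (band b n k) \<omega> * ennreal (rho x / rho (level b n k)) \<partial>P x)"
      unfolding band_expectation[OF xb] by (simp add: nn_integral_multc mult.commute)
    also have "\<dots> = (\<integral>\<^sup>+\<omega>. v n \<omega> \<partial>P x)" unfolding v_def by (rule nn_integral_suminf[symmetric]) measurable
    finally show ?thesis .
  qed
  have rx: "rho x / rho c \<le> rho x" "0 \<le> rho x / rho c" for c
    using rho_ge_1[of x] rho_ge_1[of c] by (auto simp: divide_le_eq mult_le_cancel_left1)
  have fin: "AE \<omega> in P x. \<exists>m. Mx \<omega> = ereal m"
    using AE_regular[of x]
  proof eventually_elim
    case (elim \<omega>)
    then show ?case by (cases "Mx \<omega>") (auto simp: regular_def)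
  qed
  have lim: "AE \<omega> in P x. (\<lambda>n. u n \<omega>) \<longlonglongrightarrow> indicator (passes b 0) \<omega> * ennreal (exp (- \<gamma> * enn2real (expI \<omega>))) \<and>
     (\<lambda>n. v n \<omega>) \<longlonglongrightarrow> indicator (passes b 0) \<omega> * ennreal (rho x / rho (real_of_ereal (Mx \<omega>)))"
    using AE_regular[of x] fin
  proof eventually_elim
    case (elim \<omega>)
    then obtain m where m: "Mx \<omega> = ereal m" by blast
    have \<omega>: "\<omega> \<in> \<Omega>" using elim by (simp add: regular_def)
    show ?case
    proof (cases "b < m")
      case True
      then have p: "\<omega> \<in> passes b 0" using m by (simp add: passes_iff_Mx)
      have "\<exists>k. \<omega> \<in> band b n k \<and> level b n k < m \<and> m - 1 / 2 ^ n \<le> level b n k \<and> (\<forall>j. \<omega> \<in> band b n j \<longrightarrow> j = k)" for n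
        by (rule band_exists[OF \<omega> m True, of n]) blast
      then obtain k where k: "\<And>n. \<omega> \<in> band b n (k n)" "\<And>n. level b n (k n) < m" "\<And>n. m - 1 / 2 ^ n \<le> level b n (k n)"
        "\<And>n j. \<omega> \<in> band b n j \<Longrightarrow> j = k n" by metis
      let ?a = "\<lambda>n. level b n (k n)"
      have a_lim: "?a \<longlonglongrightarrow> m"
      proof (rule tendsto_sandwich[of "\<lambda>n. m - 1 / 2 ^ n" _ _ "\<lambda>_. m"])
        show "(\<lambda>n. m - 1 / 2 ^ n) \<longlonglongrightarrow> m" using tendsto_diff[OF tendsto_const LIMSEQ_half_pow[of 1], of m] by simp
      qed (use k in \<open>auto intro!: always_eventually less_imp_le\<close>)
      have "(\<lambda>n. expfun (?a n) \<omega>) \<longlonglongrightarrow> expI \<omega>"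
        by (rule expfun_tendsto) (use k(2) m order_tendstoD(1)[OF a_lim] in auto)
      moreover have "expI \<omega> = ennreal (enn2real (expI \<omega>))" using exp_functional_G(2)[OF elim(1)] by simp
      ultimately have "(\<lambda>n. enn2real (expfun (?a n) \<omega>)) \<longlonglongrightarrow> enn2real (expI \<omega>)"
        by (metis enn2real_nonneg tendsto_enn2real)
      from tendsto_ennrealI[OF tendsto_exp[OF tendsto_mult[OF tendsto_const this]]]
      have 1: "(\<lambda>n. ennreal (exp (- \<gamma> * enn2real (expfun (?a n) \<omega>)))) \<longlonglongrightarrow> ennreal (exp (- \<gamma> * enn2real (expI \<omega>)))" .
      have "(\<lambda>n. rho (?a n)) \<longlonglongrightarrow> rho m" by (rule isCont_tendsto_compose[OF isCont_rho a_lim])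
      then have 2: "(\<lambda>n. ennreal (rho x / rho (?a n))) \<longlonglongrightarrow> ennreal (rho x / rho m)"
        using rho_ge_1[of m] by (intro tendsto_ennrealI tendsto_intros) auto
      have ueq: "u n \<omega> = ennreal (exp (- \<gamma> * enn2real (expfun (?a n) \<omega>)))" for n
        unfolding u_def by (rule suminf_band[OF k(4) k(1)])
      have veq: "v n \<omega> = ennreal (rho x / rho (?a n))" for n
        unfolding v_def by (rule suminf_band[OF k(4) k(1)])
      show ?thesis using 1 2 p m by (simp add: ueq veq)
    next
      case False
      have "\<omega> \<notin> band b n j" for n j
        using level_mono(2)[of b n j] False m by (auto simp: band_def passes_iff_Mx)
      then have "u n \<omega> = 0" "v n \<omega> = 0" for n by (auto simp: u_def v_def indicator_def)
      moreover have "\<omega> \<notin> passes b 0" using False m by (simp add: passes_iff_Mx)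
      ultimately show ?thesis by simp
    qed
  qed
  have "(\<lambda>n. \<integral>\<^sup>+\<omega>. u n \<omega> \<partial>P x) \<longlonglongrightarrow> (\<integral>\<^sup>+\<omega>. indicator (passes b 0) \<omega> * ennreal (exp (- \<gamma> * enn2real (expI \<omega>))) \<partial>P x)"
  proof (rule nn_integral_dominated_convergence[where w="\<lambda>_. 1"])
    show "AE \<omega> in P x. u n \<omega> \<le> 1" for n
      using fin AE_space unfolding u_def
    proof eventually_elim
      case (elim \<omega>)
      then obtain m where "Mx \<omega> = ereal m" "\<omega> \<in> \<Omega>" by auto
      then show ?case using gamma_nonneg by (intro suminf_band_bound) (auto simp: ennreal_le_1)
    qed
    show "AE \<omega> in P x. (\<lambda>n. u n \<omega>) \<longlonglongrightarrow> indicator (passes b 0) \<omega> * ennreal (exp (- \<gamma> * enn2real (expI \<omega>)))"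
      using lim by eventually_elim simp
  qed (auto simp: P.emeasure_space_1[simplified])
  moreover have "(\<lambda>n. \<integral>\<^sup>+\<omega>. v n \<omega> \<partial>P x) \<longlonglongrightarrow> (\<integral>\<^sup>+\<omega>. indicator (passes b 0) \<omega> * ennreal (rho x / rho (real_of_ereal (Mx \<omega>))) \<partial>P x)"
  proof (rule nn_integral_dominated_convergence[where w="\<lambda>_. ennreal (rho x)"])
    show "AE \<omega> in P x. v n \<omega> \<le> ennreal (rho x)" for n
      using fin AE_space unfolding v_def
    proof eventually_elim
      case (elim \<omega>)
      then obtain m where "Mx \<omega> = ereal m" "\<omega> \<in> \<Omega>" by auto
      then show ?case using rx by (intro suminf_band_bound ennreal_leI) auto
    qed
    show "AE \<omega> in P x. (\<lambda>n. v n \<omega>) \<longlonglongrightarrow> indicator (passes b 0) \<omega> * ennreal (rho x / rho (real_of_ereal (Mx \<omega>)))"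
      using lim by eventually_elim simp
  qed (auto simp: P.emeasure_space_1[simplified])
  ultimately show ?thesis unfolding uv by (rule LIMSEQ_unique)
qed

text \<open>A common form for both claims, with the conditioning variable an arbitrary measurable
  function \<theta> of the supremum. The candidate is tested on its sigma-algebra through two finite
  measures on the line which agree on rays, and therefore on all Borel sets.\<close>

theorem cond_exp_given_function_of_Mx:
  fixes Zf :: "'a \<Rightarrow> ereal" and \<theta> :: "real \<Rightarrow> real" and h :: "ereal \<Rightarrow> real"
  assumes f: "AE \<omega> in P x. f \<omega> = exp (- \<gamma> * enn2real (expI \<omega>))"
    and Zf: "AE \<omega> in P x. Zf \<omega> = ereal (\<theta> (real_of_ereal (Mx \<omega>)))"
    and \<theta> [measurable]: "\<theta> \<in> borel_measurable borel" and h [measurable]: "h \<in> borel_measurable borel"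
    and hZ: "AE \<omega> in P x. h (Zf \<omega>) = rho x / rho (real_of_ereal (Mx \<omega>))"
  shows "AE \<omega> in P x. cond_exp_given (P x) f Zf \<omega> = h (Zf \<omega>)"
proof -
  let ?C = "completion (P x)" and ?S = "vimage_algebra \<Omega> Zf borel"
  let ?M = "\<lambda>\<omega>. real_of_ereal (Mx \<omega>)"
  let ?H = "\<lambda>\<omega>. exp (- \<gamma> * enn2real (expI \<omega>))" and ?R = "\<lambda>\<omega>. rho x / rho (?M \<omega>)"
  have R: "0 \<le> ?R \<omega>" "?R \<omega> \<le> rho x" for \<omega>
    using rho_ge_1[of x] rho_ge_1[of "?M \<omega>"] by (auto simp: divide_le_eq mult_le_cancel_left1)
  have H: "0 \<le> ?H \<omega>" "?H \<omega> \<le> 1" for \<omega> using gamma_nonneg by auto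
  have spC: "space ?C = \<Omega>" by simp
  have Zm: "Zf \<in> borel_measurable ?C"
  proof (rule measurable_completion_AE_eq)
    show "AE \<omega> in P x. ereal (\<theta> (?M \<omega>)) = Zf \<omega>" using Zf by eventually_elim simp
  qed auto
  have fm: "f \<in> borel_measurable ?C"
  proof (rule measurable_completion_AE_eq)
    show "AE \<omega> in P x. ?H \<omega> = f \<omega>" using f by eventually_elim simp
  qed auto
  have sub: "subalgebra ?C ?S"
    using sets_image_in_sets[OF spC Zm] by (simp add: subalgebra_def)
  have "finite_measure ?C"
    by (rule finite_measureI) (use P.emeasure_space_1[of x] sets.top[of "P x"] in \<open>simp add: emeasure_completion\<close>)
  then interpret C: finite_measure_subalgebra ?C ?S
    by (intro finite_measure_subalgebra.intro finite_measure_subalgebra_axioms.intro sub)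
  \<comment> \<open>The image on the real line, under the supremum, of the measure with density g;
    it is used for the functional ?H and for the candidate ?R.\<close>
  define \<mu> where "\<mu> g = distr (density (P x) (\<lambda>\<omega>. ennreal (g \<omega>))) borel ?M" for g :: "'a \<Rightarrow> real"
  have \<mu>: "emeasure (\<mu> g) B = (\<integral>\<^sup>+\<omega>. indicator B (?M \<omega>) * ennreal (g \<omega>) \<partial>P x)"
    if [measurable]: "g \<in> borel_measurable (P x)" "B \<in> sets borel" for g B
  proof -
    have "emeasure (\<mu> g) B = emeasure (density (P x) (\<lambda>\<omega>. ennreal (g \<omega>))) (?M -` B \<inter> space (P x))"
      unfolding \<mu>_def by (subst emeasure_distr) auto
    also have "\<dots> = (\<integral>\<^sup>+\<omega>. ennreal (g \<omega>) * indicator (?M -` B \<inter> space (P x)) \<omega> \<partial>P x)"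
      by (rule emeasure_density) measurable
    also have "\<dots> = (\<integral>\<^sup>+\<omega>. indicator B (?M \<omega>) * ennreal (g \<omega>) \<partial>P x)"
      by (rule nn_integral_cong) (auto simp: indicator_def)
    finally show ?thesis .
  qed
  have mH: "?H \<in> borel_measurable (P x)" and mR: "?R \<in> borel_measurable (P x)" by measurable
  \<comment> \<open>\<open>ray_identity\<close> concerns levels from x upwards. For b below x the
    level x serves as well, since the supremum exceeds x almost surely.\<close>
  have ray: "emeasure (\<mu> g) {b<..} = (\<integral>\<^sup>+\<omega>. indicator (passes (max b x) 0) \<omega> * ennreal (g \<omega>) \<partial>P x)"
    if [measurable]: "g \<in> borel_measurable (P x)" for g b
  proof -
    have "AE \<omega> in P x. indicator {b<..} (?M \<omega>) * ennreal (g \<omega>) = indicator (passes (max b x) 0) \<omega> * ennreal (g \<omega>)"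
      using AE_regular[of x]
    proof eventually_elim
      case (elim \<omega>)
      then obtain m where "Mx \<omega> = ereal m" "x < m" by (cases "Mx \<omega>") (auto simp: regular_def)
      then show ?case by (auto simp: indicator_def passes_iff_Mx)
    qed
    then show ?thesis by (subst \<mu>) (auto intro: nn_integral_cong_AE)
  qed
  have bound: "emeasure (\<mu> g) B < \<infinity>"
    if [measurable]: "g \<in> borel_measurable (P x)" "B \<in> sets borel" and g: "\<And>\<omega>. g \<omega> \<le> c" for g B c
  proof -
    have "emeasure (\<mu> g) B \<le> (\<integral>\<^sup>+\<omega>. ennreal c \<partial>P x)"
      unfolding \<mu>[OF that(1,2)] using g by (intro nn_integral_mono) (auto simp: indicator_def intro: ennreal_leI)
    then show ?thesis by (simp add: P.emeasure_space_1[simplified] le_less_trans)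
  qed
  have \<mu>_eq: "\<mu> ?H = \<mu> ?R"
  proof (rule measure_eqI_lessThan)
    show "sets (\<mu> ?H) = sets borel" "sets (\<mu> ?R) = sets borel" by (auto simp: \<mu>_def)
    show "emeasure (\<mu> ?H) {b<..} < \<infinity>" for b by (rule bound[OF mH _ H(2)]) simp
    show "emeasure (\<mu> ?H) {b<..} = emeasure (\<mu> ?R) {b<..}" for b
      unfolding ray[OF mH] ray[OF mR] by (rule ray_identity) simp
  qed
  have int_eq: "(\<integral>\<omega>. indicator B (?M \<omega>) * ?H \<omega> \<partial>P x) = (\<integral>\<omega>. indicator B (?M \<omega>) * ?R \<omega> \<partial>P x)"
    if B [measurable]: "B \<in> sets borel" for B
  proof -
    have "(\<integral>\<omega>. indicator B (?M \<omega>) * ?H \<omega> \<partial>P x) = enn2real (emeasure (\<mu> ?H) B)"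
      unfolding \<mu>[OF mH B] by (subst integral_eq_nn_integral) (auto intro!: arg_cong[where f=enn2real] nn_integral_cong simp: indicator_def)
    also have "\<dots> = enn2real (emeasure (\<mu> ?R) B)" by (simp only: \<mu>_eq)
    also have "\<dots> = (\<integral>\<omega>. indicator B (?M \<omega>) * ?R \<omega> \<partial>P x)"
      unfolding \<mu>[OF mR B] using R by (subst integral_eq_nn_integral) (auto intro!: arg_cong[where f=enn2real] nn_integral_cong simp: indicator_def)
    finally show ?thesis .
  qed
  have hm: "(\<lambda>\<omega>. h (Zf \<omega>)) \<in> borel_measurable ?S"
    using measurable_compose[OF measurable_vimage_algebra1[of Zf \<Omega> borel] h] by simp
  have "AE \<omega> in ?C. real_cond_exp ?C ?S f \<omega> = h (Zf \<omega>)"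
  proof (rule C.real_cond_exp_charact[OF _ _ _ hm])
    have fC: "AE \<omega> in ?C. f \<omega> = ?H \<omega>" using f by (rule AE_completion)
    have hC: "AE \<omega> in ?C. h (Zf \<omega>) = ?R \<omega>" using hZ by (rule AE_completion)
    have hmC: "(\<lambda>\<omega>. h (Zf \<omega>)) \<in> borel_measurable ?C" using measurable_compose[OF Zm h] .
    show "integrable ?C f"
      by (rule C.integrable_const_bound[where B=1, OF _ fm]) (use fC in \<open>eventually_elim, use H in auto\<close>)
    show "integrable ?C (\<lambda>\<omega>. h (Zf \<omega>))"
      by (rule C.integrable_const_bound[where B="rho x", OF _ hmC]) (use hC in \<open>eventually_elim, use R in \<open>simp only: real_norm_def abs_of_nonneg\<close>\<close>)
    fix A assume "A \<in> sets ?S"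
    then obtain B where B: "B \<in> sets borel" "A = Zf -` B \<inter> \<Omega>" by (auto simp: sets_vimage_algebra2)
    \<comment> \<open>Pulling B back along \<theta> turns the conditioning event, up to a null set,
      into a Borel condition on the supremum.\<close>
    define B' where "B' = (\<lambda>r. ereal (\<theta> r)) -` B"
    have "(\<lambda>r. ereal (\<theta> r)) \<in> borel_measurable borel" by measurable
    from measurable_sets[OF this B(1)] have B'm [measurable]: "B' \<in> sets borel" by (simp add: B'_def)
    have AC: "A \<in> sets ?C" using \<open>A \<in> sets ?S\<close> sub by (auto simp: subalgebra_def)
    have Aeq: "AE \<omega> in ?C. (indicator A \<omega> :: real) = indicator B' (?M \<omega>)"
      using AE_completion[OF Zf] AE_space by eventually_elim (auto simp: B(2) B'_def indicator_def)
    have "(\<integral>\<omega>\<in>A. f \<omega> \<partial>?C) = (\<integral>\<omega>. indicator B' (?M \<omega>) * ?H \<omega> \<partial>?C)"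
      unfolding set_lebesgue_integral_def
    proof (rule integral_cong_AE)
      show "(\<lambda>\<omega>. indicator A \<omega> *\<^sub>R f \<omega>) \<in> borel_measurable ?C" using fm AC by measurable
      show "(\<lambda>\<omega>. indicator B' (?M \<omega>) * ?H \<omega>) \<in> borel_measurable ?C" by (rule measurable_completion) measurable
      show "AE \<omega> in ?C. indicator A \<omega> *\<^sub>R f \<omega> = indicator B' (?M \<omega>) * ?H \<omega>" using Aeq fC by eventually_elim simp
    qed
    also have "\<dots> = (\<integral>\<omega>. indicator B' (?M \<omega>) * ?H \<omega> \<partial>P x)" by (rule integral_completion) measurable
    also have "\<dots> = (\<integral>\<omega>. indicator B' (?M \<omega>) * ?R \<omega> \<partial>P x)" by (rule int_eq) measurable
    also have "\<dots> = (\<integral>\<omega>. indicator B' (?M \<omega>) * ?R \<omega> \<partial>?C)" by (rule integral_completion[symmetric]) measurable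
    also have "\<dots> = (\<integral>\<omega>\<in>A. h (Zf \<omega>) \<partial>?C)"
      unfolding set_lebesgue_integral_def
    proof (rule integral_cong_AE)
      show "(\<lambda>\<omega>. indicator A \<omega> *\<^sub>R h (Zf \<omega>)) \<in> borel_measurable ?C" using hmC AC by measurable
      show "(\<lambda>\<omega>. indicator B' (?M \<omega>) * ?R \<omega>) \<in> borel_measurable ?C" by (rule measurable_completion) measurable
      show "AE \<omega> in ?C. indicator B' (?M \<omega>) * ?R \<omega> = indicator A \<omega> *\<^sub>R h (Zf \<omega>)" using Aeq hC by eventually_elim simp
    qed
    finally show "(\<integral>\<omega>\<in>A. f \<omega> \<partial>?C) = (\<integral>\<omega>\<in>A. h (Zf \<omega>) \<partial>?C)" .
  qed
  then show ?thesis unfolding cond_exp_given_def by (simp add: AE_completion_iff)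
qed

end

section \<open>The Lamperti transform\<close>

context transient_exp_functional begin

definition clock :: "'a \<Rightarrow> real \<Rightarrow> ennreal" where
  "clock \<omega> t = exp_functional \<alpha> (\<lambda>t. X t \<omega>) (ennreal t)"

lemma clock_eq: "0 \<le> t \<Longrightarrow> clock \<omega> t = (\<integral>\<^sup>+u. ennreal (exp (\<alpha> * X u \<omega>)) * indicator {0..t} u \<partial>lborel)"
proof -
  assume t: "0 \<le> t"
  have "times_upto (ennreal t) = {0..t}" unfolding times_upto_def using t by (auto simp: ennreal_le_iff)
  then show ?thesis by (simp add: clock_def exp_functional_def)
qed

lemma clock_mono: "0 \<le> s \<Longrightarrow> s \<le> t \<Longrightarrow> clock \<omega> s \<le> clock \<omega> t"
  by (subst (1 2) clock_eq) (auto intro!: nn_integral_mono mult_left_mono simp: indicator_def)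

lemma exp_X_measurable_time:
  assumes \<omega>: "\<omega> \<in> \<Omega>" and A: "A \<subseteq> {0..}" "A \<in> sets borel"
  shows "(\<lambda>u. ennreal (exp (\<alpha> * X u \<omega>)) * indicator A u) \<in> borel_measurable borel"
proof -
  have "(\<lambda>u. (u, \<omega>)) \<in> measurable borel (borel \<Otimes>\<^sub>M P 0)" using \<omega> by (intro measurable_Pair) auto
  from measurable_compose[OF this progressive_measurable_P[OF progressive_X, of 0]]
  have [measurable]: "(\<lambda>u. X (max 0 u) \<omega>) \<in> borel_measurable borel" by simp
  have "(\<lambda>u. ennreal (exp (\<alpha> * X (max 0 u) \<omega>)) * indicator A u) \<in> borel_measurable borel" using A(2) by measurable
  also have "(\<lambda>u. ennreal (exp (\<alpha> * X (max 0 u) \<omega>)) * indicator A u) = (\<lambda>u. ennreal (exp (\<alpha> * X u \<omega>)) * indicator A u)"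
    using A(1) by (auto simp: fun_eq_iff indicator_def max_absorb2)
  finally show ?thesis .
qed

lemma clock_split:
  assumes \<omega>: "\<omega> \<in> \<Omega>" and st: "0 \<le> s" "s \<le> t"
  shows "clock \<omega> t = clock \<omega> s + (\<integral>\<^sup>+u. ennreal (exp (\<alpha> * X u \<omega>)) * indicator {s<..t} u \<partial>lborel)"
proof -
  have "clock \<omega> t = (\<integral>\<^sup>+u. ennreal (exp (\<alpha> * X u \<omega>)) * indicator {0..s} u + ennreal (exp (\<alpha> * X u \<omega>)) * indicator {s<..t} u \<partial>lborel)"
    using st by (subst clock_eq) (auto intro!: nn_integral_cong simp: indicator_def)
  also have "\<dots> = clock \<omega> s + (\<integral>\<^sup>+u. ennreal (exp (\<alpha> * X u \<omega>)) * indicator {s<..t} u \<partial>lborel)"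
    unfolding clock_eq[OF st(1)] using st by (intro nn_integral_add) (auto intro!: exp_X_measurable_time[OF \<omega>])
  finally show ?thesis .
qed

definition total_clock :: "'a \<Rightarrow> ennreal" where
  "total_clock \<omega> = exp_functional \<alpha> (\<lambda>t. X t \<omega>) (\<e> \<omega>)"

section \<open>The clock along one regular path\<close>

context
  fixes x :: real and \<omega> :: 'a and m :: real
  assumes reg: "regular x \<omega>" and m: "Mx \<omega> = ereal m"
begin

lemma reg_facts: "\<omega> \<in> \<Omega>" "X 0 \<omega> = x" "\<omega> \<in> alive 0" "x < m"
  using reg m by (auto simp: regular_def)

lemma X_le_m: "0 \<le> u \<Longrightarrow> \<omega> \<in> alive u \<Longrightarrow> X u \<omega> \<le> m"
proof -
  assume u: "0 \<le> u" "\<omega> \<in> alive u"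
  have "ereal (X u \<omega>) \<le> Mx \<omega>" unfolding Mx_def using u by (intro SUP_upper) auto
  then show ?thesis by (simp add: m)
qed

text \<open>While the path is alive it stays at or below m, so the clock runs at speed at most
  exp(\<alpha> m).\<close>

lemma clock_Lipschitz:
  assumes st: "0 \<le> s" "s \<le> t" and al: "\<omega> \<in> alive t"
  shows "clock \<omega> t \<le> clock \<omega> s + ennreal (exp (\<alpha> * m) * (t - s))"
proof -
  have "(\<integral>\<^sup>+u. ennreal (exp (\<alpha> * X u \<omega>)) * indicator {s<..t} u \<partial>lborel) \<le> (\<integral>\<^sup>+u. ennreal (exp (\<alpha> * m)) * indicator {s<..t} u \<partial>lborel)"
  proof (rule nn_integral_mono)
    fix u :: real
    show "ennreal (exp (\<alpha> * X u \<omega>)) * indicator {s<..t} u \<le> ennreal (exp (\<alpha> * m)) * indicator {s<..t} u"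
    proof (cases "u \<in> {s<..t}")
      case True
      then have "X u \<omega> \<le> m" using st alive_antimono[of u t] al by (intro X_le_m) auto
      then show ?thesis using True alpha_pos by (auto intro!: ennreal_leI)
    qed simp
  qed
  also have "\<dots> = ennreal (exp (\<alpha> * m) * (t - s))" using st by (simp add: nn_integral_cmult_indicator ennreal_mult)
  finally show ?thesis unfolding clock_split[OF reg_facts(1) st] by (rule add_left_mono)
qed

lemma clock_0: "clock \<omega> 0 = 0"
proof -
  have "clock \<omega> 0 = (\<integral>\<^sup>+u. ennreal (exp (\<alpha> * X u \<omega>)) * indicator {0..0} u \<partial>lborel)" by (rule clock_eq) simp
  also have "\<dots> = (\<integral>\<^sup>+u. 0 \<partial>(lborel :: real measure))"
    by (rule nn_integral_cong_AE) (use AE_lborel_singleton[of 0] in \<open>eventually_elim, auto\<close>)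
  finally show ?thesis by simp
qed

lemma clock_finite: "0 \<le> t \<Longrightarrow> \<omega> \<in> alive t \<Longrightarrow> clock \<omega> t < \<top>"
  using clock_Lipschitz[of 0 t] by (auto simp: clock_0 intro: le_less_trans)

lemma clock_strict:
  assumes st: "0 \<le> s" "s < t" and al: "\<omega> \<in> alive s"
  shows "clock \<omega> s < clock \<omega> t"
proof -
  let ?d = "\<integral>\<^sup>+u. ennreal (exp (\<alpha> * X u \<omega>)) * indicator {s<..t} u \<partial>lborel"
  have "?d \<noteq> 0"
  proof
    assume "?d = 0"
    then have "AE u in lborel. ennreal (exp (\<alpha> * X u \<omega>)) * indicator {s<..t} u = 0"
      using st by (subst (asm) nn_integral_0_iff_AE) (auto intro!: exp_X_measurable_time[OF reg_facts(1)])
    then have "AE u in lborel. u \<notin> {s<..t}" by eventually_elim (auto simp: indicator_def)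
    then have "emeasure lborel {s<..t} = 0" by (subst (asm) AE_iff_measurable[of "{s<..t}"]) auto
    then show False using st by simp
  qed
  then have "0 < ?d" by (simp add: zero_less_iff_neq_zero)
  then have "clock \<omega> s + 0 < clock \<omega> s + ?d"
    using clock_finite[OF st(1) al] by (intro ennreal_add_left_cancel_less[THEN iffD2]) auto
  then show ?thesis using clock_split[OF reg_facts(1) st(1) less_imp_le[OF st(2)]] by simp
qed

text \<open>\<open>times_upto\<close> includes time \<e> itself, when the path is no longer alive;
  one point does not change the integral.\<close>

lemma total_eq: "total_clock \<omega> = (\<integral>\<^sup>+u. ennreal (exp (\<alpha> * X u \<omega>)) * indicator {u. 0 \<le> u \<and> \<omega> \<in> alive u} u \<partial>lborel)"
proof -
  have "AE u in lborel. u \<noteq> enn2real (\<e> \<omega>)" by (rule AE_lborel_singleton)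
  then have "AE u in lborel. u \<in> times_upto (\<e> \<omega>) \<longleftrightarrow> 0 \<le> u \<and> \<omega> \<in> alive u"
  proof eventually_elim
    case (elim u)
    have "ennreal u \<noteq> \<e> \<omega>" if "0 \<le> u" using elim that by (metis enn2real_ennreal)
    then show ?case unfolding times_upto_def alive_def by (auto simp: less_le)
  qed
  then show ?thesis unfolding total_clock_def exp_functional_def
    by (intro nn_integral_cong_AE) (auto elim!: eventually_mono simp: indicator_def)
qed

lemma clock_le_total: "0 \<le> t \<Longrightarrow> \<omega> \<in> alive t \<Longrightarrow> clock \<omega> t \<le> total_clock \<omega>"
  unfolding total_eq
proof (subst clock_eq, assumption, rule nn_integral_mono)
  fix u assume "0 \<le> t" "\<omega> \<in> alive t"
  then show "ennreal (exp (\<alpha> * X u \<omega>)) * indicator {0..t} u \<le> ennreal (exp (\<alpha> * X u \<omega>)) * indicator {u. 0 \<le> u \<and> \<omega> \<in> alive u} u"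
    using alive_antimono[of u t] by (intro mult_left_mono) (auto simp: indicator_def)
qed

lemma clock_less_total:
  assumes "0 \<le> t" "\<omega> \<in> alive t" shows "clock \<omega> t < total_clock \<omega>"
proof -
  obtain t' where t': "t < t'" "\<And>v. v < t' \<Longrightarrow> \<omega> \<in> alive v" using alive_nhd[OF assms] by blast
  define v where "v = (t + t') / 2"
  have v: "t < v" "v < t'" using t'(1) by (auto simp: v_def)
  have "clock \<omega> t < clock \<omega> v" by (rule clock_strict[OF assms(1) v(1) assms(2)])
  also have "\<dots> \<le> total_clock \<omega>" using v t'(2) assms by (intro clock_le_total) auto
  finally show ?thesis .
qed

text \<open>Fatou's lemma along alive times that exhaust the lifetime: if the clock never exceeded y
  while alive, the total could not exceed y either.\<close>

lemma less_total:
  assumes "y < total_clock \<omega>" obtains t where "0 \<le> t" "\<omega> \<in> alive t" "y < clock \<omega> t"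
proof -
  have "total_clock \<omega> \<le> y" if le: "\<And>t. 0 \<le> t \<Longrightarrow> \<omega> \<in> alive t \<Longrightarrow> clock \<omega> t \<le> y"
  proof -
    \<comment> \<open>For infinite lifetime the integers serve; for lifetime \<epsilon> the times
      \<epsilon> - \<epsilon>/2^n, scaled by \<epsilon> so that they stay nonnegative.\<close>
    obtain t :: "nat \<Rightarrow> real" where t: "\<And>n. 0 \<le> t n" "\<And>n. \<omega> \<in> alive (t n)"
        "\<And>u. 0 \<le> u \<Longrightarrow> \<omega> \<in> alive u \<Longrightarrow> \<forall>\<^sub>F n in sequentially. u \<le> t n"
    proof (cases "\<e> \<omega>")
      case top
      show ?thesis
      proof (rule that[of real])
        fix u :: real
        obtain n :: nat where "u \<le> real n" using real_arch_simple by blast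
        then show "\<forall>\<^sub>F n in sequentially. u \<le> real n" by (intro eventually_sequentiallyI[of n]) simp
      qed (auto simp: alive_def top)
    next
      case (real \<epsilon>)
      have alive_iff: "\<omega> \<in> alive u \<longleftrightarrow> u < \<epsilon>" if "0 \<le> u" for u
        using that real by (simp add: alive_def ennreal_less_iff)
      have pos: "0 < \<epsilon>" using reg_facts(3) alive_iff[of 0] by simp
      have lim: "(\<lambda>n. \<epsilon> - \<epsilon> / 2 ^ n) \<longlonglongrightarrow> \<epsilon>"
        using tendsto_diff[OF tendsto_const LIMSEQ_half_pow[of \<epsilon>], of \<epsilon>] by simp
      have nonneg: "0 \<le> \<epsilon> - \<epsilon> / 2 ^ n" for n
      proof -
        have "\<epsilon> / 2 ^ n \<le> \<epsilon> / 1" using pos by (intro divide_left_mono) auto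
        then show ?thesis by simp
      qed
      show ?thesis
      proof (rule that[of "\<lambda>n. \<epsilon> - \<epsilon> / 2 ^ n"])
        fix u assume u: "0 \<le> u" "\<omega> \<in> alive u"
        then have "u < \<epsilon>" using alive_iff by simp
        from order_tendstoD(1)[OF lim this] show "\<forall>\<^sub>F n in sequentially. u \<le> \<epsilon> - \<epsilon> / 2 ^ n"
          by eventually_elim simp
      qed (use nonneg alive_iff pos in auto)
    qed
    let ?f = "\<lambda>n u. ennreal (exp (\<alpha> * X u \<omega>)) * indicator {0..t n} u"
    have "total_clock \<omega> \<le> (\<integral>\<^sup>+u. liminf (\<lambda>n. ?f n u) \<partial>lborel)"
      unfolding total_eq
    proof (rule nn_integral_mono)
      fix u
      show "ennreal (exp (\<alpha> * X u \<omega>)) * indicator {u. 0 \<le> u \<and> \<omega> \<in> alive u} u \<le> liminf (\<lambda>n. ?f n u)"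
      proof (cases "0 \<le> u \<and> \<omega> \<in> alive u")
        case True
        with t(3)[of u] have "\<forall>\<^sub>F n in sequentially. ennreal (exp (\<alpha> * X u \<omega>)) \<le> ?f n u"
          by (auto elim: eventually_mono)
        then have "ennreal (exp (\<alpha> * X u \<omega>)) \<le> liminf (\<lambda>n. ?f n u)" by (rule Liminf_bounded)
        then show ?thesis using True by simp
      qed simp
    qed
    also have "\<dots> \<le> liminf (\<lambda>n. \<integral>\<^sup>+u. ?f n u \<partial>lborel)"
      by (rule nn_integral_liminf) (auto intro!: exp_X_measurable_time[OF reg_facts(1)])
    also have "\<dots> \<le> y"
      by (rule Liminf_le[OF sequentially_bot], rule always_eventually) (use le t in \<open>auto simp: clock_eq\<close>)
    finally show ?thesis .
  qed
  then show ?thesis using that assms by (meson not_le)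
qed

text \<open>The intermediate value theorem: the clock starts at 0, exceeds s at some alive time, and
  is Lipschitz in between.\<close>

lemma clock_onto:
  assumes "0 \<le> s" "ennreal s < total_clock \<omega>"
  obtains t where "0 \<le> t" "\<omega> \<in> alive t" "clock \<omega> t = ennreal s"
proof -
  obtain t1 where t1: "0 \<le> t1" "\<omega> \<in> alive t1" "ennreal s < clock \<omega> t1" using less_total[OF assms(2)] by blast
  define i where "i t = enn2real (clock \<omega> t)" for t
  have al: "\<omega> \<in> alive t" if "t \<le> t1" for t using alive_antimono[OF that] t1 by auto
  have i: "clock \<omega> t = ennreal (i t)" if "0 \<le> t" "t \<le> t1" for t
    using clock_finite[OF that(1) al[OF that(2)]] by (simp add: i_def)
  have i0: "0 \<le> i t" for t by (simp add: i_def)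
  have lip: "\<bar>i t - i u\<bar> \<le> exp (\<alpha> * m) * \<bar>t - u\<bar>" if "0 \<le> t" "t \<le> t1" "0 \<le> u" "u \<le> t1" for t u
  proof -
    have *: "i u \<le> i t \<and> i t \<le> i u + exp (\<alpha> * m) * (t - u)" if "0 \<le> u" "u \<le> t" "t \<le> t1" for t u
    proof
      show "i u \<le> i t" using clock_mono[OF that(1,2), of \<omega>] that i[of t] i[of u] i0 by simp
      have "ennreal (i t) \<le> ennreal (i u + exp (\<alpha> * m) * (t - u))"
        using clock_Lipschitz[OF that(1,2) al[OF that(3)]] that i[of t] i[of u] i0 by (simp add: ennreal_plus)
      then show "i t \<le> i u + exp (\<alpha> * m) * (t - u)" by (subst (asm) ennreal_le_iff) (use i0 that in auto)
    qed
    show ?thesis using *[of u t] *[of t u] that by (cases "u \<le> t") auto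
  qed
  have "continuous_on {0..t1} i"
  proof (rule lipschitz_on_continuous_on)
    show "(exp (\<alpha> * m))-lipschitz_on {0..t1} i"
      by (rule lipschitz_onI) (use lip in \<open>auto simp: dist_real_def\<close>)
  qed
  moreover have "i 0 \<le> s" using assms(1) by (simp add: i_def clock_0)
  moreover have "s \<le> i t1" using t1 i[of t1] assms(1) by (simp add: ennreal_less_iff)
  ultimately obtain t where "0 \<le> t" "t \<le> t1" "i t = s" using IVT'[of i 0 s t1] t1(1) by auto
  then show ?thesis using that[of t] al i by auto
qed

text \<open>Strict growth makes the times at which the clock exceeds s exactly those after t. Their
  infimum is t, so the time change inverts the clock.\<close>

lemma lamperti_clock:
  assumes t: "0 \<le> t" "\<omega> \<in> alive t" "clock \<omega> t = ennreal s" and s: "0 \<le> s"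
  shows "lamperti \<alpha> (\<lambda>t. X t \<omega>) (\<e> \<omega>) s = exp (X t \<omega>)"
proof -
  have iff: "clock \<omega> t < clock \<omega> u \<longleftrightarrow> t < u" if "0 \<le> u" for u
    using clock_strict[OF t(1) _ t(2), of u] clock_mono[OF that, of t \<omega>] by (meson leD not_le)
  have "{ennreal u | u. 0 \<le> u \<and> exp_functional \<alpha> (\<lambda>t. X t \<omega>) (ennreal u) > ennreal s} = {ennreal u | u. 0 \<le> u \<and> t < u}"
    unfolding clock_def[symmetric] t(3)[symmetric] using iff by auto
  moreover have "Inf {ennreal u | u. 0 \<le> u \<and> t < u} = ennreal t"
  proof (rule antisym)
    show "ennreal t \<le> Inf {ennreal u | u. 0 \<le> u \<and> t < u}" by (rule Inf_greatest) (auto intro!: ennreal_leI)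
    show "Inf {ennreal u | u. 0 \<le> u \<and> t < u} \<le> ennreal t"
    proof (rule LIMSEQ_le_const)
      have "(\<lambda>n. t + 1 / 2 ^ n) \<longlonglongrightarrow> t" using tendsto_add[OF tendsto_const LIMSEQ_half_pow[of 1], of t] by simp
      then show "(\<lambda>n. ennreal (t + 1 / 2 ^ n)) \<longlonglongrightarrow> ennreal t" by (rule tendsto_ennrealI)
      show "\<exists>N. \<forall>n\<ge>N. Inf {ennreal u | u. 0 \<le> u \<and> t < u} \<le> ennreal (t + 1 / 2 ^ n)"
      proof (intro exI[of _ 0] allI impI)
        fix n :: nat
        have "0 \<le> t + 1 / 2 ^ n" "t < t + 1 / 2 ^ n" using t(1) by auto
        then show "Inf {ennreal u | u. 0 \<le> u \<and> t < u} \<le> ennreal (t + 1 / 2 ^ n)" by (intro Inf_lower) blast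
      qed
    qed
  qed
  ultimately have "time_change \<alpha> (\<lambda>t. X t \<omega>) s = ennreal t" by (simp add: time_change_def)
  moreover have "ennreal s < exp_functional \<alpha> (\<lambda>t. X t \<omega>) (\<e> \<omega>)"
    using clock_less_total[OF t(1,2)] t(3) by (simp add: total_clock_def)
  ultimately show ?thesis using t(1) by (simp add: lamperti_def)
qed

section \<open>Supremum and record times of the transformed path\<close>

abbreviation "Y \<equiv> lamperti \<alpha> (\<lambda>t. X t \<omega>) (\<e> \<omega>)"

lemma Y_cases:
  assumes "0 \<le> s"
  obtains (alive) t where "0 \<le> t" "\<omega> \<in> alive t" "clock \<omega> t = ennreal s" "Y s = exp (X t \<omega>)" | (dead) "Y s = 0"
proof (cases "ennreal s < total_clock \<omega>")
  case True
  from clock_onto[OF assms True] obtain t where "0 \<le> t" "\<omega> \<in> alive t" "clock \<omega> t = ennreal s" by blast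
  then show ?thesis using lamperti_clock[OF _ _ _ assms] alive by blast
next
  case False
  then show ?thesis using dead by (simp add: lamperti_def total_clock_def)
qed

lemma Y_clock:
  assumes "0 \<le> t" "\<omega> \<in> alive t"
  obtains s where "0 \<le> s" "clock \<omega> t = ennreal s" "Y s = exp (X t \<omega>)"
proof -
  have "clock \<omega> t = ennreal (enn2real (clock \<omega> t))" using clock_finite[OF assms] by simp
  then show ?thesis using that[of "enn2real (clock \<omega> t)"] lamperti_clock[OF assms] by auto
qed

text \<open>Before the clock runs out the values of Y are exactly exp(X_t) over alive t, and
  afterwards they are 0, which lies below. A smaller supremum \<sigma> of Y would bound X by ln
  \<sigma>.\<close>

lemma run_sup_Y: "run_sup Y \<infinity> = ereal (exp m)"
proof (rule antisym)
  show "run_sup Y \<infinity> \<le> ereal (exp m)"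
    unfolding run_sup_def times_upto_def
  proof (rule SUP_least)
    fix s assume "s \<in> {u. 0 \<le> u \<and> ennreal u \<le> \<infinity>}"
    then have "0 \<le> s" by simp
    then show "ereal (Y s) \<le> ereal (exp m)" by (cases rule: Y_cases) (use X_le_m in auto)
  qed
  have up: "ereal (Y s) \<le> run_sup Y \<infinity>" if "0 \<le> s" for s
    unfolding run_sup_def times_upto_def using that by (intro SUP_upper) auto
  show "ereal (exp m) \<le> run_sup Y \<infinity>"
  proof (rule ccontr)
    assume "\<not> ?thesis"
    then have less: "run_sup Y \<infinity> < ereal (exp m)" by simp
    \<comment> \<open>The value at the start shows that \<sigma> is positive, so that ln \<sigma> is
      meaningful.\<close>
    obtain s0 where s0: "0 \<le> s0" "Y s0 = exp (X 0 \<omega>)" using Y_clock[OF order_refl reg_facts(3)] by blast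
    have "ereal (exp (X 0 \<omega>)) \<le> run_sup Y \<infinity>" using up[OF s0(1)] s0(2) by simp
    with less obtain \<sigma> where \<sigma>: "run_sup Y \<infinity> = ereal \<sigma>" "exp (X 0 \<omega>) \<le> \<sigma>" "\<sigma> < exp m"
      by (cases "run_sup Y \<infinity>") auto
    have pos: "0 < \<sigma>" using \<sigma>(2) exp_gt_zero less_le_trans by blast
    have "X t \<omega> \<le> ln \<sigma>" if t: "0 \<le> t" "\<omega> \<in> alive t" for t
    proof -
      obtain s where s: "0 \<le> s" "Y s = exp (X t \<omega>)" using Y_clock[OF t] by blast
      have "exp (X t \<omega>) \<le> \<sigma>" using up[OF s(1)] s(2) \<sigma>(1) by simp
      then show ?thesis using pos by (simp add: ln_ge_iff)
    qed
    then have "Mx \<omega> \<le> ereal (ln \<sigma>)" unfolding Mx_def by (intro SUP_least) auto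
    then have "m \<le> ln \<sigma>" by (simp add: m)
    then show False using \<sigma>(3) pos by (simp add: ln_ge_iff)
  qed
qed

text \<open>The clock preserves order strictly, so it maps record times of X to record times of Y. A
  time after killing is no record, since Y vanishes there and is positive at time 0.\<close>

lemma clock_G: "last_sup_time Y \<infinity> = exp_functional \<alpha> (\<lambda>t. X t \<omega>) (G \<omega>)"
proof -
  have set: "{ennreal s | s. 0 \<le> s \<and> ennreal s < \<infinity> \<and> run_sup Y (ennreal s) = ereal (Y s)} = clock \<omega> ` Gset \<omega>"
  proof safe
    fix s assume s: "0 \<le> s" "run_sup Y (ennreal s) = ereal (Y s)"
    then have max: "\<And>v. 0 \<le> v \<Longrightarrow> v \<le> s \<Longrightarrow> Y v \<le> Y s" using run_sup_eq_end_iff[OF s(1)] by auto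
    obtain s0 where s0: "0 \<le> s0" "clock \<omega> 0 = ennreal s0" "Y s0 = exp (X 0 \<omega>)" using Y_clock[OF order_refl reg_facts(3)] by blast
    have "s0 = 0" using s0 clock_0 by simp
    with max[of 0] s0 s have "0 < Y s" using exp_gt_zero[of "X 0 \<omega>"] by (metis less_le_trans order_refl)
    with s(1) obtain t where t: "0 \<le> t" "\<omega> \<in> alive t" "clock \<omega> t = ennreal s" "Y s = exp (X t \<omega>)"
      by (cases rule: Y_cases) auto
    have "\<omega> \<in> stays (X t \<omega>) 0 t" unfolding stays_def
    proof (intro CollectI ballI)
      fix v assume v: "v \<in> {0..t}"
      then have "\<omega> \<in> alive v" using alive_antimono[of v t] t by auto
      with v obtain r where r: "0 \<le> r" "clock \<omega> v = ennreal r" "Y r = exp (X v \<omega>)" using Y_clock[of v] by auto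
      have "ennreal r \<le> ennreal s" using clock_mono[of v t \<omega>] v r t by simp
      then have "Y r \<le> Y s" using max[of r] r s by (simp add: ennreal_le_iff)
      then show "X v \<omega> \<le> X t \<omega>" using r t by simp
    qed
    then show "ennreal s \<in> clock \<omega> ` Gset \<omega>" using t by (intro image_eqI[of _ _ t]) (auto simp: Gset_def)
  next
    fix t assume "t \<in> Gset \<omega>"
    then have t: "0 \<le> t" "\<omega> \<in> alive t" "\<omega> \<in> stays (X t \<omega>) 0 t" by (auto simp: Gset_def)
    obtain s where s: "0 \<le> s" "clock \<omega> t = ennreal s" "Y s = exp (X t \<omega>)" using Y_clock[OF t(1,2)] by blast
    have "Y v \<le> Y s" if v: "0 \<le> v" "v \<le> s" for v
      using v(1)
    proof (cases rule: Y_cases)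
      case (alive r)
      have "r \<le> t"
      proof (rule ccontr)
        assume "\<not> r \<le> t"
        then have "clock \<omega> t < clock \<omega> r" by (intro clock_strict[OF t(1) _ t(2)]) simp
        then show False using alive s v by (simp add: ennreal_less_iff)
      qed
      then have "X r \<omega> \<le> X t \<omega>" using t(3) alive(1) by (auto simp: stays_def)
      then show ?thesis using alive s by simp
    qed (use s in simp)
    then have "run_sup Y (ennreal s) = ereal (Y s)" using run_sup_eq_end_iff[OF s(1)] by auto
    then show "\<exists>s. clock \<omega> t = ennreal s \<and> 0 \<le> s \<and> ennreal s < \<infinity> \<and> run_sup Y (ennreal s) = ereal (Y s)"
      using s by (intro exI[of _ s]) simp
  qed
  have "last_sup_time Y \<infinity> = (SUP t\<in>Gset \<omega>. clock \<omega> t)" unfolding last_sup_time_def set ..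
  also have "\<dots> = exp_functional \<alpha> (\<lambda>t. X t \<omega>) (G \<omega>)"
  proof (rule antisym)
    show "(SUP t\<in>Gset \<omega>. clock \<omega> t) \<le> exp_functional \<alpha> (\<lambda>t. X t \<omega>) (G \<omega>)"
    proof (rule SUP_least)
      fix t assume "t \<in> Gset \<omega>"
      then have "ennreal t \<le> G \<omega>" unfolding G_eq by (intro SUP_upper)
      then have "times_upto (ennreal t) \<subseteq> times_upto (G \<omega>)" by (auto simp: times_upto_def)
      then show "clock \<omega> t \<le> exp_functional \<alpha> (\<lambda>t. X t \<omega>) (G \<omega>)"
        unfolding clock_def exp_functional_def by (intro nn_integral_mono mult_left_mono) (auto simp: indicator_def)
    qed
    \<comment> \<open>The comparison goes through \<open>expI\<close> and so avoids continuity of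
      the clock at G, which may fail to be an alive time. The level is raised to at least x so that
      a first passage above it exists.\<close>
    have le: "expfun r \<omega> \<le> (SUP t\<in>Gset \<omega>. clock \<omega> t)" if r: "ereal r < Mx \<omega>" for r
    proof -
      have "ereal (max r x) < Mx \<omega>" using r reg_facts(4) by (simp add: m)
      then obtain \<tau> where \<tau>: "\<tau> \<in> Gset \<omega>" "\<And>u. 0 \<le> u \<Longrightarrow> \<omega> \<in> stays (max r x) 0 u \<Longrightarrow> u \<le> \<tau>"
        using record_time[OF reg, of "max r x"] by auto
      have \<tau>0: "0 \<le> \<tau>" using \<tau>(1) by (simp add: Gset_def)
      have "expfun r \<omega> \<le> expfun (max r x) \<omega>" by (rule expfun_mono) simp
      also have "\<dots> \<le> clock \<omega> \<tau>"
        unfolding expfun_def clock_eq[OF \<tau>0]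
      proof (rule nn_integral_mono)
        fix u :: real
        show "ennreal (surv \<alpha> (max r x) 0 (max 0 u) \<omega>) * indicator {0..} u \<le> ennreal (exp (\<alpha> * X u \<omega>)) * indicator {0..\<tau>} u"
          using \<tau>(2)[of u] by (auto simp: indicator_def surv_def max_absorb2)
      qed
      also have "\<dots> \<le> (SUP t\<in>Gset \<omega>. clock \<omega> t)" by (rule SUP_upper[OF \<tau>(1)])
      finally show ?thesis .
    qed
    show "exp_functional \<alpha> (\<lambda>t. X t \<omega>) (G \<omega>) \<le> (SUP t\<in>Gset \<omega>. clock \<omega> t)"
      unfolding exp_functional_G(1)[OF reg] expI_def using le by (intro SUP_least) auto
  qed
  finally show ?thesis .
qed

end

end

section \<open>The two conditional expectations\<close>

context transient_exp_functional begin

lemma regular_Mx: "regular x \<omega> \<Longrightarrow> Mx \<omega> = ereal (real_of_ereal (Mx \<omega>))"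
  by (cases "Mx \<omega>") (auto simp: regular_def)

lemma power_series_measurable: "power_series \<psi> p \<alpha> \<in> borel_measurable borel"
proof (rule borel_measurable_continuous_onI, rule continuous_at_imp_continuous_on, rule ballI)
  show "isCont (power_series \<psi> p \<alpha>) z" for z
    unfolding power_series_def[abs_def] by (rule isCont_powser_converges_everywhere[OF coeff_summable])
qed

theorem cond_exp_given_run_sup:
  "AE \<omega> in P x. cond_exp_given (P x) (\<lambda>\<omega>. exp (- \<gamma> * enn2real (exp_functional \<alpha> (\<lambda>t. X t \<omega>) (G \<omega>))))
      (\<lambda>\<omega>. run_sup (\<lambda>t. X t \<omega>) (\<e> \<omega>)) \<omega> =
    power_series \<psi> p \<alpha> (\<gamma> * exp (\<alpha> * x)) /
      power_series \<psi> p \<alpha> (\<gamma> * exp (\<alpha> * real_of_ereal (run_sup (\<lambda>t. X t \<omega>) (\<e> \<omega>))))"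
proof -
  have sup: "AE \<omega> in P x. run_sup (\<lambda>t. X t \<omega>) (\<e> \<omega>) = ereal (real_of_ereal (Mx \<omega>))"
    using AE_regular
  proof eventually_elim
    case (elim \<omega>)
    then show ?case using run_sup_eq_Mx[of \<omega>] regular_Mx[OF elim] by (simp add: regular_def)
  qed
  have "AE \<omega> in P x. cond_exp_given (P x) (\<lambda>\<omega>. exp (- \<gamma> * enn2real (exp_functional \<alpha> (\<lambda>t. X t \<omega>) (G \<omega>))))
      (\<lambda>\<omega>. run_sup (\<lambda>t. X t \<omega>) (\<e> \<omega>)) \<omega> = (\<lambda>z. rho x / rho (real_of_ereal z)) (run_sup (\<lambda>t. X t \<omega>) (\<e> \<omega>))"
  proof (rule cond_exp_given_function_of_Mx[where \<theta> = "\<lambda>m. m"])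
    show "AE \<omega> in P x. exp (- \<gamma> * enn2real (exp_functional \<alpha> (\<lambda>t. X t \<omega>) (G \<omega>))) = exp (- \<gamma> * enn2real (expI \<omega>))"
      using AE_regular by eventually_elim (simp add: exp_functional_G(1))
    show "AE \<omega> in P x. rho x / rho (real_of_ereal (run_sup (\<lambda>t. X t \<omega>) (\<e> \<omega>))) = rho x / rho (real_of_ereal (Mx \<omega>))"
      using sup by eventually_elim simp
  qed (use sup in simp_all)
  then show ?thesis by (simp add: rho_def)
qed

theorem cond_exp_given_lamperti_sup:
  assumes y: "0 < y"
  shows "AE \<omega> in P (ln y). cond_exp_given (P (ln y))
      (\<lambda>\<omega>. exp (- \<gamma> * enn2real (last_sup_time (lamperti \<alpha> (\<lambda>t. X t \<omega>) (\<e> \<omega>)) \<infinity>)))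
      (\<lambda>\<omega>. run_sup (lamperti \<alpha> (\<lambda>t. X t \<omega>) (\<e> \<omega>)) \<infinity>) \<omega> =
    power_series \<psi> p \<alpha> (\<gamma> * y powr \<alpha>) /
      power_series \<psi> p \<alpha> (\<gamma> * real_of_ereal (run_sup (lamperti \<alpha> (\<lambda>t. X t \<omega>) (\<e> \<omega>)) \<infinity>) powr \<alpha>)"
proof -
  note [measurable] = power_series_measurable
  have sup: "AE \<omega> in P (ln y). run_sup (lamperti \<alpha> (\<lambda>t. X t \<omega>) (\<e> \<omega>)) \<infinity> = ereal (exp (real_of_ereal (Mx \<omega>)))"
    using AE_regular by eventually_elim (rule run_sup_Y, assumption, rule regular_Mx)
  show ?thesis
  \<comment> \<open>The supremum of Y is exp of that of X, hence \<theta> = exp; writing powers with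
    \<open>powr\<close> as exp(\<alpha> ln) turns h into the quotient of values of \<rho>, with x =
    ln y.\<close>
  proof (rule cond_exp_given_function_of_Mx[where \<theta> = exp and
        h = "\<lambda>z. power_series \<psi> p \<alpha> (\<gamma> * y powr \<alpha>) / power_series \<psi> p \<alpha> (\<gamma> * real_of_ereal z powr \<alpha>)"])
    show "AE \<omega> in P (ln y). exp (- \<gamma> * enn2real (last_sup_time (lamperti \<alpha> (\<lambda>t. X t \<omega>) (\<e> \<omega>)) \<infinity>)) =
        exp (- \<gamma> * enn2real (expI \<omega>))"
      using AE_regular
    proof eventually_elim
      case (elim \<omega>)
      show ?case unfolding clock_G[OF elim regular_Mx[OF elim]] exp_functional_G(1)[OF elim] ..
    qed
    show "AE \<omega> in P (ln y). power_series \<psi> p \<alpha> (\<gamma> * y powr \<alpha>) /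
        power_series \<psi> p \<alpha> (\<gamma> * real_of_ereal (run_sup (lamperti \<alpha> (\<lambda>t. X t \<omega>) (\<e> \<omega>)) \<infinity>) powr \<alpha>) =
        rho (ln y) / rho (real_of_ereal (Mx \<omega>))"
      using sup by eventually_elim (use y in \<open>simp add: rho_def powr_def\<close>)
  qed (use sup in simp_all)
qed

end

theorem proposition4p1:
  fixes \<Omega> :: "'a set" and F :: "ennreal \<Rightarrow> 'a measure"
    and P :: "real \<Rightarrow> 'a measure" and X :: "real \<Rightarrow> 'a \<Rightarrow> real"
    and \<e> :: "'a \<Rightarrow> ennreal" and p \<alpha> \<gamma> :: real
  assumes levy: "killed_spectrally_negative_levy \<Omega> F P X \<e> p"
    and alpha: "0 < \<alpha>"
    and standing: "p = 0 \<Longrightarrow> (\<And>x. AE \<omega> in P x. filterlim (\<lambda>t. X t \<omega>) at_bot at_top)"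
    and gamma: "0 \<le> \<gamma>"
  defines "I \<equiv> power_series (laplace_exponent P X) p \<alpha>"
    and "Xbar_\<e> \<equiv> (\<lambda>\<omega>. run_sup (\<lambda>t. X t \<omega>) (\<e> \<omega>))"
    and "G \<equiv> (\<lambda>\<omega>. last_sup_time (\<lambda>t. X t \<omega>) (\<e> \<omega>))"
    and "Y \<equiv> (\<lambda>s \<omega>. lamperti \<alpha> (\<lambda>t. X t \<omega>) (\<e> \<omega>) s)"
    and "Q \<equiv> (\<lambda>y. P (ln y))"
  defines "Ybar_inf \<equiv> (\<lambda>\<omega>. run_sup (\<lambda>s. Y s \<omega>) \<infinity>)"
    and "L \<equiv> (\<lambda>\<omega>. last_sup_time (\<lambda>s. Y s \<omega>) \<infinity>)"
  shows "(\<forall>x. AE \<omega> in P x.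
            cond_exp_given (P x)
              (\<lambda>\<omega>. exp (- \<gamma> * enn2real (exp_functional \<alpha> (\<lambda>t. X t \<omega>) (G \<omega>)))) Xbar_\<e> \<omega>
            = I (\<gamma> * exp (\<alpha> * x)) / I (\<gamma> * exp (\<alpha> * real_of_ereal (Xbar_\<e> \<omega>)))) \<and>
         (\<forall>y>0. AE \<omega> in Q y.
            cond_exp_given (Q y) (\<lambda>\<omega>. exp (- \<gamma> * enn2real (L \<omega>))) Ybar_inf \<omega>
            = I (\<gamma> * y powr \<alpha>) / I (\<gamma> * real_of_ereal (Ybar_inf \<omega>) powr \<alpha>))"
proof -
  interpret T: transient_exp_functional \<Omega> F P X \<e> p \<alpha> \<gamma>
    by (intro transient_exp_functional.intro transient_killed_levy.intro levy
        transient_killed_levy_axioms.intro transient_exp_functional_axioms.intro standing alpha gamma)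
  show ?thesis
    unfolding I_def Xbar_\<e>_def G_def Ybar_inf_def L_def Y_def Q_def
    using T.cond_exp_given_run_sup[unfolded T.G_def] T.cond_exp_given_lamperti_sup by blast
qed

end
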